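(* Let $(M,g)$ be a compact, oriented Riemannian manifold, $(N,h,J)$ a compact Kähler manifold with Kähler form $\omega=h(J\cdot,\cdot)$, and let $\phi:M\to N$ be a critical point of the energy functional $E(\phi)=\frac12\int_M|\phi^*\omega|^2\,{\ast 1}$. Then the Hessian of $E$ at $\phi$ is given by $$H_\phi(X,Y)=\int_M h(X,\mathscr{L}_\phi Y)\,{\ast 1}\qquad(X,Y\in\Gamma(\phi^{-1}TN)),$$ where $$\mathscr{L}_\phi Y=-J\Big(\nabla^\phi_{Z_\phi}Y+d\phi(\sharp\,\delta d\,\phi^*\iota_Y\omega)\Big)\quad\text{and}\quad Z_\phi=\sharp\,\delta\phi^*\omega.$$
   Context: $\ast 1$ is the volume form of $M$; the pointwise norm on $p$-forms is induced by $\langle\alpha,\beta\rangle=\frac1{p!}\sum_{i_1,\dots,i_p}\alpha(e_{i_1},\dots,e_{i_p})\beta(e_{i_1},\dots,e_{i_p})$ for a local orthonormal frame. $\delta$ is the formal $L^2$-adjoint of the exterior derivative $d$; $\sharp:\Gamma(T^*M)\to\Gamma(TM)$ is the inverse of $\flat:X\mapsto g(X,\cdot)$. $\nabla^\phi$ is the connection on $\phi^{-1}TN$ induced by the Levi-Civita connection of $N$; $h$, $J$ and $\omega$ also denote the induced structures on $\phi^{-1}TN$. For $Y\in\Gamma(\phi^{-1}TN)$, $\phi^*\iota_Y\omega$ is the $1$-form on $M$ given by $A\mapsto\omega(Y,d\phi(A))$. The Hessian of $E$ at a critical point $\phi$ is $H_\phi(X,Y)=\frac{\partial^2}{\partial s\,\partial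 t}\big|_{s=t=0}E(\phi_{s,t})$, where $\phi_{s,t}$ is a smooth $2$-parameter variation of $\phi=\phi_{0,0}$ with $X=\partial_t\phi_{s,t}|_{s=t=0}$ and $Y=\partial_s\phi_{s,t}|_{s=t=0}$. *)

theory Defs
  imports "HOL-Analysis.Analysis"
begin

section \<open>Smooth maps between open subsets of normed spaces\<close>

text \<open>Only meant for open sets \<open>S\<close>.\<close>

primrec times_differentiable_on ::
  "nat \<Rightarrow> 'a::real_normed_vector set \<Rightarrow> ('a \<Rightarrow> 'b::real_normed_vector) \<Rightarrow> bool"
where
  "times_differentiable_on 0 S f \<longleftrightarrow> continuous_on S f"
| "times_differentiable_on (Suc k) S f \<longleftrightarrow>
     (\<forall>x\<in>S. f differentiable (at x)) \<and>
     (\<forall>v. times_differentiable_on k S (\<lambda>x. frechet_derivative f (at x) v))"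

definition smooth_on ::
  "'a::real_normed_vector set \<Rightarrow> ('a \<Rightarrow> 'b::real_normed_vector) \<Rightarrow> bool"
where
  "smooth_on S f \<longleftrightarrow> (\<forall>k. times_differentiable_on k S f)"


section \<open>Manifolds\<close>

text \<open>
  A chart is a pair of a domain and a coordinate map; the values of the coordinate map outside
  the domain are irrelevant. The points of a manifold are all elements of a Hausdorff type, and
  its smooth structure is given by an atlas, which need not be maximal.
\<close>

type_synonym ('a, 'm) chart = "'a set \<times> ('a \<Rightarrow> real ^ 'm)"

abbreviation chart_dom :: "('a, 'm::finite) chart \<Rightarrow> 'a set" where
  "chart_dom c \<equiv> fst c"

abbreviation chart_map :: "('a, 'm::finite) chart \<Rightarrow> 'a \<Rightarrow> real ^ 'm" where
  "chart_map c \<equiv> snd c"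

definition chart_inv :: "('a, 'm::finite) chart \<Rightarrow> real ^ 'm \<Rightarrow> 'a" where
  "chart_inv c = inv_into (chart_dom c) (chart_map c)"

definition chart_img :: "('a, 'm::finite) chart \<Rightarrow> (real ^ 'm) set" where
  "chart_img c = chart_map c ` chart_dom c"

definition is_chart :: "('a::topological_space, 'm::finite) chart \<Rightarrow> bool" where
  "is_chart c \<longleftrightarrow> open (chart_dom c) \<and> open (chart_img c) \<and>
     homeomorphism (chart_dom c) (chart_img c) (chart_map c) (chart_inv c)"

definition smooth_transition ::
  "('a::topological_space, 'm::finite) chart \<Rightarrow> ('a, 'm) chart \<Rightarrow> bool"
where
  "smooth_transition c c' \<longleftrightarrow>
     smooth_on (chart_map c ` (chart_dom c \<inter> chart_dom c')) (chart_map c' \<circ> chart_inv c)"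

definition atlas :: "('a::topological_space, 'm::finite) chart set \<Rightarrow> bool" where
  "atlas A \<longleftrightarrow> (\<forall>c\<in>A. is_chart c) \<and> (\<Union>c\<in>A. chart_dom c) = UNIV \<and>
     (\<forall>c\<in>A. \<forall>c'\<in>A. smooth_transition c c')"

text \<open>An orientation is encoded by an atlas all of whose charts are positively oriented.\<close>

definition oriented_atlas :: "('a::topological_space, 'm::finite) chart set \<Rightarrow> bool" where
  "oriented_atlas A \<longleftrightarrow> atlas A \<and>
     (\<forall>c\<in>A. \<forall>c'\<in>A. \<forall>y\<in>chart_map c ` (chart_dom c \<inter> chart_dom c').
        0 < det (matrix (frechet_derivative (chart_map c' \<circ> chart_inv c) (at y))))"

text \<open>
  The tangent space at \<open>p\<close> is a copy of the model space \<open>real ^ 'm\<close>: a tangent vector is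
  represented by its components in a fixed preferred chart around \<open>p\<close>, as is done for instance
  in Lean's Mathlib. Pointwise linear algebra can therefore be written without reference to
  charts. The preferred chart varies discontinuously with \<open>p\<close>, so whenever a field is
  differentiated or required to be smooth, it is first rewritten in the components of one
  chart, by the following two maps.

  \<open>to_chart A c p v\<close> gives the components in the chart \<open>c\<close> of the tangent vector \<open>v\<close> at \<open>p\<close>,
  and \<open>from_chart A c p u\<close> is the tangent vector at \<open>p\<close> with components \<open>u\<close> in the chart \<open>c\<close>.
\<close>

definition chart_at :: "('a, 'm::finite) chart set \<Rightarrow> 'a \<Rightarrow> ('a, 'm) chart" where
  "chart_at A p = (SOME c. c \<in> A \<and> p \<in> chart_dom c)"

definition to_chart ::
  "('a, 'm::finite) chart set \<Rightarrow> ('a, 'm) chart \<Rightarrow> 'a \<Rightarrow> real ^ 'm \<Rightarrow> real ^ 'm"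
where
  "to_chart A c p =
     frechet_derivative (chart_map c \<circ> chart_inv (chart_at A p)) (at (chart_map (chart_at A p) p))"

definition from_chart ::
  "('a, 'm::finite) chart set \<Rightarrow> ('a, 'm) chart \<Rightarrow> 'a \<Rightarrow> real ^ 'm \<Rightarrow> real ^ 'm"
where
  "from_chart A c p =
     frechet_derivative (chart_map (chart_at A p) \<circ> chart_inv c) (at (chart_map c p))"

definition smooth_map ::
  "('a::topological_space, 'm::finite) chart set \<Rightarrow> ('b::topological_space, 'n::finite) chart set
   \<Rightarrow> ('a \<Rightarrow> 'b) \<Rightarrow> bool"
where
  "smooth_map A B \<phi> \<longleftrightarrow> continuous_on UNIV \<phi> \<and>
     (\<forall>c\<in>A. \<forall>d\<in>B. smooth_on (chart_map c ` (chart_dom c \<inter> \<phi> -` chart_dom d))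
                          (chart_map d \<circ> \<phi> \<circ> chart_inv c))"

definition tangent_map ::
  "('a, 'm::finite) chart set \<Rightarrow> ('b, 'n::finite) chart set \<Rightarrow> ('a \<Rightarrow> 'b)
   \<Rightarrow> 'a \<Rightarrow> real ^ 'm \<Rightarrow> real ^ 'n"
where
  "tangent_map A B \<phi> p =
     frechet_derivative (chart_map (chart_at B (\<phi> p)) \<circ> \<phi> \<circ> chart_inv (chart_at A p))
                        (at (chart_map (chart_at A p) p))"

text \<open>Smooth sections of the pull-back bundle \<open>\<phi>\<inverse>TN\<close>.\<close>

definition smooth_section ::
  "('a::topological_space, 'm::finite) chart set \<Rightarrow> ('b::topological_space, 'n::finite) chart set
   \<Rightarrow> ('a \<Rightarrow> 'b) \<Rightarrow> ('a \<Rightarrow> real ^ 'n) \<Rightarrow> bool"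
where
  "smooth_section A B \<phi> Y \<longleftrightarrow>
     (\<forall>c\<in>A. \<forall>d\<in>B. smooth_on (chart_map c ` (chart_dom c \<inter> \<phi> -` chart_dom d))
        (\<lambda>y. to_chart B d (\<phi> (chart_inv c y)) (Y (chart_inv c y))))"


section \<open>Riemannian metrics and differential forms\<close>

definition riemannian_metric ::
  "('a::topological_space, 'm::finite) chart set \<Rightarrow> ('a \<Rightarrow> real ^ 'm \<Rightarrow> real ^ 'm \<Rightarrow> real) \<Rightarrow> bool"
where
  "riemannian_metric A g \<longleftrightarrow>
     (\<forall>p. bilinear (g p)) \<and> (\<forall>p u v. g p u v = g p v u) \<and> (\<forall>p v. v \<noteq> 0 \<longrightarrow> 0 < g p v v) \<and>
     (\<forall>c\<in>A. \<forall>u v. smooth_on (chart_img c)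
        (\<lambda>y. g (chart_inv c y) (from_chart A c (chart_inv c y) u) (from_chart A c (chart_inv c y) v)))"

text \<open>
  A \<open>k\<close>-form takes its arguments as a list of length \<open>k\<close>; its value on lists of any other
  length is normalised to \<open>0\<close>.
\<close>

type_synonym ('a, 'm) form = "'a \<Rightarrow> (real ^ 'm) list \<Rightarrow> real"

definition smooth_form ::
  "('a::topological_space, 'm::finite) chart set \<Rightarrow> nat \<Rightarrow> ('a, 'm) form \<Rightarrow> bool"
where
  "smooth_form A k \<alpha> \<longleftrightarrow>
     (\<forall>p vs. length vs \<noteq> k \<longrightarrow> \<alpha> p vs = 0) \<and>
     (\<forall>p us ws. Suc (length us + length ws) = k \<longrightarrow> linear (\<lambda>v. \<alpha> p (us @ v # ws))) \<and>
     (\<forall>p vs. length vs = k \<and> \<not> distinct vs \<longrightarrow> \<alpha> p vs = 0) \<and>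
     (\<forall>c\<in>A. \<forall>us. length us = k \<longrightarrow>
        smooth_on (chart_img c) (\<lambda>y. \<alpha> (chart_inv c y) (map (from_chart A c (chart_inv c y)) us)))"

text \<open>
  Coordinate formula for the exterior derivative, evaluated in the preferred chart:
  \<open>d\<alpha>(v\<^sub>0,\<dots>,v\<^sub>k) = \<Sum>\<^sub>i (-1)\<^sup>i \<partial>\<^bsub>v\<^sub>i\<^esub> (\<alpha>(v\<^sub>0,\<dots>,v\<^sub>i omitted,\<dots>,v\<^sub>k))\<close>
  for vectors \<open>v\<^sub>i\<close> extended with constant components.
\<close>

definition ext_deriv ::
  "('a, 'm::finite) chart set \<Rightarrow> ('a, 'm) form \<Rightarrow> ('a, 'm) form"
where
  "ext_deriv A \<alpha> p vs = (let c = chart_at A p in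
     \<Sum>i<length vs. (- 1) ^ i *
       frechet_derivative
         (\<lambda>y. \<alpha> (chart_inv c y)
                (map (from_chart A c (chart_inv c y)) (take i vs @ drop (Suc i) vs)))
         (at (chart_map c p)) (vs ! i))"

definition pullback ::
  "('a, 'm::finite) chart set \<Rightarrow> ('b, 'n::finite) chart set \<Rightarrow> ('a \<Rightarrow> 'b)
   \<Rightarrow> ('b, 'n) form \<Rightarrow> ('a, 'm) form"
where
  "pullback A B \<phi> \<beta> p vs = \<beta> (\<phi> p) (map (tangent_map A B \<phi> p) vs)"

text \<open>The form \<open>\<phi>\<^sup>*\<iota>\<^sub>Y\<beta>\<close> for a section \<open>Y\<close> of \<open>\<phi>\<inverse>TN\<close>.\<close>

definition pullback_contraction ::
  "('a, 'm::finite) chart set \<Rightarrow> ('b, 'n::finite) chart set \<Rightarrow> ('a \<Rightarrow> 'b)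
   \<Rightarrow> ('a \<Rightarrow> real ^ 'n) \<Rightarrow> ('b, 'n) form \<Rightarrow> ('a, 'm) form"
where
  "pullback_contraction A B \<phi> Y \<beta> p vs = \<beta> (\<phi> p) (Y p # map (tangent_map A B \<phi> p) vs)"

definition orthonormal_frame ::
  "(real ^ 'm \<Rightarrow> real ^ 'm \<Rightarrow> real) \<Rightarrow> ('m::finite \<Rightarrow> real ^ 'm) \<Rightarrow> bool"
where
  "orthonormal_frame b e \<longleftrightarrow> (\<forall>i j. b (e i) (e j) = (if i = j then 1 else 0))"

text \<open>The choice of the frame does not matter.\<close>

definition form_inner ::
  "('a \<Rightarrow> real ^ 'm \<Rightarrow> real ^ 'm \<Rightarrow> real) \<Rightarrow> nat
   \<Rightarrow> ('a, 'm::finite) form \<Rightarrow> ('a, 'm) form \<Rightarrow> 'a \<Rightarrow> real"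
where
  "form_inner g k \<alpha> \<beta> p = (let e = (SOME e. orthonormal_frame (g p) e) in
     (1 / fact k) * (\<Sum>is\<in>{is::'m list. length is = k}. \<alpha> p (map e is) * \<beta> p (map e is)))"

definition sharp ::
  "('a \<Rightarrow> real ^ 'm \<Rightarrow> real ^ 'm \<Rightarrow> real) \<Rightarrow> ('a, 'm::finite) form \<Rightarrow> 'a \<Rightarrow> real ^ 'm"
where
  "sharp g \<alpha> p = (THE v. \<forall>w. g p v w = \<alpha> p [w])"


section \<open>Integration against the volume form\<close>

definition partition_of_unity ::
  "('a::topological_space, 'm::finite) chart set \<Rightarrow> nat \<Rightarrow> (nat \<Rightarrow> ('a, 'm) chart)
   \<Rightarrow> (nat \<Rightarrow> 'a \<Rightarrow> real) \<Rightarrow> bool"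
where
  "partition_of_unity A n \<kappa> \<rho> \<longleftrightarrow>
     (\<forall>i<n. \<kappa> i \<in> A \<and> (\<forall>p. 0 \<le> \<rho> i p) \<and> closure {p. \<rho> i p \<noteq> 0} \<subseteq> chart_dom (\<kappa> i) \<and>
            (\<forall>c\<in>A. smooth_on (chart_img c) (\<rho> i \<circ> chart_inv c))) \<and>
     (\<forall>p. (\<Sum>i<n. \<rho> i p) = 1)"

text \<open>
  In a positively oriented chart \<open>c\<close> the volume form is
  \<open>\<surd>det(g\<^sub>i\<^sub>j) dx\<^sup>1 \<and> \<dots> \<and> dx\<^sup>m\<close>; this is its coefficient.
\<close>

definition volume_coeff ::
  "('a, 'm::finite) chart set \<Rightarrow> ('a \<Rightarrow> real ^ 'm \<Rightarrow> real ^ 'm \<Rightarrow> real)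
   \<Rightarrow> ('a, 'm) chart \<Rightarrow> 'a \<Rightarrow> real"
where
  "volume_coeff A g c p =
     sqrt (det (\<chi> i j. g p (from_chart A c p (axis i 1)) (from_chart A c p (axis j 1))))"

text \<open>
  The integral of the top-degree form \<open>f \<^emph>\<open>times\<close> volume form\<close> over a compact manifold with
  oriented atlas \<open>A\<close>, by a partition of unity; the value is the one common to all of them.
\<close>

definition vol_integral ::
  "('a::topological_space, 'm::finite) chart set \<Rightarrow> ('a \<Rightarrow> real ^ 'm \<Rightarrow> real ^ 'm \<Rightarrow> real)
   \<Rightarrow> ('a \<Rightarrow> real) \<Rightarrow> real"
where
  "vol_integral A g f = (THE r. \<forall>n \<kappa> \<rho>. partition_of_unity A n \<kappa> \<rho> \<longrightarrow>
     r = (\<Sum>i<n. LINT y:chart_img (\<kappa> i)|lborel.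
            \<rho> i (chart_inv (\<kappa> i) y) * f (chart_inv (\<kappa> i) y)
              * volume_coeff A g (\<kappa> i) (chart_inv (\<kappa> i) y)))"

text \<open>
  The codifferential from \<open>(k+1)\<close>-forms to \<open>k\<close>-forms: the formal adjoint of \<^const>\<open>ext_deriv\<close>
  with respect to the \<open>L\<^sup>2\<close> inner products on the compact manifold.
\<close>

definition codiff ::
  "('a::topological_space, 'm::finite) chart set \<Rightarrow> ('a \<Rightarrow> real ^ 'm \<Rightarrow> real ^ 'm \<Rightarrow> real)
   \<Rightarrow> nat \<Rightarrow> ('a, 'm) form \<Rightarrow> ('a, 'm) form"
where
  "codiff A g k \<alpha> = (THE \<beta>. smooth_form A k \<beta> \<and>
     (\<forall>\<gamma>. smooth_form A k \<gamma> \<longrightarrow>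
        vol_integral A g (form_inner g (Suc k) (ext_deriv A \<gamma>) \<alpha>)
          = vol_integral A g (form_inner g k \<gamma> \<beta>)))"


section \<open>Levi-Civita connection\<close>

text \<open>
  The Christoffel map of the Levi-Civita connection at \<open>q\<close> in the preferred chart at \<open>q\<close>, that is
  \<open>\<nabla>\<^sub>u V = \<partial>\<^sub>u V + \<Gamma>(u, V)\<close>. In coordinates the connection is torsion-free iff
  \<open>\<Gamma>\<close> is symmetric, and it is metric iff the last condition holds.
\<close>

definition christoffel ::
  "('b, 'n::finite) chart set \<Rightarrow> ('b \<Rightarrow> real ^ 'n \<Rightarrow> real ^ 'n \<Rightarrow> real)
   \<Rightarrow> 'b \<Rightarrow> real ^ 'n \<Rightarrow> real ^ 'n \<Rightarrow> real ^ 'n"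
where
  "christoffel B h q = (let d = chart_at B q in THE \<Gamma>. bilinear \<Gamma> \<and> (\<forall>u v. \<Gamma> u v = \<Gamma> v u) \<and>
     (\<forall>z u v. frechet_derivative
                (\<lambda>y. h (chart_inv d y) (from_chart B d (chart_inv d y) u)
                                       (from_chart B d (chart_inv d y) v))
                (at (chart_map d q)) z
              = h q (\<Gamma> z u) v + h q u (\<Gamma> z v)))"

text \<open>The induced connection on \<open>\<phi>\<inverse>TN\<close>: \<open>\<nabla>\<^sup>\<phi>\<^sub>v Y = \<partial>\<^sub>v Y + \<Gamma>(d\<phi>(v), Y)\<close> at \<open>p\<close>.\<close>

definition pullback_connection ::
  "('a, 'm::finite) chart set \<Rightarrow> ('b, 'n::finite) chart set
   \<Rightarrow> ('b \<Rightarrow> real ^ 'n \<Rightarrow> real ^ 'n \<Rightarrow> real) \<Rightarrow> ('a \<Rightarrow> 'b)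
   \<Rightarrow> 'a \<Rightarrow> real ^ 'm \<Rightarrow> ('a \<Rightarrow> real ^ 'n) \<Rightarrow> real ^ 'n"
where
  "pullback_connection A B h \<phi> p v Y = (let c = chart_at A p; d = chart_at B (\<phi> p) in
     frechet_derivative (\<lambda>y. to_chart B d (\<phi> (chart_inv c y)) (Y (chart_inv c y)))
                        (at (chart_map c p)) v
     + christoffel B h (\<phi> p) (tangent_map A B \<phi> p v) (Y p))"


section \<open>Kaehler manifolds\<close>

text \<open>\<open>\<omega> = h(J\<cdot>,\<cdot>)\<close>\<close>

definition kaehler_form ::
  "('b \<Rightarrow> real ^ 'n \<Rightarrow> real ^ 'n \<Rightarrow> real) \<Rightarrow> ('b \<Rightarrow> real ^ 'n \<Rightarrow> real ^ 'n) \<Rightarrow> ('b, 'n::finite) form"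
where
  "kaehler_form h J q vs = (case vs of [u, v] \<Rightarrow> h q (J q u) v | _ \<Rightarrow> 0)"

text \<open>
  The second condition says that \<open>J\<close> comes from a holomorphic atlas: around every point there
  are coordinates, compatible with the smooth structure, in which \<open>J\<close> has constant components.
\<close>

definition complex_structure ::
  "('b::topological_space, 'n::finite) chart set \<Rightarrow> ('b \<Rightarrow> real ^ 'n \<Rightarrow> real ^ 'n) \<Rightarrow> bool"
where
  "complex_structure B J \<longleftrightarrow>
     (\<forall>q. linear (J q) \<and> (\<forall>v. J q (J q v) = - v)) \<and>
     (\<forall>q. \<exists>d. is_chart d \<and> q \<in> chart_dom d \<and>
        (\<forall>c\<in>B. smooth_transition c d \<and> smooth_transition d c) \<and>
        (\<exists>J0. \<forall>q'\<in>chart_dom d. \<forall>v. to_chart B d q' (J q' v) = J0 (to_chart B d q' v)))"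

definition kaehler ::
  "('b::topological_space, 'n::finite) chart set \<Rightarrow> ('b \<Rightarrow> real ^ 'n \<Rightarrow> real ^ 'n \<Rightarrow> real)
   \<Rightarrow> ('b \<Rightarrow> real ^ 'n \<Rightarrow> real ^ 'n) \<Rightarrow> bool"
where
  "kaehler B h J \<longleftrightarrow> riemannian_metric B h \<and> complex_structure B J \<and>
     (\<forall>q u v. h q (J q u) (J q v) = h q u v) \<and>
     (\<forall>q vs. ext_deriv B (kaehler_form h J) q vs = 0)"


section \<open>The energy and its first and second variation\<close>

definition energy ::
  "('a::topological_space, 'm::finite) chart set \<Rightarrow> ('a \<Rightarrow> real ^ 'm \<Rightarrow> real ^ 'm \<Rightarrow> real)
   \<Rightarrow> ('b, 'n::finite) chart set \<Rightarrow> ('b \<Rightarrow> real ^ 'n \<Rightarrow> real ^ 'n \<Rightarrow> real)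
   \<Rightarrow> ('b \<Rightarrow> real ^ 'n \<Rightarrow> real ^ 'n) \<Rightarrow> ('a \<Rightarrow> 'b) \<Rightarrow> real"
where
  "energy A g B h J \<phi> = (let \<Omega> = pullback A B \<phi> (kaehler_form h J) in
     1 / 2 * vol_integral A g (form_inner g 2 \<Omega> \<Omega>))"

text \<open>Families of maps depending smoothly on a parameter in the open set \<open>U\<close>.\<close>

definition smooth_family ::
  "('a::topological_space, 'm::finite) chart set \<Rightarrow> ('b::topological_space, 'n::finite) chart set
   \<Rightarrow> 's::euclidean_space set \<Rightarrow> ('s \<Rightarrow> 'a \<Rightarrow> 'b) \<Rightarrow> bool"
where
  "smooth_family A B U \<Phi> \<longleftrightarrow> continuous_on (U \<times> UNIV) (\<lambda>(s, p). \<Phi> s p) \<and>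
     (\<forall>c\<in>A. \<forall>d\<in>B.
        smooth_on {(s, y). s \<in> U \<and> y \<in> chart_img c \<and> \<Phi> s (chart_inv c y) \<in> chart_dom d}
                  (\<lambda>(s, y). chart_map d (\<Phi> s (chart_inv c y))))"

definition critical_point ::
  "('a::topological_space, 'm::finite) chart set \<Rightarrow> ('a \<Rightarrow> real ^ 'm \<Rightarrow> real ^ 'm \<Rightarrow> real)
   \<Rightarrow> ('b::topological_space, 'n::finite) chart set \<Rightarrow> ('b \<Rightarrow> real ^ 'n \<Rightarrow> real ^ 'n \<Rightarrow> real)
   \<Rightarrow> ('b \<Rightarrow> real ^ 'n \<Rightarrow> real ^ 'n) \<Rightarrow> ('a \<Rightarrow> 'b) \<Rightarrow> bool"
where
  "critical_point A g B h J \<phi> \<longleftrightarrow> smooth_map A B \<phi> \<and>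
     (\<forall>(U :: real set) \<Phi>. open U \<and> 0 \<in> U \<and> smooth_family A B U \<Phi> \<and> \<Phi> 0 = \<phi> \<longrightarrow>
        ((\<lambda>t. energy A g B h J (\<Phi> t)) has_real_derivative 0) (at 0))"

definition velocity :: "('b, 'n::finite) chart set \<Rightarrow> (real \<Rightarrow> 'b) \<Rightarrow> real ^ 'n" where
  "velocity B \<gamma> = vector_derivative (\<lambda>t. chart_map (chart_at B (\<gamma> 0)) (\<gamma> t)) (at 0)"

text \<open>Two-parameter variations \<open>\<phi>\<^sub>s\<^sub>,\<^sub>t = \<Phi> (s, t)\<close> with \<open>X = \<partial>\<^sub>t\<phi>\<^sub>s\<^sub>,\<^sub>t\<close> and \<open>Y = \<partial>\<^sub>s\<phi>\<^sub>s\<^sub>,\<^sub>t\<close> at \<open>(0, 0)\<close>.\<close>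

definition variation2 ::
  "('a::topological_space, 'm::finite) chart set \<Rightarrow> ('b::topological_space, 'n::finite) chart set
   \<Rightarrow> ('a \<Rightarrow> 'b) \<Rightarrow> ('a \<Rightarrow> real ^ 'n) \<Rightarrow> ('a \<Rightarrow> real ^ 'n)
   \<Rightarrow> (real \<times> real \<Rightarrow> 'a \<Rightarrow> 'b) \<Rightarrow> bool"
where
  "variation2 A B \<phi> X Y \<Phi> \<longleftrightarrow>
     (\<exists>U. open U \<and> (0, 0) \<in> U \<and> smooth_family A B U \<Phi>) \<and> \<Phi> (0, 0) = \<phi> \<and>
     (\<forall>p. X p = velocity B (\<lambda>t. \<Phi> (0, t) p)) \<and>
     (\<forall>p. Y p = velocity B (\<lambda>s. \<Phi> (s, 0) p))"

definition has_mixed_derivative_at_0 :: "(real \<times> real \<Rightarrow> real) \<Rightarrow> real \<Rightarrow> bool" where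
  "has_mixed_derivative_at_0 f r \<longleftrightarrow>
     (\<exists>f'. (\<forall>\<^sub>F s in nhds 0. ((\<lambda>t. f (s, t)) has_real_derivative f' s) (at 0)) \<and>
           (f' has_real_derivative r) (at 0))"

text \<open>
  The common value of \<open>\<partial>\<^sup>2E(\<phi>\<^sub>s\<^sub>,\<^sub>t)/\<partial>s\<partial>t\<close> at \<open>(0, 0)\<close> over all variations in the directions \<open>X\<close> and \<open>Y\<close>.
\<close>

definition hessian ::
  "('a::topological_space, 'm::finite) chart set \<Rightarrow> ('a \<Rightarrow> real ^ 'm \<Rightarrow> real ^ 'm \<Rightarrow> real)
   \<Rightarrow> ('b::topological_space, 'n::finite) chart set \<Rightarrow> ('b \<Rightarrow> real ^ 'n \<Rightarrow> real ^ 'n \<Rightarrow> real)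
   \<Rightarrow> ('b \<Rightarrow> real ^ 'n \<Rightarrow> real ^ 'n) \<Rightarrow> ('a \<Rightarrow> 'b)
   \<Rightarrow> ('a \<Rightarrow> real ^ 'n) \<Rightarrow> ('a \<Rightarrow> real ^ 'n) \<Rightarrow> real"
where
  "hessian A g B h J \<phi> X Y = (THE r. \<forall>\<Phi>. variation2 A B \<phi> X Y \<Phi> \<longrightarrow>
     has_mixed_derivative_at_0 (\<lambda>st. energy A g B h J (\<Phi> st)) r)"

text \<open>\<open>Z\<^sub>\<phi> = \<sharp>\<delta>\<phi>\<^sup>*\<omega>\<close>\<close>

definition Z_field ::
  "('a::topological_space, 'm::finite) chart set \<Rightarrow> ('a \<Rightarrow> real ^ 'm \<Rightarrow> real ^ 'm \<Rightarrow> real)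
   \<Rightarrow> ('b, 'n::finite) chart set \<Rightarrow> ('b \<Rightarrow> real ^ 'n \<Rightarrow> real ^ 'n \<Rightarrow> real)
   \<Rightarrow> ('b \<Rightarrow> real ^ 'n \<Rightarrow> real ^ 'n) \<Rightarrow> ('a \<Rightarrow> 'b) \<Rightarrow> 'a \<Rightarrow> real ^ 'm"
where
  "Z_field A g B h J \<phi> = sharp g (codiff A g 1 (pullback A B \<phi> (kaehler_form h J)))"

text \<open>\<open>\<L>\<^sub>\<phi>Y = -J(\<nabla>\<^sup>\<phi>\<^bsub>Z\<^sub>\<phi>\<^esub> Y + d\<phi>(\<sharp>\<delta>d\<phi>\<^sup>*\<iota>\<^sub>Y\<omega>))\<close>\<close>

definition jacobi_operator ::
  "('a::topological_space, 'm::finite) chart set \<Rightarrow> ('a \<Rightarrow> real ^ 'm \<Rightarrow> real ^ 'm \<Rightarrow> real)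
   \<Rightarrow> ('b, 'n::finite) chart set \<Rightarrow> ('b \<Rightarrow> real ^ 'n \<Rightarrow> real ^ 'n \<Rightarrow> real)
   \<Rightarrow> ('b \<Rightarrow> real ^ 'n \<Rightarrow> real ^ 'n) \<Rightarrow> ('a \<Rightarrow> 'b)
   \<Rightarrow> ('a \<Rightarrow> real ^ 'n) \<Rightarrow> 'a \<Rightarrow> real ^ 'n"
where
  "jacobi_operator A g B h J \<phi> Y p =
     - J (\<phi> p)
         (pullback_connection A B h \<phi> p (Z_field A g B h J \<phi> p) Y
          + tangent_map A B \<phi> p
              (sharp g
                (codiff A g 1
                  (ext_deriv A (pullback_contraction A B \<phi> Y (kaehler_form h J)))) p))"

end

theory Submission
  imports Defs
begin

text \<open>
  Along a variation, closedness of \<open>\<omega>\<close> gives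
  \<open>\<partial>\<^sub>t \<phi>\<^sub>s\<^sub>,\<^sub>t\<^sup>*\<omega> = d(\<phi>\<^sub>s\<^sub>,\<^sub>t\<^sup>*\<iota>\<^bsub>\<partial>\<^sub>t\<phi>\<^esub>\<omega>)\<close>, so the first variation is the
  integral of \<open>\<langle>\<phi>\<^sup>*\<omega>, d\<phi>\<^sup>*\<iota>\<^sub>X\<omega>\<rangle>\<close>. Differentiating once more in \<open>s\<close> produces
  \<open>\<langle>d\<phi>\<^sup>*\<iota>\<^sub>X\<omega>, d\<phi>\<^sup>*\<iota>\<^sub>Y\<omega>\<rangle> + \<langle>\<phi>\<^sup>*\<omega>, d\<zeta>\<rangle>\<close> with \<open>\<zeta> = \<partial>\<^sub>s \<phi>\<^sub>s\<^sub>,\<^sub>t\<^sup>*\<iota>\<^bsub>\<partial>\<^sub>t\<phi>\<^esub>\<omega>\<close>.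
  Since \<open>\<omega>\<close> is parallel, \<open>\<zeta> = \<phi>\<^sup>*\<iota>\<^sub>W\<omega> + \<omega>(X, \<nabla>\<^sup>\<phi>Y)\<close> with \<open>W = \<nabla>\<^sub>s\<partial>\<^sub>t\<phi>\<close>. The first summand contributes
  the first variation in the direction \<open>W\<close>, which vanishes at a critical point; the remaining terms
  become the asserted integral after moving \<open>d\<close> to the other side as \<open>\<delta>\<close>.
\<close>

section \<open>Smooth functions on open sets\<close>

text \<open>\<open>vol_integral\<close>, \<open>codiff\<close>, \<open>christoffel\<close> and
  \<open>hessian\<close> are definite descriptions, so existence and uniqueness must be settled
  before anything can be computed: change of variables makes the integral independent of the
  partition of unity, integration by parts in charts yields an explicit codifferential, and the
  Hessian needs at least one variation with prescribed \<open>X\<close> and \<open>Y\<close>. That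
  last construction serves twice: criticality only speaks of derivatives along families of maps, so
  the acceleration has to be realised as the velocity of such a family. That \<open>\<omega>\<close>
  is parallel is not built into \<open>kaehler\<close>, which asks for closedness and for charts in
  which \<open>J\<close> is constant. It is derived from these through the Nijenhuis tensor. Tangent
  vectors are stored in a chart that jumps from point to point. Each object therefore gets a
  coordinate version in arbitrary charts, where smoothness and derivatives make sense. Independence
  of the charts always rests on the same point: second derivatives of coordinate changes cancel by
  symmetry, or against Christoffel terms.\<close>

abbreviation dd :: "('a::real_normed_vector \<Rightarrow> 'b::real_normed_vector) \<Rightarrow> 'a \<Rightarrow> 'a \<Rightarrow> 'b" where
  "dd f x \<equiv> frechet_derivative f (at x)"

lemma dd_eqI: "(f has_derivative f') (at x) \<Longrightarrow> dd f x = f'"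
  by (metis frechet_derivative_at)

lemma dd_has_derivative: "f differentiable (at x) \<Longrightarrow> (f has_derivative dd f x) (at x)"
  by (simp add: frechet_derivative_works)

lemma dd_linear: "f differentiable (at x) \<Longrightarrow> linear (dd f x)"
  by (rule linear_frechet_derivative)

lemma differentiable_cong_open:
  assumes "open S" "x \<in> S" "\<And>y. y \<in> S \<Longrightarrow> f y = g y"
  shows "f differentiable (at x) \<longleftrightarrow> g differentiable (at x)"
  using has_derivative_transform_within_open[OF _ assms(1,2)] assms(3)
  unfolding differentiable_def by metis

text \<open>The two functions have the same derivatives at \<open>x\<close>, so the choice behind
  \<open>frechet_derivative\<close> falls on the same map even where neither is
  differentiable.\<close>

lemma dd_cong_open:
  assumes "open S" "x \<in> S" "\<And>y. y \<in> S \<Longrightarrow> f y = g y"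
  shows "dd f x = dd g x"
proof -
  have "(f has_derivative f') (at x) \<longleftrightarrow> (g has_derivative f') (at x)" for f'
    using has_derivative_transform_within_open[OF _ assms(1,2)] assms(3) by metis
  then show ?thesis unfolding frechet_derivative_def by simp
qed

lemma td_cong:
  assumes "open S" "\<And>y. y \<in> S \<Longrightarrow> f y = g y"
  shows "times_differentiable_on k S f \<longleftrightarrow> times_differentiable_on k S g"
  using assms(2)
proof (induction k arbitrary: f g)
  case 0
  then show ?case by (auto cong: continuous_on_cong)
next
  case (Suc k)
  have "times_differentiable_on k S (\<lambda>x. dd f x v) \<longleftrightarrow> times_differentiable_on k S (\<lambda>x. dd g x v)" for v
    by (rule Suc.IH) (use Suc.prems assms(1) dd_cong_open in metis)
  then show ?case using Suc.prems assms(1) differentiable_cong_open[of S _ f g] by auto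
qed

lemma td_subset: "times_differentiable_on k S f \<Longrightarrow> T \<subseteq> S \<Longrightarrow> times_differentiable_on k T f"
  by (induction k arbitrary: f) (auto intro: continuous_on_subset)

lemma td_Suc_imp: "times_differentiable_on (Suc k) S f \<Longrightarrow> times_differentiable_on k S f"
proof (induction k arbitrary: f)
  case 0
  then show ?case
    by (auto simp: differentiable_imp_continuous_within intro!: continuous_at_imp_continuous_on)
qed auto

lemma td_local:
  assumes "\<And>x. x \<in> S \<Longrightarrow> \<exists>T. open T \<and> x \<in> T \<and> times_differentiable_on k T f"
  shows "times_differentiable_on k S f"
  using assms
proof (induction k arbitrary: f)
  case 0
  then show ?case
    by (metis continuous_at_imp_continuous_on continuous_on_eq_continuous_at times_differentiable_on.simps(1))
next
  case (Suc k)
  have "times_differentiable_on k S (\<lambda>x. dd f x v)" for v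
    using Suc.prems by (intro Suc.IH) (metis times_differentiable_on.simps(2))
  then show ?case using Suc.prems by auto
qed

lemma td_const: "times_differentiable_on k S (\<lambda>x. c)"
  by (induction k arbitrary: c) auto

lemma td_bounded_linear:
  assumes "bounded_linear f" shows "times_differentiable_on k S f"
proof -
  have "(f has_derivative f) (at x)" for x
    using assms by (rule bounded_linear_imp_has_derivative)
  then have "f differentiable (at x)" "dd f x = f" for x
    by (auto simp: differentiable_def dd_eqI)
  then show ?thesis by (cases k) (auto simp: td_const assms linear_continuous_on)
qed

lemma td_add:
  assumes "open S"
  shows "times_differentiable_on k S f \<Longrightarrow> times_differentiable_on k S g \<Longrightarrow>
    times_differentiable_on k S (\<lambda>x. f x + g x)"
proof (induction k arbitrary: f g)
  case 0
  then show ?case by (auto intro: continuous_on_add)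
next
  case (Suc k)
  have "dd (\<lambda>x. f x + g x) x v = dd f x v + dd g x v" if "x \<in> S" for x v
    using dd_eqI[OF has_derivative_add[OF dd_has_derivative dd_has_derivative], of f x g] Suc.prems that by simp
  then have "times_differentiable_on k S (\<lambda>x. dd (\<lambda>x. f x + g x) x v)" for v
    using Suc by (subst td_cong[OF assms(1)]) auto
  then show ?case using Suc.prems by auto
qed

lemma td_bilinear:
  assumes "bounded_bilinear b" "open S"
  shows "times_differentiable_on k S f \<Longrightarrow> times_differentiable_on k S g \<Longrightarrow>
    times_differentiable_on k S (\<lambda>x. b (f x) (g x))"
proof (induction k arbitrary: f g)
  case 0
  then show ?case by (auto intro: bounded_bilinear.continuous_on[OF assms(1)])
next
  case (Suc k)
  have *: "((\<lambda>x. b (f x) (g x)) has_derivative (\<lambda>v. b (f x) (dd g x v) + b (dd f x v) (g x))) (at x)"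
    if "x \<in> S" for x
    using bounded_bilinear.FDERIV[OF assms(1) dd_has_derivative dd_has_derivative, of f x g] Suc.prems that
    by simp
  have "times_differentiable_on k S (\<lambda>x. dd (\<lambda>x. b (f x) (g x)) x v)" for v
    using Suc td_Suc_imp[OF Suc.prems(1)] td_Suc_imp[OF Suc.prems(2)]
    by (subst td_cong[OF assms(2) fun_cong[OF dd_eqI[OF *]]]) (auto intro: td_add[OF assms(2)])
  then show ?case using * by (auto simp: differentiable_def)
qed

lemma td_sum:
  assumes "open S" "\<And>i. i \<in> I \<Longrightarrow> times_differentiable_on k S (f i)"
  shows "times_differentiable_on k S (\<lambda>x. \<Sum>i\<in>I. f i x)"
  using assms(2) by (induction I rule: infinite_finite_induct) (auto intro: td_add[OF assms(1)] td_const)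

text \<open>The chain rule differentiates \<open>f\<close> in the direction \<open>dd g x v\<close>,
  which moves with \<open>x\<close>, whereas \<open>times_differentiable_on\<close> only controls
  fixed directions. Expanding that direction in \<open>Basis\<close> turns the derivative into a
  finite sum of products covered by the induction hypothesis.\<close>

lemma td_compose:
  fixes f :: "'b::euclidean_space \<Rightarrow> 'c::real_normed_vector" and g :: "'a::real_normed_vector \<Rightarrow> 'b"
  assumes "open S" "\<And>x. x \<in> S \<Longrightarrow> g x \<in> T"
  shows "times_differentiable_on k T f \<Longrightarrow> times_differentiable_on k S g \<Longrightarrow>
    times_differentiable_on k S (\<lambda>x. f (g x))"
proof (induction k arbitrary: f)
  case 0
  then show ?case using assms(2) by (auto intro: continuous_on_compose2)
next
  case (Suc k)
  have *: "((\<lambda>x. f (g x)) has_derivative (\<lambda>v. dd f (g x) (dd g x v))) (at x)" if "x \<in> S" for x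
    using has_derivative_compose[OF dd_has_derivative dd_has_derivative, of g x f] Suc.prems that assms(2)
    by (simp add: o_def)
  have e: "dd (\<lambda>x. f (g x)) x v = (\<Sum>i\<in>Basis. (dd g x v \<bullet> i) *\<^sub>R dd f (g x) i)" if "x \<in> S" for x v
  proof -
    have lin: "linear (dd f (g x))" using Suc.prems that assms(2) by (auto intro: dd_linear)
    have "dd f (g x) (dd g x v) = dd f (g x) (\<Sum>i\<in>Basis. (dd g x v \<bullet> i) *\<^sub>R i)"
      by (simp add: euclidean_representation)
    then show ?thesis unfolding dd_eqI[OF *[OF that]] by (simp add: linear_sum[OF lin] linear_cmul[OF lin])
  qed
  have "times_differentiable_on k S (\<lambda>x. \<Sum>i\<in>Basis. (dd g x v \<bullet> i) *\<^sub>R dd f (g x) i)" for v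
  proof (intro td_sum[OF assms(1)] td_bilinear[OF bounded_bilinear_scaleR assms(1)])
    fix i :: 'b
    show "times_differentiable_on k S (\<lambda>x. dd g x v \<bullet> i)"
      using Suc.prems(2) by (intro td_bilinear[OF bounded_bilinear_inner assms(1)] td_const) auto
    show "times_differentiable_on k S (\<lambda>x. dd f (g x) i)"
      using Suc.prems by (intro Suc.IH td_Suc_imp[OF Suc.prems(2)]) auto
  qed
  then have "times_differentiable_on k S (\<lambda>x. dd (\<lambda>x. f (g x)) x v)" for v
    by (subst td_cong[OF assms(1) e])
  then show ?case using * by (auto simp: differentiable_def)
qed

named_theorems smooth_intros

lemma smooth_on_cong:
  "open S \<Longrightarrow> (\<And>y. y \<in> S \<Longrightarrow> f y = g y) \<Longrightarrow> smooth_on S f \<longleftrightarrow> smooth_on S g"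
  unfolding smooth_on_def using td_cong by blast

lemma smooth_on_subset: "smooth_on S f \<Longrightarrow> T \<subseteq> S \<Longrightarrow> smooth_on T f"
  unfolding smooth_on_def using td_subset by blast

lemma smooth_on_local:
  assumes "\<And>x. x \<in> S \<Longrightarrow> \<exists>T. open T \<and> x \<in> T \<and> smooth_on T f"
  shows "smooth_on S f"
  unfolding smooth_on_def
proof
  fix k show "times_differentiable_on k S f"
    by (rule td_local) (use assms in \<open>metis smooth_on_def\<close>)
qed

lemma smooth_on_differentiable: "smooth_on S f \<Longrightarrow> x \<in> S \<Longrightarrow> f differentiable (at x)"
  unfolding smooth_on_def by (metis times_differentiable_on.simps(2))

lemma smooth_on_has_derivative: "smooth_on S f \<Longrightarrow> x \<in> S \<Longrightarrow> (f has_derivative dd f x) (at x)"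
  by (blast intro: dd_has_derivative smooth_on_differentiable)

lemma smooth_on_dd [smooth_intros]: "smooth_on S f \<Longrightarrow> smooth_on S (\<lambda>x. dd f x v)"
  unfolding smooth_on_def by (metis times_differentiable_on.simps(2))

lemma smooth_on_continuous: "smooth_on S f \<Longrightarrow> continuous_on S f"
  unfolding smooth_on_def by (metis times_differentiable_on.simps(1))

lemma smooth_on_const [smooth_intros]: "smooth_on S (\<lambda>x. c)"
  unfolding smooth_on_def by (simp add: td_const)

lemma smooth_on_bounded_linear: "bounded_linear f \<Longrightarrow> smooth_on S f"
  unfolding smooth_on_def by (simp add: td_bounded_linear)

lemma smooth_on_id [smooth_intros]: "smooth_on S (\<lambda>x. x)"
  by (rule smooth_on_bounded_linear) simp

lemma smooth_on_add [smooth_intros]: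
  "open S \<Longrightarrow> smooth_on S f \<Longrightarrow> smooth_on S g \<Longrightarrow> smooth_on S (\<lambda>x. f x + g x)"
  unfolding smooth_on_def by (simp add: td_add)

lemma smooth_on_sum [smooth_intros]:
  "open S \<Longrightarrow> (\<And>i. i \<in> I \<Longrightarrow> smooth_on S (f i)) \<Longrightarrow> smooth_on S (\<lambda>x. \<Sum>i\<in>I. f i x)"
  unfolding smooth_on_def by (simp add: td_sum)

lemma smooth_on_bilinear:
  "bounded_bilinear b \<Longrightarrow> open S \<Longrightarrow> smooth_on S f \<Longrightarrow> smooth_on S g \<Longrightarrow> smooth_on S (\<lambda>x. b (f x) (g x))"
  unfolding smooth_on_def by (simp add: td_bilinear)

lemmas smooth_on_scaleR [smooth_intros] = smooth_on_bilinear[OF bounded_bilinear_scaleR]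
lemmas smooth_on_mult [smooth_intros] = smooth_on_bilinear[OF bounded_bilinear_mult]
lemmas smooth_on_inner [smooth_intros] = smooth_on_bilinear[OF bounded_bilinear_inner]

lemma smooth_on_compose:
  fixes f :: "'b::euclidean_space \<Rightarrow> 'c::real_normed_vector" and g :: "'a::real_normed_vector \<Rightarrow> 'b"
  assumes "smooth_on T f" "smooth_on S g" "open S" "\<And>x. x \<in> S \<Longrightarrow> g x \<in> T"
  shows "smooth_on S (\<lambda>x. f (g x))"
  using td_compose[of S g T] assms unfolding smooth_on_def by blast

lemma smooth_on_bounded_linear_compose:
  assumes "bounded_linear f" "open S" "smooth_on S g"
  shows "smooth_on S (\<lambda>x. f (g x :: 'b::euclidean_space))"
  by (rule smooth_on_compose[OF smooth_on_bounded_linear[OF assms(1)] assms(3,2), of UNIV]) auto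

lemma smooth_on_minus [smooth_intros]:
  "open S \<Longrightarrow> smooth_on S f \<Longrightarrow> smooth_on S (\<lambda>x. - f x :: 'b::euclidean_space)"
  by (rule smooth_on_bounded_linear_compose[OF bounded_linear_minus[OF bounded_linear_ident]])

lemma smooth_on_diff [smooth_intros]:
  "open S \<Longrightarrow> smooth_on S f \<Longrightarrow> smooth_on S g \<Longrightarrow> smooth_on S (\<lambda>x. f x - g x :: 'b::euclidean_space)"
  using smooth_on_add[of S f "\<lambda>x. - g x"] smooth_on_minus[of S g] by simp

lemma smooth_on_prod [smooth_intros]:
  "open S \<Longrightarrow> (\<And>i. i \<in> I \<Longrightarrow> smooth_on S (f i)) \<Longrightarrow> smooth_on S (\<lambda>x. \<Prod>i\<in>I. f i x :: real)"
  by (induction I rule: infinite_finite_induct) (auto intro: smooth_intros)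

lemma smooth_on_euclidean_componentwise:
  fixes f :: "'a::real_normed_vector \<Rightarrow> 'b::euclidean_space"
  assumes "open S" "\<And>i. i \<in> Basis \<Longrightarrow> smooth_on S (\<lambda>x. f x \<bullet> i)"
  shows "smooth_on S f"
proof -
  have "smooth_on S (\<lambda>x. \<Sum>i\<in>Basis. (f x \<bullet> i) *\<^sub>R i)"
    by (intro smooth_intros assms)
  then show ?thesis by (simp add: euclidean_representation)
qed

lemma smooth_on_Pair [smooth_intros]:
  fixes f :: "'a::real_normed_vector \<Rightarrow> 'b::euclidean_space" and g :: "'a \<Rightarrow> 'c::euclidean_space"
  assumes "open S" "smooth_on S f" "smooth_on S g"
  shows "smooth_on S (\<lambda>x. (f x, g x))"
proof -
  have "bounded_linear (\<lambda>x :: 'b. (x, 0 :: 'c))" "bounded_linear (\<lambda>y :: 'c. (0 :: 'b, y))"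
    by (auto intro!: bounded_linear_intros)
  then have "smooth_on S (\<lambda>x. (f x, 0) + (0, g x))"
    using assms by (intro smooth_on_add smooth_on_bounded_linear_compose[of "\<lambda>x :: 'b. (x, 0 :: 'c)"]
      smooth_on_bounded_linear_compose[of "\<lambda>y :: 'c. (0 :: 'b, y)"])
  then show ?thesis by simp
qed

lemma smooth_on_vec [smooth_intros]:
  assumes "open S" "\<And>i. smooth_on S (\<lambda>x. f x i)"
  shows "smooth_on S (\<lambda>x. (\<chi> i. f x i) :: real ^ 'n)"
  by (rule smooth_on_euclidean_componentwise)
     (auto simp: Basis_vec_def assms inner_axis)

lemma smooth_on_fst [smooth_intros]:
  fixes f :: "'a::real_normed_vector \<Rightarrow> 'b::euclidean_space \<times> 'c::euclidean_space"
  shows "open S \<Longrightarrow> smooth_on S f \<Longrightarrow> smooth_on S (\<lambda>x. fst (f x))"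
  by (rule smooth_on_bounded_linear_compose[OF bounded_linear_fst])

lemma smooth_on_snd [smooth_intros]:
  fixes f :: "'a::real_normed_vector \<Rightarrow> 'b::euclidean_space \<times> 'c::euclidean_space"
  shows "open S \<Longrightarrow> smooth_on S f \<Longrightarrow> smooth_on S (\<lambda>x. snd (f x))"
  by (rule smooth_on_bounded_linear_compose[OF bounded_linear_snd])

text \<open>The derivative is a polynomial in \<open>inverse\<close> itself, so the product rule
  closes the induction.\<close>

lemma td_inverse: "times_differentiable_on k (- {0}) (inverse :: real \<Rightarrow> real)"
proof (induction k)
  case 0
  then show ?case by (auto intro: continuous_intros)
next
  case (Suc k)
  have *: "((inverse :: real \<Rightarrow> real) has_derivative (\<lambda>v. - (inverse x * v * inverse x))) (at x)"
    if "x \<in> - {0}" for x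
    using that by (auto intro!: derivative_eq_intros)
  have "times_differentiable_on k (- {0}) (\<lambda>x. - v * (inverse x * inverse x) :: real)" for v
    using Suc by (intro td_bilinear[OF bounded_bilinear_mult] td_const) auto
  then have "times_differentiable_on k (- {0}) (\<lambda>x. dd (inverse :: real \<Rightarrow> real) x v)" for v
    by (subst td_cong[OF _ fun_cong[OF dd_eqI[OF *]]]) (auto simp: mult_ac)
  then show ?case using * by (auto simp: differentiable_def)
qed

lemma smooth_on_inverse [smooth_intros]:
  fixes f :: "'a::real_normed_vector \<Rightarrow> real"
  assumes "open S" "smooth_on S f" "\<And>x. x \<in> S \<Longrightarrow> f x \<noteq> 0"
  shows "smooth_on S (\<lambda>x. inverse (f x))"
  by (rule smooth_on_compose[of "- {0}" inverse S f]) (use assms td_inverse in \<open>auto simp: smooth_on_def\<close>)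

lemma smooth_on_divide [smooth_intros]:
  fixes f :: "'a::real_normed_vector \<Rightarrow> real"
  assumes "open S" "smooth_on S f" "smooth_on S g" "\<And>x. x \<in> S \<Longrightarrow> g x \<noteq> 0"
  shows "smooth_on S (\<lambda>x. f x / g x)"
  unfolding divide_inverse by (intro smooth_intros assms)

text \<open>The derivative is written with \<open>sqrt x * inverse x\<close> in place of the inverse
  of \<open>sqrt x\<close>: the first factor is then covered by the induction hypothesis and the
  second by \<open>td_inverse\<close>.\<close>

lemma td_sqrt: "times_differentiable_on k {0<..} sqrt"
proof (induction k)
  case 0
  then show ?case by (auto intro: continuous_intros)
next
  case (Suc k)
  have *: "(sqrt has_derivative (\<lambda>v. (v / 2) * (sqrt x * inverse x))) (at x)" if "x \<in> {0<..}" for x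
  proof -
    have "(sqrt has_field_derivative inverse (sqrt x) / 2) (at x)"
      using that by (auto intro!: derivative_eq_intros)
    moreover have "inverse (sqrt x) = sqrt x * inverse x"
      using that by (simp add: field_simps)
    ultimately show ?thesis
      unfolding has_field_derivative_def by (auto elim!: has_derivative_eq_rhs simp: fun_eq_iff)
  qed
  have "times_differentiable_on k {0<..} (\<lambda>x. v / 2 * (sqrt x * inverse x))" for v
    using Suc by (intro td_bilinear[OF bounded_bilinear_mult] td_const td_subset[OF td_inverse]) auto
  then have "times_differentiable_on k {0<..} (\<lambda>x. dd sqrt x v)" for v
    by (subst td_cong[OF _ fun_cong[OF dd_eqI[OF *]]]) auto
  then show ?case using * by (auto simp: differentiable_def)
qed

lemma smooth_on_sqrt [smooth_intros]:
  assumes "open S" "smooth_on S f" "\<And>x. x \<in> S \<Longrightarrow> 0 < f x"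
  shows "smooth_on S (\<lambda>x. sqrt (f x))"
  by (rule smooth_on_compose[of "{0<..}" sqrt S f]) (use assms td_sqrt in \<open>auto simp: smooth_on_def\<close>)


section \<open>Symmetry of second derivatives\<close>

lemma smooth_line_derivative:
  fixes f :: "'a::real_normed_vector \<Rightarrow> real"
  assumes "smooth_on S f" "p + s *\<^sub>R u \<in> S"
  shows "((\<lambda>s. f (p + s *\<^sub>R u)) has_field_derivative dd f (p + s *\<^sub>R u) u) (at s)"
proof -
  have d: "(f has_derivative dd f (p + s *\<^sub>R u)) (at (p + s *\<^sub>R u))"
    using smooth_on_has_derivative[OF assms] .
  have "((\<lambda>s. p + s *\<^sub>R u) has_derivative (\<lambda>t. t *\<^sub>R u)) (at s)"
    by (auto intro!: derivative_eq_intros)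
  from has_derivative_compose[OF this d]
  show ?thesis
    unfolding has_field_derivative_def
    by (rule has_derivative_eq_rhs)
       (auto simp: fun_eq_iff linear_cmul[OF has_derivative_linear[OF d]] mult.commute)
qed

text \<open>The mean value theorem is applied to the increment of \<open>f\<close> along
  \<open>h *\<^sub>R v\<close> as a function of the \<open>u\<close> coordinate, and then to the
  derivative in direction \<open>u\<close> as a function of the \<open>v\<close> coordinate. The
  second difference is symmetric in \<open>u\<close> and \<open>v\<close>, while the mixed
  derivative on the right is not visibly so.\<close>

lemma second_difference_mvt:
  fixes f :: "'a::real_normed_vector \<Rightarrow> real"
  assumes sm: "smooth_on S f" and h: "0 < h"
    and S: "\<And>s t. 0 \<le> s \<Longrightarrow> s \<le> h \<Longrightarrow> 0 \<le> t \<Longrightarrow> t \<le> h \<Longrightarrow> x + s *\<^sub>R u + t *\<^sub>R v \<in> S"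
  obtains s t where "0 < s" "s < h" "0 < t" "t < h"
    "f (x + h *\<^sub>R u + h *\<^sub>R v) - f (x + h *\<^sub>R u) - f (x + h *\<^sub>R v) + f x
       = h * h * dd (\<lambda>z. dd f z u) (x + s *\<^sub>R u + t *\<^sub>R v) v"
proof -
  have "\<exists>s>0. s < h \<and> (f (x + h *\<^sub>R v + h *\<^sub>R u) - f (x + h *\<^sub>R u)) - (f (x + h *\<^sub>R v + 0 *\<^sub>R u) - f (x + 0 *\<^sub>R u))
      = (h - 0) * (dd f (x + h *\<^sub>R v + s *\<^sub>R u) u - dd f (x + s *\<^sub>R u) u)"
  proof (rule MVT2[OF h])
    fix s assume s: "0 \<le> s" "s \<le> h"
    show "((\<lambda>s. f (x + h *\<^sub>R v + s *\<^sub>R u) - f (x + s *\<^sub>R u)) has_field_derivative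
        dd f (x + h *\<^sub>R v + s *\<^sub>R u) u - dd f (x + s *\<^sub>R u) u) (at s)"
      using S[of s h] S[of s 0] s h
      by (intro DERIV_diff smooth_line_derivative[OF sm]) (auto simp: algebra_simps)
  qed
  then obtain s where s: "0 < s" "s < h"
    and 1: "f (x + h *\<^sub>R v + h *\<^sub>R u) - f (x + h *\<^sub>R u) - (f (x + h *\<^sub>R v) - f x)
      = h * (dd f (x + h *\<^sub>R v + s *\<^sub>R u) u - dd f (x + s *\<^sub>R u) u)"
    by auto
  have "\<exists>t>0. t < h \<and> dd f (x + s *\<^sub>R u + h *\<^sub>R v) u - dd f (x + s *\<^sub>R u + 0 *\<^sub>R v) u
      = (h - 0) * dd (\<lambda>z. dd f z u) (x + s *\<^sub>R u + t *\<^sub>R v) v"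
  proof (rule MVT2[OF h])
    fix t assume "0 \<le> t" "t \<le> h"
    then show "((\<lambda>t. dd f (x + s *\<^sub>R u + t *\<^sub>R v) u) has_field_derivative
        dd (\<lambda>z. dd f z u) (x + s *\<^sub>R u + t *\<^sub>R v) v) (at t)"
      using S s by (intro smooth_line_derivative[OF smooth_on_dd[OF sm]]) auto
  qed
  then obtain t where t: "0 < t" "t < h"
    and 2: "dd f (x + s *\<^sub>R u + h *\<^sub>R v) u - dd f (x + s *\<^sub>R u) u
      = h * dd (\<lambda>z. dd f z u) (x + s *\<^sub>R u + t *\<^sub>R v) v"
    by auto
  show thesis
    by (rule that[OF s t]) (use 1 2 in \<open>simp add: algebra_simps\<close>)
qed

text \<open>The second difference over a small parallelogram is \<open>h * h\<close> times a value
  of either mixed derivative near \<open>x\<close>. These two values coincide, which is impossible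
  if each lies within half of the gap from its own limit.\<close>

lemma second_derivative_symmetric_real:
  fixes f :: "'a::real_normed_vector \<Rightarrow> real"
  assumes "open S" "smooth_on S f" "x \<in> S"
  shows "dd (\<lambda>y. dd f y u) x v = dd (\<lambda>y. dd f y v) x u"
proof (rule ccontr)
  define A where "A y = dd (\<lambda>z. dd f z u) y v" for y
  define B where "B y = dd (\<lambda>z. dd f z v) y u" for y
  assume "dd (\<lambda>y. dd f y u) x v \<noteq> dd (\<lambda>y. dd f y v) x u"
  then have ne: "A x \<noteq> B x" by (simp add: A_def B_def)
  define e where "e = \<bar>A x - B x\<bar> / 2"
  have e: "e > 0" using ne by (simp add: e_def)
  have "continuous_on S A" "continuous_on S B"
    unfolding A_def B_def using assms(2) by (auto intro!: smooth_on_continuous smooth_intros)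
  then have "isCont A x" "isCont B x"
    using assms(1,3) continuous_on_eq_continuous_at by blast+
  then have "\<forall>\<^sub>F y in nhds x. dist (A y) (A x) < e" "\<forall>\<^sub>F y in nhds x. dist (B y) (B x) < e"
    using e by (auto simp: continuous_at dest!: tendstoD tendsto_at_iff_tendsto_nhds[THEN iffD1])
  moreover have "\<forall>\<^sub>F y in nhds x. y \<in> S"
    using assms(1,3) eventually_nhds by blast
  ultimately have "\<forall>\<^sub>F y in nhds x. y \<in> S \<and> dist (A y) (A x) < e \<and> dist (B y) (B x) < e"
    by eventually_elim auto
  then obtain r where r: "r > 0"
    "\<And>y. dist y x < r \<Longrightarrow> y \<in> S \<and> dist (A y) (A x) < e \<and> dist (B y) (B x) < e"
    unfolding eventually_nhds_metric by auto
  \<comment> \<open>The parallelogram with sides \<open>h *\<^sub>R u\<close> and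
    \<open>h *\<^sub>R v\<close> then stays within \<open>r / 2\<close> of \<open>x\<close>; the
    summand 1 keeps the denominator positive when \<open>u\<close> and \<open>v\<close> are both
    zero.\<close>
  define h where "h = r / (2 * (norm u + norm v + 1))"
  have h: "h > 0" using r(1) by (auto simp: h_def intro!: divide_pos_pos add_nonneg_pos)
  have nz: "norm u + norm v + 1 \<noteq> 0"
    using norm_ge_zero[of u] norm_ge_zero[of v] by linarith
  have near: "dist (x + s *\<^sub>R u + t *\<^sub>R v) x < r" if "0 \<le> s" "s \<le> h" "0 \<le> t" "t \<le> h" for s t
  proof -
    have "dist (x + s *\<^sub>R u + t *\<^sub>R v) x \<le> s * norm u + t * norm v"
      using norm_triangle_ineq[of "s *\<^sub>R u" "t *\<^sub>R v"] that by (simp add: dist_norm add.assoc)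
    also have "\<dots> \<le> h * norm u + h * norm v"
      using that by (intro add_mono mult_right_mono) auto
    also have "\<dots> \<le> h * (norm u + norm v + 1)" using h by (simp add: algebra_simps)
    also have "\<dots> = r / 2" 
      unfolding h_def using nz by (simp only: times_divide_eq_left mult.commute[of 2] divide_divide_eq_left[symmetric] nonzero_mult_div_cancel_right[OF nz])

    finally show ?thesis using r(1) by simp
  qed
  obtain s t where 1: "0 < s" "s < h" "0 < t" "t < h"
    "f (x + h *\<^sub>R u + h *\<^sub>R v) - f (x + h *\<^sub>R u) - f (x + h *\<^sub>R v) + f x = h * h * A (x + s *\<^sub>R u + t *\<^sub>R v)"
    using second_difference_mvt[OF assms(2) h, of x u v] near r(2) unfolding A_def by metis
  have near': "dist (x + s *\<^sub>R v + t *\<^sub>R u) x < r" if "0 \<le> s" "s \<le> h" "0 \<le> t" "t \<le> h" for s t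
    using near[OF that(3,4,1,2)] by (simp add: algebra_simps)
  obtain s' t' where 2: "0 < s'" "s' < h" "0 < t'" "t' < h"
    "f (x + h *\<^sub>R v + h *\<^sub>R u) - f (x + h *\<^sub>R v) - f (x + h *\<^sub>R u) + f x = h * h * B (x + s' *\<^sub>R v + t' *\<^sub>R u)"
    using second_difference_mvt[OF assms(2) h, of x v u] near' r(2) unfolding B_def by metis
  have "h * h * A (x + s *\<^sub>R u + t *\<^sub>R v) = h * h * B (x + s' *\<^sub>R v + t' *\<^sub>R u)"
    using 1(5) 2(5) by (simp add: algebra_simps)
  then have "A (x + s *\<^sub>R u + t *\<^sub>R v) = B (x + s' *\<^sub>R v + t' *\<^sub>R u)" using h by simp
  moreover have "dist (A (x + s *\<^sub>R u + t *\<^sub>R v)) (A x) < e" "dist (B (x + s' *\<^sub>R v + t' *\<^sub>R u)) (B x) < e"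
    using r(2) near near' 1 2 by (meson less_imp_le)+
  ultimately show False unfolding e_def by (simp add: dist_real_def abs_if split: if_splits)
qed

lemma dd_inner:
  assumes "f differentiable (at x)"
  shows "dd (\<lambda>y. f y \<bullet> i) x v = dd f x v \<bullet> i"
  using dd_eqI[OF has_derivative_inner_left[OF dd_has_derivative[OF assms]]] by simp

lemma second_derivative_symmetric:
  fixes f :: "'a::real_normed_vector \<Rightarrow> 'b::euclidean_space"
  assumes "open S" "smooth_on S f" "x \<in> S"
  shows "dd (\<lambda>y. dd f y u) x v = dd (\<lambda>y. dd f y v) x u"
proof (rule euclidean_eqI)
  fix i :: 'b
  have "dd (\<lambda>y. dd f y u) x v \<bullet> i = dd (\<lambda>y. dd (\<lambda>z. f z \<bullet> i) y u) x v" for u v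
  proof -
    have "dd (\<lambda>y. dd f y u) x v \<bullet> i = dd (\<lambda>y. dd f y u \<bullet> i) x v"
      by (rule dd_inner[symmetric]) (rule smooth_on_differentiable[OF smooth_on_dd[OF assms(2)] assms(3)])
    also have "\<dots> = dd (\<lambda>y. dd (\<lambda>z. f z \<bullet> i) y u) x v"
      by (rule fun_cong[OF dd_cong_open[OF assms(1,3)]])
         (simp add: dd_inner smooth_on_differentiable[OF assms(2)])
    finally show ?thesis .
  qed
  moreover have "smooth_on S (\<lambda>z. f z \<bullet> i)" by (intro smooth_intros assms)
  ultimately show "dd (\<lambda>y. dd f y u) x v \<bullet> i = dd (\<lambda>y. dd f y v) x u \<bullet> i"
    using second_derivative_symmetric_real[OF assms(1) _ assms(3)] by simp
qed

section \<open>Product rules for families of bilinear and linear maps\<close>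

lemma bilinear_expand:
  fixes a :: "'b::euclidean_space"
  assumes "bilinear b"
  shows "b a c = (\<Sum>i\<in>Basis. \<Sum>j\<in>Basis. ((a \<bullet> i) * (c \<bullet> j)) *\<^sub>R b i (j :: 'c::euclidean_space))"
proof -
  have "b a c = b (\<Sum>i\<in>Basis. (a \<bullet> i) *\<^sub>R i) (\<Sum>j\<in>Basis. (c \<bullet> j) *\<^sub>R j)"
    by (simp add: euclidean_representation)
  also have "\<dots> = (\<Sum>i\<in>Basis. \<Sum>j\<in>Basis. b ((a \<bullet> i) *\<^sub>R i) ((c \<bullet> j) *\<^sub>R j))"
    unfolding bilinear_sum[OF assms] sum.cartesian_product ..
  also have "\<dots> = (\<Sum>i\<in>Basis. \<Sum>j\<in>Basis. ((a \<bullet> i) * (c \<bullet> j)) *\<^sub>R b i j)"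
    by (simp only: bilinear_lmul[OF assms] bilinear_rmul[OF assms] scaleR_scaleR mult.commute[of "c \<bullet> _"])
  finally show ?thesis .
qed

text \<open>Differentiability is only known for \<open>b\<close> with fixed arguments. Expanding
  both arguments in \<open>Basis\<close> reduces the claim to finitely many such functions,
  multiplied by coordinates of \<open>U\<close> and \<open>V\<close>.\<close>

lemma has_derivative_bilinear_family:
  fixes b :: "'a::real_normed_vector \<Rightarrow> 'b::euclidean_space \<Rightarrow> 'c::euclidean_space \<Rightarrow> 'd::real_normed_vector"
  assumes S: "open S" "x \<in> S" and bl: "\<And>y. y \<in> S \<Longrightarrow> bilinear (b y)"
    and db: "\<And>u v. (\<lambda>y. b y u v) differentiable (at x)"
    and U: "(U has_derivative U') (at x)" and V: "(V has_derivative V') (at x)"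
  shows "((\<lambda>y. b y (U y) (V y)) has_derivative
    (\<lambda>h. dd (\<lambda>y. b y (U x) (V x)) x h + b x (U' h) (V x) + b x (U x) (V' h))) (at x)"
proof -
  have main: "((\<lambda>y. b y (P y) (Q y)) has_derivative
    (\<lambda>h. (\<Sum>i\<in>Basis. \<Sum>j\<in>Basis. ((P x \<bullet> i) * (Q x \<bullet> j)) *\<^sub>R dd (\<lambda>y. b y i j) x h) + b x (P' h) (Q x) + b x (P x) (Q' h))) (at x)"
    if P: "(P has_derivative P') (at x)" and Q: "(Q has_derivative Q') (at x)" for P Q P' Q'
  proof (rule has_derivative_transform_within_open[OF _ S])
    show "((\<lambda>y. \<Sum>i\<in>Basis. \<Sum>j\<in>Basis. ((P y \<bullet> i) * (Q y \<bullet> j)) *\<^sub>R b y i j) has_derivative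
      (\<lambda>h. (\<Sum>i\<in>Basis. \<Sum>j\<in>Basis. ((P x \<bullet> i) * (Q x \<bullet> j)) *\<^sub>R dd (\<lambda>y. b y i j) x h) + b x (P' h) (Q x) + b x (P x) (Q' h))) (at x)"
      unfolding bilinear_expand[OF bl[OF S(2)], of "P' _"] bilinear_expand[OF bl[OF S(2)], of _ "Q' _"]
    proof (rule has_derivative_eq_rhs)
      show "((\<lambda>y. \<Sum>i\<in>Basis. \<Sum>j\<in>Basis. ((P y \<bullet> i) * (Q y \<bullet> j)) *\<^sub>R b y i j) has_derivative
        (\<lambda>h. \<Sum>i\<in>Basis. \<Sum>j\<in>Basis. ((P x \<bullet> i) * (Q x \<bullet> j)) *\<^sub>R dd (\<lambda>y. b y i j) x h
          + ((P x \<bullet> i) * (Q' h \<bullet> j) + (P' h \<bullet> i) * (Q x \<bullet> j)) *\<^sub>R b x i j)) (at x)"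
        by (rule has_derivative_sum, rule has_derivative_sum)
           (rule has_derivative_scaleR[OF has_derivative_mult[OF has_derivative_inner_left[OF P]
              has_derivative_inner_left[OF Q]] dd_has_derivative[OF db]])
    qed (rule ext, simp add: sum.distrib scaleR_add_left)
  qed (rule bilinear_expand[OF bl, symmetric])
  \<comment> \<open>The case of constant arguments identifies the double sum in \<open>main\<close>
    with the derivative of \<open>b\<close> at frozen arguments; this is why \<open>main\<close> is
    proved for arbitrary \<open>P\<close> and \<open>Q\<close>.\<close>
  have "dd (\<lambda>y. b y (U x) (V x)) x h
    = (\<Sum>i\<in>Basis. \<Sum>j\<in>Basis. ((U x \<bullet> i) * (V x \<bullet> j)) *\<^sub>R dd (\<lambda>y. b y i j) x h)" for h
    using fun_cong[OF dd_eqI[OF main[OF has_derivative_const[of "U x"] has_derivative_const[of "V x"]]], of h]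
    by (simp add: bilinear_lzero[OF bl[OF S(2)]] bilinear_rzero[OF bl[OF S(2)]])
  then show ?thesis using main[OF U V] by simp
qed

lemma smooth_on_bilinear_family:
  fixes b :: "'a::real_normed_vector \<Rightarrow> 'b::euclidean_space \<Rightarrow> 'c::euclidean_space \<Rightarrow> 'd::real_normed_vector"
  assumes S: "open S" and bl: "\<And>y. y \<in> S \<Longrightarrow> bilinear (b y)"
    and db: "\<And>u v. smooth_on S (\<lambda>y. b y u v)" and U: "smooth_on S U" and V: "smooth_on S V"
  shows "smooth_on S (\<lambda>y. b y (U y) (V y))"
proof -
  have "smooth_on S (\<lambda>y. \<Sum>i\<in>Basis. \<Sum>j\<in>Basis. ((U y \<bullet> i) * (V y \<bullet> j)) *\<^sub>R b y i j)"
    by (intro smooth_intros assms)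
  then show ?thesis
    by (subst smooth_on_cong[OF S bilinear_expand[OF bl]])
qed

text \<open>A linear family becomes a bilinear one with a dummy real argument, later held at 1, so
  the linear product rules are instances of the bilinear ones.\<close>

lemma bilinear_scaleR_linear:
  "linear a \<Longrightarrow> bilinear (\<lambda>u (r::real). r *\<^sub>R a u)"
  by (auto simp: bilinear_def linear_iff algebra_simps)

lemma has_derivative_linear_family:
  fixes a :: "'a::real_normed_vector \<Rightarrow> 'b::euclidean_space \<Rightarrow> 'd::real_normed_vector"
  assumes S: "open S" "x \<in> S" and bl: "\<And>y. y \<in> S \<Longrightarrow> linear (a y)"
    and db: "\<And>u. (\<lambda>y. a y u) differentiable (at x)"
    and U: "(U has_derivative U') (at x)"
  shows "((\<lambda>y. a y (U y)) has_derivative (\<lambda>h. dd (\<lambda>y. a y (U x)) x h + a x (U' h))) (at x)"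
  using has_derivative_bilinear_family[OF S, of "\<lambda>y u (r::real). r *\<^sub>R a y u" U U' "\<lambda>_. 1" "\<lambda>_. 0"]
    assms by (auto intro: bilinear_scaleR_linear)

lemma smooth_on_linear_family:
  fixes a :: "'a::real_normed_vector \<Rightarrow> 'b::euclidean_space \<Rightarrow> 'd::real_normed_vector"
  assumes S: "open S" and bl: "\<And>y. y \<in> S \<Longrightarrow> linear (a y)"
    and db: "\<And>u. smooth_on S (\<lambda>y. a y u)" and U: "smooth_on S U"
  shows "smooth_on S (\<lambda>y. a y (U y))"
proof -
  have "smooth_on S (\<lambda>y. 1 *\<^sub>R a y (U y))"
    by (rule smooth_on_bilinear_family[OF S, of "\<lambda>y u (r::real). r *\<^sub>R a y u" U "\<lambda>_. 1"])
       (auto intro!: bilinear_scaleR_linear smooth_on_scaleR smooth_on_const assms)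
  then show ?thesis by simp
qed

section \<open>Smooth families of linear and bilinear maps\<close>

definition smooth_bilinear ::
  "'a::real_normed_vector set \<Rightarrow> ('a \<Rightarrow> 'b::euclidean_space \<Rightarrow> 'c::euclidean_space \<Rightarrow> 'd::real_normed_vector) \<Rightarrow> bool"
where
  "smooth_bilinear T w \<longleftrightarrow> open T \<and> (\<forall>z\<in>T. bilinear (w z)) \<and> (\<forall>u v. smooth_on T (\<lambda>z. w z u v))"

definition smooth_linear ::
  "'a::real_normed_vector set \<Rightarrow> ('a \<Rightarrow> 'b::euclidean_space \<Rightarrow> 'd::real_normed_vector) \<Rightarrow> bool"
where
  "smooth_linear T w \<longleftrightarrow> open T \<and> (\<forall>z\<in>T. linear (w z)) \<and> (\<forall>u. smooth_on T (\<lambda>z. w z u))"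

definition smooth_between ::
  "'a::real_normed_vector set \<Rightarrow> 'b::real_normed_vector set \<Rightarrow> ('a \<Rightarrow> 'b) \<Rightarrow> bool" where
  "smooth_between S T F \<longleftrightarrow> open S \<and> smooth_on S F \<and> F ` S \<subseteq> T"

lemma smooth_linear_dd:
  "open S \<Longrightarrow> smooth_on S f \<Longrightarrow> smooth_linear S (\<lambda>x. dd f x)"
  for f :: "'a::euclidean_space \<Rightarrow> 'b::real_normed_vector"
  by (auto simp: smooth_linear_def intro!: smooth_on_dd dd_linear smooth_on_differentiable)

lemma dd_compose:
  assumes "f differentiable (at (g x))" "g differentiable (at x)"
  shows "dd (\<lambda>x. f (g x)) x = (\<lambda>v. dd f (g x) (dd g x v))"
  using dd_eqI[OF has_derivative_compose[OF dd_has_derivative[OF assms(2)] dd_has_derivative[OF assms(1)]]]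
  by simp

lemma smooth_bilinear_compose:
  fixes w :: "'a::euclidean_space \<Rightarrow> 'b::euclidean_space \<Rightarrow> 'c::euclidean_space \<Rightarrow> 'd::real_normed_vector"
  assumes "smooth_bilinear T w" "smooth_between S T F"
  shows "smooth_bilinear S (\<lambda>y. w (F y))"
  unfolding smooth_bilinear_def
proof (intro conjI ballI allI)
  show "smooth_on S (\<lambda>y. w (F y) u v)" for u v
    by (rule smooth_on_compose[of T "\<lambda>z. w z u v"])
       (use assms in \<open>auto simp: smooth_bilinear_def smooth_between_def\<close>)
qed (use assms in \<open>auto simp: smooth_bilinear_def smooth_between_def\<close>)

lemma smooth_linear_compose:
  fixes w :: "'a::euclidean_space \<Rightarrow> 'b::euclidean_space \<Rightarrow> 'd::real_normed_vector"
  assumes "smooth_linear T w" "smooth_between S T F"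
  shows "smooth_linear S (\<lambda>y. w (F y))"
  unfolding smooth_linear_def
proof (intro conjI ballI allI)
  show "smooth_on S (\<lambda>y. w (F y) u)" for u
    by (rule smooth_on_compose[of T "\<lambda>z. w z u"])
       (use assms in \<open>auto simp: smooth_linear_def smooth_between_def\<close>)
qed (use assms in \<open>auto simp: smooth_linear_def smooth_between_def\<close>)

lemma smooth_bilinear_apply:
  "smooth_bilinear S w \<Longrightarrow> smooth_on S U \<Longrightarrow> smooth_on S V \<Longrightarrow> smooth_on S (\<lambda>y. w y (U y) (V y))"
  unfolding smooth_bilinear_def by (blast intro: smooth_on_bilinear_family)

lemma smooth_linear_apply:
  "smooth_linear S w \<Longrightarrow> smooth_on S U \<Longrightarrow> smooth_on S (\<lambda>y. w y (U y))"
  unfolding smooth_linear_def by (blast intro: smooth_on_linear_family)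

lemma dd_bilinear_apply:
  assumes "smooth_bilinear S w" "smooth_on S U" "smooth_on S V" "x \<in> S"
  shows "dd (\<lambda>y. w y (U y) (V y)) x h
    = dd (\<lambda>y. w y (U x) (V x)) x h + w x (dd U x h) (V x) + w x (U x) (dd V x h)"
  using assms unfolding smooth_bilinear_def
  by (subst dd_eqI[OF has_derivative_bilinear_family[of S x w U "dd U x" V "dd V x"]])
     (auto intro: smooth_on_differentiable smooth_on_has_derivative)

lemma dd_linear_apply:
  assumes "smooth_linear S w" "smooth_on S U" "x \<in> S"
  shows "dd (\<lambda>y. w y (U y)) x h = dd (\<lambda>y. w y (U x)) x h + w x (dd U x h)"
  using assms unfolding smooth_linear_def
  by (subst dd_eqI[OF has_derivative_linear_family[of S x w U "dd U x"]])
     (auto intro: smooth_on_differentiable smooth_on_has_derivative)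

lemma dd_bilinear_pull:
  fixes w :: "'a::euclidean_space \<Rightarrow> 'b::euclidean_space \<Rightarrow> 'c::euclidean_space \<Rightarrow> 'd::real_normed_vector"
  assumes w: "smooth_bilinear T w" and F: "smooth_between S T F"
    and UV: "smooth_on S U" "smooth_on S V" and x: "x \<in> S"
  shows "dd (\<lambda>y. w (F y) (U y) (V y)) x h
    = dd (\<lambda>z. w z (U x) (V x)) (F x) (dd F x h) + w (F x) (dd U x h) (V x) + w (F x) (U x) (dd V x h)"
proof -
  have "dd (\<lambda>y. w (F y) a c) x h = dd (\<lambda>z. w z a c) (F x) (dd F x h)" for a c
  proof -
    have "smooth_on T (\<lambda>z. w z a c)" "F x \<in> T" "smooth_on S F"
      using w F x by (auto simp: smooth_bilinear_def smooth_between_def)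
    then show ?thesis
      using x by (subst dd_compose[of "\<lambda>z. w z a c" F]) (auto elim: smooth_on_differentiable)
  qed
  then show ?thesis
    using dd_bilinear_apply[OF smooth_bilinear_compose[OF w F] UV x, of h] by simp
qed

lemma dd_linear_pull:
  fixes w :: "'a::euclidean_space \<Rightarrow> 'b::euclidean_space \<Rightarrow> 'd::real_normed_vector"
  assumes w: "smooth_linear T w" and F: "smooth_between S T F"
    and U: "smooth_on S U" and x: "x \<in> S"
  shows "dd (\<lambda>y. w (F y) (U y)) x h = dd (\<lambda>z. w z (U x)) (F x) (dd F x h) + w (F x) (dd U x h)"
proof -
  have "dd (\<lambda>y. w (F y) a) x h = dd (\<lambda>z. w z a) (F x) (dd F x h)" for a
  proof -
    have "smooth_on T (\<lambda>z. w z a)" "F x \<in> T" "smooth_on S F"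
      using w F x by (auto simp: smooth_linear_def smooth_between_def)
    then show ?thesis
      using x by (subst dd_compose[of "\<lambda>z. w z a" F]) (auto elim: smooth_on_differentiable)
  qed
  then show ?thesis
    using dd_linear_apply[OF smooth_linear_compose[OF w F] U x, of h] by simp
qed

definition closed_2form :: "'a::real_normed_vector set \<Rightarrow> ('a \<Rightarrow> 'a \<Rightarrow> 'a \<Rightarrow> real) \<Rightarrow> bool" where
  "closed_2form T w \<longleftrightarrow> (\<forall>z\<in>T. \<forall>a b c.
     dd (\<lambda>z. w z b c) z a + dd (\<lambda>z. w z c a) z b + dd (\<lambda>z. w z a b) z c = 0)"

text \<open>Differentiating the pull-back gives the cyclic sum for \<open>w\<close>, which vanishes,
  and six terms with second derivatives of \<open>F\<close>. Symmetry of the latter and the sign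
  rule for \<open>w\<close> make those six cancel in pairs.\<close>

lemma closed_2form_pullback:
  fixes w :: "'a::euclidean_space \<Rightarrow> 'a \<Rightarrow> 'a \<Rightarrow> real" and F :: "'b::euclidean_space \<Rightarrow> 'a"
  assumes w: "smooth_bilinear T w" and alt: "\<And>z u v. z \<in> T \<Longrightarrow> w z u v = - w z v u"
    and cl: "closed_2form T w" and F: "smooth_between S T F"
  shows "closed_2form S (\<lambda>y u v. w (F y) (dd F y u) (dd F y v))"
  unfolding closed_2form_def
proof (intro ballI allI)
  fix x a b c assume x: "x \<in> S"
  have S: "open S" "smooth_on S F" and Fx: "F x \<in> T" using F x by (auto simp: smooth_between_def)
  have e: "dd (\<lambda>y. w (F y) (dd F y u) (dd F y v)) x h
    = dd (\<lambda>z. w z (dd F x u) (dd F x v)) (F x) (dd F x h)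
      + w (F x) (dd (\<lambda>y. dd F y u) x h) (dd F x v) + w (F x) (dd F x u) (dd (\<lambda>y. dd F y v) x h)" for u v h
    by (rule dd_bilinear_pull[OF w F _ _ x]) (intro smooth_on_dd S)+
  have sym: "dd (\<lambda>y. dd F y u) x v = dd (\<lambda>y. dd F y v) x u" for u v
    by (rule second_derivative_symmetric[OF S x])
  have "w (F x) (dd (\<lambda>y. dd F y u) x v) (dd F x h) + w (F x) (dd F x h) (dd (\<lambda>y. dd F y v) x u) = 0" for u v h
    using alt[OF Fx, of "dd (\<lambda>y. dd F y v) x u" "dd F x h"] unfolding sym[of u v] by simp
  note 1 = this[of b a c] this[of c b a] this[of a c b]
  have 2: "dd (\<lambda>z. w z (dd F x b) (dd F x c)) (F x) (dd F x a) + dd (\<lambda>z. w z (dd F x c) (dd F x a)) (F x) (dd F x b)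
      + dd (\<lambda>z. w z (dd F x a) (dd F x b)) (F x) (dd F x c) = 0"
    using cl Fx unfolding closed_2form_def by blast
  show "dd (\<lambda>y. w (F y) (dd F y b) (dd F y c)) x a + dd (\<lambda>y. w (F y) (dd F y c) (dd F y a)) x b
      + dd (\<lambda>y. w (F y) (dd F y a) (dd F y b)) x c = 0"
    unfolding e using 1 2 by linarith
qed

section \<open>Riesz representation with parameters\<close>

definition posdef :: "('v::real_vector \<Rightarrow> 'v \<Rightarrow> real) \<Rightarrow> bool" where
  "posdef b \<longleftrightarrow> (\<forall>v. v \<noteq> 0 \<longrightarrow> 0 < b v v)"

definition riesz :: "('v \<Rightarrow> 'v \<Rightarrow> real) \<Rightarrow> ('v \<Rightarrow> real) \<Rightarrow> 'v" where
  "riesz b f = (THE v. \<forall>w. b v w = f w)"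

lemma posdef_eqI:
  assumes "bilinear b" "posdef b" "\<And>w. b v w = b v' w"
  shows "v = v'"
proof (rule ccontr)
  assume "v \<noteq> v'"
  then have "0 < b (v - v') (v - v')" using assms(2) by (simp add: posdef_def)
  then show False using assms(3) by (simp add: bilinear_lsub[OF assms(1)])
qed

lemma axis_expansion: "v = (\<Sum>i\<in>UNIV. v $ i *\<^sub>R axis i (1::real))"
  by (simp add: vec_eq_iff axis_def if_distrib cong: if_cong)

text \<open>The indices are transposed so that multiplying by a vector \<open>v\<close> lists the
  values of \<open>b v\<close> on the standard basis without appeal to symmetry of
  \<open>b\<close>.\<close>

definition gram :: "(real ^ 'n \<Rightarrow> real ^ 'n \<Rightarrow> real) \<Rightarrow> real ^ 'n ^ 'n" where
  "gram b = (\<chi> i j. b (axis j 1) (axis i 1))"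

lemma linear_axis_expansion:
  assumes "linear f" shows "f v = (\<Sum>i\<in>UNIV. v $ i *\<^sub>R f (axis i (1::real)))"
  using arg_cong[OF axis_expansion[of v], of f]
  by (simp only: linear_sum[OF assms] linear_cmul[OF assms])

lemma gram_mult:
  assumes "bilinear b" shows "(gram b *v v) $ i = b v (axis i 1)"
proof -
  have "linear (\<lambda>v. b v (axis i 1))" using assms by (simp add: bilinear_def)
  from linear_axis_expansion[OF this, of v] show ?thesis
    by (simp add: gram_def matrix_vector_mult_def mult.commute)
qed

lemma gram_det:
  assumes "bilinear b" "posdef b" shows "det (gram b) \<noteq> 0"
proof -
  have "v = 0" if "gram b *v v = 0" for v
  proof (rule posdef_eqI[OF assms])
    fix w
    have "linear (b v)" using assms(1) by (simp add: bilinear_def)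
    then have "b v w = (\<Sum>i\<in>UNIV. w $ i *\<^sub>R b v (axis i 1))" by (rule linear_axis_expansion)
    also have "\<dots> = 0" using that gram_mult[OF assms(1), of v] by simp
    finally show "b v w = b 0 w" by (simp add: bilinear_lzero[OF assms(1)])
  qed
  then have "inj ((*v) (gram b))"
    by (simp add: linear_injective_0[OF matrix_vector_mul_linear])
  then show ?thesis
    by (metis invertible_det_nz invertible_left_inverse matrix_left_invertible_injective)
qed

text \<open>Cramer's rule gives existence and uniqueness of the representing vector at once. It also
  displays it as a quotient of determinants, from which smooth dependence on parameters is read off
  in \<open>smooth_on_riesz\<close>.\<close>

lemma riesz_eq_iff:
  assumes b: "bilinear b" "posdef b" and f: "linear f"
  shows "(\<forall>w. b v w = f w) \<longleftrightarrow>
    v = (\<chi> k. det (\<chi> i j. if j = k then f (axis i 1) else gram b $ i $ j) / det (gram b))"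
proof -
  have lin: "linear (b v)" using b(1) by (simp add: bilinear_def)
  have "(\<forall>w. b v w = f w) \<longleftrightarrow> gram b *v v = (\<chi> i. f (axis i 1))"
  proof
    assume "gram b *v v = (\<chi> i. f (axis i 1))"
    then have "b v (axis i 1) = f (axis i 1)" for i
      using gram_mult[OF b(1), of v i] by simp
    then have "(\<Sum>i\<in>UNIV. w $ i *\<^sub>R b v (axis i 1)) = (\<Sum>i\<in>UNIV. w $ i *\<^sub>R f (axis i 1))" for w
      by simp
    then show "\<forall>w. b v w = f w"
      using linear_axis_expansion[OF lin] linear_axis_expansion[OF f] by metis
  qed (simp add: vec_eq_iff gram_mult[OF b(1)])
  then show ?thesis unfolding cramer[OF gram_det[OF b]] by (simp only: vec_lambda_beta)
qed

lemma riesz: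
  fixes b :: "real ^ 'n \<Rightarrow> real ^ 'n \<Rightarrow> real"
  assumes b: "bilinear b" "posdef b" and f: "linear f"
  shows "b (riesz b f) w = f w"
proof -
  have "\<exists>!v. \<forall>w. b v w = f w" unfolding riesz_eq_iff[OF assms] by simp
  from theI'[OF this] show ?thesis unfolding riesz_def by blast
qed

lemma riesz_eqI:
  assumes b: "bilinear b" "posdef b" and f: "\<And>w. b v w = f w"
  shows "riesz b f = v"
  unfolding riesz_def
proof (rule the_equality)
  fix v' assume "\<forall>w. b v' w = f w"
  then show "v' = v" using posdef_eqI[OF b] f by simp
qed (use f in simp)

lemma smooth_on_det [smooth_intros]:
  "open S \<Longrightarrow> (\<And>i j. smooth_on S (\<lambda>y. M y $ i $ j)) \<Longrightarrow> smooth_on S (\<lambda>y. det (M y))"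
  for M :: "'a::real_normed_vector \<Rightarrow> real ^ 'n ^ 'n"
  unfolding det_def by (intro smooth_on_sum smooth_on_mult smooth_on_const smooth_on_prod)

lemma smooth_on_riesz:
  fixes b :: "'a::real_normed_vector \<Rightarrow> real ^ 'n \<Rightarrow> real ^ 'n \<Rightarrow> real"
  assumes b: "smooth_bilinear S b" "\<And>y. y \<in> S \<Longrightarrow> posdef (b y)" and f: "smooth_linear S f"
  shows "smooth_on S (\<lambda>y. riesz (b y) (f y))"
proof -
  have S: "open S" using b(1) by (simp add: smooth_bilinear_def)
  have bl: "bilinear (b y)" "linear (f y)" if "y \<in> S" for y
    using that b f by (auto simp: smooth_bilinear_def smooth_linear_def)
  have sm: "smooth_on S (\<lambda>y. gram (b y) $ i $ j)" "smooth_on S (\<lambda>y. f y u)" for i j u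
    using b f by (auto simp: gram_def smooth_bilinear_def smooth_linear_def)
  have e: "riesz (b y) (f y)
      = (\<chi> k. det (\<chi> i j. if j = k then f y (axis i 1) else gram (b y) $ i $ j) / det (gram (b y)))"
    if "y \<in> S" for y
    using riesz[OF bl(1) b(2) bl(2)] riesz_eq_iff[OF bl(1) b(2) bl(2)] that by blast
  have "smooth_on S (\<lambda>y. (if j = k then f y (axis i 1) else gram (b y) $ i $ j))" for i j k
    by (cases "j = k") (simp_all add: sm)
  then have 1: "smooth_on S (\<lambda>y. det (\<chi> i j. if j = k then f y (axis i 1) else gram (b y) $ i $ j))" for k
    by (intro smooth_on_det S) (simp only: vec_lambda_beta)
  have 2: "smooth_on S (\<lambda>y. det (gram (b y)))" by (intro smooth_on_det S sm)
  show ?thesis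
    by (subst smooth_on_cong[OF S e], assumption, intro smooth_on_vec smooth_on_divide S 1 2)
       (use gram_det[OF bl(1) b(2)] in blast)
qed

section \<open>Bump functions\<close>

text \<open>The function exp(-1/x) divided by the \<open>n\<close>-th power of \<open>x\<close>,
  extended by 0. The index makes the family closed under differentiation up to linear combinations,
  which is what an induction on smoothness needs.\<close>

definition flat_fn :: "nat \<Rightarrow> real \<Rightarrow> real" where
  "flat_fn n x = (if 0 < x then inverse x ^ n / exp (inverse x) else 0)"

lemma flat_fn_tendsto_0: "(flat_fn n \<longlongrightarrow> 0) (at 0)"
proof -
  have "((\<lambda>x. inverse x ^ n / exp (inverse x)) \<longlongrightarrow> 0) (at_right (0::real))"
    using filterlim_compose[OF tendsto_power_div_exp_0 filterlim_inverse_at_top_right] .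
  then have "(flat_fn n \<longlongrightarrow> 0) (at_right 0)"
    by (rule Lim_transform_eventually) (auto simp: flat_fn_def eventually_at_right_less eventually_at_filter)
  moreover have "(flat_fn n \<longlongrightarrow> 0) (at_left 0)"
    by (rule Lim_transform_eventually[OF tendsto_const]) (auto simp: flat_fn_def eventually_at_filter)
  ultimately show ?thesis by (rule filterlim_split_at[rotated])
qed

lemma flat_fn_derivative:
  "(flat_fn n has_field_derivative (flat_fn (n + 2) x - real n * flat_fn (n + 1) x)) (at x)"
proof -
  consider "x < 0" | "x = 0" | "0 < x" by linarith
  then show ?thesis
  proof cases
    case 1
    have "(flat_fn n has_field_derivative 0) (at x)"
      by (rule has_field_derivative_transform_within_open[of "\<lambda>_. 0" _ _ "{..<0}"])
         (use 1 in \<open>auto simp: flat_fn_def\<close>)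
    then show ?thesis using 1 by (simp add: flat_fn_def)
  next
    case 2
    \<comment> \<open>At 0 the difference quotient of one member of the family is the next member,
      so the derivative there is the limit from \<open>flat_fn_tendsto_0\<close>.\<close>
    have "flat_fn (n + 1) = (\<lambda>h. (flat_fn n (0 + h) - flat_fn n 0) / h)"
      by (auto simp: flat_fn_def fun_eq_iff field_simps)
    then have "(flat_fn n has_field_derivative 0) (at 0)"
      using flat_fn_tendsto_0[of "n + 1"] by (simp add: DERIV_def)
    then show ?thesis using 2 by (simp add: flat_fn_def)
  next
    case 3
    have "((\<lambda>x. inverse x ^ n / exp (inverse x)) has_field_derivative
        (flat_fn (n + 2) x - real n * flat_fn (n + 1) x)) (at x)"
    proof (rule DERIV_cong)
      have "((\<lambda>u. u ^ n / exp u) has_field_derivative (real n * u ^ (n - 1) - u ^ n) / exp u) (at u)" for u :: real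
        by (auto intro!: derivative_eq_intros simp: field_simps)
      from DERIV_chain2[OF this DERIV_inverse[of x]]
      show "((\<lambda>x. inverse x ^ n / exp (inverse x)) has_field_derivative
        (real n * inverse x ^ (n - 1) - inverse x ^ n) / exp (inverse x) * - (inverse x ^ Suc (Suc 0))) (at x)"
        using 3 by simp
      show "(real n * inverse x ^ (n - 1) - inverse x ^ n) / exp (inverse x) * - (inverse x ^ Suc (Suc 0))
        = flat_fn (n + 2) x - real n * flat_fn (n + 1) x"
        using 3 by (cases n) (simp_all add: flat_fn_def diff_divide_distrib add_divide_distrib algebra_simps)
    qed
    then show ?thesis
      by (rule has_field_derivative_transform_within_open[of _ _ _ "{0<..}"])
         (use 3 in \<open>auto simp: flat_fn_def\<close>)
  qed
qed

lemma td_flat_fn: "times_differentiable_on k UNIV (flat_fn n)"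
proof (induction k arbitrary: n)
  case 0
  show ?case using flat_fn_derivative[of n]
    by (auto intro!: continuous_at_imp_continuous_on DERIV_isCont)
next
  case (Suc k)
  have *: "(flat_fn n has_derivative (\<lambda>v. (flat_fn (n + 2) x + (- real n) * flat_fn (n + 1) x) * v)) (at x)" for x
    using flat_fn_derivative[of n x] by (simp add: has_field_derivative_def)
  have "times_differentiable_on k UNIV (\<lambda>x. (flat_fn (n + 2) x + (- real n) * flat_fn (n + 1) x) * v)" for v
    by (intro td_bilinear[OF bounded_bilinear_mult] td_add td_const Suc.IH open_UNIV)
  then have "times_differentiable_on k UNIV (\<lambda>x. dd (flat_fn n) x v)" for v
    by (simp only: dd_eqI[OF *])
  then show ?case using * by (auto simp: differentiable_def)
qed

text \<open>The argument of \<open>flat_fn 0\<close> is \<open>r\<^sup>2\<close> minus the squared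
  distance from \<open>a\<close>: positive exactly on the ball and, unlike the distance, smooth at
  its centre.\<close>

lemma smooth_bump:
  fixes a :: "'a::euclidean_space"
  obtains \<beta> :: "'a \<Rightarrow> real" where "smooth_on UNIV \<beta>" "\<And>y. 0 \<le> \<beta> y" "\<And>y. \<beta> y \<noteq> 0 \<longleftrightarrow> dist a y < r"
proof (cases "0 < r")
  case True
  have "smooth_on UNIV (\<lambda>y. r\<^sup>2 - (y - a) \<bullet> (y - a))"
    by (intro smooth_on_diff smooth_on_inner smooth_on_const smooth_on_id open_UNIV)
  then have sm: "smooth_on UNIV (\<lambda>y. flat_fn 0 (r\<^sup>2 - (y - a) \<bullet> (y - a)))"
    using td_flat_fn
    by (intro smooth_on_compose[of UNIV "flat_fn 0" UNIV "\<lambda>y. r\<^sup>2 - (y - a) \<bullet> (y - a)"]) (auto simp: smooth_on_def)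
  have "(y - a) \<bullet> (y - a) < r\<^sup>2 \<longleftrightarrow> dist a y < r" for y
  proof -
    have "(y - a) \<bullet> (y - a) = (dist a y)\<^sup>2"
      unfolding dist_norm norm_minus_commute[of a y] power2_norm_eq_inner ..
    then show ?thesis using True power_mono_iff[of r "dist a y" 2] by (simp add: not_le[symmetric])
  qed
  then show thesis using that[OF sm] by (auto simp: flat_fn_def)
next
  case False
  then have "\<not> dist a y < r" for y using zero_le_dist[of a y] by linarith
  then show thesis using that[of "\<lambda>_. 0"] smooth_on_const by auto
qed

section \<open>Integrals of compactly supported functions\<close>

lemma continuous_on_Pair1: "continuous_on S (Pair t)"
  using continuous_on_Pair[OF continuous_on_const continuous_on_id, of S t] by simp

lemma continuous_on_zero_extension:
  assumes "open S" "closed K" "K \<subseteq> S" "continuous_on (T \<times> S) f"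
    and "\<And>t y. t \<in> T \<Longrightarrow> y \<in> S - K \<Longrightarrow> f (t, y) = 0"
  shows "continuous_on (T \<times> UNIV) (\<lambda>(t, y). if y \<in> S then f (t, y) else 0)"
proof -
  have U: "T \<times> UNIV = T \<times> S \<union> T \<times> (- K)" using assms(3) by auto
  have "continuous_on (T \<times> S \<union> T \<times> (- K)) (\<lambda>(t, y). if y \<in> S then f (t, y) else 0)"
  proof (rule continuous_on_Un_local_open)
    have "T \<times> S = T \<times> UNIV \<inter> UNIV \<times> S" "T \<times> (- K) = T \<times> UNIV \<inter> UNIV \<times> (- K)" by auto
    then show "openin (top_of_set (T \<times> S \<union> T \<times> - K)) (T \<times> S)"
      "openin (top_of_set (T \<times> S \<union> T \<times> - K)) (T \<times> - K)"
      unfolding U[symmetric] using assms(1,2) by (metis openin_open_Int open_Times open_UNIV open_Compl)+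
    show "continuous_on (T \<times> S) (\<lambda>(t, y). if y \<in> S then f (t, y) else 0)"
      by (rule continuous_on_eq[OF assms(4)]) auto
    show "continuous_on (T \<times> - K) (\<lambda>(t, y). if y \<in> S then f (t, y) else 0)"
      by (rule continuous_on_eq[OF continuous_on_const[of _ 0]]) (use assms(5) in auto)
  qed
  then show ?thesis unfolding U .
qed

lemma continuous_on_zero_extension':
  assumes "open S" "closed K" "K \<subseteq> S" "continuous_on S f" "\<And>y. y \<in> S - K \<Longrightarrow> f y = 0"
  shows "continuous_on UNIV (\<lambda>y. if y \<in> S then f y else 0)"
proof -
  have "continuous_on ({0::real} \<times> S) (\<lambda>z. f (snd z))"
    by (rule continuous_on_compose2[OF assms(4)]) (auto intro: continuous_intros)
  from continuous_on_zero_extension[OF assms(1-3) this] assms(5)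
  have "continuous_on ({0::real} \<times> UNIV) (\<lambda>(t, y). if y \<in> S then f y else 0)" by (simp cong: if_cong)
  from continuous_on_compose2[OF this, of UNIV "\<lambda>y. (0, y)"] show ?thesis
    using continuous_on_Pair1 by auto
qed

lemma smooth_on_zero_extension:
  assumes "open S" "closed K" "K \<subseteq> S" "smooth_on S f" "\<And>y. y \<in> S - K \<Longrightarrow> f y = 0"
  shows "smooth_on UNIV (\<lambda>y. if y \<in> S then f y else 0)"
proof (rule smooth_on_local)
  fix x
  show "\<exists>T. open T \<and> x \<in> T \<and> smooth_on T (\<lambda>y. if y \<in> S then f y else 0)"
  proof (cases "x \<in> K")
    case True
    have "smooth_on S (\<lambda>y. if y \<in> S then f y else 0)"
      by (subst smooth_on_cong[OF assms(1), of _ f]) (use assms in auto)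
    then show ?thesis using True assms by blast
  next
    case False
    have "smooth_on (- K) (\<lambda>y. if y \<in> S then f y else 0)"
      by (subst smooth_on_cong[of _ _ "\<lambda>_. 0"]) (use assms smooth_on_const in auto)
    then show ?thesis using False assms(2) by blast
  qed
qed

lemma set_integral_zero_extension:
  "(LINT y:S|lborel. f y) = (LINT y|lborel. (if y \<in> S then f y else (0::real)))"
  unfolding set_lebesgue_integral_def by (rule Bochner_Integration.integral_cong) (auto simp: indicator_def)

lemma compact_support_integrable:
  fixes f :: "'a::euclidean_space \<Rightarrow> real"
  assumes "continuous_on UNIV f" "compact K" "\<And>y. y \<notin> K \<Longrightarrow> f y = 0"
  shows "integrable lborel f"
proof -
  have "f = (\<lambda>y. indicator K y *\<^sub>R f y)" using assms(3) by (auto simp: indicator_def fun_eq_iff)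
  then show ?thesis
    using borel_integrable_compact[OF assms(2) continuous_on_subset[OF assms(1)]] by simp
qed

lemma compact_support_set_integrable:
  fixes f :: "'a::euclidean_space \<Rightarrow> real"
  assumes "open S" "compact K" "K \<subseteq> S" "continuous_on S f" "\<And>y. y \<in> S - K \<Longrightarrow> f y = 0"
  shows "set_integrable lborel S f"
proof -
  have "integrable lborel (\<lambda>y. if y \<in> S then f y else 0)"
    by (rule compact_support_integrable[OF continuous_on_zero_extension'[OF assms(1) compact_imp_closed[OF assms(2)] assms(3-5)] assms(2)])
       (use assms in auto)
  moreover have "(\<lambda>y. if y \<in> S then f y else 0) = (\<lambda>y. indicator S y *\<^sub>R f y)"
    by (auto simp: indicator_def fun_eq_iff)
  ultimately show ?thesis by (simp add: set_integrable_def)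
qed

lemma compact_support_integral_cbox:
  fixes f :: "'a::euclidean_space \<Rightarrow> real"
  assumes "continuous_on UNIV f" "\<And>y. y \<notin> cbox a b \<Longrightarrow> f y = 0"
  shows "(LINT y|lborel. f y) = integral (cbox a b) f"
proof -
  have "(f has_integral (LINT y|lborel. f y)) UNIV"
    using has_integral_integral_lborel[OF compact_support_integrable[OF assms(1) compact_cbox assms(2)]] by simp
  moreover have "(f has_integral integral (cbox a b) f) UNIV"
    by (rule has_integral_on_superset[of f "integral (cbox a b) f" "cbox a b"])
       (use assms in \<open>auto intro!: integrable_integral integrable_continuous intro: continuous_on_subset\<close>)
  ultimately show ?thesis by (rule has_integral_unique)
qed

text \<open>Since the support stays in one compact \<open>K\<close> for all parameters, extension by
  zero moves the integrals to a fixed box, where the parameter integral rule for continuous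
  functions applies.\<close>

lemma leibniz_compact_support:
  fixes f f' :: "real \<Rightarrow> 'a::euclidean_space \<Rightarrow> real"
  assumes I: "open I" "convex I" "t0 \<in> I" and S: "open S" "compact K" "K \<subseteq> S"
    and cf: "continuous_on (I \<times> S) (\<lambda>(t, y). f t y)" and cf': "continuous_on (I \<times> S) (\<lambda>(t, y). f' t y)"
    and z: "\<And>t y. t \<in> I \<Longrightarrow> y \<in> S - K \<Longrightarrow> f t y = 0" and z': "\<And>t y. t \<in> I \<Longrightarrow> y \<in> S - K \<Longrightarrow> f' t y = 0"
    and df: "\<And>t y. t \<in> I \<Longrightarrow> y \<in> S \<Longrightarrow> ((\<lambda>t. f t y) has_real_derivative f' t y) (at t)"
  shows "((\<lambda>t. LINT y:S|lborel. f t y) has_real_derivative (LINT y:S|lborel. f' t0 y)) (at t0)"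
proof -
  obtain a where a: "K \<subseteq> cbox (-a) a"
    using bounded_subset_cbox_symmetric[OF compact_imp_bounded[OF S(2)]] by blast
  define g g' where "g t y = (if y \<in> S then f t y else 0)" and "g' t y = (if y \<in> S then f' t y else 0)" for t y
  have c: "continuous_on (I \<times> UNIV) (\<lambda>(t, y). g t y)" "continuous_on (I \<times> UNIV) (\<lambda>(t, y). g' t y)"
    using continuous_on_zero_extension[OF S(1) compact_imp_closed[OF S(2)] S(3) cf] z
      continuous_on_zero_extension[OF S(1) compact_imp_closed[OF S(2)] S(3) cf'] z'
    unfolding g_def g'_def by auto
  have c1: "continuous_on UNIV (g t)" "continuous_on UNIV (g' t)" if "t \<in> I" for t
    using continuous_on_compose2[OF c(1), of UNIV "\<lambda>y. (t, y)"]
      continuous_on_compose2[OF c(2), of UNIV "\<lambda>y. (t, y)"] that continuous_on_Pair1 by auto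
  have e: "(LINT y:S|lborel. f t y) = integral (cbox (-a) a) (g t)"
      "(LINT y:S|lborel. f' t y) = integral (cbox (-a) a) (g' t)" if "t \<in> I" for t
  proof -
    have "g t y = 0" "g' t y = 0" if "y \<notin> cbox (-a) a" for y
    proof -
      have "y \<notin> K" using a that by blast
      then show "g t y = 0" "g' t y = 0" using z[of t y] z'[of t y] \<open>t \<in> I\<close> by (simp_all add: g_def g'_def)
    qed
    then show "(LINT y:S|lborel. f t y) = integral (cbox (-a) a) (g t)"
      "(LINT y:S|lborel. f' t y) = integral (cbox (-a) a) (g' t)"
      unfolding set_integral_zero_extension g_def[symmetric] g'_def[symmetric]
      using compact_support_integral_cbox[OF c1(1)[OF that]] compact_support_integral_cbox[OF c1(2)[OF that]]
      by blast+
  qed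
  have "((\<lambda>t. integral (cbox (-a) a) (g t)) has_field_derivative integral (cbox (-a) a) (g' t0)) (at t0 within I)"
  proof (rule leibniz_rule_field_derivative[OF _ _ _ I(3,2)])
    fix t y assume "t \<in> I"
    then show "((\<lambda>t. g t y) has_field_derivative g' t y) (at t within I)"
      using df[of t y] unfolding g_def g'_def by (cases "y \<in> S") (auto intro: has_field_derivative_at_within)
  next
    show "g t integrable_on cbox (-a) a" if "t \<in> I" for t
      using c1[OF that] by (auto intro: integrable_continuous continuous_on_subset)
    show "continuous_on (I \<times> cbox (-a) a) (\<lambda>(t, y). g' t y)"
      by (rule continuous_on_subset[OF c(2)]) auto
  qed
  then have "((\<lambda>t. integral (cbox (-a) a) (g t)) has_field_derivative integral (cbox (-a) a) (g' t0)) (at t0)"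
    using at_within_open[OF I(3,1)] by simp
  then show ?thesis unfolding e(2)[OF I(3)]
    by (rule has_field_derivative_transform_within_open[OF _ I(1,3)]) (simp add: e)
qed

lemma lborel_integral_translate:
  fixes f :: "'a::euclidean_space \<Rightarrow> real"
  assumes "continuous_on UNIV f"
  shows "(LINT y|lborel. f (y + c)) = (LINT y|lborel. f y)"
proof -
  have "(LINT y|lborel. f y) = (LINT y|distr lborel borel ((+) c). f y)"
    by (simp add: lborel_distr_plus)
  also have "\<dots> = (LINT y|lborel. f (c + y))"
    using assms by (intro integral_distr) (auto intro: borel_measurable_continuous_onI)
  finally show ?thesis by (simp add: add.commute)
qed

text \<open>Translation invariance: the integral of the shifted function does not depend on the
  shift, and its derivative at shift 0 is the integral in question. This is the divergence theorem
  needed for the codifferential.\<close>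

lemma integral_derivative_compact_support:
  fixes f :: "'a::euclidean_space \<Rightarrow> real"
  assumes S: "open S" "compact K" "K \<subseteq> S" and f: "smooth_on S f" "\<And>y. y \<in> S - K \<Longrightarrow> f y = 0"
  shows "(LINT y:S|lborel. dd f y e) = 0"
proof -
  define F where "F y = (if y \<in> S then f y else 0)" for y
  have F: "smooth_on UNIV F"
    unfolding F_def by (rule smooth_on_zero_extension[OF S(1) compact_imp_closed[OF S(2)] S(3) f])
  have Fz: "F y = 0" if "y \<notin> K" for y using that f(2) by (auto simp: F_def)
  have dFz: "dd F y e = 0" if "y \<notin> K" for y
  proof -
    have "dd F y = dd (\<lambda>_. 0) y"
      by (rule dd_cong_open[of "- K"]) (use that S(2) Fz in \<open>auto intro: compact_imp_closed\<close>)
    then show ?thesis by simp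
  qed
  have c: "continuous_on UNIV F" "continuous_on UNIV (\<lambda>y. dd F y e)"
    using F by (auto intro: smooth_on_continuous smooth_on_dd)
  \<comment> \<open>One compact set containing the supports of all shifts with parameter in
    \<open>{-1<..<1}\<close>, as differentiation under the integral requires.\<close>
  define K' where "K' = (\<lambda>(t, k). k - t *\<^sub>R e) ` ({-1..1} \<times> K)"
  have K': "compact K'" unfolding K'_def
    by (rule compact_continuous_image) (auto intro!: continuous_intros compact_Times S simp: case_prod_unfold)
  have outK': "y + t *\<^sub>R e \<notin> K" if "y \<notin> K'" "t \<in> {-1<..<1}" for y t
  proof
    assume "y + t *\<^sub>R e \<in> K"
    then have "(\<lambda>(t, k). k - t *\<^sub>R e) (t, y + t *\<^sub>R e) \<in> K'"
      unfolding K'_def using that(2) by (intro imageI) auto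
    then show False using that(1) by simp
  qed
  have ct: "continuous_on ({-1<..<1} \<times> UNIV) (\<lambda>(t, y). F (y + t *\<^sub>R e))"
    "continuous_on ({-1<..<1} \<times> UNIV) (\<lambda>(t, y). dd F (y + t *\<^sub>R e) e)"
    unfolding case_prod_unfold
    by (rule continuous_on_compose2[OF c(1)] continuous_on_compose2[OF c(2)]; auto intro!: continuous_intros)+
  have "((\<lambda>t. LINT y:UNIV|lborel. F (y + t *\<^sub>R e)) has_real_derivative
      (LINT y:UNIV|lborel. dd F (y + 0 *\<^sub>R e) e)) (at 0)"
    using outK' Fz dFz smooth_line_derivative[OF F]
    by (intro leibniz_compact_support[of "{-1<..<1}" 0 UNIV K', OF _ _ _ _ K' _ ct]) auto
  moreover have "(\<lambda>t. LINT y:UNIV|lborel. F (y + t *\<^sub>R e)) = (\<lambda>t. LINT y|lborel. F y)"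
    using lborel_integral_translate[OF c(1)] by (simp add: set_lebesgue_integral_def)
  ultimately have "(LINT y|lborel. dd F y e) = 0"
    using DERIV_unique[OF _ DERIV_const] by (simp add: set_lebesgue_integral_def)
  moreover have "(if y \<in> S then dd f y e else 0) = dd F y e" for y
  proof (cases "y \<in> S")
    case True
    then show ?thesis using dd_cong_open[OF S(1), of y F f] by (simp add: F_def)
  next
    case False
    then show ?thesis using dFz S(3) by auto
  qed
  ultimately show ?thesis unfolding set_integral_zero_extension by simp
qed

section \<open>Change of variables\<close>

text \<open>
  The change of variables theorem of the library needs a wellordered index type. It is transferred
  to an arbitrary finite index type along a wellordered copy of that type.
\<close>

typedef 'a wo = "UNIV :: 'a set" morphisms of_wo to_wo ..

lemma bij_to_wo: "bij to_wo"
  by (metis bijI' of_wo_inverse to_wo_inject UNIV_I)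

lemma bij_of_wo: "bij of_wo"
  by (metis bijI' of_wo_inject to_wo_inverse UNIV_I)

lemma to_wo_of_wo [simp]: "to_wo (of_wo x) = x" "of_wo (to_wo y) = y"
  by (simp_all add: of_wo_inverse to_wo_inverse)

lemma inv_to_wo: "inv to_wo = of_wo"
  by (rule inv_equality) simp_all

instance wo :: (finite) finite
  by standard (metis bij_to_wo finite bij_betw_finite)

text \<open>An arbitrary injection into the natural numbers; the order pulled back along it is a
  wellorder.\<close>

definition wo_rank :: "'a::finite wo \<Rightarrow> nat" where
  "wo_rank = (SOME f. inj f)"

lemma inj_wo_rank: "inj wo_rank"
  unfolding wo_rank_def
proof (rule someI_ex[of inj])
  have "finite (UNIV :: 'a wo set)" by simp
  from finite_imp_inj_to_nat_seg[OF this] show "\<exists>f :: 'a wo \<Rightarrow> nat. inj f" by blast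
qed

instantiation wo :: (finite) wellorder
begin

definition less_eq_wo :: "'a wo \<Rightarrow> 'a wo \<Rightarrow> bool" where
  "less_eq_wo x y \<longleftrightarrow> wo_rank x \<le> wo_rank y"

definition less_wo :: "'a wo \<Rightarrow> 'a wo \<Rightarrow> bool" where
  "less_wo x y \<longleftrightarrow> wo_rank x < wo_rank y"

instance
proof
  fix P :: "'a wo \<Rightarrow> bool" and a
  assume *: "\<And>x. (\<And>y. y < x \<Longrightarrow> P y) \<Longrightarrow> P x"
  show "P a"
    by (induction a rule: measure_induct_rule[of wo_rank]) (use * in \<open>auto simp: less_wo_def\<close>)
qed (use inj_wo_rank in \<open>auto simp: less_eq_wo_def less_wo_def inj_def\<close>)

end

definition vec_to_wo :: "real ^ 'm::finite \<Rightarrow> real ^ ('m wo)" where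
  "vec_to_wo x = (\<chi> i. x $ of_wo i)"

definition vec_of_wo :: "real ^ ('m::finite wo) \<Rightarrow> real ^ 'm" where
  "vec_of_wo x = (\<chi> i. x $ to_wo i)"

lemma vec_wo_inverse [simp]: "vec_to_wo (vec_of_wo x) = x" "vec_of_wo (vec_to_wo y) = y"
  by (simp_all add: vec_to_wo_def vec_of_wo_def vec_eq_iff)

lemma vec_wo_nth [simp]: "vec_to_wo x $ i = x $ of_wo i" "vec_of_wo y $ j = y $ to_wo j"
  by (simp_all add: vec_to_wo_def vec_of_wo_def)

lemma linear_vec_wo: "linear vec_to_wo" "linear vec_of_wo"
  by (auto simp: linear_iff vec_to_wo_def vec_of_wo_def vec_eq_iff)

lemma continuous_on_vec_wo: "continuous_on X vec_to_wo" "continuous_on Y vec_of_wo"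
  using linear_vec_wo by (auto intro: linear_continuous_on simp: linear_conv_bounded_linear)

lemma vec_to_wo_image: "vec_to_wo ` X = vec_of_wo -` X"
  by (auto intro: image_eqI[of _ _ "vec_of_wo _"])

lemma open_vec_to_wo_image: "open X \<Longrightarrow> open (vec_to_wo ` X)"
  unfolding vec_to_wo_image by (rule open_vimage[OF _ continuous_on_vec_wo(2)])

lemma Basis_cart: "(Basis :: (real ^ 'n) set) = range (\<lambda>i. axis i 1)"
  by (auto simp: Basis_vec_def)

lemma emeasure_lborel_box_cart:
  fixes l u :: "real ^ 'n"
  assumes "\<And>i. l $ i \<le> u $ i"
  shows "emeasure lborel (box l u) = (\<Prod>i\<in>UNIV. u $ i - l $ i)"
proof -
  have "inj (\<lambda>i::'n. axis i (1::real))" by (auto simp: inj_def axis_eq_axis)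
  then have "(\<Prod>b\<in>Basis. (u - l) \<bullet> b) = (\<Prod>i\<in>UNIV. u $ i - l $ i)"
    unfolding Basis_cart by (simp add: prod.reindex inner_axis)
  then show ?thesis
    using assms by (subst emeasure_lborel_box) (auto simp: Basis_cart inner_axis)
qed

text \<open>Lebesgue measure is determined by its values on boxes, and the product of the side
  lengths is invariant under relabelling the coordinates.\<close>

lemma lborel_vec_to_wo: "distr lborel borel vec_to_wo = lborel"
proof (rule lborel_eqI[symmetric])
  fix l u :: "real ^ ('m::finite wo)"
  assume *: "\<And>b. b \<in> Basis \<Longrightarrow> l \<bullet> b \<le> u \<bullet> b"
  have le: "l $ i \<le> u $ i" for i using *[of "axis i 1"] by (simp add: inner_axis)
  have m: "vec_to_wo \<in> borel_measurable borel"
    by (rule borel_measurable_continuous_onI[OF continuous_on_vec_wo(1)])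
  have "vec_to_wo -` box l u = box (vec_of_wo l) (vec_of_wo u)"
    by (auto simp: mem_box_cart) (metis to_wo_of_wo)+
  then have "emeasure (distr lborel borel vec_to_wo) (box l u) = emeasure lborel (box (vec_of_wo l) (vec_of_wo u))"
    using m by (subst emeasure_distr) simp_all
  also have "\<dots> = (\<Prod>i\<in>UNIV. u $ to_wo i - l $ to_wo i)"
    by (subst emeasure_lborel_box_cart) (simp_all add: le)
  also have "\<dots> = (\<Prod>i\<in>UNIV. u $ i - l $ i)"
    using prod.reindex_bij_betw[OF bij_to_wo, of "\<lambda>i. u $ i - l $ i"] by simp
  also have "\<dots> = emeasure lborel (box l u)"
    by (rule emeasure_lborel_box_cart[OF le, symmetric])
  also have "\<dots> = (\<Prod>b\<in>Basis. (u - l) \<bullet> b)"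
    using le by (subst emeasure_lborel_box) (auto simp: Basis_cart inner_axis)
  finally show "emeasure (distr lborel borel vec_to_wo) (box l u) = (\<Prod>b\<in>Basis. (u - l) \<bullet> b)" .
qed simp

text \<open>In the Leibniz expansion, conjugating permutations by the relabelling is a bijection
  that preserves signs.\<close>

lemma det_reindex_wo: "det (\<chi> i j. M $ of_wo i $ of_wo j) = det M"
  for M :: "real ^ 'm::finite ^ 'm"
proof -
  let ?f = "\<lambda>p x. to_wo (p (inv_into UNIV to_wo x))"
  have b: "bij_betw ?f {p. p permutes (UNIV :: 'm set)} {p. p permutes UNIV}"
    using bij_betw_permutations[OF bij_to_wo] by simp
  have sgn: "sign (?f p) = sign p" if "p permutes UNIV" for p :: "'m \<Rightarrow> 'm"
  proof -
    have "?f p = map_permutation UNIV to_wo p"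
      unfolding map_permutation_def by (simp add: restrict_id_def fun_eq_iff bij_is_surj[OF bij_to_wo])
    then show ?thesis
      using sign_map_permutation[OF bij_is_inj[OF bij_to_wo] that] by simp
  qed
  have "det (\<chi> i j. M $ of_wo i $ of_wo j)
    = (\<Sum>p\<in>{p. p permutes (UNIV :: 'm set)}. of_int (sign (?f p)) * (\<Prod>i\<in>UNIV. M $ of_wo i $ of_wo (?f p i)))"
    unfolding det_def by (subst sum.reindex_bij_betw[OF b, symmetric]) simp
  also have "\<dots> = (\<Sum>p\<in>{p. p permutes (UNIV :: 'm set)}. of_int (sign p) * (\<Prod>i\<in>UNIV. M $ i $ p i))"
  proof (rule sum.cong[OF refl])
    fix p :: "'m \<Rightarrow> 'm" assume "p \<in> {p. p permutes UNIV}"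
    then show "of_int (sign (?f p)) * (\<Prod>i\<in>UNIV. M $ of_wo i $ of_wo (?f p i))
      = of_int (sign p) * (\<Prod>i\<in>UNIV. M $ i $ p i)"
      using prod.reindex_bij_betw[OF bij_of_wo, of "\<lambda>i. M $ i $ p i"] sgn by (simp add: inv_to_wo)
  qed
  finally show ?thesis unfolding det_def .
qed

text \<open>The compact sets \<open>K\<close> and \<open>L\<close> make the integrands on both sides
  integrable, so that Lebesgue integrals and gauge integrals may be interchanged.\<close>

lemma change_of_variables_wellorder:
  fixes f :: "real ^ 'm::{finite,wellorder} \<Rightarrow> real" and \<tau> :: "real ^ 'm::_ \<Rightarrow> real ^ 'm::_"
  assumes S: "open S" "open (\<tau> ` S)" and inj: "inj_on \<tau> S"
    and d: "\<And>x. x \<in> S \<Longrightarrow> (\<tau> has_derivative \<tau>' x) (at x)"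
    and f: "continuous_on (\<tau> ` S) f" "compact K" "K \<subseteq> \<tau> ` S" "\<And>z. z \<in> \<tau> ` S - K \<Longrightarrow> f z = 0"
    and h: "continuous_on S (\<lambda>y. \<bar>det (matrix (\<tau>' y))\<bar> * f (\<tau> y))" "compact L" "L \<subseteq> S"
      "\<And>y. y \<in> S - L \<Longrightarrow> f (\<tau> y) = 0"
  shows "(LINT z:\<tau> ` S|lborel. f z) = (LINT y:S|lborel. \<bar>det (matrix (\<tau>' y))\<bar> * f (\<tau> y))"
proof -
  let ?h = "\<lambda>y. \<bar>det (matrix (\<tau>' y))\<bar> * f (\<tau> y)"
  have fi: "set_integrable lborel (\<tau> ` S) f" by (rule compact_support_set_integrable[OF S(2) f(2,3,1,4)])
  have hi: "set_integrable lborel S ?h"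
    by (rule compact_support_set_integrable[OF S(1) h(2,3,1)]) (use h(4) in simp)
  \<comment> \<open>The theorem invoked next concerns vector-valued functions; real values are
    treated as vectors in \<open>real ^ 1\<close> and recovered by taking the component.\<close>
  have f1: "(\<lambda>z. vec (f z) :: real ^ 1) absolutely_integrable_on (\<tau> ` S)"
  proof -
    have "f absolutely_integrable_on (\<tau> ` S)"
      using fi unfolding set_integrable_def by (simp add: integrable_completion borel_measurable_integrable)
    from absolutely_integrable_linear[OF this, of "\<lambda>x. vec x :: real ^ 1"] show ?thesis
      by (simp add: o_def linear_vec linear_conv_bounded_linear[symmetric])
  qed
  from has_absolute_integral_change_of_variables[of S \<tau> \<tau>' "\<lambda>z. vec (f z) :: real ^ 1", OF _ _ inj]
  have 2: "(\<lambda>x. \<bar>det (matrix (\<tau>' x))\<bar> *\<^sub>R (vec (f (\<tau> x)) :: real ^ 1)) absolutely_integrable_on S"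
    and 3: "integral S (\<lambda>x. \<bar>det (matrix (\<tau>' x))\<bar> *\<^sub>R (vec (f (\<tau> x)) :: real ^ 1)) = integral (\<tau> ` S) (\<lambda>z. vec (f z))"
    using f1 S(1) d by (auto intro: has_derivative_at_withinI)
  have "integral S (\<lambda>x. (\<bar>det (matrix (\<tau>' x))\<bar> *\<^sub>R (vec (f (\<tau> x)) :: real ^ 1)) $ 1)
      = integral (\<tau> ` S) (\<lambda>z. (vec (f z) :: real ^ 1) $ 1)"
    using integral_linear[OF set_lebesgue_integral_eq_integral(1)[OF 2] bounded_linear_vec_nth[of 1]]
      integral_linear[OF set_lebesgue_integral_eq_integral(1)[OF f1] bounded_linear_vec_nth[of 1]] 3
    by (simp add: o_def)
  then show ?thesis
    unfolding set_borel_integral_eq_integral(2)[OF fi] set_borel_integral_eq_integral(2)[OF hi] by simp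
qed

lemma set_integral_vec_to_wo:
  fixes f :: "real ^ 'm::finite \<Rightarrow> real"
  assumes "open S" "compact K" "K \<subseteq> S" "continuous_on S f" "\<And>y. y \<in> S - K \<Longrightarrow> f y = 0"
  shows "(LINT z:vec_to_wo ` S|lborel. f (vec_of_wo z)) = (LINT y:S|lborel. f y)"
proof -
  define F where "F y = (if y \<in> S then f y else 0)" for y
  have F: "continuous_on UNIV F" unfolding F_def
    by (rule continuous_on_zero_extension'[OF assms(1) compact_imp_closed[OF assms(2)] assms(3-5)])
  have "(LINT z:vec_to_wo ` S|lborel. f (vec_of_wo z)) = (LINT z|lborel. F (vec_of_wo z))"
    unfolding set_integral_zero_extension F_def vec_to_wo_image by simp
  also have "\<dots> = (LINT z|distr lborel borel vec_to_wo. F (vec_of_wo z))"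
    by (simp add: lborel_vec_to_wo)
  also have "\<dots> = (LINT y|lborel. F (vec_of_wo (vec_to_wo y)))"
    by (intro integral_distr borel_measurable_continuous_onI continuous_on_vec_wo
        continuous_on_compose2[OF F continuous_on_vec_wo(2)])
       (auto intro: borel_measurable_continuous_onI[OF continuous_on_vec_wo(1)])
  finally show ?thesis unfolding set_integral_zero_extension F_def by (simp cong: if_cong)
qed

text \<open>Conjugating \<open>\<tau>\<close> by the relabelling of coordinates changes neither the
  integrals nor the Jacobian determinant.\<close>

theorem change_of_variables_compact_support:
  fixes f :: "real ^ 'm::finite \<Rightarrow> real" and \<tau> :: "real ^ 'm \<Rightarrow> real ^ 'm"
  assumes S: "open S" "open (\<tau> ` S)" and inj: "inj_on \<tau> S"
    and d: "\<And>x. x \<in> S \<Longrightarrow> (\<tau> has_derivative \<tau>' x) (at x)"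
    and f: "continuous_on (\<tau> ` S) f" "compact K" "K \<subseteq> \<tau> ` S" "\<And>z. z \<in> \<tau> ` S - K \<Longrightarrow> f z = 0"
    and h: "continuous_on S (\<lambda>y. \<bar>det (matrix (\<tau>' y))\<bar> * f (\<tau> y))" "compact L" "L \<subseteq> S"
      "\<And>y. y \<in> S - L \<Longrightarrow> f (\<tau> y) = 0"
  shows "(LINT z:\<tau> ` S|lborel. f z) = (LINT y:S|lborel. \<bar>det (matrix (\<tau>' y))\<bar> * f (\<tau> y))"
proof -
  define \<sigma> where "\<sigma> z = vec_to_wo (\<tau> (vec_of_wo z))" for z
  define \<sigma>' where "\<sigma>' z = (\<lambda>v. vec_to_wo (\<tau>' (vec_of_wo z) (vec_of_wo v)))" for z
  let ?S = "vec_to_wo ` S"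
  have img: "\<sigma> ` ?S = vec_to_wo ` \<tau> ` S" by (auto simp: \<sigma>_def image_iff)
  have bl: "bounded_linear vec_to_wo" "bounded_linear vec_of_wo"
    using linear_vec_wo by (auto simp: linear_conv_bounded_linear)
  have d': "(\<sigma> has_derivative \<sigma>' z) (at z)" if "z \<in> ?S" for z
  proof -
    have "(\<tau> has_derivative \<tau>' (vec_of_wo z)) (at (vec_of_wo z))" using that d by auto
    from has_derivative_compose[OF bounded_linear_imp_has_derivative[OF bl(2)] this]
    have "((\<lambda>z. \<tau> (vec_of_wo z)) has_derivative (\<lambda>v. \<tau>' (vec_of_wo z) (vec_of_wo v))) (at z)" .
    from bounded_linear.has_derivative[OF bl(1) this] show ?thesis unfolding \<sigma>_def \<sigma>'_def .
  qed
  have mat: "matrix (\<sigma>' z) = (\<chi> i j. matrix (\<tau>' (vec_of_wo z)) $ of_wo i $ of_wo j)" for z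
  proof -
    have "to_wo k = j \<longleftrightarrow> k = of_wo j" for k and j :: "'m wo" by (metis to_wo_of_wo)
    then have ax: "vec_of_wo (axis j 1) = axis (of_wo j) 1" for j :: "'m wo"
      unfolding vec_eq_iff by (simp add: axis_def)
    show ?thesis unfolding vec_eq_iff matrix_def \<sigma>'_def by (simp only: vec_lambda_beta vec_wo_nth ax simp_thms)
  qed
  have det: "det (matrix (\<sigma>' z)) = det (matrix (\<tau>' (vec_of_wo z)))" for z
    by (subst mat) (rule det_reindex_wo)
  let ?h = "\<lambda>y. \<bar>det (matrix (\<tau>' y))\<bar> * f (\<tau> y)"
  have "(LINT z:\<sigma> ` ?S|lborel. f (vec_of_wo z)) = (LINT z:?S|lborel. \<bar>det (matrix (\<sigma>' z))\<bar> * f (vec_of_wo (\<sigma> z)))"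
  proof (rule change_of_variables_wellorder[where K = "vec_to_wo ` K" and L = "vec_to_wo ` L"])
    show "open ?S" "open (\<sigma> ` ?S)" unfolding img using S by (auto intro: open_vec_to_wo_image)
    show "inj_on \<sigma> ?S" using inj unfolding inj_on_def \<sigma>_def by (metis vec_wo_inverse(2) imageE)
    show "continuous_on (\<sigma> ` ?S) (\<lambda>z. f (vec_of_wo z))" unfolding img
      by (rule continuous_on_compose2[OF f(1) continuous_on_vec_wo(2)]) auto
    have "continuous_on ?S (\<lambda>z. ?h (vec_of_wo z))"
      by (rule continuous_on_compose2[OF h(1) continuous_on_vec_wo(2)]) auto
    then show "continuous_on ?S (\<lambda>z. \<bar>det (matrix (\<sigma>' z))\<bar> * f (vec_of_wo (\<sigma> z)))"
      unfolding det \<sigma>_def by simp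
    show "compact (vec_to_wo ` K)" "compact (vec_to_wo ` L)"
      using f(2) h(2) by (auto intro: compact_continuous_image continuous_on_vec_wo)
    fix z
    show "f (vec_of_wo z) = 0" if "z \<in> \<sigma> ` ?S - vec_to_wo ` K"
      using that f(4)[of "vec_of_wo z"] image_eqI[of z vec_to_wo "vec_of_wo z" K] unfolding img by auto blast
    show "f (vec_of_wo (\<sigma> z)) = 0" if "z \<in> ?S - vec_to_wo ` L"
      using that h(4)[of "vec_of_wo z"] image_eqI[of z vec_to_wo "vec_of_wo z" L] unfolding \<sigma>_def by auto blast
  qed (use d' f h img in auto)
  also have "\<dots> = (LINT z:?S|lborel. ?h (vec_of_wo z))" unfolding det \<sigma>_def by simp
  also have "\<dots> = (LINT y:S|lborel. ?h y)"
    by (rule set_integral_vec_to_wo[OF S(1) h(2,3,1)]) (use h(4) in simp)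
  also have "(LINT z:\<sigma> ` ?S|lborel. f (vec_of_wo z)) = (LINT z:\<tau> ` S|lborel. f z)"
    unfolding img by (rule set_integral_vec_to_wo[OF S(2) f(2,3,1,4)])
  finally show ?thesis .
qed

section \<open>Charts and partitions of unity\<close>

lemma is_chartD:
  assumes "is_chart c"
  shows "open (chart_dom c)" "open (chart_img c)" "continuous_on (chart_dom c) (chart_map c)"
    "continuous_on (chart_img c) (chart_inv c)"
    "\<And>p. p \<in> chart_dom c \<Longrightarrow> chart_inv c (chart_map c p) = p"
    "\<And>p. p \<in> chart_dom c \<Longrightarrow> chart_map c p \<in> chart_img c"
    "\<And>y. y \<in> chart_img c \<Longrightarrow> chart_map c (chart_inv c y) = y"
    "\<And>y. y \<in> chart_img c \<Longrightarrow> chart_inv c y \<in> chart_dom c"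
  using assms unfolding is_chart_def homeomorphism_def chart_img_def by auto

lemma chart_image_Int:
  assumes "is_chart c"
  shows "chart_map c ` (chart_dom c \<inter> U) = {y \<in> chart_img c. chart_inv c y \<in> U}"
  using is_chartD(5-8)[OF assms] by (auto intro!: image_eqI[of _ _ "chart_inv c _"])

lemma open_chart_image:
  assumes "is_chart c" "open U"
  shows "open (chart_map c ` (chart_dom c \<inter> U))"
proof -
  have "{y \<in> chart_img c. chart_inv c y \<in> U} = chart_img c \<inter> chart_inv c -` U" by auto
  then show ?thesis
    using continuous_open_preimage[OF is_chartD(4,2)[OF assms(1)] assms(2)]
    by (simp add: chart_image_Int[OF assms(1)])
qed

lemma atlasD:
  assumes "atlas A"
  shows "c \<in> A \<Longrightarrow> is_chart c" "c \<in> A \<Longrightarrow> c' \<in> A \<Longrightarrow> smooth_transition c c'"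
    "\<exists>c\<in>A. p \<in> chart_dom c"
  using assms unfolding atlas_def by blast+

lemma chart_at:
  assumes "atlas A" shows "chart_at A p \<in> A" "p \<in> chart_dom (chart_at A p)"
  using someI_ex[of "\<lambda>c. c \<in> A \<and> p \<in> chart_dom c"] atlasD(3)[OF assms, of p]
  unfolding chart_at_def by blast+

section \<open>Coordinate changes and their Jacobians\<close>

definition coord_change :: "('a, 'm::finite) chart \<Rightarrow> ('a, 'm) chart \<Rightarrow> real ^ 'm \<Rightarrow> real ^ 'm" where
  "coord_change c c' = chart_map c' \<circ> chart_inv c"

definition overlap :: "('a, 'm::finite) chart \<Rightarrow> ('a, 'm) chart \<Rightarrow> (real ^ 'm) set" where
  "overlap c c' = chart_map c ` (chart_dom c \<inter> chart_dom c')"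

lemma overlap_eq: "is_chart c \<Longrightarrow> overlap c c' = {y \<in> chart_img c. chart_inv c y \<in> chart_dom c'}"
  unfolding overlap_def by (rule chart_image_Int)

lemma open_overlap: "is_chart c \<Longrightarrow> is_chart c' \<Longrightarrow> open (overlap c c')"
  unfolding overlap_def by (intro open_chart_image is_chartD)

lemma smooth_between_coord_change:
  assumes "is_chart c" "is_chart c'" "smooth_transition c c'"
  shows "smooth_between (overlap c c') (overlap c' c) (coord_change c c')"
  using assms(3) open_overlap[OF assms(1,2)] is_chartD[OF assms(1)] is_chartD[OF assms(2)]
  unfolding smooth_between_def smooth_transition_def coord_change_def
  by (auto simp: overlap_def image_iff intro!: bexI[of _ "chart_inv c _"])

definition coord_D :: "('a, 'm::finite) chart \<Rightarrow> ('a, 'm) chart \<Rightarrow> 'a \<Rightarrow> real ^ 'm \<Rightarrow> real ^ 'm" where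
  "coord_D c c' p = dd (coord_change c c') (chart_map c p)"

text \<open>Both conversions of components are Jacobians of coordinate changes from or to the
  preferred chart. All rules in \<open>from_to_chart\<close> thus become instances of the cocycle
  identity \<open>coord_D_chain\<close>.\<close>

lemma to_chart_trans: "to_chart A c p = coord_D (chart_at A p) c p"
  unfolding to_chart_def coord_D_def coord_change_def ..

lemma from_chart_trans: "from_chart A c p = coord_D c (chart_at A p) p"
  unfolding from_chart_def coord_D_def coord_change_def ..

lemma coord_change_differentiable:
  assumes "is_chart c" "is_chart c'" "smooth_transition c c'" "p \<in> chart_dom c" "p \<in> chart_dom c'"
  shows "coord_change c c' differentiable (at (chart_map c p))"
  using smooth_between_coord_change[OF assms(1-3)] assms(4,5)
  by (auto simp: smooth_between_def overlap_def intro: smooth_on_differentiable)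

lemma linear_coord_D:
  assumes "is_chart c" "is_chart c'" "smooth_transition c c'" "p \<in> chart_dom c" "p \<in> chart_dom c'"
  shows "linear (coord_D c c' p)"
  unfolding coord_D_def by (rule dd_linear[OF coord_change_differentiable[OF assms]])

text \<open>The chain rule on a triple overlap. It is stated for arbitrary compatible charts because
  it is also applied to holomorphic charts, which come with the complex structure and are not taken
  from the atlas.\<close>

lemma coord_D_chain:
  assumes c: "is_chart c" "is_chart c'" "is_chart c''"
    and s: "smooth_transition c c'" "smooth_transition c' c''"
    and p: "p \<in> chart_dom c" "p \<in> chart_dom c'" "p \<in> chart_dom c''"
  shows "coord_D c' c'' p (coord_D c c' p v) = coord_D c c'' p v"
proof -
  let ?S = "chart_map c ` (chart_dom c \<inter> (chart_dom c' \<inter> chart_dom c''))"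
  have e: "coord_change c c' (chart_map c p) = chart_map c' p"
    using is_chartD(5)[OF c(1) p(1)] by (simp add: coord_change_def)
  have "dd (coord_change c c'') (chart_map c p) = dd (\<lambda>y. coord_change c' c'' (coord_change c c' y)) (chart_map c p)"
  proof (rule dd_cong_open[of ?S])
    show "open ?S" by (intro open_chart_image c open_Int is_chartD)
    fix y assume "y \<in> ?S"
    then show "coord_change c c'' y = coord_change c' c'' (coord_change c c' y)"
      using is_chartD(5)[OF c(1)] is_chartD(5)[OF c(2)] by (auto simp: coord_change_def)
  qed (use p in blast)
  also have "\<dots> = (\<lambda>v. dd (coord_change c' c'') (coord_change c c' (chart_map c p)) (dd (coord_change c c') (chart_map c p) v))"
    by (rule dd_compose)
       (use coord_change_differentiable[OF c(2,3) s(2) p(2,3)] coord_change_differentiable[OF c(1,2) s(1) p(1,2)] in \<open>simp_all add: e\<close>)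
  finally show ?thesis unfolding coord_D_def e by simp
qed

lemma coord_D_refl:
  assumes "is_chart c" "p \<in> chart_dom c"
  shows "coord_D c c p v = v"
proof -
  have "dd (coord_change c c) (chart_map c p) = dd (\<lambda>x. x) (chart_map c p)"
    by (rule dd_cong_open[of "chart_img c"]) (use is_chartD[OF assms(1)] assms(2) in \<open>auto simp: coord_change_def\<close>)
  then show ?thesis by (simp add: coord_D_def)
qed

lemma from_to_chart:
  assumes "atlas A" "c \<in> A" "p \<in> chart_dom c"
  shows "linear (from_chart A c p)" "linear (to_chart A c p)"
    "to_chart A c p (from_chart A c p v) = v" "from_chart A c p (to_chart A c p v) = v"
    and "c' \<in> A \<Longrightarrow> p \<in> chart_dom c' \<Longrightarrow> to_chart A c' p (from_chart A c p v) = coord_D c c' p v"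
    and "c' \<in> A \<Longrightarrow> p \<in> chart_dom c' \<Longrightarrow> coord_D c c' p (to_chart A c p v) = to_chart A c' p v"
    and "c' \<in> A \<Longrightarrow> p \<in> chart_dom c' \<Longrightarrow> from_chart A c' p (coord_D c c' p v) = from_chart A c p v"
proof -
  note m = assms(2) chart_at(1)[OF assms(1), of p] and p = assms(3) chart_at(2)[OF assms(1), of p]
  note ch = atlasD(1)[OF assms(1)] and st = atlasD(2)[OF assms(1)]
  show "linear (from_chart A c p)" "linear (to_chart A c p)"
    unfolding from_chart_trans to_chart_trans by (rule linear_coord_D; rule ch st m p; rule m)+
  show "to_chart A c p (from_chart A c p v) = v"
    unfolding from_chart_trans to_chart_trans
    by (simp only: coord_D_chain[OF ch[OF m(1)] ch[OF m(2)] ch[OF m(1)] st[OF m(1,2)] st[OF m(2,1)] p(1,2,1)]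
        coord_D_refl[OF ch[OF m(1)] p(1)])
  show "from_chart A c p (to_chart A c p v) = v"
    unfolding from_chart_trans to_chart_trans
    by (simp only: coord_D_chain[OF ch[OF m(2)] ch[OF m(1)] ch[OF m(2)] st[OF m(2,1)] st[OF m(1,2)] p(2,1,2)]
        coord_D_refl[OF ch[OF m(2)] p(2)])
  assume c': "c' \<in> A" "p \<in> chart_dom c'"
  show "to_chart A c' p (from_chart A c p v) = coord_D c c' p v"
    unfolding from_chart_trans to_chart_trans
    by (rule coord_D_chain[OF ch[OF m(1)] ch[OF m(2)] ch[OF c'(1)] st[OF m(1,2)] st[OF m(2) c'(1)] p(1,2) c'(2)])
  show "coord_D c c' p (to_chart A c p v) = to_chart A c' p v"
    unfolding from_chart_trans to_chart_trans
    by (rule coord_D_chain[OF ch[OF m(2)] ch[OF m(1)] ch[OF c'(1)] st[OF m(2,1)] st[OF m(1) c'(1)] p(2,1) c'(2)])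
  show "from_chart A c' p (coord_D c c' p v) = from_chart A c p v"
    unfolding from_chart_trans to_chart_trans
    by (rule coord_D_chain[OF ch[OF m(1)] ch[OF c'(1)] ch[OF m(2)] st[OF m(1) c'(1)] st[OF c'(1) m(2)] p(1) c'(2) p(2)])
qed

lemma to_chart_at:
  assumes "atlas A" shows "to_chart A (chart_at A p) p v = v" "from_chart A (chart_at A p) p v = v"
  unfolding from_chart_trans to_chart_trans
  using coord_D_refl[OF atlasD(1)[OF assms chart_at(1)[OF assms]] chart_at(2)[OF assms]] by blast+

section \<open>Smooth functions, bumps and partitions of unity\<close>

definition smooth_fun :: "('a::topological_space, 'm::finite) chart set \<Rightarrow> ('a \<Rightarrow> real) \<Rightarrow> bool" where
  "smooth_fun A f \<longleftrightarrow> (\<forall>c\<in>A. smooth_on (chart_img c) (\<lambda>y. f (chart_inv c y)))"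

lemma continuous_chartwise:
  assumes "atlas A" "\<And>c. c \<in> A \<Longrightarrow> continuous_on (chart_img c) (\<lambda>y. f (chart_inv c y))"
  shows "continuous_on UNIV f"
proof -
  have "continuous_on (\<Union>c\<in>A. chart_dom c) f"
  proof (rule continuous_on_open_UN)
    fix c assume c: "c \<in> A"
    note C = is_chartD[OF atlasD(1)[OF assms(1) c]]
    show "open (chart_dom c)" by (rule C(1))
    have "continuous_on (chart_dom c) (\<lambda>p. f (chart_inv c (chart_map c p)))"
      by (rule continuous_on_compose2[OF assms(2)[OF c] C(3)]) (use C(6) in auto)
    then show "continuous_on (chart_dom c) f"
      by (rule continuous_on_eq) (simp add: C(5))
  qed
  then show ?thesis using assms(1) by (simp add: atlas_def)
qed

lemma smooth_fun_continuous: "atlas A \<Longrightarrow> smooth_fun A f \<Longrightarrow> continuous_on UNIV f"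
  unfolding smooth_fun_def by (rule continuous_chartwise) (auto intro: smooth_on_continuous)

lemma smooth_chart_change:
  fixes h :: "real ^ 'm \<Rightarrow> 'b::real_normed_vector"
  assumes "is_chart c" "is_chart c'" "smooth_transition c' c" "smooth_on (chart_img c) h"
  shows "smooth_on (overlap c' c) (\<lambda>y. h (coord_change c' c y))"
proof (rule smooth_on_compose[of "chart_img c" h])
  show "smooth_on (overlap c' c) (coord_change c' c)" "open (overlap c' c)"
    using smooth_between_coord_change[OF assms(2,1,3)] by (auto simp: smooth_between_def)
  show "coord_change c' c y \<in> chart_img c" if "y \<in> overlap c' c" for y
    using that smooth_between_coord_change[OF assms(2,1,3)] overlap_eq[OF assms(1), of c'] by (auto simp: smooth_between_def)
qed (rule assms(4))

lemma coord_change_inv: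
  assumes "is_chart c" "is_chart c'" "y \<in> overlap c c'"
  shows "chart_inv c' (coord_change c c' y) = chart_inv c y"
  using assms is_chartD[OF assms(1)] is_chartD[OF assms(2)] by (auto simp: overlap_eq coord_change_def)

lemma smooth_fun_zero_extension:
  fixes c :: "('a::t2_space, 'm::finite) chart"
  assumes A: "atlas A" "c \<in> A" and K: "closed K" "K \<subseteq> chart_dom c" "\<And>p. p \<notin> K \<Longrightarrow> f p = 0"
    and f: "smooth_on (chart_img c) (\<lambda>y. f (chart_inv c y))"
  shows "smooth_fun A f"
  unfolding smooth_fun_def
proof
  fix c' assume c': "c' \<in> A"
  note C = is_chartD[OF atlasD(1)[OF A(1) A(2)]] and C' = is_chartD[OF atlasD(1)[OF A(1) c']]
  note ch = atlasD(1)[OF A(1) A(2)] atlasD(1)[OF A(1) c']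
  show "smooth_on (chart_img c') (\<lambda>y. f (chart_inv c' y))"
  proof (rule smooth_on_local)
    fix y assume y: "y \<in> chart_img c'"
    show "\<exists>T. open T \<and> y \<in> T \<and> smooth_on T (\<lambda>y. f (chart_inv c' y))"
    proof (cases "chart_inv c' y \<in> K")
      case True
      have "smooth_on (overlap c' c) (\<lambda>y. f (chart_inv c (coord_change c' c y)))"
        by (rule smooth_chart_change[OF ch atlasD(2)[OF A(1) c' A(2)] f])
      then have "smooth_on (overlap c' c) (\<lambda>y. f (chart_inv c' y))"
        by (subst (asm) smooth_on_cong[OF open_overlap[OF ch(2,1)]]) (simp add: coord_change_inv[OF ch(2,1)])
      then show ?thesis using open_overlap[OF ch(2,1)] True K y overlap_eq[OF ch(2)] by blast
    next
      case False
      let ?T = "chart_map c' ` (chart_dom c' \<inter> - K)"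
      have T: "open ?T" using K(1) by (intro open_chart_image ch) auto
      have "smooth_on ?T (\<lambda>y. f (chart_inv c' y))"
        by (subst smooth_on_cong[OF T, of _ "\<lambda>_. 0"])
           (use K(3) in \<open>auto simp: chart_image_Int[OF ch(2)] smooth_on_const\<close>)
      then show ?thesis using T False y chart_image_Int[OF ch(2)] by blast
    qed
  qed
qed

lemma smooth_fun_sum:
  "atlas A \<Longrightarrow> (\<And>i. i \<in> I \<Longrightarrow> smooth_fun A (f i)) \<Longrightarrow> smooth_fun A (\<lambda>p. \<Sum>i\<in>I. f i p)"
  unfolding smooth_fun_def by (auto intro!: smooth_on_sum is_chartD(2)[OF atlasD(1)])

text \<open>A Euclidean bump supported in a closed coordinate ball is carried to the manifold. The
  image \<open>K\<close> of that ball is compact, hence closed in a Hausdorff space, and this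
  confines the closure of the support.\<close>

lemma chart_bump:
  fixes A :: "('a::t2_space, 'm::finite) chart set"
  assumes A: "atlas A" and G: "open G" "p \<in> G"
  obtains f :: "'a \<Rightarrow> real" where "smooth_fun A f" "\<And>x. 0 \<le> f x" "0 < f p" "open {x. f x \<noteq> 0}"
    "closure {x. f x \<noteq> 0} \<subseteq> G \<inter> chart_dom (chart_at A p)"
proof -
  define c where "c = chart_at A p"
  have c: "c \<in> A" "p \<in> chart_dom c" using chart_at[OF A] by (auto simp: c_def)
  note ch = atlasD(1)[OF A c(1)] and C = is_chartD[OF atlasD(1)[OF A c(1)]]
  let ?W = "chart_map c ` (chart_dom c \<inter> G)"
  have "open ?W" "chart_map c p \<in> ?W" using open_chart_image[OF ch G(1)] c G by auto
  then obtain r where r: "r > 0" "cball (chart_map c p) r \<subseteq> ?W"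
    using open_contains_cball_eq by blast
  obtain \<beta> :: "real ^ 'm \<Rightarrow> real" where \<beta>: "smooth_on UNIV \<beta>" "\<And>y. 0 \<le> \<beta> y"
    "\<And>y. \<beta> y \<noteq> 0 \<longleftrightarrow> dist (chart_map c p) y < r"
    using smooth_bump[of "chart_map c p" r] by blast
  define f where "f x = (if x \<in> chart_dom c then \<beta> (chart_map c x) else 0)" for x
  define K where "K = chart_inv c ` cball (chart_map c p) r"
  have sub: "cball (chart_map c p) r \<subseteq> chart_img c" using r(2) C(6) by auto
  have "compact K" unfolding K_def
    by (rule compact_continuous_image[OF continuous_on_subset[OF C(4) sub]]) simp
  then have K: "closed K" by (rule compact_imp_closed)
  have KO: "K \<subseteq> G \<inter> chart_dom c"
    using r(2) C(5) unfolding K_def by force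
  have f0: "f x = 0" if "x \<notin> K" for x
  proof (rule ccontr)
    assume "f x \<noteq> 0"
    then have "x \<in> chart_dom c" "dist (chart_map c p) (chart_map c x) < r"
      using \<beta>(3) by (auto simp: f_def split: if_splits)
    then have "x \<in> K" unfolding K_def using C(5) by (intro image_eqI[of _ _ "chart_map c x"]) auto
    then show False using that by simp
  qed
  have "smooth_on (chart_img c) \<beta>" using \<beta>(1) by (rule smooth_on_subset) simp
  then have "smooth_on (chart_img c) (\<lambda>y. f (chart_inv c y))"
    by (subst smooth_on_cong[OF C(2)]) (use C(7,8) in \<open>auto simp: f_def\<close>)
  from smooth_fun_zero_extension[OF A c(1) K _ f0 this] have sm: "smooth_fun A f" using KO by blast
  have "open (f -` (- {0}))" by (rule open_vimage[OF _ smooth_fun_continuous[OF A sm]]) auto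
  then have "open {x. f x \<noteq> 0}" by (simp add: vimage_def)
  moreover have "0 < f p"
    using \<beta>(2)[of "chart_map c p"] \<beta>(3)[of "chart_map c p"] r(1) c(2) by (auto simp: f_def less_le)
  moreover have "closure {x. f x \<noteq> 0} \<subseteq> K"
    by (rule closure_minimal[OF _ K]) (use f0 in auto)
  moreover have "0 \<le> f x" for x using \<beta>(2) by (simp add: f_def)
  ultimately show thesis by (rule_tac that[OF sm]) (use KO c_def in auto)
qed

text \<open>Finitely many bumps have a positive sum by compactness, and dividing by it normalises
  them. The neighbourhoods \<open>G\<close> are prescribed because the construction of variations
  needs each support to be mapped into a single chart of the target.\<close>

lemma partition_of_unity_exists:
  fixes A :: "('a::t2_space, 'm::finite) chart set"
  assumes M: "compact (UNIV :: 'a set)" and A: "atlas A"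
    and G: "\<And>p. open (G p)" "\<And>p. p \<in> G p"
  obtains n q \<rho> where "partition_of_unity A n (\<lambda>i. chart_at A (q i)) \<rho>"
    "\<And>i. i < n \<Longrightarrow> closure {p. \<rho> i p \<noteq> 0} \<subseteq> G (q i) \<inter> chart_dom (chart_at A (q i))"
proof -
  have "\<exists>f. smooth_fun A f \<and> (\<forall>x. 0 \<le> f x) \<and> 0 < f p \<and> open {x. f x \<noteq> 0} \<and>
      closure {x. f x \<noteq> 0} \<subseteq> G p \<inter> chart_dom (chart_at A p)" for p
    using chart_bump[OF A G] by metis
  then obtain f where f: "\<And>p. smooth_fun A (f p)" "\<And>p x. 0 \<le> f p x" "\<And>p. 0 < f p p"
    "\<And>p. open {x. f p x \<noteq> 0}" "\<And>p. closure {x. f p x \<noteq> 0} \<subseteq> G p \<inter> chart_dom (chart_at A p)"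
    by metis
  have "x \<in> {y. f x y \<noteq> 0}" for x using f(3)[of x] by simp
  then have "UNIV \<subseteq> (\<Union>p\<in>UNIV. {x. f p x \<noteq> 0})" by blast
  then obtain P where P: "finite P" "UNIV \<subseteq> (\<Union>p\<in>P. {x. f p x \<noteq> 0})"
    using compactE_image[OF M, of UNIV "\<lambda>p. {x. f p x \<noteq> 0}"] f(4) by metis
  obtain n and q :: "nat \<Rightarrow> 'a" where q: "P = q ` {i. i < n}" "inj_on q {i. i < n}"
    using finite_imp_nat_seg_image_inj_on[OF P(1)] by metis
  have q': "P = q ` {..<n}" "inj_on q {..<n}" using q by (simp_all add: lessThan_def)
  define \<sigma> where "\<sigma> x = (\<Sum>i<n. f (q i) x)" for x
  have \<sigma>: "0 < \<sigma> x" for x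
  proof -
    obtain i where "i < n" "f (q i) x \<noteq> 0" using P(2) q by auto
    then have "0 < f (q i) x" using f(2)[of "q i" x] by simp
    then show ?thesis unfolding \<sigma>_def using \<open>i < n\<close> f(2) by (intro sum_pos2[of _ i]) auto
  qed
  have s\<sigma>: "smooth_fun A \<sigma>" unfolding \<sigma>_def using A f(1) by (intro smooth_fun_sum)
  define \<rho> where "\<rho> i x = f (q i) x / \<sigma> x" for i x
  have supp: "{x. \<rho> i x \<noteq> 0} = {x. f (q i) x \<noteq> 0}" for i
    using \<sigma> by (auto simp: \<rho>_def less_imp_neq[THEN not_sym])
  have "partition_of_unity A n (\<lambda>i. chart_at A (q i)) \<rho>"
    unfolding partition_of_unity_def
  proof (intro conjI allI impI ballI)
    fix i show "chart_at A (q i) \<in> A" by (rule chart_at[OF A])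
    show "0 \<le> \<rho> i p" for p using f(2) \<sigma> by (simp add: \<rho>_def less_imp_le)
    show "closure {p. \<rho> i p \<noteq> 0} \<subseteq> chart_dom (chart_at A (q i))" unfolding supp using f(5) by auto
    fix c assume c: "c \<in> A"
    show "smooth_on (chart_img c) (\<rho> i \<circ> chart_inv c)"
      unfolding \<rho>_def o_def using f(1) s\<sigma> c \<sigma>[THEN less_imp_neq, THEN not_sym] unfolding smooth_fun_def
      by (intro smooth_on_divide is_chartD(2)[OF atlasD(1)[OF A c]]) auto
  next
    fix p
    have "(\<Sum>i<n. \<rho> i p) = \<sigma> p / \<sigma> p"
      unfolding \<rho>_def sum_divide_distrib[symmetric] by (simp add: \<sigma>_def)
    then show "(\<Sum>i<n. \<rho> i p) = 1" using \<sigma>[of p] by simp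
  qed
  then show thesis by (rule that) (use f(5) supp in auto)
qed

section \<open>Orthonormal frames\<close>

text \<open>Gram-Schmidt by induction over subsets of the index type, so that the frame is indexed
  by that type itself. Fewer than \<open>CARD('m)\<close> vectors cannot span, which supplies the
  next vector to be orthogonalised.\<close>

lemma orthonormal_frame_exists:
  fixes b :: "real ^ 'm \<Rightarrow> real ^ 'm \<Rightarrow> real"
  assumes bl: "bilinear b" and sym: "\<And>u v. b u v = b v u" and pd: "posdef b"
  shows "\<exists>e. orthonormal_frame b e"
proof -
  have "\<exists>e :: 'm \<Rightarrow> real ^ 'm. \<forall>i\<in>I. \<forall>j\<in>I. b (e i) (e j) = (if i = j then 1 else 0)" if "finite I" for I
    using that
  proof (induction I)
    case (insert k I)
    then obtain e :: "'m \<Rightarrow> real ^ 'm" where e: "\<forall>i\<in>I. \<forall>j\<in>I. b (e i) (e j) = (if i = j then 1 else 0)" by blast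
    have "dim (e ` I) \<le> card (e ` I)" using insert(1) by (intro dim_le_card') auto
    also have "\<dots> \<le> card I" by (rule card_image_le[OF insert(1)])
    also have "\<dots> < CARD('m)" using insert(2) by (intro psubset_card_mono) auto
    finally have "span (e ` I) \<noteq> UNIV" by (metis dim_span dim_UNIV DIM_cart DIM_real mult.right_neutral less_irrefl)
    then obtain v where v: "v \<notin> span (e ` I)" by blast
    define w where "w = v - (\<Sum>i\<in>I. b v (e i) *\<^sub>R e i)"
    have "w \<noteq> 0"
    proof
      assume "w = 0"
      then have "v = (\<Sum>i\<in>I. b v (e i) *\<^sub>R e i)" by (simp add: w_def)
      also have "\<dots> \<in> span (e ` I)" by (intro span_sum span_scale span_base) auto
      finally show False using v by simp
    qed
    then have ww: "b w w > 0" using pd by (simp add: posdef_def)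
    have we: "b w (e j) = 0" if "j \<in> I" for j
    proof -
      have lin: "linear (\<lambda>x. b x (e j))" using bl by (simp add: bilinear_def)
      have "b w (e j) = b v (e j) - (\<Sum>i\<in>I. b v (e i) * b (e i) (e j))"
        unfolding w_def linear_diff[OF lin] linear_sum[OF lin] linear_cmul[OF lin] by simp
      also have "(\<Sum>i\<in>I. b v (e i) * b (e i) (e j)) = (\<Sum>i\<in>I. if i = j then b v (e i) else 0)"
        by (rule sum.cong) (use e that in auto)
      also have "\<dots> = b v (e j)" using insert(1) that by simp
      finally show ?thesis by simp
    qed
    define e' where "e' = e(k := (1 / sqrt (b w w)) *\<^sub>R w)"
    have kk: "b (e' k) (e' k) = 1"
      using ww by (simp add: e'_def bilinear_lmul[OF bl] bilinear_rmul[OF bl])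
    have kj: "b (e' k) (e' j) = 0" "b (e' j) (e' k) = 0" if "j \<in> I" for j
      using we[OF that] sym[of "e j" w] insert(2) that
      by (auto simp: e'_def bilinear_lmul[OF bl] bilinear_rmul[OF bl])
    have "\<forall>i\<in>insert k I. \<forall>j\<in>insert k I. b (e' i) (e' j) = (if i = j then 1 else 0)"
      using kk kj e insert(2) by (auto simp: e'_def)
    then show ?case by blast
  qed simp
  from this[of UNIV] show ?thesis unfolding orthonormal_frame_def by auto
qed

lemma gram_linear:
  assumes "bilinear b" "linear L"
  shows "gram (\<lambda>u v. b (L u) (L v)) = transpose (matrix L) ** gram b ** matrix L"
proof -
  have ax: "L (axis j 1) = (\<Sum>k\<in>UNIV. matrix L $ k $ j *\<^sub>R axis k 1)" for j
    using axis_expansion[of "L (axis j 1)"] by (simp add: matrix_def)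
  have "b (L (axis j 1)) (L (axis i 1)) = (\<Sum>l\<in>UNIV. \<Sum>k\<in>UNIV. matrix L $ k $ i * b (axis l 1) (axis k 1) * matrix L $ l $ j)" for i j
    unfolding ax bilinear_sum[OF assms(1)] sum.cartesian_product[symmetric]
    by (simp add: bilinear_lmul[OF assms(1)] bilinear_rmul[OF assms(1)] mult_ac)
  then show ?thesis
    by (simp add: vec_eq_iff gram_def matrix_matrix_mult_def transpose_def sum_distrib_right)
qed

lemma det_gram_linear:
  assumes "bilinear b" "linear L"
  shows "det (gram (\<lambda>u v. b (L u) (L v))) = (det (matrix L))\<^sup>2 * det (gram b)"
  unfolding gram_linear[OF assms] by (simp add: det_mul power2_eq_square)

definition frame_map :: "('m::finite \<Rightarrow> real ^ 'm) \<Rightarrow> real ^ 'm \<Rightarrow> real ^ 'm" where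
  "frame_map e x = (\<Sum>i\<in>UNIV. x $ i *\<^sub>R e i)"

lemma linear_frame_map: "linear (frame_map e)"
  by (auto simp: linear_iff frame_map_def sum.distrib scaleR_add_left scaleR_sum_right)

lemma frame_map_axis: "frame_map e (axis i 1) = e i"
proof -
  have "axis i 1 $ k *\<^sub>R e k = (if k = i then e k else 0)" for k by (simp add: axis_def)
  then show ?thesis by (simp add: frame_map_def)
qed

text \<open>The Gram matrix of the frame is the identity. Two consequences are used: the Gram
  determinant is positive, so the volume coefficient is a square root of a positive number, and the
  frame is a basis.\<close>

lemma orthonormal_frame_det:
  assumes "bilinear b" "orthonormal_frame b e"
  shows "(det (matrix (frame_map e)))\<^sup>2 * det (gram b) = 1"
proof -
  have "gram (\<lambda>u v. b (frame_map e u) (frame_map e v)) = mat 1"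
    using assms(2) by (auto simp: gram_def frame_map_axis orthonormal_frame_def mat_def vec_eq_iff)
  then show ?thesis using det_gram_linear[OF assms(1) linear_frame_map, of e] by simp
qed

lemma gram_det_pos:
  assumes "bilinear b" "\<And>u v. b u v = b v u" "posdef b"
  shows "0 < det (gram b)"
proof -
  obtain e where "orthonormal_frame b e" using orthonormal_frame_exists[OF assms] by blast
  from orthonormal_frame_det[OF assms(1) this] show ?thesis
    by (metis mult_nonneg_nonpos not_le zero_le_power2 zero_less_one)
qed

lemma frame_expansion:
  assumes bl: "bilinear b" and e: "orthonormal_frame b e"
  shows "v = (\<Sum>i\<in>UNIV. b v (e i) *\<^sub>R e i)"
proof -
  have "det (matrix (frame_map e)) \<noteq> 0" using orthonormal_frame_det[OF assms] by auto
  then have "surj (frame_map e)"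
    using det_nz_iff_inj[OF linear_frame_map] linear_injective_imp_surjective[OF linear_frame_map] by blast
  then obtain x where x: "v = frame_map e x" by blast
  have "b v (e j) = x $ j" for j
  proof -
    have lin: "linear (\<lambda>x. b x (e j))" using bl by (simp add: bilinear_def)
    have "b v (e j) = (\<Sum>i\<in>UNIV. if i = j then x $ i else 0)"
      unfolding x frame_map_def linear_sum[OF lin] linear_cmul[OF lin]
      using e by (intro sum.cong) (auto simp: orthonormal_frame_def)
    then show ?thesis by simp
  qed
  then show ?thesis by (simp add: x frame_map_def)
qed

lemma riesz_frame:
  assumes bl: "bilinear b" "posdef b" and sym: "\<And>u v. b u v = b v u" and e: "orthonormal_frame b e" and f: "linear f"
  shows "riesz b f = (\<Sum>i\<in>UNIV. f (e i) *\<^sub>R e i)"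
proof (rule riesz_eqI[OF bl])
  fix w
  have lin: "linear (\<lambda>x. b x w)" using bl by (simp add: bilinear_def)
  have "f w = (\<Sum>i\<in>UNIV. b w (e i) * f (e i))"
    by (subst frame_expansion[OF bl(1) e, of w]) (simp add: linear_sum[OF f] linear_cmul[OF f])
  then show "b (\<Sum>i\<in>UNIV. f (e i) *\<^sub>R e i) w = f w"
    unfolding linear_sum[OF lin] linear_cmul[OF lin] by (simp add: sym[of _ w] mult.commute)
qed

section \<open>Integration over a compact Riemannian manifold\<close>

text \<open>Coordinate expression of a field of bilinear forms; it serves for both metrics and,
  through \<open>chart_form2\<close>, for 2-forms.\<close>

definition chart_bilinear ::
  "('a, 'm::finite) chart set \<Rightarrow> ('a, 'm) chart \<Rightarrow> ('a \<Rightarrow> real ^ 'm \<Rightarrow> real ^ 'm \<Rightarrow> real)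
   \<Rightarrow> real ^ 'm \<Rightarrow> real ^ 'm \<Rightarrow> real ^ 'm \<Rightarrow> real"
where
  "chart_bilinear A c b y u v =
     b (chart_inv c y) (from_chart A c (chart_inv c y) u) (from_chart A c (chart_inv c y) v)"

lemma from_chart_change:
  assumes "atlas A" "c \<in> A" "c' \<in> A" "y \<in> overlap c c'"
  shows "from_chart A c (chart_inv c y) u
    = from_chart A c' (chart_inv c' (coord_change c c' y)) (dd (coord_change c c') y u)"
proof -
  note ch = atlasD(1)[OF assms(1,2)] atlasD(1)[OF assms(1,3)]
  have y: "y \<in> chart_img c" "chart_inv c y \<in> chart_dom c" "chart_inv c y \<in> chart_dom c'"
    using assms(4) is_chartD[OF ch(1)] by (auto simp: overlap_eq[OF ch(1)])
  have "from_chart A c' (chart_inv c y) (coord_D c c' (chart_inv c y) u) = from_chart A c (chart_inv c y) u"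
    by (rule from_to_chart(7)[OF assms(1,2) y(2) assms(3) y(3)])
  then show ?thesis
    unfolding coord_change_inv[OF ch assms(4)] coord_D_def is_chartD(7)[OF ch(1) y(1)] by simp
qed

lemma chart_bilinear_change:
  assumes "atlas A" "c \<in> A" "c' \<in> A" "y \<in> overlap c c'"
  shows "chart_bilinear A c b y u v
    = chart_bilinear A c' b (coord_change c c' y) (dd (coord_change c c') y u) (dd (coord_change c c') y v)"
  using from_chart_change[OF assms]
    coord_change_inv[OF atlasD(1)[OF assms(1,2)] atlasD(1)[OF assms(1,3)] assms(4)]
  unfolding chart_bilinear_def by simp

lemma bilinear_compose_linear:
  "bilinear b \<Longrightarrow> linear L \<Longrightarrow> bilinear (\<lambda>u v. b (L u) (L v))"
  unfolding bilinear_def using linear_compose[of L] by (auto simp: o_def)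

lemma chart_metric:
  assumes A: "atlas A" and g: "riemannian_metric A g" and c: "c \<in> A"
  shows "smooth_bilinear (chart_img c) (chart_bilinear A c g)"
    "chart_bilinear A c g y u v = chart_bilinear A c g y v u"
    "y \<in> chart_img c \<Longrightarrow> posdef (chart_bilinear A c g y)"
proof -
  note C = is_chartD[OF atlasD(1)[OF A c]]
  have g': "bilinear (g p)" "posdef (g p)" "g p u v = g p v u" for p u v
    using g by (auto simp: riemannian_metric_def posdef_def)
  have lin: "linear (from_chart A c (chart_inv c y))" if "y \<in> chart_img c" for y
    using from_to_chart(1)[OF A c C(8)[OF that]] .
  show "smooth_bilinear (chart_img c) (chart_bilinear A c g)"
    unfolding smooth_bilinear_def
  proof (intro conjI ballI allI C(2))
    show "bilinear (chart_bilinear A c g y)" if "y \<in> chart_img c" for y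
      using bilinear_compose_linear[OF g'(1) lin[OF that], of "chart_inv c y"]
      unfolding chart_bilinear_def[abs_def] .
    show "smooth_on (chart_img c) (\<lambda>y. chart_bilinear A c g y u v)" for u v
      using g c unfolding chart_bilinear_def riemannian_metric_def by blast
  qed
  show "chart_bilinear A c g y u v = chart_bilinear A c g y v u" unfolding chart_bilinear_def by (rule g')
  show "posdef (chart_bilinear A c g y)" if y: "y \<in> chart_img c"
    unfolding posdef_def chart_bilinear_def
  proof (intro allI impI)
    fix v :: "real ^ 'b" assume "v \<noteq> 0"
    then have "from_chart A c (chart_inv c y) v \<noteq> 0"
      using from_to_chart(3)[OF A c C(8)[OF y], of v] linear_0[OF from_to_chart(2)[OF A c C(8)[OF y]]] by metis
    then show "0 < g (chart_inv c y) (from_chart A c (chart_inv c y) v) (from_chart A c (chart_inv c y) v)"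
      using g'(2) by (simp add: posdef_def)
  qed
qed

locale compact_riemannian =
  fixes A :: "('a::t2_space, 'm::finite) chart set" and g :: "'a \<Rightarrow> real ^ 'm \<Rightarrow> real ^ 'm \<Rightarrow> real"
  assumes compact_M: "compact (UNIV :: 'a set)" and atlas_A: "atlas A" and metric_g: "riemannian_metric A g"
begin

abbreviation gc where "gc c \<equiv> chart_bilinear A c g"

lemma chart_A: "c \<in> A \<Longrightarrow> is_chart c" by (rule atlasD(1)[OF atlas_A])

lemma gc_bilinear: "c \<in> A \<Longrightarrow> y \<in> chart_img c \<Longrightarrow> bilinear (gc c y)"
  using chart_metric(1)[OF atlas_A metric_g] by (auto simp: smooth_bilinear_def)

lemma g_metric: "bilinear (g p)" "posdef (g p)" "g p u v = g p v u"
  using metric_g by (auto simp: riemannian_metric_def posdef_def)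

definition vol :: "('a, 'm) chart \<Rightarrow> real ^ 'm \<Rightarrow> real" where
  "vol c y = sqrt (det (gram (gc c y)))"

lemma volume_coeff: "volume_coeff A g c (chart_inv c y) = vol c y"
proof -
  have "(\<chi> i j. g (chart_inv c y) (from_chart A c (chart_inv c y) (axis i 1)) (from_chart A c (chart_inv c y) (axis j 1)))
    = gram (gc c y)"
    unfolding gram_def chart_bilinear_def vec_eq_iff vec_lambda_beta using g_metric(3) by blast
  then show ?thesis unfolding volume_coeff_def vol_def by simp
qed

lemma det_gc_pos: "c \<in> A \<Longrightarrow> y \<in> chart_img c \<Longrightarrow> 0 < det (gram (gc c y))"
  by (rule gram_det_pos[OF gc_bilinear chart_metric(2,3)[OF atlas_A metric_g]])

lemma vol_pos: "c \<in> A \<Longrightarrow> y \<in> chart_img c \<Longrightarrow> 0 < vol c y"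
  unfolding vol_def using det_gc_pos by simp

lemma smooth_vol: assumes "c \<in> A" shows "smooth_on (chart_img c) (vol c)"
proof -
  have "smooth_on (chart_img c) (\<lambda>y. gram (gc c y) $ i $ j)" for i j
    using chart_metric(1)[OF atlas_A metric_g assms] by (simp add: gram_def smooth_bilinear_def)
  then have "smooth_on (chart_img c) (\<lambda>y. det (gram (gc c y)))"
    by (intro smooth_on_det is_chartD(2)[OF chart_A[OF assms]])
  from smooth_on_sqrt[OF is_chartD(2)[OF chart_A[OF assms]] this det_gc_pos[OF assms]]
  show ?thesis unfolding vol_def[abs_def] .
qed

lemma vol_change:
  assumes "c \<in> A" "c' \<in> A" "y \<in> overlap c c'"
  shows "vol c y = \<bar>det (matrix (dd (coord_change c c') y))\<bar> * vol c' (coord_change c c' y)"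
proof -
  let ?z = "coord_change c c' y"
  have sb: "smooth_between (overlap c c') (overlap c' c) (coord_change c c')"
    by (rule smooth_between_coord_change[OF chart_A chart_A atlasD(2)[OF atlas_A]]) (use assms in auto)
  have z: "?z \<in> chart_img c'" using sb assms(3) overlap_eq[OF chart_A[OF assms(2)], of c]
    by (auto simp: smooth_between_def)
  have lin: "linear (dd (coord_change c c') y)"
    using sb assms(3) by (auto simp: smooth_between_def intro: dd_linear smooth_on_differentiable)
  have "gc c y = (\<lambda>u v. gc c' ?z (dd (coord_change c c') y u) (dd (coord_change c c') y v))"
    using chart_bilinear_change[OF atlas_A assms] by blast
  then show ?thesis unfolding vol_def
    using det_gram_linear[OF gc_bilinear[OF assms(2) z] lin] by (simp add: real_sqrt_mult)
qed

definition chart_integral :: "('a, 'm) chart \<Rightarrow> ('a \<Rightarrow> real) \<Rightarrow> real" where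
  "chart_integral c f = (LINT y:chart_img c|lborel. f (chart_inv c y) * vol c y)"

lemma chart_image_compact:
  assumes "c \<in> A" "closed K" "K \<subseteq> chart_dom c"
  shows "compact (chart_map c ` K)" "chart_map c ` K \<subseteq> chart_img c"
proof -
  have "compact K" using compact_Int_closed[OF compact_M assms(2)] by simp
  then show "compact (chart_map c ` K)"
    by (intro compact_continuous_image continuous_on_subset[OF is_chartD(3)[OF chart_A[OF assms(1)]] assms(3)])
  show "chart_map c ` K \<subseteq> chart_img c" using assms(3) by (auto simp: chart_img_def)
qed

lemma chart_off_support:
  assumes "c \<in> A" "y \<in> chart_img c - chart_map c ` K" shows "chart_inv c y \<notin> K"
  using assms is_chartD(7)[OF chart_A[OF assms(1)], of y] by force

lemma continuous_chart_integrand: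
  assumes "c \<in> A" "continuous_on UNIV f"
  shows "continuous_on (chart_img c) (\<lambda>y. f (chart_inv c y) * vol c y)"
  by (intro continuous_on_mult smooth_on_continuous[OF smooth_vol[OF assms(1)]]
      continuous_on_compose2[OF assms(2) is_chartD(4)[OF chart_A[OF assms(1)]]]) auto

lemma chart_integrable:
  assumes "c \<in> A" "continuous_on UNIV f" "closed K" "K \<subseteq> chart_dom c" "\<And>p. p \<notin> K \<Longrightarrow> f p = 0"
  shows "set_integrable lborel (chart_img c) (\<lambda>y. f (chart_inv c y) * vol c y)"
  by (rule compact_support_set_integrable[OF is_chartD(2)[OF chart_A[OF assms(1)]] chart_image_compact[OF assms(1,3,4)]
        continuous_chart_integrand[OF assms(1,2)]])
     (use chart_off_support[OF assms(1)] assms(5) in auto)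

text \<open>The factor produced by the change of variables is exactly the one by which the volume
  coefficient transforms in \<open>vol_change\<close>. Both integrals may first be restricted to the
  overlap, as \<open>f\<close> vanishes outside \<open>K\<close>.\<close>

lemma chart_integral_change:
  assumes c: "c \<in> A" "c' \<in> A" and f: "continuous_on UNIV f"
    and K: "closed K" "K \<subseteq> chart_dom c" "K \<subseteq> chart_dom c'" "\<And>p. p \<notin> K \<Longrightarrow> f p = 0"
  shows "chart_integral c f = chart_integral c' f"
proof -
  let ?\<tau> = "coord_change c c'" and ?S = "overlap c c'" and ?S' = "overlap c' c"
  note ch = chart_A[OF c(1)] chart_A[OF c(2)] and st = atlasD(2)[OF atlas_A]
  have sb: "smooth_between ?S ?S' ?\<tau>" "smooth_between ?S' ?S (coord_change c' c)"
    by (intro smooth_between_coord_change ch st c)+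
  have inv: "coord_change c' c (?\<tau> y) = y" if "y \<in> ?S" for y
    using that is_chartD[OF ch(1)] is_chartD[OF ch(2)] by (auto simp: overlap_eq[OF ch(1)] coord_change_def)
  have inv': "?\<tau> (coord_change c' c z) = z" if "z \<in> ?S'" for z
    using that is_chartD[OF ch(1)] is_chartD[OF ch(2)] by (auto simp: overlap_eq[OF ch(2)] coord_change_def)
  have img: "?\<tau> ` ?S = ?S'"
    using sb inv' unfolding smooth_between_def by (auto intro!: image_eqI[of _ ?\<tau> "coord_change c' c _"])
  let ?F = "\<lambda>c y. f (chart_inv c y) * vol c y"
  have restr: "(LINT y:chart_img c|lborel. ?F c y) = (LINT y:overlap c c'|lborel. ?F c y)"
    if "c \<in> A" "K \<subseteq> chart_dom c'" for c c'
  proof -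
    have "(if y \<in> chart_img c then ?F c y else 0) = (if y \<in> overlap c c' then ?F c y else 0)" for y
      using that K(4) overlap_eq[OF chart_A[OF that(1)], of c'] by auto
    then show ?thesis unfolding set_integral_zero_extension by simp
  qed
  have "(LINT z:?\<tau> ` ?S|lborel. ?F c' z) = (LINT y:?S|lborel. \<bar>det (matrix (dd ?\<tau> y))\<bar> * ?F c' (?\<tau> y))"
  proof (rule change_of_variables_compact_support[where K = "chart_map c' ` K" and L = "chart_map c ` K"])
    show "open ?S" "open (?\<tau> ` ?S)" using sb unfolding img by (simp_all add: smooth_between_def)
    show "inj_on ?\<tau> ?S" using inv by (metis inj_onI)
    show "(?\<tau> has_derivative dd ?\<tau> y) (at y)" if "y \<in> ?S" for y
      using sb(1) that by (auto simp: smooth_between_def intro: smooth_on_has_derivative)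
    show "continuous_on (?\<tau> ` ?S) (?F c')" unfolding img
      by (rule continuous_on_subset[OF continuous_chart_integrand[OF c(2) f]]) (auto simp: overlap_eq[OF ch(2)])
    show "compact (chart_map c' ` K)" "compact (chart_map c ` K)" using chart_image_compact c K by auto
    show "chart_map c' ` K \<subseteq> ?\<tau> ` ?S" unfolding img using K by (auto simp: overlap_def)
    show "chart_map c ` K \<subseteq> ?S" using K by (auto simp: overlap_def)
    show "?F c' z = 0" if "z \<in> ?\<tau> ` ?S - chart_map c' ` K" for z
      using that K(4) chart_off_support[OF c(2), of z K] unfolding img by (auto simp: overlap_eq[OF ch(2)])
    have e: "\<bar>det (matrix (dd ?\<tau> y))\<bar> * ?F c' (?\<tau> y) = ?F c y" if "y \<in> ?S" for y
      using vol_change[OF c that] coord_change_inv[OF ch that] by simp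
    have "continuous_on ?S (?F c)"
      by (rule continuous_on_subset[OF continuous_chart_integrand[OF c(1) f]]) (auto simp: overlap_eq[OF ch(1)])
    then show "continuous_on ?S (\<lambda>y. \<bar>det (matrix (dd ?\<tau> y))\<bar> * ?F c' (?\<tau> y))"
      by (rule continuous_on_eq) (simp add: e)
    show "?F c' (?\<tau> y) = 0" if "y \<in> ?S - chart_map c ` K" for y
      using that K(4) chart_off_support[OF c(1), of y K] coord_change_inv[OF ch, of y]
      by (auto simp: overlap_eq[OF ch(1)])
  qed
  also have "\<dots> = (LINT y:?S|lborel. ?F c y)"
    unfolding set_integral_zero_extension using vol_change[OF c] coord_change_inv[OF ch]
    by (intro Bochner_Integration.integral_cong) auto
  finally show ?thesis
    unfolding chart_integral_def img restr[OF c(1) K(3)] restr[OF c(2) K(2)] by simp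
qed

section \<open>Independence of the partition of unity, linearity and positivity of the
  integral\<close>

definition pou :: "nat \<Rightarrow> (nat \<Rightarrow> ('a, 'm) chart) \<Rightarrow> (nat \<Rightarrow> 'a \<Rightarrow> real) \<Rightarrow> bool" where
  "pou = partition_of_unity A"

definition msupp :: "('a \<Rightarrow> real) \<Rightarrow> 'a set" where "msupp f = closure {p. f p \<noteq> 0}"

lemma pouD:
  assumes "pou n \<kappa> \<rho>" "i < n"
  shows "\<kappa> i \<in> A" "0 \<le> \<rho> i p" "smooth_fun A (\<rho> i)" "continuous_on UNIV (\<rho> i)"
    "closed (msupp (\<rho> i))" "msupp (\<rho> i) \<subseteq> chart_dom (\<kappa> i)" "p \<notin> msupp (\<rho> i) \<Longrightarrow> \<rho> i p = 0"
proof -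
  show "\<kappa> i \<in> A" "0 \<le> \<rho> i p" "msupp (\<rho> i) \<subseteq> chart_dom (\<kappa> i)" and s: "smooth_fun A (\<rho> i)"
    using assms unfolding pou_def partition_of_unity_def smooth_fun_def msupp_def by (auto simp: o_def)
  show "continuous_on UNIV (\<rho> i)" by (rule smooth_fun_continuous[OF atlas_A s])
  show "closed (msupp (\<rho> i))" by (simp add: msupp_def)
  show "p \<notin> msupp (\<rho> i) \<Longrightarrow> \<rho> i p = 0"
    unfolding msupp_def using closure_subset[of "{p. \<rho> i p \<noteq> 0}"] by blast
qed

lemma pou_sum: "pou n \<kappa> \<rho> \<Longrightarrow> (\<Sum>i<n. \<rho> i p) = 1"
  unfolding pou_def partition_of_unity_def by blast

lemma pou_exists: obtains n \<kappa> \<rho> where "pou n \<kappa> \<rho>"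
  unfolding pou_def using partition_of_unity_exists[OF compact_M atlas_A, of "\<lambda>_. UNIV"] by (metis UNIV_I open_UNIV)

lemma chart_integral_sum:
  assumes "c \<in> A" "closed K" "K \<subseteq> chart_dom c" "\<And>i. i \<in> I \<Longrightarrow> continuous_on UNIV (f i)"
    "\<And>i p. i \<in> I \<Longrightarrow> p \<notin> K \<Longrightarrow> f i p = 0"
  shows "chart_integral c (\<lambda>p. \<Sum>i\<in>I. f i p) = (\<Sum>i\<in>I. chart_integral c (f i))"
proof -
  have "integrable lborel (\<lambda>y. indicator (chart_img c) y *\<^sub>R (f i (chart_inv c y) * vol c y))" if "i \<in> I" for i
    using chart_integrable[OF assms(1) assms(4)[OF that] assms(2,3) assms(5)[OF that]] by (simp add: set_integrable_def)
  then show ?thesis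
    unfolding chart_integral_def set_lebesgue_integral_def sum_distrib_right scaleR_sum_right
    by (rule Bochner_Integration.integral_sum)
qed

text \<open>Each product is supported in both charts, so it may be integrated in \<open>c\<close>;
  there the weights add up to 1.\<close>

lemma pou_chart_integral:
  assumes p: "pou n \<kappa> \<rho>" and c: "c \<in> A" and f: "continuous_on UNIV f"
    and K: "closed K" "K \<subseteq> chart_dom c" "\<And>p. p \<notin> K \<Longrightarrow> f p = 0"
  shows "(\<Sum>i<n. chart_integral (\<kappa> i) (\<lambda>p. \<rho> i p * f p)) = chart_integral c f"
proof -
  have "chart_integral (\<kappa> i) (\<lambda>p. \<rho> i p * f p) = chart_integral c (\<lambda>p. \<rho> i p * f p)" if "i < n" for i
  proof (rule chart_integral_change[OF pouD(1)[OF p that] c, where K = "K \<inter> msupp (\<rho> i)"])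
    show "continuous_on UNIV (\<lambda>p. \<rho> i p * f p)" by (intro continuous_on_mult f pouD(4)[OF p that])
    show "K \<inter> msupp (\<rho> i) \<subseteq> chart_dom (\<kappa> i)" using pouD(6)[OF p that] by blast
    show "\<rho> i q * f q = 0" if "q \<notin> K \<inter> msupp (\<rho> i)" for q
      using that K(3)[of q] pouD(7)[OF p \<open>i < n\<close>, of q] by fastforce
    show "closed (K \<inter> msupp (\<rho> i))" by (intro closed_Int K pouD(5)[OF p that])
  qed (use K in auto)
  then have "(\<Sum>i<n. chart_integral (\<kappa> i) (\<lambda>p. \<rho> i p * f p)) = (\<Sum>i<n. chart_integral c (\<lambda>p. \<rho> i p * f p))" by simp
  also have "\<dots> = chart_integral c (\<lambda>p. \<Sum>i<n. \<rho> i p * f p)"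
    by (rule chart_integral_sum[symmetric, OF c K(1,2)]) (use pouD(4)[OF p] f K(3) in \<open>auto intro: continuous_on_mult\<close>)
  finally show ?thesis by (simp add: sum_distrib_right[symmetric] pou_sum[OF p])
qed

text \<open>Both sides equal the double sum over products of members of the two partitions.\<close>

lemma pou_independent:
  assumes p: "pou n \<kappa> \<rho>" "pou n' \<kappa>' \<rho>'" and f: "continuous_on UNIV f"
  shows "(\<Sum>i<n. chart_integral (\<kappa> i) (\<lambda>p. \<rho> i p * f p)) = (\<Sum>j<n'. chart_integral (\<kappa>' j) (\<lambda>p. \<rho>' j p * f p))"
proof -
  have 1: "chart_integral (\<kappa> i) (\<lambda>p. \<rho> i p * f p) = (\<Sum>j<n'. chart_integral (\<kappa>' j) (\<lambda>p. \<rho>' j p * (\<rho> i p * f p)))" if "i < n" for i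
    by (rule pou_chart_integral[symmetric, OF p(2) pouD(1)[OF p(1) that] _ pouD(5,6)[OF p(1) that]])
       (use pouD(4,7)[OF p(1) that] f in \<open>auto intro: continuous_on_mult\<close>)
  have 2: "chart_integral (\<kappa>' j) (\<lambda>p. \<rho>' j p * f p) = (\<Sum>i<n. chart_integral (\<kappa>' j) (\<lambda>p. \<rho>' j p * (\<rho> i p * f p)))" if "j < n'" for j
  proof -
    have "chart_integral (\<kappa>' j) (\<lambda>p. \<Sum>i<n. \<rho>' j p * (\<rho> i p * f p)) = (\<Sum>i<n. chart_integral (\<kappa>' j) (\<lambda>p. \<rho>' j p * (\<rho> i p * f p)))"
      by (rule chart_integral_sum[OF pouD(1,5,6)[OF p(2) that]])
         (use pouD(7)[OF p(2) that] continuous_on_mult[OF pouD(4)[OF p(2) that] continuous_on_mult[OF pouD(4)[OF p(1)] f]] in auto)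
    then show ?thesis
      by (simp add: sum_distrib_right[symmetric] sum_distrib_left[symmetric] pou_sum[OF p(1)])
  qed
  show ?thesis using 1 2 by simp (rule sum.swap)
qed

text \<open>Justifies the definite description in \<open>vol_integral\<close>: independence gives
  existence, and the given partition pins the value down.\<close>

lemma vol_integral_eq:
  assumes p: "pou n \<kappa> \<rho>" and f: "continuous_on UNIV f"
  shows "vol_integral A g f = (\<Sum>i<n. chart_integral (\<kappa> i) (\<lambda>p. \<rho> i p * f p))"
  unfolding vol_integral_def volume_coeff chart_integral_def[symmetric] 
proof (rule the_equality)
  have "(\<Sum>i<n'. LINT y:chart_img (\<kappa>' i)|lborel. \<rho>' i (chart_inv (\<kappa>' i) y) * f (chart_inv (\<kappa>' i) y) * vol (\<kappa>' i) y)
     = (\<Sum>i<n'. chart_integral (\<kappa>' i) (\<lambda>p. \<rho>' i p * f p))" for n' \<kappa>' \<rho>'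
    unfolding chart_integral_def ..
  note e = this
  show "\<forall>n' \<kappa>' \<rho>'. partition_of_unity A n' \<kappa>' \<rho>' \<longrightarrow> (\<Sum>i<n. chart_integral (\<kappa> i) (\<lambda>p. \<rho> i p * f p)) =
     (\<Sum>i<n'. LINT y:chart_img (\<kappa>' i)|lborel. \<rho>' i (chart_inv (\<kappa>' i) y) * f (chart_inv (\<kappa>' i) y) * vol (\<kappa>' i) y)"
    unfolding e using pou_independent[OF p _ f] unfolding pou_def by blast
  fix r
  assume "\<forall>n \<kappa> \<rho>. partition_of_unity A n \<kappa> \<rho> \<longrightarrow> r =
     (\<Sum>i<n. LINT y:chart_img (\<kappa> i)|lborel. \<rho> i (chart_inv (\<kappa> i) y) * f (chart_inv (\<kappa> i) y) * vol (\<kappa> i) y)"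
  then show "r = (\<Sum>i<n. chart_integral (\<kappa> i) (\<lambda>p. \<rho> i p * f p))"
    unfolding e using p unfolding pou_def by blast
qed

lemma vol_integral_chart:
  assumes "c \<in> A" "continuous_on UNIV f" "closed K" "K \<subseteq> chart_dom c" "\<And>p. p \<notin> K \<Longrightarrow> f p = 0"
  shows "vol_integral A g f = chart_integral c f"
proof -
  obtain n \<kappa> \<rho> where p: "pou n \<kappa> \<rho>" by (rule pou_exists)
  show ?thesis unfolding vol_integral_eq[OF p assms(2)] by (rule pou_chart_integral[OF p assms])
qed

lemma vol_integral_sum:
  assumes "\<And>i. i \<in> I \<Longrightarrow> continuous_on UNIV (f i)"
  shows "vol_integral A g (\<lambda>p. \<Sum>i\<in>I. f i p) = (\<Sum>i\<in>I. vol_integral A g (f i))"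
proof -
  obtain n \<kappa> \<rho> where p: "pou n \<kappa> \<rho>" by (rule pou_exists)
  have "vol_integral A g (\<lambda>p. \<Sum>i\<in>I. f i p) = (\<Sum>j<n. chart_integral (\<kappa> j) (\<lambda>p. \<Sum>i\<in>I. \<rho> j p * f i p))"
    unfolding sum_distrib_left[symmetric] by (rule vol_integral_eq[OF p]) (use assms in \<open>auto intro: continuous_on_sum\<close>)
  also have "\<dots> = (\<Sum>j<n. \<Sum>i\<in>I. chart_integral (\<kappa> j) (\<lambda>p. \<rho> j p * f i p))"
  proof (intro sum.cong refl)
    fix j assume "j \<in> {..<n}"
    then have j: "j < n" by simp
    show "chart_integral (\<kappa> j) (\<lambda>p. \<Sum>i\<in>I. \<rho> j p * f i p) = (\<Sum>i\<in>I. chart_integral (\<kappa> j) (\<lambda>p. \<rho> j p * f i p))"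
      by (rule chart_integral_sum[OF pouD(1,5,6)[OF p j]])
         (use pouD(4,7)[OF p j] assms in \<open>auto intro: continuous_on_mult\<close>)
  qed
  also have "\<dots> = (\<Sum>i\<in>I. \<Sum>j<n. chart_integral (\<kappa> j) (\<lambda>p. \<rho> j p * f i p))" by (rule sum.swap)
  also have "\<dots> = (\<Sum>i\<in>I. vol_integral A g (f i))"
    using vol_integral_eq[OF p assms] by simp
  finally show ?thesis .
qed

lemma vol_integral_cmult:
  assumes "continuous_on UNIV f"
  shows "vol_integral A g (\<lambda>p. a * f p) = a * vol_integral A g f"
proof -
  obtain n \<kappa> \<rho> where p: "pou n \<kappa> \<rho>" by (rule pou_exists)
  have "chart_integral c (\<lambda>p. \<rho> i p * (a * f p)) = a * chart_integral c (\<lambda>p. \<rho> i p * f p)" for c i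
    unfolding chart_integral_def set_integral_mult_right[symmetric] by (simp add: mult_ac)
  then show ?thesis
    unfolding vol_integral_eq[OF p assms]
    by (subst vol_integral_eq[OF p]) (auto intro: continuous_on_mult continuous_on_const assms simp: sum_distrib_left)
qed

lemma vol_integral_add:
  assumes "continuous_on UNIV f" "continuous_on UNIV f'"
  shows "vol_integral A g (\<lambda>p. f p + f' p) = vol_integral A g f + vol_integral A g f'"
  using vol_integral_sum[of "{True, False}" "\<lambda>b. if b then f else f'"] assms by simp

text \<open>Makes the inner product on smooth 1-forms definite, hence the codifferential unique.
  Each chart integral is nonnegative, so each one vanishes, and a nonnegative continuous function on
  a box with zero integral is zero.\<close>

lemma vol_integral_pos:
  assumes f: "continuous_on UNIV f" "\<And>p. 0 \<le> f p" and z: "vol_integral A g f = 0"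
  shows "f p = 0"
proof -
  obtain n \<kappa> \<rho> where P: "pou n \<kappa> \<rho>" by (rule pou_exists)
  let ?F = "\<lambda>i y. \<rho> i (chart_inv (\<kappa> i) y) * f (chart_inv (\<kappa> i) y) * vol (\<kappa> i) y"
  have nn: "0 \<le> ?F i y" if "i < n" "y \<in> chart_img (\<kappa> i)" for i y
    by (intro mult_nonneg_nonneg pouD(2)[OF P that(1)] f(2) less_imp_le[OF vol_pos[OF pouD(1)[OF P that(1)] that(2)]])
  have "0 \<le> chart_integral (\<kappa> i) (\<lambda>p. \<rho> i p * f p)" if "i < n" for i
    unfolding chart_integral_def set_integral_zero_extension
    by (rule Bochner_Integration.integral_nonneg) (use nn that in auto)
  then have 0: "chart_integral (\<kappa> i) (\<lambda>p. \<rho> i p * f p) = 0" if "i < n" for i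
    using z that unfolding vol_integral_eq[OF P f(1)] by (subst (asm) sum_nonneg_eq_0_iff) auto
  have *: "\<rho> i p * f p = 0" if i: "i < n" for i
  proof (rule ccontr)
    assume ne: "\<rho> i p * f p \<noteq> 0"
    define K where "K = msupp (\<rho> i)"
    have pK: "p \<in> K" using ne pouD(7)[OF P i, of p] unfolding K_def by auto
    note k = pouD[OF P i, folded K_def]
    note ch = chart_A[OF k(1)]
    define G where "G y = (if y \<in> chart_img (\<kappa> i) then ?F i y else 0)" for y
    have G: "continuous_on UNIV G" unfolding G_def
      by (rule continuous_on_zero_extension'[OF is_chartD(2)[OF ch] compact_imp_closed[OF chart_image_compact(1)[OF k(1,5,6)]]
            chart_image_compact(2)[OF k(1,5,6)] continuous_chart_integrand[OF k(1)]])
         (use k f chart_off_support[OF k(1)] in \<open>auto intro: continuous_on_mult\<close>)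
    obtain a where a: "chart_map (\<kappa> i) ` K \<subseteq> cbox (-a) a" "box (-a) a \<noteq> {}"
    proof -
      \<comment> \<open>The unit ball is added only to make the interior of the box nonempty, as
        \<open>integral_cbox_eq_0_iff\<close> requires.\<close>
      obtain a where a: "chart_map (\<kappa> i) ` K \<union> ball 0 1 \<subseteq> cbox (-a) a"
        using bounded_subset_cbox_symmetric[of "chart_map (\<kappa> i) ` K \<union> ball 0 1"]
          compact_imp_bounded[OF chart_image_compact(1)[OF k(1,5,6)]] by auto
      then have "ball 0 1 \<subseteq> box (-a) a" using interior_maximal[of "ball 0 1" "cbox (-a) a"] by (simp add: interior_cbox)
      then have "0 \<in> box (-a) a" by (rule subsetD) simp
      then have "box (-a) a \<noteq> {}" by blast
      then show thesis using that a by blast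
    qed
    have out: "G y = 0" if "y \<notin> cbox (-a) a" for y
      using that a(1) chart_off_support[OF k(1), of y K] k(7) unfolding G_def by force
    have "integral (cbox (-a) a) G = 0"
      using compact_support_integral_cbox[OF G out] 0[OF i]
      unfolding chart_integral_def set_integral_zero_extension G_def by simp
    then have "\<forall>y\<in>cbox (-a) a. G y = 0"
      using integral_cbox_eq_0_iff[OF continuous_on_subset[OF G] a(2)] nn[OF i] unfolding G_def by auto
    moreover have "chart_map (\<kappa> i) p \<in> cbox (-a) a" using pK a(1) by blast
    moreover have pd: "p \<in> chart_dom (\<kappa> i)" using pK k(6) by blast
    ultimately have "\<rho> i p * f p * vol (\<kappa> i) (chart_map (\<kappa> i) p) = 0"
      using is_chartD(5,6)[OF ch pd] unfolding G_def by auto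
    then show False using ne vol_pos[OF k(1) is_chartD(6)[OF ch pd]] by simp
  qed
  have "(\<Sum>i<n. \<rho> i p) * f p = 0" unfolding sum_distrib_right by (rule sum.neutral) (use * in blast)
  then show ?thesis using pou_sum[OF P] by simp
qed

end

section \<open>Differential forms of degree one and two\<close>

definition chart_form1 ::
  "('a, 'm::finite) chart set \<Rightarrow> ('a, 'm) chart \<Rightarrow> ('a, 'm) form \<Rightarrow> real ^ 'm \<Rightarrow> real ^ 'm \<Rightarrow> real"
where
  "chart_form1 A c \<alpha> y u = \<alpha> (chart_inv c y) [from_chart A c (chart_inv c y) u]"

definition chart_form2 ::
  "('a, 'm::finite) chart set \<Rightarrow> ('a, 'm) chart \<Rightarrow> ('a, 'm) form \<Rightarrow> real ^ 'm \<Rightarrow> real ^ 'm \<Rightarrow> real ^ 'm \<Rightarrow> real"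
where
  "chart_form2 A c \<alpha> = chart_bilinear A c (\<lambda>q u v. \<alpha> q [u, v])"

lemma chart_form2_eq:
  "chart_form2 A c \<alpha> y u v = \<alpha> (chart_inv c y) [from_chart A c (chart_inv c y) u, from_chart A c (chart_inv c y) v]"
  by (simp add: chart_form2_def chart_bilinear_def)

lemma chart_form1_change:
  assumes "atlas A" "c \<in> A" "c' \<in> A" "y \<in> overlap c c'"
  shows "chart_form1 A c \<alpha> y u = chart_form1 A c' \<alpha> (coord_change c c' y) (dd (coord_change c c') y u)"
  using from_chart_change[OF assms]
    coord_change_inv[OF atlasD(1)[OF assms(1,2)] atlasD(1)[OF assms(1,3)] assms(4)]
  unfolding chart_form1_def by simp

lemma list_split_1: "Suc (length us + length ws) = 1 \<longleftrightarrow> us = [] \<and> ws = []"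
  by auto

lemma list_split_2:
  "Suc (length us + length ws) = 2 \<longleftrightarrow> (\<exists>w. us = [] \<and> ws = [w]) \<or> (\<exists>u. us = [u] \<and> ws = [])"
  by (cases us; cases ws) auto

lemma length_2_conv: "length us = 2 \<longleftrightarrow> (\<exists>u v. us = [u, v])"
  by (auto simp: numeral_2_eq_2 length_Suc_conv)

lemma linear_chart_form1:
  assumes "atlas A" "c \<in> A" "y \<in> chart_img c" "\<And>p. linear (\<lambda>v. \<alpha> p [v])"
  shows "linear (chart_form1 A c \<alpha> y)"
  using linear_compose[OF from_to_chart(1)[OF assms(1,2)] assms(4)]
    is_chartD(8)[OF atlasD(1)[OF assms(1,2)] assms(3)]
  unfolding chart_form1_def o_def by blast

lemma bilinear_chart_bilinear:
  assumes "atlas A" "c \<in> A" "y \<in> chart_img c" "\<And>p. bilinear (b p)"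
  shows "bilinear (chart_bilinear A c b y)"
  using bilinear_compose_linear[OF assms(4) from_to_chart(1)[OF assms(1,2)], of "chart_inv c y" "chart_inv c y"]
    is_chartD(8)[OF atlasD(1)[OF assms(1,2)] assms(3)]
  unfolding chart_bilinear_def[abs_def] by blast

lemma smooth_form1I:
  assumes "atlas A" "\<And>p vs. length vs \<noteq> 1 \<Longrightarrow> \<alpha> p vs = 0" "\<And>p. linear (\<lambda>v. \<alpha> p [v])"
    "\<And>c u. c \<in> A \<Longrightarrow> smooth_on (chart_img c) (\<lambda>y. chart_form1 A c \<alpha> y u)"
  shows "smooth_form A 1 \<alpha>"
  unfolding smooth_form_def list_split_1
proof (intro conjI allI impI ballI)
  show "linear (\<lambda>v. \<alpha> p (us @ v # ws))" if "us = [] \<and> ws = []" for p us ws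
    using that assms(3) by simp
  show "\<alpha> p vs = 0" if "length vs = 1 \<and> \<not> distinct vs" for p vs
    using that by (auto simp: length_Suc_conv)
  show "smooth_on (chart_img c) (\<lambda>y. \<alpha> (chart_inv c y) (map (from_chart A c (chart_inv c y)) us))"
    if c: "c \<in> A" and us: "length us = 1" for c us
  proof -
    obtain u where "us = [u]" using us by (auto simp: length_Suc_conv)
    then show ?thesis using assms(4)[OF c, of u] by (simp add: chart_form1_def)
  qed
qed (rule assms(2))

lemma smooth_form1D:
  assumes "smooth_form A 1 \<alpha>"
  shows "length vs \<noteq> 1 \<Longrightarrow> \<alpha> p vs = 0" "linear (\<lambda>v. \<alpha> p [v])"
    "c \<in> A \<Longrightarrow> smooth_on (chart_img c) (\<lambda>y. chart_form1 A c \<alpha> y u)"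
proof -
  show "length vs \<noteq> 1 \<Longrightarrow> \<alpha> p vs = 0" using assms unfolding smooth_form_def by blast
  have "\<forall>us ws. Suc (length us + length ws) = 1 \<longrightarrow> linear (\<lambda>v. \<alpha> p (us @ v # ws))"
    using assms unfolding smooth_form_def by blast
  from this[rule_format, of "[]" "[]"] show "linear (\<lambda>v. \<alpha> p [v])" by simp
  assume "c \<in> A"
  then have "\<forall>us. length us = 1 \<longrightarrow>
      smooth_on (chart_img c) (\<lambda>y. \<alpha> (chart_inv c y) (map (from_chart A c (chart_inv c y)) us))"
    using assms unfolding smooth_form_def by blast
  from this[rule_format, of "[u]"] show "smooth_on (chart_img c) (\<lambda>y. chart_form1 A c \<alpha> y u)"
    by (simp add: chart_form1_def)
qed

lemma smooth_form1_chart: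
  assumes "atlas A" "c \<in> A" "smooth_form A 1 \<alpha>"
  shows "smooth_linear (chart_img c) (chart_form1 A c \<alpha>)"
  using linear_chart_form1[OF assms(1,2)] smooth_form1D(2,3)[OF assms(3)] assms(2)
    is_chartD(2)[OF atlasD(1)[OF assms(1,2)]]
  unfolding smooth_linear_def by blast

lemma smooth_form2I:
  assumes "atlas A" "\<And>p vs. length vs \<noteq> 2 \<Longrightarrow> \<alpha> p vs = 0" "\<And>p. bilinear (\<lambda>u v. \<alpha> p [u, v])"
    "\<And>p v. \<alpha> p [v, v] = 0"
    "\<And>c u v. c \<in> A \<Longrightarrow> smooth_on (chart_img c) (\<lambda>y. chart_form2 A c \<alpha> y u v)"
  shows "smooth_form A 2 \<alpha>"
  unfolding smooth_form_def list_split_2 length_2_conv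
proof (intro conjI allI impI ballI)
  show "\<alpha> p vs = 0" if "\<nexists>u v. vs = [u, v]" for p vs using that assms(2) length_2_conv by blast
  show "linear (\<lambda>v. \<alpha> p (us @ v # ws))" if "(\<exists>w. us = [] \<and> ws = [w]) \<or> (\<exists>u. us = [u] \<and> ws = [])" for p us ws
    using that assms(3)[of p] by (auto simp: bilinear_def)
  show "\<alpha> p vs = 0" if "(\<exists>u v. vs = [u, v]) \<and> \<not> distinct vs" for p vs
    using that assms(4) by auto
  show "smooth_on (chart_img c) (\<lambda>y. \<alpha> (chart_inv c y) (map (from_chart A c (chart_inv c y)) us))"
    if "c \<in> A" "\<exists>u v. us = [u, v]" for c us
    using that(2) assms(5)[OF that(1)] by (auto simp: chart_form2_eq)
qed

lemma smooth_form2D: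
  assumes "smooth_form A 2 \<alpha>"
  shows "length vs \<noteq> 2 \<Longrightarrow> \<alpha> p vs = 0" "bilinear (\<lambda>u v. \<alpha> p [u, v])" "\<alpha> p [v, v] = 0" "\<alpha> p [u, v] = - \<alpha> p [v, u]"
    "c \<in> A \<Longrightarrow> smooth_on (chart_img c) (\<lambda>y. chart_form2 A c \<alpha> y u v)"
proof -
  show "length vs \<noteq> 2 \<Longrightarrow> \<alpha> p vs = 0" using assms unfolding smooth_form_def by blast
  have "\<forall>us ws. Suc (length us + length ws) = 2 \<longrightarrow> linear (\<lambda>v. \<alpha> p (us @ v # ws))"
    using assms unfolding smooth_form_def by blast
  from this[rule_format, of "[]" "[_]"] this[rule_format, of "[_]" "[]"]
  show b: "bilinear (\<lambda>u v. \<alpha> p [u, v])" by (simp add: bilinear_def)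
  have "\<forall>p vs. length vs = 2 \<and> \<not> distinct vs \<longrightarrow> \<alpha> p vs = 0"
    using assms unfolding smooth_form_def by blast
  from this[rule_format, of "[v, v]" for v] have z: "\<alpha> p [v, v] = 0" for v by simp
  show "\<alpha> p [v, v] = 0" by (rule z)
  have "\<alpha> p [u + v, u + v] = \<alpha> p [u, u] + \<alpha> p [u, v] + \<alpha> p [v, u] + \<alpha> p [v, v]"
    using bilinear_ladd[OF b] bilinear_radd[OF b] by simp
  then show "\<alpha> p [u, v] = - \<alpha> p [v, u]" using z by simp
  assume "c \<in> A"
  then have "\<forall>us. length us = 2 \<longrightarrow>
      smooth_on (chart_img c) (\<lambda>y. \<alpha> (chart_inv c y) (map (from_chart A c (chart_inv c y)) us))"
    using assms unfolding smooth_form_def by blast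
  from this[rule_format, of "[u, v]"] show "smooth_on (chart_img c) (\<lambda>y. chart_form2 A c \<alpha> y u v)"
    by (simp add: chart_form2_eq)
qed

lemma smooth_form2_chart:
  assumes "atlas A" "c \<in> A" "smooth_form A 2 \<alpha>"
  shows "smooth_bilinear (chart_img c) (chart_form2 A c \<alpha>)"
  using bilinear_chart_bilinear[OF assms(1,2), of _ "\<lambda>q u v. \<alpha> q [u, v]", OF _ smooth_form2D(2)[OF assms(3)]]
    smooth_form2D(5)[OF assms(3,2)] is_chartD(2)[OF atlasD(1)[OF assms(1,2)]]
  unfolding smooth_bilinear_def chart_form2_def by blast

lemma chart_form2_alt:
  "smooth_form A 2 \<alpha> \<Longrightarrow> chart_form2 A c \<alpha> y u v = - chart_form2 A c \<alpha> y v u"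
  unfolding chart_form2_eq by (rule smooth_form2D(4))

lemma ext_deriv_1form:
  "ext_deriv A \<eta> p [u, v] = (let c = chart_at A p in
     dd (\<lambda>y. chart_form1 A c \<eta> y v) (chart_map c p) u - dd (\<lambda>y. chart_form1 A c \<eta> y u) (chart_map c p) v)"
  unfolding ext_deriv_def Let_def chart_form1_def by (simp add: numeral_2_eq_2)

lemma ext_deriv_1form_0:
  assumes "\<And>p vs. length vs \<noteq> 1 \<Longrightarrow> \<eta> p vs = 0" "length vs \<noteq> 2"
  shows "ext_deriv A \<eta> p vs = 0"
proof -
  have "\<eta> q (map f (take i vs @ drop (Suc i) vs)) = 0" if "i < length vs" for i q f
    using that assms(2) by (intro assms(1)) auto
  then show ?thesis unfolding ext_deriv_def Let_def by (intro sum.neutral) (simp del: map_append)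
qed

text \<open>\<open>ext_deriv\<close> is defined at each point through the preferred chart of that
  point. Passing to another chart adds a term with the second derivative of the coordinate change,
  which is symmetric in \<open>u\<close> and \<open>v\<close> and drops out of the difference. Only
  with this can \<open>ext_deriv\<close> be differentiated or integrated in a fixed chart.\<close>

lemma ext_deriv_chart:
  assumes A: "atlas A" and \<eta>: "smooth_form A 1 \<eta>" and c: "c \<in> A" "y \<in> chart_img c"
  shows "chart_form2 A c (ext_deriv A \<eta>) y u v
    = dd (\<lambda>y. chart_form1 A c \<eta> y v) y u - dd (\<lambda>y. chart_form1 A c \<eta> y u) y v"
proof -
  define p where "p = chart_inv c y"
  define c' where "c' = chart_at A p"
  note ch = atlasD(1)[OF A c(1)]
  have p: "p \<in> chart_dom c" "chart_map c p = y" using is_chartD[OF ch] c(2) by (auto simp: p_def)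
  have c': "c' \<in> A" "p \<in> chart_dom c'" using chart_at[OF A] by (auto simp: c'_def)
  note ch' = atlasD(1)[OF A c'(1)]
  let ?\<tau> = "coord_change c c'" and ?S = "overlap c c'"
  have yS: "y \<in> ?S" using p c' by (auto simp: overlap_def)
  have sb: "smooth_between ?S (overlap c' c) ?\<tau>"
    by (rule smooth_between_coord_change[OF ch ch' atlasD(2)[OF A c(1) c'(1)]])
  then have S: "open ?S" "smooth_on ?S ?\<tau>" by (auto simp: smooth_between_def)
  have sb': "smooth_between ?S (chart_img c') ?\<tau>" using sb overlap_eq[OF ch', of c] by (auto simp: smooth_between_def)
  have \<tau>y: "?\<tau> y = chart_map c' p" by (simp add: coord_change_def p_def)
  have fc: "from_chart A c p w = dd ?\<tau> y w" for w
    unfolding from_chart_trans coord_D_def c'_def[symmetric] p(2) ..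
  have e: "dd (\<lambda>y. chart_form1 A c \<eta> y v) y u = dd (\<lambda>z. chart_form1 A c' \<eta> z (dd ?\<tau> y v)) (?\<tau> y) (dd ?\<tau> y u)
      + chart_form1 A c' \<eta> (?\<tau> y) (dd (\<lambda>y. dd ?\<tau> y v) y u)" for u v
  proof -
    have "dd (\<lambda>y. chart_form1 A c \<eta> y v) y = dd (\<lambda>y. chart_form1 A c' \<eta> (?\<tau> y) (dd ?\<tau> y v)) y"
      by (rule dd_cong_open[OF S(1) yS]) (rule chart_form1_change[OF A c(1) c'(1)])
    then show ?thesis
      using dd_linear_pull[OF smooth_form1_chart[OF A c'(1) \<eta>] sb' smooth_on_dd[OF S(2)] yS] by metis
  qed
  have "chart_form2 A c (ext_deriv A \<eta>) y u v = ext_deriv A \<eta> p [dd ?\<tau> y u, dd ?\<tau> y v]"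
    unfolding chart_form2_eq p_def[symmetric] fc ..
  also have "\<dots> = dd (\<lambda>z. chart_form1 A c' \<eta> z (dd ?\<tau> y v)) (?\<tau> y) (dd ?\<tau> y u)
      - dd (\<lambda>z. chart_form1 A c' \<eta> z (dd ?\<tau> y u)) (?\<tau> y) (dd ?\<tau> y v)"
    unfolding ext_deriv_1form Let_def c'_def[symmetric] \<tau>y[symmetric] ..
  finally show ?thesis
    unfolding e using second_derivative_symmetric[OF S yS, of u v] by simp
qed

lemma linear_dd_linear_family:
  assumes "smooth_linear T w" "z \<in> T"
  shows "linear (\<lambda>v. dd (\<lambda>z. w z v) z u)"
proof -
  have T: "open T" "\<And>z. z \<in> T \<Longrightarrow> linear (w z)" and s: "smooth_on T (\<lambda>z. w z v)" for v
    using assms(1) by (auto simp: smooth_linear_def)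
  have d: "(\<lambda>z. w z v) differentiable (at z)" for v by (rule smooth_on_differentiable[OF s assms(2)])
  have "dd (\<lambda>z. w z (v + v')) z = dd (\<lambda>z. w z v + w z v') z" for v v'
    by (rule dd_cong_open[OF T(1) assms(2)]) (simp add: linear_add[OF T(2)])
  moreover have "dd (\<lambda>z. w z (r *\<^sub>R v)) z = dd (\<lambda>z. r *\<^sub>R w z v) z" for r v
    by (rule dd_cong_open[OF T(1) assms(2)]) (simp add: linear_cmul[OF T(2)])
  ultimately show ?thesis
    using dd_eqI[OF has_derivative_add[OF dd_has_derivative[OF d] dd_has_derivative[OF d]]]
      dd_eqI[OF has_derivative_scaleR_right[OF dd_has_derivative[OF d]]]
    by (auto simp: linear_iff)
qed

lemma smooth_ext_deriv:
  assumes A: "atlas A" and \<eta>: "smooth_form A 1 \<eta>"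
  shows "smooth_form A 2 (ext_deriv A \<eta>)"
proof (rule smooth_form2I[OF A])
  show "ext_deriv A \<eta> p vs = 0" if "length vs \<noteq> 2" for p vs
    by (rule ext_deriv_1form_0[OF smooth_form1D(1)[OF \<eta>] that])
  show "ext_deriv A \<eta> p [v, v] = 0" for p v
    unfolding ext_deriv_1form Let_def by simp
  show "bilinear (\<lambda>u v. ext_deriv A \<eta> p [u, v])" for p
  proof -
    let ?c = "chart_at A p"
    have c: "?c \<in> A" "p \<in> chart_dom ?c" using chart_at[OF A] by auto
    have y: "chart_map ?c p \<in> chart_img ?c" using is_chartD(6)[OF atlasD(1)[OF A c(1)] c(2)] .
    note s = smooth_form1_chart[OF A c(1) \<eta>]
    have "linear (dd (\<lambda>y. chart_form1 A ?c \<eta> y v) (chart_map ?c p))" for v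
      using s y by (auto simp: smooth_linear_def intro: dd_linear smooth_on_differentiable)
    then show ?thesis
      unfolding ext_deriv_1form Let_def bilinear_def
      using linear_dd_linear_family[OF s y] by (auto intro: linear_compose_sub)
  qed
  fix c u v assume c: "c \<in> A"
  have S: "open (chart_img c)" by (rule is_chartD(2)[OF atlasD(1)[OF A c]])
  show "smooth_on (chart_img c) (\<lambda>y. chart_form2 A c (ext_deriv A \<eta>) y u v)"
    by (subst smooth_on_cong[OF S ext_deriv_chart[OF A \<eta> c]])
       (auto intro!: smooth_on_diff smooth_on_dd S smooth_form1D(3)[OF \<eta> c])
qed

lemma smooth_form1_zero_extension:
  fixes c :: "('a::t2_space, 'm::finite) chart"
  assumes A: "atlas A" "c \<in> A" and K: "closed K" "K \<subseteq> chart_dom c" "\<And>p vs. p \<notin> K \<Longrightarrow> \<eta> p vs = 0"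
    and \<eta>: "\<And>p vs. length vs \<noteq> 1 \<Longrightarrow> \<eta> p vs = 0" "\<And>p. linear (\<lambda>v. \<eta> p [v])"
    and s: "smooth_linear (chart_img c) (chart_form1 A c \<eta>)"
  shows "smooth_form A 1 \<eta>"
proof (rule smooth_form1I[OF A(1) \<eta>])
  fix c' u assume c': "c' \<in> A"
  note ch = atlasD(1)[OF A] atlasD(1)[OF A(1) c']
  show "smooth_on (chart_img c') (\<lambda>y. chart_form1 A c' \<eta> y u)"
  proof (rule smooth_on_local)
    fix y assume y: "y \<in> chart_img c'"
    show "\<exists>T. open T \<and> y \<in> T \<and> smooth_on T (\<lambda>y. chart_form1 A c' \<eta> y u)"
    proof (cases "chart_inv c' y \<in> K")
      case True
      let ?\<tau> = "coord_change c' c" and ?S = "overlap c' c"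
      have sb: "smooth_between ?S (chart_img c) ?\<tau>"
        using smooth_between_coord_change[OF ch(2,1) atlasD(2)[OF A(1) c' A(2)]] overlap_eq[OF ch(1), of c']
        by (auto simp: smooth_between_def)
      then have S: "open ?S" "smooth_on ?S ?\<tau>" by (auto simp: smooth_between_def)
      have "smooth_on ?S (\<lambda>y. chart_form1 A c \<eta> (?\<tau> y) (dd ?\<tau> y u))"
        by (rule smooth_linear_apply[OF smooth_linear_compose[OF s sb] smooth_on_dd[OF S(2)]])
      then have "smooth_on ?S (\<lambda>y. chart_form1 A c' \<eta> y u)"
        by (subst smooth_on_cong[OF S(1) chart_form1_change[OF A(1) c' A(2)]])
      then show ?thesis using S(1) True K y overlap_eq[OF ch(2)] by blast
    next
      case False
      let ?T = "chart_map c' ` (chart_dom c' \<inter> - K)"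
      have T: "open ?T" using K(1) by (intro open_chart_image ch) auto
      have "smooth_on ?T (\<lambda>y. chart_form1 A c' \<eta> y u)"
        by (subst smooth_on_cong[OF T, of _ "\<lambda>_. 0"])
           (use K(3) in \<open>auto simp: chart_image_Int[OF ch(2)] smooth_on_const chart_form1_def\<close>)
      then show ?thesis using T False y chart_image_Int[OF ch(2)] by blast
    qed
  qed
qed

lemma smooth_form1_sum:
  assumes A: "atlas A" and \<eta>: "\<And>i. i \<in> I \<Longrightarrow> smooth_form A 1 (\<eta> i)"
  shows "smooth_form A 1 (\<lambda>p vs. \<Sum>i\<in>I. \<eta> i p vs)"
proof (rule smooth_form1I[OF A])
  show "(\<Sum>i\<in>I. \<eta> i p vs) = 0" if "length vs \<noteq> 1" for p vs
    using smooth_form1D(1)[OF \<eta> that] by simp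
  show "linear (\<lambda>v. \<Sum>i\<in>I. \<eta> i p [v])" for p
    using smooth_form1D(2)[OF \<eta>] by (rule linear_compose_sum[rule_format])
  show "smooth_on (chart_img c) (\<lambda>y. chart_form1 A c (\<lambda>p vs. \<Sum>i\<in>I. \<eta> i p vs) y u)" if "c \<in> A" for c u
    using smooth_form1D(3)[OF \<eta> that] unfolding chart_form1_def
    by (intro smooth_on_sum is_chartD(2)[OF atlasD(1)[OF A that]])
qed

lemma smooth_form1_add:
  assumes A: "atlas A" and \<eta>: "smooth_form A 1 \<eta>" "smooth_form A 1 \<eta>'"
  shows "smooth_form A 1 (\<lambda>p vs. \<eta> p vs + r * \<eta>' p vs)"
proof (rule smooth_form1I[OF A])
  show "\<eta> p vs + r * \<eta>' p vs = 0" if "length vs \<noteq> 1" for p vs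
    using smooth_form1D(1)[OF \<eta>(1) that] smooth_form1D(1)[OF \<eta>(2) that] by simp
  show "linear (\<lambda>v. \<eta> p [v] + r * \<eta>' p [v])" for p
    using smooth_form1D(2)[OF \<eta>(1), of p] smooth_form1D(2)[OF \<eta>(2), of p]
    by (auto simp: linear_iff algebra_simps)
  show "smooth_on (chart_img c) (\<lambda>y. chart_form1 A c (\<lambda>p vs. \<eta> p vs + r * \<eta>' p vs) y u)" if "c \<in> A" for c u
    using smooth_form1D(3)[OF \<eta>(1) that] smooth_form1D(3)[OF \<eta>(2) that] unfolding chart_form1_def
    by (intro smooth_on_add smooth_on_mult smooth_on_const is_chartD(2)[OF atlasD(1)[OF A that]])
qed

section \<open>The codifferential\<close>

lemma sum_lists_1: "(\<Sum>is\<in>{is. length is = 1}. f is) = (\<Sum>i\<in>UNIV. f [i])"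
proof -
  have e: "{is. length is = 1} = (\<lambda>i. [i]) ` UNIV" by (auto simp: length_Suc_conv image_iff)
  show ?thesis unfolding e by (subst sum.reindex) (auto simp: inj_on_def)
qed

lemma sum_lists_2: "(\<Sum>is\<in>{is. length is = 2}. f is) = (\<Sum>i\<in>UNIV. \<Sum>j\<in>UNIV. f [i, j])"
proof -
  have e: "{is. length is = 2} = (\<lambda>(i, j). [i, j]) ` (UNIV \<times> UNIV)" by (auto simp: length_2_conv)
  show ?thesis
    unfolding e sum.cartesian_product by (subst sum.reindex) (auto simp: inj_on_def case_prod_unfold)
qed

lemma form_inner_add_right:
  "form_inner g k \<alpha> (\<lambda>p vs. \<beta> p vs + r * \<beta>' p vs) p = form_inner g k \<alpha> \<beta> p + r * form_inner g k \<alpha> \<beta>' p"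
  by (simp add: form_inner_def Let_def algebra_simps sum.distrib sum_distrib_left)

text \<open>\<open>form_inner\<close> uses a frame chosen pointwise without any continuity. The
  frame sum is rewritten with the vectors dual to the coordinate functionals, which depend smoothly
  on the metric.\<close>

lemma frame_double_sum:
  fixes a b B :: "real ^ 'm \<Rightarrow> real ^ 'm \<Rightarrow> real"
  assumes a: "bilinear a" and b: "bilinear b" and B: "bilinear B" "posdef B" "\<And>u v. B u v = B v u"
    and u: "orthonormal_frame B u"
  shows "(\<Sum>i\<in>UNIV. \<Sum>j\<in>UNIV. a (u i) (u j) * b (u i) (u j))
    = (\<Sum>k\<in>UNIV. \<Sum>l\<in>UNIV. a (axis k 1) (axis l 1) * b (riesz B (\<lambda>w. w $ k)) (riesz B (\<lambda>w. w $ l)))"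
proof -
  have ea: "a x y = (\<Sum>k\<in>UNIV. \<Sum>l\<in>UNIV. x $ k * y $ l * a (axis k 1) (axis l 1))" for x y
  proof -
    have l: "linear (\<lambda>x. a x y)" "linear (\<lambda>y. a x y)" for x y using a by (auto simp: bilinear_def)
    show ?thesis
      by (subst linear_axis_expansion[OF l(1)], subst linear_axis_expansion[OF l(2)]) (simp add: sum_distrib_left mult.assoc)
  qed
  have r: "riesz B (\<lambda>w. w $ k) = (\<Sum>i\<in>UNIV. (u i $ k) *\<^sub>R u i)" for k
    by (rule riesz_frame[OF B u]) (simp add: linear_iff)
  have rb: "b (riesz B (\<lambda>w. w $ k)) (riesz B (\<lambda>w. w $ l)) = (\<Sum>i\<in>UNIV. \<Sum>j\<in>UNIV. u i $ k * u j $ l * b (u i) (u j))" for k l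
    unfolding r bilinear_sum[OF b] sum.cartesian_product[symmetric]
    by (simp add: bilinear_lmul[OF b] bilinear_rmul[OF b] mult_ac)
  have "(\<Sum>k\<in>UNIV. \<Sum>l\<in>UNIV. a (axis k 1) (axis l 1) * b (riesz B (\<lambda>w. w $ k)) (riesz B (\<lambda>w. w $ l)))
    = (\<Sum>k\<in>UNIV. \<Sum>l\<in>UNIV. \<Sum>i\<in>UNIV. \<Sum>j\<in>UNIV. u i $ k * u j $ l * a (axis k 1) (axis l 1) * b (u i) (u j))"
    unfolding rb sum_distrib_left by (simp add: mult_ac)
  also have "\<dots> = (\<Sum>k\<in>UNIV. \<Sum>i\<in>UNIV. \<Sum>l\<in>UNIV. \<Sum>j\<in>UNIV. u i $ k * u j $ l * a (axis k 1) (axis l 1) * b (u i) (u j))"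
    by (rule sum.cong[OF refl], rule sum.swap)
  also have "\<dots> = (\<Sum>i\<in>UNIV. \<Sum>k\<in>UNIV. \<Sum>j\<in>UNIV. \<Sum>l\<in>UNIV. u i $ k * u j $ l * a (axis k 1) (axis l 1) * b (u i) (u j))"
    by (subst sum.swap, rule sum.cong[OF refl], rule sum.cong[OF refl], rule sum.swap)
  also have "\<dots> = (\<Sum>i\<in>UNIV. \<Sum>j\<in>UNIV. \<Sum>k\<in>UNIV. \<Sum>l\<in>UNIV. u i $ k * u j $ l * a (axis k 1) (axis l 1) * b (u i) (u j))"
    by (rule sum.cong[OF refl], rule sum.swap)
  also have "\<dots> = (\<Sum>i\<in>UNIV. \<Sum>j\<in>UNIV. a (u i) (u j) * b (u i) (u j))"
    unfolding ea[of "u _" "u _"] sum_distrib_right ..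
  finally show ?thesis ..
qed

context compact_riemannian
begin

lemma frame_g: "orthonormal_frame (g p) (SOME e. orthonormal_frame (g p) e)"
  by (rule someI_ex[OF orthonormal_frame_exists[OF g_metric(1,3,2)]])

text \<open>The vector \<open>sharp g \<beta> p\<close> is expanded in the very frame that
  \<open>form_inner\<close> uses.\<close>

lemma form_inner_1:
  assumes "linear (\<lambda>v. \<alpha> p [v])" "linear (\<lambda>v. \<beta> p [v])"
  shows "form_inner g 1 \<alpha> \<beta> p = \<alpha> p [sharp g \<beta> p]"
proof -
  have "sharp g \<beta> p = riesz (g p) (\<lambda>w. \<beta> p [w])" by (simp add: sharp_def riesz_def)
  also have "\<dots> = (\<Sum>i\<in>UNIV. \<beta> p [(SOME e. orthonormal_frame (g p) e) i] *\<^sub>R (SOME e. orthonormal_frame (g p) e) i)"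
    by (rule riesz_frame[OF g_metric(1,2,3) frame_g assms(2)])
  finally show ?thesis
    unfolding form_inner_def Let_def sum_lists_1
    by (simp add: linear_sum[OF assms(1)] linear_cmul[OF assms(1)] mult.commute)
qed

lemma form_inner_2:
  "form_inner g 2 \<alpha> \<beta> p = (let e = (SOME e. orthonormal_frame (g p) e) in
     1 / 2 * (\<Sum>i\<in>UNIV. \<Sum>j\<in>UNIV. \<alpha> p [e i, e j] * \<beta> p [e i, e j]))"
  unfolding form_inner_def Let_def sum_lists_2 by (simp add: numeral_2_eq_2)

text \<open>The metric gradient of the \<open>k\<close>-th coordinate, that is, the
  \<open>k\<close>-th row of the inverse metric matrix. Evaluating a form on these vectors raises
  its indices.\<close>

definition raised :: "('a, 'm) chart \<Rightarrow> 'm \<Rightarrow> real ^ 'm \<Rightarrow> real ^ 'm" where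
  "raised c k y = riesz (gc c y) (\<lambda>w. w $ k)"

lemma smooth_raised: "c \<in> A \<Longrightarrow> smooth_on (chart_img c) (raised c k)"
  unfolding raised_def[abs_def]
  by (rule smooth_on_riesz[OF chart_metric(1,3)[OF atlas_A metric_g]])
     (auto simp: smooth_linear_def linear_iff smooth_on_const is_chartD(2)[OF chart_A])

lemma form_inner_2_chart:
  assumes c: "c \<in> A" "y \<in> chart_img c"
    and b: "bilinear (\<lambda>u v. \<alpha> (chart_inv c y) [u, v])" "bilinear (\<lambda>u v. \<beta> (chart_inv c y) [u, v])"
  shows "form_inner g 2 \<alpha> \<beta> (chart_inv c y) = 1 / 2 * (\<Sum>k\<in>UNIV. \<Sum>l\<in>UNIV.
    chart_form2 A c \<alpha> y (axis k 1) (axis l 1) * chart_form2 A c \<beta> y (raised c k y) (raised c l y))"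
proof -
  define p where "p = chart_inv c y"
  have p: "p \<in> chart_dom c" using is_chartD(8)[OF chart_A[OF c(1)] c(2)] by (simp add: p_def)
  define e where "e = (SOME e. orthonormal_frame (g p) e)"
  define u where "u i = to_chart A c p (e i)" for i
  have fu: "from_chart A c p (u i) = e i" for i unfolding u_def by (rule from_to_chart(4)[OF atlas_A c(1) p])
  have u: "orthonormal_frame (gc c y) u"
    using frame_g[of p] unfolding orthonormal_frame_def chart_bilinear_def p_def[symmetric] fu e_def .
  have bl: "bilinear (chart_form2 A c \<alpha> y)" "bilinear (chart_form2 A c \<beta> y)"
    unfolding chart_form2_def chart_bilinear_def[abs_def]
    using bilinear_compose_linear[OF b(1)] bilinear_compose_linear[OF b(2)] from_to_chart(1)[OF atlas_A c(1) p]
    unfolding p_def by blast+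
  show ?thesis
    unfolding raised_def frame_double_sum[OF bl gc_bilinear[OF c] chart_metric(3)[OF atlas_A metric_g c] chart_metric(2)[OF atlas_A metric_g c(1)] u, symmetric]
    unfolding form_inner_2 Let_def p_def[symmetric] e_def[symmetric] chart_form2_eq fu ..
qed

lemma smooth_form_inner_2:
  assumes "smooth_form A 2 \<alpha>" "smooth_form A 2 \<beta>"
  shows "smooth_fun A (form_inner g 2 \<alpha> \<beta>)"
  unfolding smooth_fun_def
proof
  fix c assume c: "c \<in> A"
  have S: "open (chart_img c)" by (rule is_chartD(2)[OF chart_A[OF c]])
  show "smooth_on (chart_img c) (\<lambda>y. form_inner g 2 \<alpha> \<beta> (chart_inv c y))"
    by (subst smooth_on_cong[OF S form_inner_2_chart[OF c _ smooth_form2D(2)[OF assms(1)] smooth_form2D(2)[OF assms(2)]]], assumption)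
       (intro smooth_on_mult smooth_on_sum smooth_on_const S smooth_form2D(5)[OF assms(1) c]
         smooth_bilinear_apply[OF smooth_form2_chart[OF atlas_A c assms(2)]] smooth_raised[OF c])
qed

lemma sharp_chart:
  assumes c: "c \<in> A" "y \<in> chart_img c" and \<beta>: "\<And>p. linear (\<lambda>v. \<beta> p [v])"
  shows "sharp g \<beta> (chart_inv c y) = from_chart A c (chart_inv c y) (riesz (gc c y) (chart_form1 A c \<beta> y))"
proof -
  define p where "p = chart_inv c y"
  have p: "p \<in> chart_dom c" using is_chartD(8)[OF chart_A[OF c(1)] c(2)] by (simp add: p_def)
  have "riesz (g p) (\<lambda>w. \<beta> p [w]) = from_chart A c p (riesz (gc c y) (chart_form1 A c \<beta> y))"
  proof (rule riesz_eqI[OF g_metric(1,2)])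
    fix w
    have "gc c y (riesz (gc c y) (chart_form1 A c \<beta> y)) (to_chart A c p w) = chart_form1 A c \<beta> y (to_chart A c p w)"
      by (rule riesz[OF gc_bilinear[OF c] chart_metric(3)[OF atlas_A metric_g c] linear_chart_form1[OF atlas_A c \<beta>]])
    then show "g p (from_chart A c p (riesz (gc c y) (chart_form1 A c \<beta> y))) w = \<beta> p [w]"
      unfolding chart_bilinear_def chart_form1_def p_def[symmetric] from_to_chart(4)[OF atlas_A c(1) p] .
  qed
  then show ?thesis unfolding sharp_def riesz_def p_def .
qed

lemma smooth_form_inner_1:
  assumes "smooth_form A 1 \<alpha>" "smooth_form A 1 \<beta>"
  shows "smooth_fun A (form_inner g 1 \<alpha> \<beta>)"
  unfolding smooth_fun_def
proof
  fix c assume c: "c \<in> A"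
  have S: "open (chart_img c)" by (rule is_chartD(2)[OF chart_A[OF c]])
  have e: "form_inner g 1 \<alpha> \<beta> (chart_inv c y) = chart_form1 A c \<alpha> y (riesz (gc c y) (chart_form1 A c \<beta> y))"
    if "y \<in> chart_img c" for y
    unfolding form_inner_1[of \<alpha> _ \<beta>, OF smooth_form1D(2)[OF assms(1)] smooth_form1D(2)[OF assms(2)]]
      sharp_chart[OF c that smooth_form1D(2)[OF assms(2)]] chart_form1_def ..
  show "smooth_on (chart_img c) (\<lambda>y. form_inner g 1 \<alpha> \<beta> (chart_inv c y))"
    by (subst smooth_on_cong[OF S e], assumption)
       (intro smooth_linear_apply[OF smooth_form1_chart[OF atlas_A c assms(1)]]
         smooth_on_riesz[OF chart_metric(1,3)[OF atlas_A metric_g c] smooth_form1_chart[OF atlas_A c assms(2)]])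
qed

lemma form_inner_1_definite:
  assumes \<gamma>: "smooth_form A 1 \<gamma>" and z: "vol_integral A g (form_inner g 1 \<gamma> \<gamma>) = 0"
  shows "\<gamma> p vs = 0"
proof (cases "length vs = 1")
  case True
  then obtain v where v: "vs = [v]" by (auto simp: length_Suc_conv)
  have lin: "linear (\<lambda>v. \<gamma> p [v])" by (rule smooth_form1D(2)[OF \<gamma>])
  have e: "form_inner g 1 \<gamma> \<gamma> q = (\<Sum>i\<in>UNIV. (\<gamma> q [(SOME e. orthonormal_frame (g q) e) i])\<^sup>2)" for q
    unfolding form_inner_def Let_def sum_lists_1 by (simp add: power2_eq_square)
  have "form_inner g 1 \<gamma> \<gamma> p = 0"
    by (rule vol_integral_pos[OF smooth_fun_continuous[OF atlas_A smooth_form_inner_1[OF \<gamma> \<gamma>]] _ z])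
       (unfold e, rule sum_nonneg, simp)
  then have 0: "\<gamma> p [(SOME e. orthonormal_frame (g p) e) i] = 0" for i
    unfolding e by (subst (asm) sum_nonneg_eq_0_iff) auto
  show ?thesis
    unfolding v by (subst frame_expansion[OF g_metric(1) frame_g, of v p])
      (simp add: linear_sum[OF lin] linear_cmul[OF lin] 0)
qed (rule smooth_form1D(1)[OF \<gamma>])


text \<open>The classical coordinate formula, minus the divergence of the form with raised indices,
  is written down for each piece cut off by the partition of unity. The pieces are extended by zero
  and added. Cutting off before differentiating gives compact supports, so no boundary terms arise,
  and adjointness needs to be checked only in one chart at a time.\<close>

lemma codiff_exists:
  assumes \<alpha>: "smooth_form A 2 \<alpha>"
  shows "\<exists>\<beta>. smooth_form A 1 \<beta> \<and> (\<forall>\<gamma>. smooth_form A 1 \<gamma> \<longrightarrow>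
    vol_integral A g (form_inner g 2 (ext_deriv A \<gamma>) \<alpha>) = vol_integral A g (form_inner g 1 \<gamma> \<beta>))"
proof -
  obtain n \<kappa> \<rho> where P: "pou n \<kappa> \<rho>" by (rule pou_exists)
  \<comment> \<open>\<open>R\<close> holds the components of \<open>\<alpha>\<close> with both
    indices raised, \<open>Q\<close> adds the cut-off and the volume density, and \<open>W\<close>
    is minus the divergence of \<open>Q\<close> in its first index, divided by that density.
    \<open>V\<close> is the corresponding vector field and \<open>\<beta>\<close> the 1-form dual to
    it.\<close>
  define R where "R i k l y = chart_form2 A (\<kappa> i) \<alpha> y (raised (\<kappa> i) k y) (raised (\<kappa> i) l y)" for i k l y
  define Q where "Q i k l y = \<rho> i (chart_inv (\<kappa> i) y) * vol (\<kappa> i) y * R i k l y" for i k l y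
  define W where "W i y = (\<chi> l. - (\<Sum>k\<in>UNIV. dd (Q i k l) y (axis k 1)) / vol (\<kappa> i) y)" for i y
  define V where "V i p = (if p \<in> chart_dom (\<kappa> i) then from_chart A (\<kappa> i) p (W i (chart_map (\<kappa> i) p)) else 0)" for i p
  define \<beta> where "\<beta> i p vs = (case vs of [v] \<Rightarrow> g p (V i p) v | _ \<Rightarrow> 0)" for i p and vs :: "(real ^ 'm) list"
  have gl: "linear (\<lambda>v. g p u v)" for p u using g_metric(1) by (simp add: bilinear_def)
  have \<beta>1: "\<beta> i p [v] = g p (V i p) v" for i p v by (simp add: \<beta>_def)
  have \<beta>0: "\<beta> i p vs = 0" if "length vs \<noteq> 1" for i p vs
    using that by (auto simp: \<beta>_def split: list.splits)
  have sQ: "smooth_on (chart_img (\<kappa> i)) (Q i k l)" if i: "i < n" for i k l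
  proof -
    note c = pouD(1)[OF P i]
    have "smooth_on (chart_img (\<kappa> i)) (\<lambda>y. \<rho> i (chart_inv (\<kappa> i) y))"
      using pouD(3)[OF P i] c by (simp add: smooth_fun_def)
    then show ?thesis unfolding Q_def R_def
      by (intro smooth_on_mult is_chartD(2)[OF chart_A[OF c]] smooth_vol[OF c]
          smooth_bilinear_apply[OF smooth_form2_chart[OF atlas_A c \<alpha>]] smooth_raised[OF c])
  qed
  have Q0: "Q i k l y = 0" if "i < n" "y \<in> chart_img (\<kappa> i) - chart_map (\<kappa> i) ` msupp (\<rho> i)" for i k l y
    using pouD(7)[OF P that(1)] chart_off_support[OF pouD(1)[OF P that(1)] that(2)] by (simp add: Q_def)
  have dQ0: "dd (Q i k l) y v = 0" if i: "i < n" and y: "y \<in> chart_img (\<kappa> i) - chart_map (\<kappa> i) ` msupp (\<rho> i)" for i k l y v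
  proof -
    have "open (chart_img (\<kappa> i) - chart_map (\<kappa> i) ` msupp (\<rho> i))"
      by (intro open_Diff is_chartD(2)[OF chart_A] compact_imp_closed chart_image_compact pouD[OF P i])
    from dd_cong_open[OF this y, of "Q i k l" "\<lambda>_. 0"] Q0[OF i] show ?thesis by simp
  qed
  have sW: "smooth_on (chart_img (\<kappa> i)) (W i)" if i: "i < n" for i
  proof -
    have S: "open (chart_img (\<kappa> i))" by (rule is_chartD(2)[OF chart_A[OF pouD(1)[OF P i]]])
    have nz: "vol (\<kappa> i) y \<noteq> 0" if "y \<in> chart_img (\<kappa> i)" for y
      using vol_pos[OF pouD(1)[OF P i] that] by simp
    have 1: "smooth_on (chart_img (\<kappa> i)) (\<lambda>y. - (\<Sum>k\<in>UNIV. dd (Q i k l) y (axis k 1)))" for l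
      by (rule smooth_on_minus[OF S]) (rule smooth_on_sum[OF S], rule smooth_on_dd[OF sQ[OF i]])
    show ?thesis unfolding W_def
      by (rule smooth_on_vec[OF S], rule smooth_on_divide[OF S 1 smooth_vol[OF pouD(1)[OF P i]] nz])
  qed
  have V0: "V i p = 0" if i: "i < n" and p: "p \<notin> msupp (\<rho> i)" for i p
  proof (cases "p \<in> chart_dom (\<kappa> i)")
    case True
    note ch = chart_A[OF pouD(1)[OF P i]]
    have "chart_map (\<kappa> i) p \<notin> chart_map (\<kappa> i) ` msupp (\<rho> i)"
    proof
      assume "chart_map (\<kappa> i) p \<in> chart_map (\<kappa> i) ` msupp (\<rho> i)"
      then obtain q where q: "q \<in> msupp (\<rho> i)" "chart_map (\<kappa> i) p = chart_map (\<kappa> i) q" by blast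
      have "q \<in> chart_dom (\<kappa> i)" using q(1) pouD(6)[OF P i] by blast
      note qd = this
      from is_chartD(5)[OF ch True] is_chartD(5)[OF ch qd] have "p = q" unfolding q(2) by (rule trans[OF sym])
      then show False using p q(1) by blast
    qed
    then have "W i (chart_map (\<kappa> i) p) = 0"
      using dQ0[OF i] is_chartD(6)[OF ch True] unfolding W_def vec_eq_iff by simp
    then show ?thesis
      by (simp add: V_def linear_0[OF from_to_chart(1)[OF atlas_A pouD(1)[OF P i] True]])
  qed (simp add: V_def)
  have Vc: "V i (chart_inv (\<kappa> i) y) = from_chart A (\<kappa> i) (chart_inv (\<kappa> i) y) (W i y)"
    if "i < n" "y \<in> chart_img (\<kappa> i)" for i y
    using is_chartD(7,8)[OF chart_A[OF pouD(1)[OF P that(1)]] that(2)] by (simp add: V_def)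
  have s\<beta>: "smooth_form A 1 (\<beta> i)" if i: "i < n" for i
  proof (rule smooth_form1_zero_extension[OF atlas_A pouD(1)[OF P i] pouD(5,6)[OF P i] _ \<beta>0])
    note c = pouD(1)[OF P i]
    show "\<beta> i p vs = 0" if "p \<notin> msupp (\<rho> i)" for p vs
      using V0[OF i that] bilinear_lzero[OF g_metric(1)] by (auto simp: \<beta>_def split: list.splits)
    show "linear (\<lambda>v. \<beta> i p [v])" for p unfolding \<beta>1 by (rule gl)
    have e: "chart_form1 A (\<kappa> i) (\<beta> i) y = gc (\<kappa> i) y (W i y)" if "y \<in> chart_img (\<kappa> i)" for y
      unfolding chart_form1_def chart_bilinear_def \<beta>1 Vc[OF i that] ..
    have S: "open (chart_img (\<kappa> i))" by (rule is_chartD(2)[OF chart_A[OF c]])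
    show "smooth_linear (chart_img (\<kappa> i)) (chart_form1 A (\<kappa> i) (\<beta> i))"
      unfolding smooth_linear_def
    proof (intro conjI ballI allI S)
      show "linear (chart_form1 A (\<kappa> i) (\<beta> i) y)" if "y \<in> chart_img (\<kappa> i)" for y
        unfolding e[OF that] using gc_bilinear[OF c that] by (simp add: bilinear_def)
      show "smooth_on (chart_img (\<kappa> i)) (\<lambda>y. chart_form1 A (\<kappa> i) (\<beta> i) y u)" for u
        by (subst smooth_on_cong[OF S fun_cong[OF e]], assumption)
           (rule smooth_bilinear_apply[OF chart_metric(1)[OF atlas_A metric_g c] sW[OF i] smooth_on_const])
    qed
  qed
  define B where "B p vs = (\<Sum>i<n. \<beta> i p vs)" for p vs
  have sB: "smooth_form A 1 B" unfolding B_def using s\<beta> by (intro smooth_form1_sum[OF atlas_A]) auto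
  have "vol_integral A g (form_inner g 2 (ext_deriv A \<gamma>) \<alpha>) = vol_integral A g (form_inner g 1 \<gamma> B)"
    if \<gamma>: "smooth_form A 1 \<gamma>" for \<gamma>
  proof -
    have lin: "linear (\<lambda>v. \<gamma> p [v])" for p by (rule smooth_form1D(2)[OF \<gamma>])
    have sV: "smooth_fun A (\<lambda>p. \<gamma> p [V i p])" if i: "i < n" for i
    proof (rule smooth_fun_zero_extension[OF atlas_A pouD(1)[OF P i] pouD(5,6)[OF P i]])
      note c = pouD(1)[OF P i]
      show "\<gamma> p [V i p] = 0" if "p \<notin> msupp (\<rho> i)" for p
        using V0[OF i that] linear_0[OF lin] by simp
      show "smooth_on (chart_img (\<kappa> i)) (\<lambda>y. \<gamma> (chart_inv (\<kappa> i) y) [V i (chart_inv (\<kappa> i) y)])"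
        using smooth_linear_apply[OF smooth_form1_chart[OF atlas_A c \<gamma>] sW[OF i]]
        by (subst smooth_on_cong[OF is_chartD(2)[OF chart_A[OF c]]]) (auto simp: Vc[OF i] chart_form1_def)
    qed
    have main: "chart_integral (\<kappa> i) (\<lambda>p. \<rho> i p * form_inner g 2 (ext_deriv A \<gamma>) \<alpha> p)
        = chart_integral (\<kappa> i) (\<lambda>p. \<gamma> p [V i p])" if i: "i < n" for i
    proof -
      note c = pouD(1)[OF P i]
      let ?S = "chart_img (\<kappa> i)"
      let ?K = "chart_map (\<kappa> i) ` msupp (\<rho> i)"
      have S: "open ?S" by (rule is_chartD(2)[OF chart_A[OF c]])
      note K = chart_image_compact[OF c pouD(5,6)[OF P i]]
      define G where "G l y = chart_form1 A (\<kappa> i) \<gamma> y (axis l 1)" for l y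
      have sG: "smooth_on ?S (G l)" for l unfolding G_def by (rule smooth_form1D(3)[OF \<gamma> c])
      define F where "F k l y = G l y * Q i k l y" for k l y
      have sF: "smooth_on ?S (F k l)" for k l unfolding F_def by (intro smooth_on_mult S sG sQ[OF i])
      have F0: "F k l y = 0" if "y \<in> ?S - ?K" for k l y using Q0[OF i that] by (simp add: F_def)
      have IF: "(LINT y:?S|lborel. dd (F k l) y (axis k 1)) = 0" for k l
        by (rule integral_derivative_compact_support[OF S K sF F0])
      have dF: "dd (F k l) y v = G l y * dd (Q i k l) y v + dd (G l) y v * Q i k l y" if "y \<in> ?S" for k l y v
        unfolding F_def
        using dd_eqI[OF has_derivative_mult[OF smooth_on_has_derivative[OF sG that] smooth_on_has_derivative[OF sQ[OF i] that]]]
        by simp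
      have dF0: "dd (F k l) y v = 0" if y: "y \<in> ?S - ?K" for k l y v
        using dF[of y k l v] Q0[OF i y] dQ0[OF i y] y by simp
      \<comment> \<open>Antisymmetry lets the two halves of the exterior derivative of
        \<open>\<gamma>\<close> contribute equally, which absorbs the factor 1/2 of the inner
        product on 2-forms.\<close>
      have anti: "R i k l y = - R i l k y" for k l y
        unfolding R_def by (rule chart_form2_alt[OF \<alpha>])
      \<comment> \<open>The pointwise form of the integration by parts. By the product rule for
        \<open>F\<close>, the integrand differs from the pairing of \<open>\<gamma>\<close> with
        \<open>V\<close> by a divergence, whose integral vanishes by \<open>IF\<close>.\<close>
      have pt: "\<rho> i (chart_inv (\<kappa> i) y) * form_inner g 2 (ext_deriv A \<gamma>) \<alpha> (chart_inv (\<kappa> i) y) * vol (\<kappa> i) y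
        = (\<Sum>k\<in>UNIV. \<Sum>l\<in>UNIV. dd (F k l) y (axis k 1)) + \<gamma> (chart_inv (\<kappa> i) y) [V i (chart_inv (\<kappa> i) y)] * vol (\<kappa> i) y"
        if y: "y \<in> ?S" for y
      proof -
        have "form_inner g 2 (ext_deriv A \<gamma>) \<alpha> (chart_inv (\<kappa> i) y)
          = 1 / 2 * (\<Sum>k\<in>UNIV. \<Sum>l\<in>UNIV. (dd (G l) y (axis k 1) - dd (G k) y (axis l 1)) * R i k l y)"
          unfolding form_inner_2_chart[OF c y smooth_form2D(2)[OF smooth_ext_deriv[OF atlas_A \<gamma>]] smooth_form2D(2)[OF \<alpha>]]
            ext_deriv_chart[OF atlas_A \<gamma> c y] R_def G_def ..
        also have "\<dots> = (\<Sum>k\<in>UNIV. \<Sum>l\<in>UNIV. dd (G l) y (axis k 1) * R i k l y)"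
        proof -
          have "(\<Sum>k\<in>UNIV. \<Sum>l\<in>UNIV. dd (G k) y (axis l 1) * R i k l y) = (\<Sum>l\<in>UNIV. \<Sum>k\<in>UNIV. dd (G k) y (axis l 1) * R i k l y)"
            by (rule sum.swap)
          also have "\<dots> = - (\<Sum>k\<in>UNIV. \<Sum>l\<in>UNIV. dd (G l) y (axis k 1) * R i k l y)"
            by (subst anti) (simp add: sum_negf)
          finally show ?thesis by (simp add: left_diff_distrib sum_subtractf)
        qed
        finally have 1: "\<rho> i (chart_inv (\<kappa> i) y) * form_inner g 2 (ext_deriv A \<gamma>) \<alpha> (chart_inv (\<kappa> i) y) * vol (\<kappa> i) y
          = (\<Sum>k\<in>UNIV. \<Sum>l\<in>UNIV. dd (G l) y (axis k 1) * Q i k l y)"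
          unfolding Q_def by (simp add: sum_distrib_left mult_ac)
        have "chart_form1 A (\<kappa> i) \<gamma> y (W i y) = (\<Sum>l\<in>UNIV. W i y $ l *\<^sub>R G l y)"
          unfolding G_def by (rule linear_axis_expansion[OF linear_chart_form1[OF atlas_A c y lin]])
        then have "\<gamma> (chart_inv (\<kappa> i) y) [V i (chart_inv (\<kappa> i) y)] * vol (\<kappa> i) y
          = (\<Sum>l\<in>UNIV. W i y $ l * vol (\<kappa> i) y * G l y)"
          unfolding Vc[OF i y] chart_form1_def by (simp add: sum_distrib_left sum_distrib_right mult_ac)
        also have "\<dots> = (\<Sum>l\<in>UNIV. - (\<Sum>k\<in>UNIV. dd (Q i k l) y (axis k 1)) * G l y)"
          using vol_pos[OF c y] by (simp add: W_def)
        also have "\<dots> = - (\<Sum>k\<in>UNIV. \<Sum>l\<in>UNIV. G l y * dd (Q i k l) y (axis k 1))"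
          by (subst sum.swap) (simp add: sum_distrib_left sum_negf mult_ac)
        finally show ?thesis unfolding 1 dF[OF y] by (simp add: sum.distrib)
      qed
      have cont: "continuous_on ?S (\<lambda>y. dd (F k l) y v)" for k l v
        by (rule smooth_on_continuous[OF smooth_on_dd[OF sF]])
      have si: "set_integrable lborel ?S (\<lambda>y. dd (F k l) y v)" for k l v
        by (rule compact_support_set_integrable[OF S K cont dF0])
      have "(LINT y:?S|lborel. \<Sum>k\<in>UNIV. \<Sum>l\<in>UNIV. dd (F k l) y (axis k 1))
          = (\<Sum>k\<in>UNIV. \<Sum>l\<in>UNIV. LINT y:?S|lborel. dd (F k l) y (axis k 1))"
      proof -
        have si': "integrable lborel (\<lambda>y. indicator ?S y *\<^sub>R dd (F k l) y v)" for k l v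
          using si unfolding set_integrable_def .
        show ?thesis
          unfolding set_lebesgue_integral_def scaleR_sum_right
          by (rule trans[OF Bochner_Integration.integral_sum sum.cong[OF refl Bochner_Integration.integral_sum]])
             (rule Bochner_Integration.integrable_sum si')+
      qed
      then have z: "(LINT y:?S|lborel. \<Sum>k\<in>UNIV. \<Sum>l\<in>UNIV. dd (F k l) y (axis k 1)) = 0" by (simp add: IF)
      have i1: "set_integrable lborel ?S (\<lambda>y. \<Sum>k\<in>UNIV. \<Sum>l\<in>UNIV. dd (F k l) y (axis k 1))"
        by (rule compact_support_set_integrable[OF S K]) (auto intro!: continuous_on_sum cont simp: dF0)
      have i2: "set_integrable lborel ?S (\<lambda>y. \<gamma> (chart_inv (\<kappa> i) y) [V i (chart_inv (\<kappa> i) y)] * vol (\<kappa> i) y)"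
        by (rule chart_integrable[OF c smooth_fun_continuous[OF atlas_A sV[OF i]] pouD(5,6)[OF P i]])
           (simp add: V0[OF i] linear_0[OF lin])
      have "chart_integral (\<kappa> i) (\<lambda>p. \<rho> i p * form_inner g 2 (ext_deriv A \<gamma>) \<alpha> p)
        = (LINT y:?S|lborel. (\<Sum>k\<in>UNIV. \<Sum>l\<in>UNIV. dd (F k l) y (axis k 1))
            + \<gamma> (chart_inv (\<kappa> i) y) [V i (chart_inv (\<kappa> i) y)] * vol (\<kappa> i) y)"
        unfolding chart_integral_def set_integral_zero_extension
        by (intro Bochner_Integration.integral_cong refl if_cong) (rule pt)
      also have "\<dots> = chart_integral (\<kappa> i) (\<lambda>p. \<gamma> p [V i p])"
        unfolding set_integral_add(2)[OF i1 i2] z chart_integral_def by simp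
      finally show ?thesis .
    qed
    have inner: "form_inner g 1 \<gamma> B p = (\<Sum>i<n. \<gamma> p [V i p])" for p
    proof -
      have "riesz (g p) (\<lambda>w. B p [w]) = (\<Sum>i<n. V i p)"
      proof (rule riesz_eqI[OF g_metric(1,2)])
        fix w
        have l: "linear (\<lambda>u. g p u w)" using g_metric(1) by (simp add: bilinear_def)
        show "g p (\<Sum>i<n. V i p) w = B p [w]" unfolding B_def \<beta>1 linear_sum[OF l] ..
      qed
      then have "sharp g B p = (\<Sum>i<n. V i p)" by (simp add: sharp_def riesz_def)
      then show ?thesis
        unfolding form_inner_1[of \<gamma> _ B, OF lin smooth_form1D(2)[OF sB]] by (simp only: linear_sum[OF lin])
    qed
    have "vol_integral A g (form_inner g 2 (ext_deriv A \<gamma>) \<alpha>)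
      = (\<Sum>i<n. chart_integral (\<kappa> i) (\<lambda>p. \<gamma> p [V i p]))"
      using vol_integral_eq[OF P smooth_fun_continuous[OF atlas_A smooth_form_inner_2[OF smooth_ext_deriv[OF atlas_A \<gamma>] \<alpha>]]] main
      by simp
    also have "\<dots> = (\<Sum>i<n. vol_integral A g (\<lambda>p. \<gamma> p [V i p]))"
    proof (rule sum.cong[OF refl])
      fix i assume "i \<in> {..<n}"
      then have i: "i < n" by simp
      show "chart_integral (\<kappa> i) (\<lambda>p. \<gamma> p [V i p]) = vol_integral A g (\<lambda>p. \<gamma> p [V i p])"
        by (rule vol_integral_chart[symmetric, OF pouD(1)[OF P i] smooth_fun_continuous[OF atlas_A sV[OF i]] pouD(5,6)[OF P i]])
           (simp add: V0[OF i] linear_0[OF lin])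
    qed
    also have "\<dots> = vol_integral A g (form_inner g 1 \<gamma> B)"
      unfolding inner using smooth_fun_continuous[OF atlas_A sV]
      by (subst vol_integral_sum) auto
    finally show ?thesis .
  qed
  then show ?thesis using sB by blast
qed

text \<open>Two candidates differ by a smooth 1-form that is orthogonal to every smooth 1-form, in
  particular to itself, so it vanishes by \<open>form_inner_1_definite\<close>.\<close>

lemma codiff:
  assumes \<alpha>: "smooth_form A 2 \<alpha>"
  shows "smooth_form A 1 (codiff A g 1 \<alpha>)"
    "smooth_form A 1 \<gamma> \<Longrightarrow> vol_integral A g (form_inner g 2 (ext_deriv A \<gamma>) \<alpha>)
      = vol_integral A g (form_inner g 1 \<gamma> (codiff A g 1 \<alpha>))"
proof -
  let ?P = "\<lambda>\<beta>. smooth_form A 1 \<beta> \<and> (\<forall>\<gamma>. smooth_form A 1 \<gamma> \<longrightarrow>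
    vol_integral A g (form_inner g 2 (ext_deriv A \<gamma>) \<alpha>) = vol_integral A g (form_inner g 1 \<gamma> \<beta>))"
  obtain \<beta> where \<beta>: "?P \<beta>" using codiff_exists[OF \<alpha>] by blast
  have uniq: "\<beta>' = \<beta>" if \<beta>': "?P \<beta>'" for \<beta>'
  proof -
    define \<gamma> where "\<gamma> p vs = \<beta> p vs + (-1) * \<beta>' p vs" for p vs
    have \<gamma>: "smooth_form A 1 \<gamma>" unfolding \<gamma>_def using \<beta> \<beta>' by (intro smooth_form1_add[OF atlas_A]) auto
    have \<gamma>_eq: "\<gamma> = (\<lambda>p vs. \<beta> p vs + (-1) * \<beta>' p vs)" unfolding \<gamma>_def[abs_def] ..
    have "form_inner g 1 \<gamma> \<gamma> = (\<lambda>p. form_inner g 1 \<gamma> \<beta> p + (-1) * form_inner g 1 \<gamma> \<beta>' p)"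
      unfolding form_inner_add_right[of g 1 \<gamma> \<beta> "-1" \<beta>', symmetric] \<gamma>_eq[symmetric] ..
    then have "vol_integral A g (form_inner g 1 \<gamma> \<gamma>)
      = vol_integral A g (\<lambda>p. form_inner g 1 \<gamma> \<beta> p + (-1) * form_inner g 1 \<gamma> \<beta>' p)" by (rule arg_cong)
    also have "\<dots> = vol_integral A g (form_inner g 1 \<gamma> \<beta>) + (-1) * vol_integral A g (form_inner g 1 \<gamma> \<beta>')"
      using smooth_fun_continuous[OF atlas_A smooth_form_inner_1[OF \<gamma>]] \<beta> \<beta>'
      by (subst vol_integral_add, simp, intro continuous_on_mult continuous_on_const, simp, subst vol_integral_cmult) auto
    also have "\<dots> = 0" using \<beta> \<beta>' \<gamma> by simp
    finally have "\<gamma> p vs = 0" for p vs by (rule form_inner_1_definite[OF \<gamma>])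
    then show ?thesis by (simp add: \<gamma>_def fun_eq_iff)
  qed
  have "Suc 1 = 2" by simp
  then have "codiff A g 1 \<alpha> = \<beta>"
    unfolding codiff_def by (simp only:) (rule the_equality[of ?P, OF \<beta> uniq])
  then show "smooth_form A 1 (codiff A g 1 \<alpha>)"
    "smooth_form A 1 \<gamma> \<Longrightarrow> vol_integral A g (form_inner g 2 (ext_deriv A \<gamma>) \<alpha>)
      = vol_integral A g (form_inner g 1 \<gamma> (codiff A g 1 \<alpha>))"
    using \<beta> by auto
qed

end

section \<open>Kaehler manifolds\<close>

text \<open>
  Here \<open>D x u\<close> stands for \<open>(\<nabla>\<^sub>x J) u\<close>. The argument compares \<open>d\<omega>(x, y, z)\<close>
  with \<open>d\<omega>(x, Jy, Jz)\<close>; the fourth assumption is the vanishing of the Nijenhuis tensor.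
\<close>

lemma kaehler_algebra:
  fixes h :: "'v::real_vector \<Rightarrow> 'v \<Rightarrow> real"
  assumes h: "bilinear h" "\<And>u v. h u v = h v u"
    and J: "linear J" "\<And>v. J (J v) = - v" "\<And>u v. h (J u) (J v) = h u v"
    and skew: "\<And>x u v. h (D x u) v = - h (D x v) u"
    and DJ: "\<And>x u. D x (J u) = - J (D x u)"
    and N: "\<And>u v. D (J u) v - J (D u v) = D (J v) u - J (D v u)"
    and cyc: "\<And>x u v. h (D x u) v + h (D u v) x + h (D v x) u = 0"
  shows "h (D x y) z = 0"
proof -
  note bl = bilinear_ladd[OF h(1)] bilinear_lneg[OF h(1)] bilinear_lsub[OF h(1)]
  have a: "h (D x (J y)) (J z) = - h (D x y) z" by (simp add: DJ bl J(3))
  have b: "h (D (J y) (J z)) x = - h (J (D (J y) z)) x" by (simp add: DJ bl)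
  have c: "h (D (J z) x) (J y) = h (J (D (J z) y)) x"
    using skew[of "J z" x "J y"] by (simp add: DJ bl)
  have "J (D (J y) z - J (D y z)) = J (D (J z) y - J (D z y))" using N[of y z] by simp
  then have "J (D (J y) z) + D y z = J (D (J z) y) + D z y"
    by (simp add: linear_diff[OF J(1)] J(2))
  then have "h (J (D (J y) z)) x + h (D y z) x = h (J (D (J z) y)) x + h (D z y) x"
    by (metis bl(1))
  \<comment> \<open>Put a = \<open>h (D x y) z\<close> and b =
    \<open>h (D y z) x - h (D z y) x\<close>. The identity for \<open>x\<close>, \<open>y\<close>,
    \<open>z\<close> reads a + b = 0, and the one for \<open>x\<close>, \<open>J y\<close>,
    \<open>J z\<close> reads b - a = 0.\<close>
  then show ?thesis
    using cyc[of x y z] cyc[of x "J y" "J z"] a b c skew[of z x y] by linarith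
qed

section \<open>The Levi-Civita connection in coordinates\<close>

definition levi_civita ::
  "('v::real_normed_vector \<Rightarrow> 'v \<Rightarrow> 'v \<Rightarrow> real) \<Rightarrow> 'v \<Rightarrow> ('v \<Rightarrow> 'v \<Rightarrow> 'v) \<Rightarrow> bool"
where
  "levi_civita b y \<Gamma> \<longleftrightarrow> bilinear \<Gamma> \<and> (\<forall>u v. \<Gamma> u v = \<Gamma> v u) \<and>
     (\<forall>z u v. dd (\<lambda>y. b y u v) y z = b y (\<Gamma> z u) v + b y u (\<Gamma> z v))"

text \<open>The Koszul formula for coordinate vector fields, whose Lie brackets vanish: the
  Christoffel symbols of the first kind.\<close>

definition koszul :: "('v::real_normed_vector \<Rightarrow> 'v \<Rightarrow> 'v \<Rightarrow> real) \<Rightarrow> 'v \<Rightarrow> 'v \<Rightarrow> 'v \<Rightarrow> 'v \<Rightarrow> real" where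
  "koszul b y u v w = (dd (\<lambda>y. b y v w) y u + dd (\<lambda>y. b y u w) y v - dd (\<lambda>y. b y u v) y w) / 2"

definition chr :: "(real ^ 'n \<Rightarrow> real ^ 'n \<Rightarrow> real ^ 'n \<Rightarrow> real) \<Rightarrow> real ^ 'n \<Rightarrow> real ^ 'n \<Rightarrow> real ^ 'n \<Rightarrow> real ^ 'n" where
  "chr b y u v = riesz (b y) (koszul b y u v)"

lemma levi_civita_koszul:
  assumes "\<And>y u v. b y u v = b y v u" "levi_civita b y \<Gamma>"
  shows "b y (\<Gamma> u v) w = koszul b y u v w"
proof -
  have s: "\<Gamma> u v = \<Gamma> v u" for u v using assms(2) by (auto simp: levi_civita_def)
  have m: "dd (\<lambda>y. b y u v) y z = b y (\<Gamma> z u) v + b y u (\<Gamma> z v)" for u v z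
    using assms(2) by (auto simp: levi_civita_def)
  show ?thesis
    unfolding koszul_def m
    using s[of v u] s[of w u] s[of w v] assms(1)[of y v "\<Gamma> u w"] assms(1)[of y u "\<Gamma> v w"] by simp
qed

lemma levi_civita_unique:
  fixes b :: "real ^ 'n \<Rightarrow> real ^ 'n \<Rightarrow> real ^ 'n \<Rightarrow> real"
  assumes "\<And>y u v. b y u v = b y v u" "levi_civita b y \<Gamma>" "bilinear (b y)" "posdef (b y)"
  shows "\<Gamma> = chr b y"
  unfolding chr_def[abs_def] using levi_civita_koszul[OF assms(1,2)]
  by (intro ext riesz_eqI[OF assms(3,4), symmetric])

lemma linear_dd_bilinear_family:
  assumes "smooth_bilinear T w" "z \<in> T"
  shows "linear (\<lambda>u. dd (\<lambda>z. w z u v) z x)" "linear (\<lambda>v. dd (\<lambda>z. w z u v) z x)" "linear (\<lambda>x. dd (\<lambda>z. w z u v) z x)"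
proof -
  have "smooth_linear T (\<lambda>z u. w z u v)" "smooth_linear T (\<lambda>z v. w z u v)" for u v
    using assms(1) by (auto simp: smooth_bilinear_def smooth_linear_def bilinear_def)
  from this[THEN linear_dd_linear_family[OF _ assms(2)]]
  show "linear (\<lambda>u. dd (\<lambda>z. w z u v) z x)" "linear (\<lambda>v. dd (\<lambda>z. w z u v) z x)" by auto
  show "linear (\<lambda>x. dd (\<lambda>z. w z u v) z x)"
    using assms by (auto simp: smooth_bilinear_def intro!: dd_linear smooth_on_differentiable)
qed

lemma koszul_linear:
  assumes "smooth_bilinear T b" "y \<in> T"
  shows "linear (koszul b y u v)" "linear (\<lambda>u. koszul b y u v w)" "linear (\<lambda>v. koszul b y u v w)"
  using linear_dd_bilinear_family[OF assms] unfolding koszul_def[abs_def]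
  by (auto simp: linear_iff algebra_simps add_divide_distrib diff_divide_distrib)

context
  fixes T and b :: "real ^ 'n \<Rightarrow> real ^ 'n \<Rightarrow> real ^ 'n \<Rightarrow> real"
  assumes b: "smooth_bilinear T b" and sym: "\<And>y u v. b y u v = b y v u" and pd: "\<And>y. y \<in> T \<Longrightarrow> posdef (b y)"
begin

lemma bl_b: "y \<in> T \<Longrightarrow> bilinear (b y)" using b by (simp add: smooth_bilinear_def)

lemma chr_koszul: "y \<in> T \<Longrightarrow> b y (chr b y u v) w = koszul b y u v w"
  unfolding chr_def by (rule riesz[OF bl_b pd koszul_linear(1)[OF b]])

lemma chr_levi_civita:
  assumes y: "y \<in> T" shows "levi_civita b y (chr b y)"
proof -
  note eqI = posdef_eqI[OF bl_b[OF y] pd[OF y]]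
  note k = chr_koszul[OF y]
  note kl = koszul_linear[OF b y]
  have "linear (\<lambda>u. chr b y u v)" for v
  proof (rule linearI)
    show "chr b y (u + u') v = chr b y u v + chr b y u' v" for u u'
      by (rule eqI) (simp add: bilinear_ladd[OF bl_b[OF y]] k linear_add[OF kl(2)])
    show "chr b y (r *\<^sub>R u) v = r *\<^sub>R chr b y u v" for r u
      by (rule eqI) (simp add: bilinear_lmul[OF bl_b[OF y]] k linear_cmul[OF kl(2)])
  qed
  moreover have s: "chr b y u v = chr b y v u" for u v
  proof (rule eqI)
    have "(\<lambda>y. b y u v) = (\<lambda>y. b y v u)" using sym by blast
    then show "b y (chr b y u v) w = b y (chr b y v u) w" for w unfolding k koszul_def by simp
  qed
  ultimately have "bilinear (chr b y)" unfolding bilinear_def by (metis (no_types, lifting) ext)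
  moreover have "dd (\<lambda>y. b y u v) y z = b y (chr b y z u) v + b y u (chr b y z v)" for u v z
  proof -
    have "(\<lambda>y. b y v u) = (\<lambda>y. b y u v)" "(\<lambda>y. b y z v) = (\<lambda>y. b y v z)" "(\<lambda>y. b y z u) = (\<lambda>y. b y u z)"
      using sym by blast+
    then show ?thesis unfolding sym[of y u] k koszul_def by (simp only:) (simp add: field_simps)
  qed
  ultimately show ?thesis using s by (auto simp: levi_civita_def)
qed

lemma smooth_chr: "smooth_bilinear T (chr b)"
  unfolding smooth_bilinear_def
proof (intro conjI ballI allI)
  show T: "open T" using b by (simp add: smooth_bilinear_def)
  show "bilinear (chr b y)" if "y \<in> T" for y using chr_levi_civita[OF that] by (simp add: levi_civita_def)
  show "smooth_on T (\<lambda>y. chr b y u v)" for u v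
    unfolding chr_def
  proof (rule smooth_on_riesz[OF b pd])
    have s: "smooth_on T (\<lambda>y. b y u v)" for u v using b by (simp add: smooth_bilinear_def)
    have "linear (dd (\<lambda>y. b y u v) y)" if "y \<in> T" for y u v
      by (rule dd_linear[OF smooth_on_differentiable[OF s that]])
    have "smooth_on T (\<lambda>y. koszul b y u v w)" for w
      unfolding koszul_def by (intro smooth_on_divide smooth_on_diff smooth_on_add T smooth_on_dd s smooth_on_const) simp
    then show "smooth_linear T (\<lambda>y. koszul b y u v)"
      using T koszul_linear(1)[OF b] unfolding smooth_linear_def by blast
  qed
qed

end

text \<open>\<open>L\<close> inverts the Jacobian of \<open>\<tau>\<close>, so the candidate is the
  classical transformation law of Christoffel symbols with its inhomogeneous second derivative term.
  It suffices to verify that the candidate is symmetric and metric, since uniqueness then identifies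
  it.\<close>

lemma levi_civita_pullback:
  fixes b :: "real ^ 'n \<Rightarrow> real ^ 'n \<Rightarrow> real ^ 'n \<Rightarrow> real" and \<tau> :: "real ^ 'n \<Rightarrow> real ^ 'n"
  assumes b: "smooth_bilinear T b" and \<tau>: "smooth_between S T \<tau>" and y: "y \<in> S"
    and lc: "levi_civita b (\<tau> y) \<Gamma>" and inv: "linear L" "\<And>v. dd \<tau> y (L v) = v"
    and eq: "\<And>y u v. y \<in> S \<Longrightarrow> b' y u v = b (\<tau> y) (dd \<tau> y u) (dd \<tau> y v)"
  shows "levi_civita b' y (\<lambda>u v. L (\<Gamma> (dd \<tau> y u) (dd \<tau> y v) + dd (\<lambda>y. dd \<tau> y v) y u))"
proof -
  have S: "open S" "smooth_on S \<tau>" and ty: "\<tau> y \<in> T" using \<tau> y by (auto simp: smooth_between_def)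
  have lt: "linear (dd \<tau> y)" by (rule dd_linear[OF smooth_on_differentiable[OF S(2) y]])
  have \<Gamma>: "bilinear \<Gamma>" "\<And>u v. \<Gamma> u v = \<Gamma> v u"
    "\<And>z u v. dd (\<lambda>y. b y u v) (\<tau> y) z = b (\<tau> y) (\<Gamma> z u) v + b (\<tau> y) u (\<Gamma> z v)"
    using lc by (auto simp: levi_civita_def)
  have sym: "dd (\<lambda>y. dd \<tau> y u) y v = dd (\<lambda>y. dd \<tau> y v) y u" for u v
    by (rule second_derivative_symmetric[OF S y])
  have l2: "linear (\<lambda>u. dd (\<lambda>y. dd \<tau> y v) y u)" for v
    by (rule dd_linear[OF smooth_on_differentiable[OF smooth_on_dd[OF S(2)] y]])
  have bl: "bilinear (\<lambda>u v. L (\<Gamma> (dd \<tau> y u) (dd \<tau> y v) + dd (\<lambda>y. dd \<tau> y v) y u))"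
  proof -
    have 1: "linear (\<lambda>u. L (\<Gamma> (dd \<tau> y u) (dd \<tau> y v) + dd (\<lambda>y. dd \<tau> y v) y u))" for v
      by (rule linearI) (simp_all add: linear_add[OF lt] linear_cmul[OF lt] bilinear_ladd[OF \<Gamma>(1)] bilinear_lmul[OF \<Gamma>(1)]
          linear_add[OF l2] linear_cmul[OF l2] linear_add[OF inv(1)] linear_cmul[OF inv(1)] scaleR_add_right)
    have "(\<lambda>v. L (\<Gamma> (dd \<tau> y u) (dd \<tau> y v) + dd (\<lambda>y. dd \<tau> y v) y u))
      = (\<lambda>v. L (\<Gamma> (dd \<tau> y v) (dd \<tau> y u) + dd (\<lambda>y. dd \<tau> y u) y v))" for u
      using \<Gamma>(2) sym by metis
    with 1 show ?thesis unfolding bilinear_def by simp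
  qed
  have bb: "bilinear (b (\<tau> y))" using b ty by (simp add: smooth_bilinear_def)
  have "dd (\<lambda>y. b' y u v) y z = b' y (L (\<Gamma> (dd \<tau> y z) (dd \<tau> y u) + dd (\<lambda>y. dd \<tau> y u) y z)) v
      + b' y u (L (\<Gamma> (dd \<tau> y z) (dd \<tau> y v) + dd (\<lambda>y. dd \<tau> y v) y z))" for u v z
  proof -
    have "dd (\<lambda>y. b' y u v) y = dd (\<lambda>y. b (\<tau> y) (dd \<tau> y u) (dd \<tau> y v)) y"
      by (rule dd_cong_open[OF S(1) y eq])
    then show ?thesis
      using dd_bilinear_pull[OF b \<tau> smooth_on_dd[OF S(2)] smooth_on_dd[OF S(2)] y, of u v z]
      unfolding eq[OF y] inv(2) \<Gamma>(3) by (simp add: bilinear_ladd[OF bb] bilinear_radd[OF bb])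
  qed
  then show ?thesis
    unfolding levi_civita_def using bl \<Gamma>(2) sym by metis
qed

section \<open>A Kaehler manifold in charts\<close>

locale kaehler_manifold =
  fixes B :: "('b::t2_space, 'n::finite) chart set" and h :: "'b \<Rightarrow> real ^ 'n \<Rightarrow> real ^ 'n \<Rightarrow> real"
    and J :: "'b \<Rightarrow> real ^ 'n \<Rightarrow> real ^ 'n"
  assumes atlas_B: "atlas B" and kaehler: "kaehler B h J"
begin

abbreviation \<omega> where "\<omega> \<equiv> kaehler_form h J"

abbreviation hd where "hd d \<equiv> chart_bilinear B d h"

abbreviation \<omega>d where "\<omega>d d \<equiv> chart_form2 B d \<omega>"

definition Jd :: "('b, 'n) chart \<Rightarrow> real ^ 'n \<Rightarrow> real ^ 'n \<Rightarrow> real ^ 'n" where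
  "Jd d y u = to_chart B d (chart_inv d y) (J (chart_inv d y) (from_chart B d (chart_inv d y) u))"

lemma chart_B: "d \<in> B \<Longrightarrow> is_chart d" by (rule atlasD(1)[OF atlas_B])

lemma metric_h: "riemannian_metric B h" using kaehler by (simp add: kaehler_def)

lemma h_metric: "bilinear (h q)" "posdef (h q)" "h q u v = h q v u"
  using metric_h by (auto simp: riemannian_metric_def posdef_def)

lemma J: "linear (J q)" "J q (J q v) = - v" "h q (J q u) (J q v) = h q u v"
  using kaehler by (auto simp: kaehler_def complex_structure_def)

lemma \<omega>_eq: "\<omega> q [u, v] = h q (J q u) v"
  by (simp add: kaehler_form_def)

lemma h_J: "h q (J q u) v = - h q u (J q v)"
  using J(3)[of q "J q u" v] by (simp add: J(2) bilinear_lneg[OF h_metric(1)])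

lemma \<omega>_alt: "\<omega> q [u, v] = - \<omega> q [v, u]"
  unfolding \<omega>_eq using h_J[of q u v] h_metric(3)[of q "J q v" u] by simp

lemma \<omega>_bilinear: "bilinear (\<lambda>u v. \<omega> q [u, v])"
  unfolding \<omega>_eq using h_metric(1)[of q] J(1)[of q] linear_compose[of "J q"]
  by (auto simp: bilinear_def o_def)

lemmas hd_smooth = chart_metric(1)[OF atlas_B metric_h]
lemmas hd_sym = chart_metric(2)[OF atlas_B metric_h]
lemmas hd_posdef = chart_metric(3)[OF atlas_B metric_h]

lemma Jd_facts:
  assumes d: "d \<in> B" "y \<in> chart_img d"
  shows "linear (Jd d y)" "Jd d y (Jd d y v) = - v" "hd d y (Jd d y u) (Jd d y v) = hd d y u v"
    "\<omega>d d y u v = hd d y (Jd d y u) v"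
proof -
  let ?q = "chart_inv d y"
  have q: "?q \<in> chart_dom d" using is_chartD(8)[OF chart_B[OF d(1)] d(2)] .
  note ft = from_to_chart[OF atlas_B d(1) q]
  show "linear (Jd d y)" unfolding Jd_def[abs_def]
    using linear_compose[OF linear_compose[OF ft(1) J(1)] ft(2)] by (simp add: o_def)
  show "Jd d y (Jd d y v) = - v" unfolding Jd_def by (simp add: ft(4) ft(3) J(2) linear_neg[OF ft(2)])
  show "hd d y (Jd d y u) (Jd d y v) = hd d y u v" "\<omega>d d y u v = hd d y (Jd d y u) v"
    unfolding chart_bilinear_def Jd_def ft(4) J(3) chart_form2_eq \<omega>_eq by simp_all
qed

text \<open>The chart \<open>e\<close> is merely compatible with \<open>B\<close>. The conclusions
  say that the Jacobian of the change to \<open>e\<close> turns \<open>Jd\<close> into the constant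
  \<open>J0\<close>, and that the Jacobians in the two directions are mutually inverse; this is all
  that is used of integrability.\<close>

lemma holomorphic_chart:
  assumes d: "d \<in> B" and y: "y \<in> chart_img d"
  obtains e J0 where "is_chart e" "smooth_transition d e" "smooth_transition e d" "y \<in> overlap d e" "linear J0"
    "\<And>z u. z \<in> overlap d e \<Longrightarrow> dd (coord_change d e) z (Jd d z u) = J0 (dd (coord_change d e) z u)"
    "\<And>z u. z \<in> overlap d e \<Longrightarrow> dd (coord_change e d) (coord_change d e z) (dd (coord_change d e) z u) = u"
    "\<And>z u. z \<in> overlap d e \<Longrightarrow> dd (coord_change d e) z (dd (coord_change e d) (coord_change d e z) u) = u"
proof -
  note ch = chart_B[OF d]
  have q: "chart_inv d y \<in> chart_dom d" using is_chartD(8)[OF ch y] .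
  obtain e J0 where e: "is_chart e" "chart_inv d y \<in> chart_dom e"
    "\<And>c. c \<in> B \<Longrightarrow> smooth_transition c e \<and> smooth_transition e c"
    "\<And>q' v. q' \<in> chart_dom e \<Longrightarrow> to_chart B e q' (J q' v) = J0 (to_chart B e q' v)"
    using kaehler unfolding kaehler_def complex_structure_def by metis
  have tr: "smooth_transition d e" "smooth_transition e d" using e(3)[OF d] by auto
  have yo: "y \<in> overlap d e" using y e(2) overlap_eq[OF ch] by auto
  have pt: "chart_inv d z \<in> chart_dom d" "chart_inv d z \<in> chart_dom e" "chart_map d (chart_inv d z) = z"
    "chart_map e (chart_inv d z) = coord_change d e z" if "z \<in> overlap d e" for z
    using that is_chartD[OF ch] overlap_eq[OF ch] by (auto simp: coord_change_def)
  have te: "to_chart B e q v = coord_D d e q (to_chart B d q v)" if "q \<in> chart_dom d" "q \<in> chart_dom e" for q v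
  proof -
    note ca = chart_at[OF atlas_B, of q]
    show ?thesis unfolding to_chart_trans
      by (rule coord_D_chain[symmetric, OF chart_B[OF ca(1)] ch e(1) atlasD(2)[OF atlas_B ca(1) d] tr(1) ca(2) that])
  qed
  have 1: "dd (coord_change d e) z (Jd d z u) = J0 (dd (coord_change d e) z u)" if "z \<in> overlap d e" for z u
  proof -
    note p = pt[OF that]
    have "coord_D d e (chart_inv d z) (Jd d z u) = to_chart B e (chart_inv d z) (J (chart_inv d z) (from_chart B d (chart_inv d z) u))"
      unfolding te[OF p(1,2)] Jd_def ..
    also have "\<dots> = J0 (coord_D d e (chart_inv d z) u)"
      by (simp only: e(4)[OF p(2)]) (simp only: te[OF p(1,2)] from_to_chart(3)[OF atlas_B d p(1)])
    finally show ?thesis unfolding coord_D_def p(3) .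
  qed
  have 2: "dd (coord_change e d) (coord_change d e z) (dd (coord_change d e) z u) = u" if "z \<in> overlap d e" for z u
    using coord_D_chain[OF ch e(1) ch tr pt(1,2,1)[OF that], of u] coord_D_refl[OF ch pt(1)[OF that], of u]
    unfolding coord_D_def pt(3,4)[OF that] by simp
  have 3: "dd (coord_change d e) z (dd (coord_change e d) (coord_change d e z) u) = u" if "z \<in> overlap d e" for z u
    using coord_D_chain[OF e(1) ch e(1) tr(2,1) pt(2,1,2)[OF that], of u] coord_D_refl[OF e(1) pt(2)[OF that], of u]
    unfolding coord_D_def pt(3,4)[OF that] by simp
  \<comment> \<open>The definition of \<open>complex_structure\<close> does not say that
    \<open>J0\<close> is linear. It is, being the linear map \<open>Jd d y\<close> conjugated by
    invertible Jacobians.\<close>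
  have "linear (\<lambda>w. dd (coord_change d e) y (Jd d y (dd (coord_change e d) (coord_change d e y) w)))"
  proof -
    have "linear (dd (coord_change d e) y)" "linear (dd (coord_change e d) (coord_change d e y))"
      using linear_coord_D[OF ch e(1) tr(1) pt(1,2)[OF yo]] linear_coord_D[OF e(1) ch tr(2) pt(2,1)[OF yo]]
      unfolding coord_D_def pt(3,4)[OF yo] by auto
    from linear_compose[OF linear_compose[OF this(2) Jd_facts(1)[OF d y]] this(1)] show ?thesis by (simp add: o_def)
  qed
  then have "linear J0" unfolding 1[OF yo] 3[OF yo] by (simp add: eta_contract_eq)
  then show thesis using that e(1) tr yo 1 2 3 by blast
qed

text \<open>Smoothness of \<open>J\<close> is not stated in \<open>complex_structure\<close> either.
  It follows because \<open>J\<close> is locally a constant map conjugated by the smooth Jacobians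
  of a holomorphic chart.\<close>

lemma Jd_smooth: assumes d: "d \<in> B" shows "smooth_linear (chart_img d) (Jd d)"
  unfolding smooth_linear_def
proof (intro conjI ballI allI)
  show "open (chart_img d)" by (rule is_chartD(2)[OF chart_B[OF d]])
  show "linear (Jd d y)" if "y \<in> chart_img d" for y by (rule Jd_facts(1)[OF d that])
  fix u
  show "smooth_on (chart_img d) (\<lambda>y. Jd d y u)"
  proof (rule smooth_on_local)
    fix y assume y: "y \<in> chart_img d"
    obtain e J0 where e: "is_chart e" "smooth_transition d e" "smooth_transition e d" "y \<in> overlap d e" "linear J0"
      "\<And>z u. z \<in> overlap d e \<Longrightarrow> dd (coord_change d e) z (Jd d z u) = J0 (dd (coord_change d e) z u)"
      "\<And>z u. z \<in> overlap d e \<Longrightarrow> dd (coord_change e d) (coord_change d e z) (dd (coord_change d e) z u) = u"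
      by (rule holomorphic_chart[OF d y]) blast
    let ?\<sigma> = "coord_change d e" and ?\<sigma>' = "coord_change e d" and ?S = "overlap d e"
    have sb: "smooth_between ?S (overlap e d) ?\<sigma>" "smooth_between (overlap e d) ?S ?\<sigma>'"
      by (intro smooth_between_coord_change chart_B d e)+
    have S: "open ?S" "smooth_on ?S ?\<sigma>" using sb(1) by (auto simp: smooth_between_def)
    have eq: "Jd d z u = dd ?\<sigma>' (?\<sigma> z) (J0 (dd ?\<sigma> z u))" if "z \<in> ?S" for z
      using e(6,7)[OF that] by metis
    have "smooth_linear (overlap e d) (dd ?\<sigma>')"
      using sb(2) by (auto simp: smooth_between_def intro: smooth_linear_dd)
    from smooth_linear_apply[OF smooth_linear_compose[OF this sb(1)]
        smooth_on_bounded_linear_compose[OF linear_conv_bounded_linear[THEN iffD1, OF e(5)] S(1) smooth_on_dd[OF S(2)]]]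
    have "smooth_on ?S (\<lambda>z. dd ?\<sigma>' (?\<sigma> z) (J0 (dd ?\<sigma> z u)))" .
    then have "smooth_on ?S (\<lambda>y. Jd d y u)" by (subst smooth_on_cong[OF S(1) eq])
    then show "\<exists>T. open T \<and> y \<in> T \<and> smooth_on T (\<lambda>y. Jd d y u)" using S(1) e(4) by blast
  qed
qed

lemma \<omega>d_smooth: assumes d: "d \<in> B" shows "smooth_bilinear (chart_img d) (\<omega>d d)"
  unfolding smooth_bilinear_def
proof (intro conjI ballI allI)
  show S: "open (chart_img d)" by (rule is_chartD(2)[OF chart_B[OF d]])
  show "bilinear (\<omega>d d y)" if "y \<in> chart_img d" for y
    unfolding chart_form2_def by (rule bilinear_chart_bilinear[OF atlas_B d that \<omega>_bilinear])
  show "smooth_on (chart_img d) (\<lambda>z. \<omega>d d z u v)" for u v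
    using smooth_bilinear_apply[OF hd_smooth[OF d] _ smooth_on_const] Jd_smooth[OF d]
    by (subst smooth_on_cong[OF S Jd_facts(4)[OF d]]) (auto simp: smooth_linear_def)
qed

lemma \<omega>_smooth_form: "smooth_form B 2 \<omega>"
proof (rule smooth_form2I[OF atlas_B _ \<omega>_bilinear])
  show "\<omega> p vs = 0" if "length vs \<noteq> 2" for p vs
    using that by (auto simp: kaehler_form_def split: list.splits)
  show "\<omega> p [v, v] = 0" for p v using \<omega>_alt[of p v v] by simp
  show "smooth_on (chart_img c) (\<lambda>y. \<omega>d c y u v)" if "c \<in> B" for c u v
    using \<omega>d_smooth[OF that] by (simp add: smooth_bilinear_def)
qed

lemma \<omega>d_alt: "\<omega>d d y u v = - \<omega>d d y v u"
  unfolding chart_form2_eq by (rule \<omega>_alt)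

text \<open>Vanishing of the Nijenhuis tensor, as symmetry in \<open>u\<close> and \<open>v\<close>.
  Differentiating the relation between \<open>Jd\<close> and the constant \<open>J0\<close>
  expresses the derivative of \<open>Jd\<close> through second derivatives \<open>s\<close> of the
  change to a holomorphic chart. After applying the Jacobian, only terms exchanged or fixed by
  swapping \<open>u\<close> and \<open>v\<close> remain, by symmetry of \<open>s\<close>.\<close>

lemma nijenhuis:
  assumes d: "d \<in> B" "y \<in> chart_img d"
  shows "dd (\<lambda>z. Jd d z v) y (Jd d y u) - Jd d y (dd (\<lambda>z. Jd d z v) y u)
    = dd (\<lambda>z. Jd d z u) y (Jd d y v) - Jd d y (dd (\<lambda>z. Jd d z u) y v)"
proof -
  obtain e J0 where e: "is_chart e" "smooth_transition d e" "smooth_transition e d" "y \<in> overlap d e" "linear J0"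
    "\<And>z u. z \<in> overlap d e \<Longrightarrow> dd (coord_change d e) z (Jd d z u) = J0 (dd (coord_change d e) z u)"
    "\<And>z u. z \<in> overlap d e \<Longrightarrow> dd (coord_change e d) (coord_change d e z) (dd (coord_change d e) z u) = u"
    "\<And>z u. z \<in> overlap d e \<Longrightarrow> dd (coord_change d e) z (dd (coord_change e d) (coord_change d e z) u) = u"
    by (rule holomorphic_chart[OF d]) blast
  let ?\<sigma> = "coord_change d e" and ?S = "overlap d e"
  have sb: "smooth_between ?S (overlap e d) ?\<sigma>"
    by (intro smooth_between_coord_change chart_B d e)
  have S: "open ?S" "smooth_on ?S ?\<sigma>" using sb by (auto simp: smooth_between_def)
  note y = e(4)
  define s where "s x u = dd (\<lambda>z. dd ?\<sigma> z u) y x" for x u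
  have s_sym: "s x u = s u x" for x u unfolding s_def by (rule second_derivative_symmetric[OF S y])
  have l\<sigma>: "linear (dd ?\<sigma> y)" by (rule dd_linear[OF smooth_on_differentiable[OF S(2) y]])
  have JS: "smooth_on ?S (\<lambda>z. Jd d z u)" for u
    using Jd_smooth[OF d(1)] overlap_eq[OF chart_B[OF d(1)], of e]
    by (auto simp: smooth_linear_def intro: smooth_on_subset)
  have J0J0: "J0 (J0 w) = - w" for w
  proof -
    obtain u where w: "w = dd ?\<sigma> y u" using e(8)[OF y] by metis
    show ?thesis unfolding w e(6)[OF y, symmetric] Jd_facts(2)[OF d] by (simp add: linear_neg[OF l\<sigma>])
  qed
  have dJ: "dd ?\<sigma> y (dd (\<lambda>z. Jd d z u) y x) = J0 (s x u) - s x (Jd d y u)" for x u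
  proof -
    have "dd (\<lambda>z. dd ?\<sigma> z (Jd d z u)) y x = s x (Jd d y u) + dd ?\<sigma> y (dd (\<lambda>z. Jd d z u) y x)"
      unfolding s_def by (rule dd_linear_apply[OF smooth_linear_dd[OF S] JS y])
    moreover have "dd (\<lambda>z. dd ?\<sigma> z (Jd d z u)) y = dd (\<lambda>z. J0 (dd ?\<sigma> z u)) y"
      by (rule dd_cong_open[OF S(1) y e(6)])
    moreover have "dd (\<lambda>z. J0 (dd ?\<sigma> z u)) y = (\<lambda>x. J0 (s x u))"
      unfolding s_def
      by (rule dd_eqI[OF bounded_linear.has_derivative[OF linear_conv_bounded_linear[THEN iffD1, OF e(5)]
            smooth_on_has_derivative[OF smooth_on_dd[OF S(2)] y]]])
    ultimately show ?thesis by simp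
  qed
  have main: "dd ?\<sigma> y (dd (\<lambda>z. Jd d z v) y (Jd d y u) - Jd d y (dd (\<lambda>z. Jd d z v) y u))
    = J0 (s (Jd d y u) v) - s (Jd d y u) (Jd d y v) + s u v + J0 (s u (Jd d y v))" for u v
    unfolding linear_diff[OF l\<sigma>] e(6)[OF y] dJ linear_diff[OF e(5)] J0J0 by simp
  have "dd ?\<sigma> y (dd (\<lambda>z. Jd d z v) y (Jd d y u) - Jd d y (dd (\<lambda>z. Jd d z v) y u))
    = dd ?\<sigma> y (dd (\<lambda>z. Jd d z u) y (Jd d y v) - Jd d y (dd (\<lambda>z. Jd d z u) y v))"
    unfolding main s_sym[of "Jd d y v" u] s_sym[of v u] s_sym[of "Jd d y u" v] s_sym[of "Jd d y u" "Jd d y v"] by simp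
  then show ?thesis using e(7)[OF y] by metis
qed

text \<open>\<open>kaehler\<close> gives closedness at each point \<open>q\<close> in the preferred
  chart of \<open>q\<close>, hence at one point of that chart only.
  \<open>closed_2form_pullback\<close> asks for closedness on an open set of coordinates, so its
  computation is repeated here at the single point.\<close>

lemma \<omega>_closed: assumes d: "d \<in> B" shows "closed_2form (chart_img d) (\<omega>d d)"
  unfolding closed_2form_def
proof (intro ballI allI)
  fix y a b c assume y: "y \<in> chart_img d"
  define q where "q = chart_inv d y"
  define d0 where "d0 = chart_at B q"
  note ch = chart_B[OF d]
  have q: "q \<in> chart_dom d" "chart_map d q = y" using is_chartD[OF ch] y by (auto simp: q_def)
  have d0: "d0 \<in> B" "q \<in> chart_dom d0" using chart_at[OF atlas_B] by (auto simp: d0_def)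
  note ch0 = chart_B[OF d0(1)]
  let ?\<tau> = "coord_change d d0" and ?S = "overlap d d0"
  have yS: "y \<in> ?S" using q d0 by (auto simp: overlap_def)
  have sb: "smooth_between ?S (chart_img d0) ?\<tau>"
    using smooth_between_coord_change[OF ch ch0 atlasD(2)[OF atlas_B d d0(1)]] overlap_eq[OF ch0, of d]
    by (auto simp: smooth_between_def)
  then have S: "open ?S" by (simp add: smooth_between_def)
  have \<tau>y: "?\<tau> y = chart_map d0 q" by (simp add: coord_change_def q_def)
  have sub: "?S \<subseteq> chart_img d" using overlap_eq[OF ch] by auto
  have cl0: "dd (\<lambda>z. \<omega>d d0 z b c) (?\<tau> y) a + dd (\<lambda>z. \<omega>d d0 z c a) (?\<tau> y) b + dd (\<lambda>z. \<omega>d d0 z a b) (?\<tau> y) c = 0" for a b c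
  proof -
    have "ext_deriv B \<omega> q [a, b, c] = 0" using kaehler by (simp add: kaehler_def)
    then have "dd (\<lambda>z. \<omega>d d0 z b c) (?\<tau> y) a - dd (\<lambda>z. \<omega>d d0 z a c) (?\<tau> y) b + dd (\<lambda>z. \<omega>d d0 z a b) (?\<tau> y) c = 0"
      unfolding ext_deriv_def Let_def d0_def[symmetric] \<tau>y[symmetric] chart_form2_eq
      by (simp add: eval_nat_numeral lessThan_Suc)
    moreover have "dd (\<lambda>z. \<omega>d d0 z c a) (?\<tau> y) = dd (\<lambda>z. - \<omega>d d0 z a c) (?\<tau> y)"
      by (rule arg_cong[where f = "\<lambda>f. dd f (?\<tau> y)"]) (use \<omega>d_alt in blast)
    moreover have "(\<lambda>z. \<omega>d d0 z a c) differentiable (at (?\<tau> y))"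
      using \<omega>d_smooth[OF d0(1)] sb yS by (auto simp: smooth_bilinear_def smooth_between_def intro!: smooth_on_differentiable)
    then have "dd (\<lambda>z. - \<omega>d d0 z a c) (?\<tau> y) = (\<lambda>x. - dd (\<lambda>z. \<omega>d d0 z a c) (?\<tau> y) x)"
      by (intro dd_eqI has_derivative_minus dd_has_derivative)
    ultimately show ?thesis by simp
  qed
  have eq: "\<omega>d d z u v = \<omega>d d0 (?\<tau> z) (dd ?\<tau> z u) (dd ?\<tau> z v)" if "z \<in> ?S" for z u v
    unfolding chart_form2_def by (rule chart_bilinear_change[OF atlas_B d d0(1) that])
  define T where "T = ?\<tau> ` ?S"
  have "dd (\<lambda>z. \<omega>d d z u v) y = dd (\<lambda>z. \<omega>d d0 (?\<tau> z) (dd ?\<tau> z u) (dd ?\<tau> z v)) y" for u v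
    by (rule dd_cong_open[OF S yS eq])
  note e1 = this
  have s\<tau>: "smooth_on ?S ?\<tau>" using sb by (simp add: smooth_between_def)
  have sym: "dd (\<lambda>y. dd ?\<tau> y u) y v = dd (\<lambda>y. dd ?\<tau> y v) y u" for u v
    by (rule second_derivative_symmetric[OF S s\<tau> yS])
  have e2: "dd (\<lambda>z. \<omega>d d0 (?\<tau> z) (dd ?\<tau> z u) (dd ?\<tau> z v)) y x
    = dd (\<lambda>z. \<omega>d d0 z (dd ?\<tau> y u) (dd ?\<tau> y v)) (?\<tau> y) (dd ?\<tau> y x)
      + \<omega>d d0 (?\<tau> y) (dd (\<lambda>y. dd ?\<tau> y u) y x) (dd ?\<tau> y v) + \<omega>d d0 (?\<tau> y) (dd ?\<tau> y u) (dd (\<lambda>y. dd ?\<tau> y v) y x)" for u v x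
    by (rule dd_bilinear_pull[OF \<omega>d_smooth[OF d0(1)] sb smooth_on_dd[OF s\<tau>] smooth_on_dd[OF s\<tau>] yS])
  have al: "\<omega>d d0 (?\<tau> y) (dd (\<lambda>y. dd ?\<tau> y u) y v) x + \<omega>d d0 (?\<tau> y) x (dd (\<lambda>y. dd ?\<tau> y v) y u) = 0" for u v x
    unfolding sym[of u v] using \<omega>d_alt[of d0 "?\<tau> y" x] by simp
  show "dd (\<lambda>z. \<omega>d d z b c) y a + dd (\<lambda>z. \<omega>d d z c a) y b + dd (\<lambda>z. \<omega>d d z a b) y c = 0"
    unfolding e1 e2 using cl0[of "dd ?\<tau> y a" "dd ?\<tau> y b" "dd ?\<tau> y c"]
      al[of b a "dd ?\<tau> y c"] al[of c b "dd ?\<tau> y a"] al[of a c "dd ?\<tau> y b"] by linarith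
qed

definition \<Gamma>d :: "('b, 'n) chart \<Rightarrow> real ^ 'n \<Rightarrow> real ^ 'n \<Rightarrow> real ^ 'n \<Rightarrow> real ^ 'n" where
  "\<Gamma>d d = chr (hd d)"

lemma \<Gamma>d_smooth: "d \<in> B \<Longrightarrow> smooth_bilinear (chart_img d) (\<Gamma>d d)"
  unfolding \<Gamma>d_def by (rule smooth_chr[OF hd_smooth hd_sym hd_posdef])

lemma \<Gamma>d_levi_civita: "d \<in> B \<Longrightarrow> y \<in> chart_img d \<Longrightarrow> levi_civita (hd d) y (\<Gamma>d d y)"
  unfolding \<Gamma>d_def by (rule chr_levi_civita[OF hd_smooth hd_sym hd_posdef])

lemma \<Gamma>d_facts:
  assumes "d \<in> B" "y \<in> chart_img d"
  shows "bilinear (\<Gamma>d d y)" "\<Gamma>d d y u v = \<Gamma>d d y v u"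
    "dd (\<lambda>z. hd d z u v) y x = hd d y (\<Gamma>d d y x u) v + hd d y u (\<Gamma>d d y x v)"
  using \<Gamma>d_levi_civita[OF assms] by (auto simp: levi_civita_def)

lemma \<Gamma>d_unique:
  assumes "d \<in> B" "y \<in> chart_img d" "levi_civita (hd d) y \<Gamma>"
  shows "\<Gamma> = \<Gamma>d d y"
  unfolding \<Gamma>d_def
  by (rule levi_civita_unique[OF hd_sym[OF assms(1)] assms(3) _ hd_posdef[OF assms(1,2)]])
     (use hd_smooth[OF assms(1)] assms(2) in \<open>simp add: smooth_bilinear_def\<close>)

text \<open>Existence and uniqueness of the Levi-Civita map justify the definite description. In the
  preferred chart of \<open>q\<close> the conversions of components at \<open>q\<close> are the
  identity.\<close>

lemma christoffel_eq: "christoffel B h q = \<Gamma>d (chart_at B q) (chart_map (chart_at B q) q)"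
proof -
  define d where "d = chart_at B q"
  have d: "d \<in> B" "q \<in> chart_dom d" using chart_at[OF atlas_B] by (auto simp: d_def)
  have y: "chart_map d q \<in> chart_img d" "chart_inv d (chart_map d q) = q"
    using is_chartD(5,6)[OF chart_B[OF d(1)] d(2)] by auto
  have hq: "h q u v = hd d (chart_map d q) u v" for u v
    unfolding chart_bilinear_def y(2) unfolding d_def to_chart_at[OF atlas_B] ..
  have "christoffel B h q = (THE \<Gamma>. levi_civita (hd d) (chart_map d q) \<Gamma>)"
    unfolding christoffel_def Let_def levi_civita_def d_def[symmetric] hq
    unfolding chart_bilinear_def ..
  also have "\<dots> = \<Gamma>d d (chart_map d q)"
    using \<Gamma>d_levi_civita[OF d(1) y(1)] \<Gamma>d_unique[OF d(1) y(1)] by (rule the_equality)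
  finally show ?thesis unfolding d_def .
qed

text \<open>The pulled-back connection is again Levi-Civita, so uniqueness identifies it with
  \<open>\<Gamma>d d\<close>.\<close>

lemma \<Gamma>d_change:
  assumes d: "d \<in> B" "d' \<in> B" and y: "y \<in> overlap d d'"
  shows "dd (coord_change d d') y (\<Gamma>d d y u v)
    = \<Gamma>d d' (coord_change d d' y) (dd (coord_change d d') y u) (dd (coord_change d d') y v)
      + dd (\<lambda>y. dd (coord_change d d') y v) y u"
proof -
  let ?\<tau> = "coord_change d d'" and ?S = "overlap d d'"
  note ch = chart_B[OF d(1)] chart_B[OF d(2)] and st = atlasD(2)[OF atlas_B d] atlasD(2)[OF atlas_B d(2,1)]
  have sb: "smooth_between ?S (chart_img d') ?\<tau>"
    using smooth_between_coord_change[OF ch st(1)] overlap_eq[OF ch(2), of d] by (auto simp: smooth_between_def)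
  have pt: "chart_inv d y \<in> chart_dom d" "chart_inv d y \<in> chart_dom d'" "chart_map d (chart_inv d y) = y"
    "chart_map d' (chart_inv d y) = ?\<tau> y" "y \<in> chart_img d"
    using y is_chartD[OF ch(1)] overlap_eq[OF ch(1)] by (auto simp: coord_change_def)
  have i: "dd ?\<tau> y (dd (coord_change d' d) (?\<tau> y) w) = w" for w
    using coord_D_chain[OF ch(2,1,2) st(2,1) pt(2,1,2), of w] coord_D_refl[OF ch(2) pt(2), of w]
    unfolding coord_D_def pt(3,4) by simp
  have l: "linear (dd (coord_change d' d) (?\<tau> y))"
    using linear_coord_D[OF ch(2,1) st(2) pt(2,1)] unfolding coord_D_def pt(4) .
  have ty: "?\<tau> y \<in> chart_img d'" using sb y by (auto simp: smooth_between_def)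
  have "levi_civita (hd d) y
      (\<lambda>u v. dd (coord_change d' d) (?\<tau> y) (\<Gamma>d d' (?\<tau> y) (dd ?\<tau> y u) (dd ?\<tau> y v) + dd (\<lambda>y. dd ?\<tau> y v) y u))"
    by (rule levi_civita_pullback[OF hd_smooth[OF d(2)] sb y \<Gamma>d_levi_civita[OF d(2) ty] l i])
       (rule chart_bilinear_change[OF atlas_B d])
  from fun_cong[OF fun_cong[OF \<Gamma>d_unique[OF d(1) pt(5) this], of u], of v]
  show ?thesis using i by metis
qed

text \<open>\<open>D\<close> is the covariant derivative of \<open>J\<close>, and \<open>hD\<close>
  identifies \<open>hd d y (D x u) v\<close> with the defect of the asserted identity. The
  hypotheses of \<open>kaehler_algebra\<close> have these sources: \<open>skew\<close> comes from
  antisymmetry of \<open>\<omega>\<close>, \<open>DJ\<close> from differentiating J J = -1,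
  \<open>N\<close> from \<open>nijenhuis\<close> and the symmetry of the Christoffel map, and
  \<open>cyc\<close> from closedness with the same symmetry.\<close>

theorem \<omega>_parallel:
  assumes d: "d \<in> B" "y \<in> chart_img d"
  shows "dd (\<lambda>z. \<omega>d d z u v) y x = \<omega>d d y (\<Gamma>d d y x u) v + \<omega>d d y u (\<Gamma>d d y x v)"
proof -
  note J = Jd_facts[OF d] and G = \<Gamma>d_facts[OF d]
  have S: "open (chart_img d)" by (rule is_chartD(2)[OF chart_B[OF d(1)]])
  have bh: "bilinear (hd d y)" using hd_smooth[OF d(1)] d(2) by (simp add: smooth_bilinear_def)
  have sJ: "smooth_on (chart_img d) (\<lambda>z. Jd d z u)" for u using Jd_smooth[OF d(1)] by (simp add: smooth_linear_def)
  define dJ where "dJ x u = dd (\<lambda>z. Jd d z u) y x" for x u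
  define D where "D x u = dJ x u + \<Gamma>d d y x (Jd d y u) - Jd d y (\<Gamma>d d y x u)" for x u
  note hl = bilinear_ladd[OF bh] bilinear_lsub[OF bh] bilinear_lneg[OF bh]
  have d\<omega>: "dd (\<lambda>z. \<omega>d d z u v) y x = hd d y (dJ x u) v + hd d y (\<Gamma>d d y x (Jd d y u)) v + hd d y (Jd d y u) (\<Gamma>d d y x v)" for x u v
  proof -
    have "dd (\<lambda>z. \<omega>d d z u v) y = dd (\<lambda>z. hd d z (Jd d z u) v) y"
      by (rule dd_cong_open[OF S d(2) Jd_facts(4)[OF d(1)]])
    moreover have "dd (\<lambda>z. hd d z (Jd d z u) v) y x = dd (\<lambda>z. hd d z (Jd d y u) v) y x + hd d y (dJ x u) v + hd d y (Jd d y u) (dd (\<lambda>_. v) y x)"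
      unfolding dJ_def by (rule dd_bilinear_apply[OF hd_smooth[OF d(1)] sJ smooth_on_const d(2)])
    ultimately show ?thesis using bilinear_rzero[OF bh] by (simp add: G(3))
  qed
  have hD: "hd d y (D x u) v = dd (\<lambda>z. \<omega>d d z u v) y x - \<omega>d d y (\<Gamma>d d y x u) v - \<omega>d d y u (\<Gamma>d d y x v)" for x u v
    unfolding d\<omega> D_def J(4) by (simp add: hl)
  have alt: "dd (\<lambda>z. \<omega>d d z u v) y x = - dd (\<lambda>z. \<omega>d d z v u) y x" for u v x
  proof -
    have "(\<lambda>z. \<omega>d d z u v) = (\<lambda>z. - \<omega>d d z v u)" using \<omega>d_alt by blast
    moreover have "((\<lambda>z. \<omega>d d z v u) has_derivative dd (\<lambda>z. \<omega>d d z v u) y) (at y)"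
      using \<omega>d_smooth[OF d(1)] d(2) by (auto simp: smooth_bilinear_def intro: smooth_on_has_derivative)
    ultimately show ?thesis using fun_cong[OF dd_eqI[OF has_derivative_minus], of _ _ y x] by metis
  qed
  have skew: "hd d y (D x u) v = - hd d y (D x v) u" for x u v
      unfolding hD using alt[of u v x] \<omega>d_alt[of d y "\<Gamma>d d y x u" v] \<omega>d_alt[of d y u "\<Gamma>d d y x v"] by linarith
  have DJ: "D x (Jd d y u) = - Jd d y (D x u)" for x u
    proof -
      have "dd (\<lambda>z. Jd d z (Jd d z u)) y x = dd (\<lambda>z. Jd d z (Jd d y u)) y x + Jd d y (dd (\<lambda>z. Jd d z u) y x)"
        by (rule dd_linear_apply[OF Jd_smooth[OF d(1)] sJ d(2)])
      moreover have "dd (\<lambda>z. Jd d z (Jd d z u)) y = dd (\<lambda>_. - u) y"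
        by (rule dd_cong_open[OF S d(2) Jd_facts(2)[OF d(1)]])
      ultimately have e: "dJ x (Jd d y u) = - Jd d y (dJ x u)" by (simp add: dJ_def eq_neg_iff_add_eq_0)
      show ?thesis
        unfolding D_def e J(2) linear_add[OF J(1)] linear_diff[OF J(1)] bilinear_rneg[OF G(1)] by simp
    qed
  have N: "D (Jd d y u) v - Jd d y (D u v) = D (Jd d y v) u - Jd d y (D v u)" for u v
    proof -
      have e: "D (Jd d y u) v - Jd d y (D u v) = (dJ (Jd d y u) v - Jd d y (dJ u v))
        + \<Gamma>d d y (Jd d y u) (Jd d y v) - Jd d y (\<Gamma>d d y (Jd d y u) v) - Jd d y (\<Gamma>d d y u (Jd d y v)) - \<Gamma>d d y u v" for u v
        unfolding D_def linear_add[OF J(1)] linear_diff[OF J(1)] J(2) by simp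
      have n: "dJ (Jd d y u) v - Jd d y (dJ u v) = dJ (Jd d y v) u - Jd d y (dJ v u)"
        unfolding dJ_def by (rule nijenhuis[OF d])
      show ?thesis
        unfolding e n G(2)[of "Jd d y v" "Jd d y u"] G(2)[of "Jd d y v" u] G(2)[of v "Jd d y u"] G(2)[of v u]
        by (simp add: algebra_simps)
    qed
  have cyc: "hd d y (D x u) v + hd d y (D u v) x + hd d y (D v x) u = 0" for x u v
    proof -
      have "dd (\<lambda>z. \<omega>d d z u v) y x + dd (\<lambda>z. \<omega>d d z v x) y u + dd (\<lambda>z. \<omega>d d z x u) y v = 0"
        using \<omega>_closed[OF d(1)] d(2) unfolding closed_2form_def by blast
      then show ?thesis
        unfolding hD using \<omega>d_alt[of d y "\<Gamma>d d y x u" v] \<omega>d_alt[of d y "\<Gamma>d d y u v" x] \<omega>d_alt[of d y "\<Gamma>d d y v x" u]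
          G(2)[of u x] G(2)[of v u] G(2)[of x v] by simp
    qed
  have "hd d y (D x u) v = 0"
    by (rule kaehler_algebra[of "hd d y" "Jd d y" D x u v, OF bh hd_sym[OF d(1)] J(1,2,3) skew DJ N cyc])
  then show ?thesis unfolding hD by simp
qed

end

section \<open>Maps and families of maps in charts\<close>

locale riemannian_to_kaehler = compact_riemannian A g + kaehler_manifold B h J
  for A :: "('a::t2_space, 'm::finite) chart set" and g
    and B :: "('b::t2_space, 'n::finite) chart set" and h J
begin

definition rep :: "('a, 'm) chart \<Rightarrow> ('b, 'n) chart \<Rightarrow> ('a \<Rightarrow> 'b) \<Rightarrow> real ^ 'm \<Rightarrow> real ^ 'n" where
  "rep c d \<psi> y = chart_map d (\<psi> (chart_inv c y))"

definition rdom :: "('a, 'm) chart \<Rightarrow> ('b, 'n) chart \<Rightarrow> ('a \<Rightarrow> 'b) \<Rightarrow> (real ^ 'm) set" where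
  "rdom c d \<psi> = {y \<in> chart_img c. \<psi> (chart_inv c y) \<in> chart_dom d}"

lemma open_rdom:
  assumes "smooth_map A B \<psi>" "c \<in> A" "d \<in> B"
  shows "open (rdom c d \<psi>)"
proof -
  have "open (\<psi> -` chart_dom d)"
    using assms(1) by (auto simp: smooth_map_def intro: open_vimage is_chartD(1)[OF chart_B[OF assms(3)]])
  from open_chart_image[OF chart_A[OF assms(2)] this] show ?thesis
    unfolding chart_image_Int[OF chart_A[OF assms(2)]] rdom_def by (simp add: vimage_def)
qed

lemma smooth_between_rep:
  assumes "smooth_map A B \<psi>" "c \<in> A" "d \<in> B"
  shows "smooth_between (rdom c d \<psi>) (chart_img d) (rep c d \<psi>)"
proof -
  have "chart_map c ` (chart_dom c \<inter> \<psi> -` chart_dom d) = rdom c d \<psi>"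
    unfolding chart_image_Int[OF chart_A[OF assms(2)]] rdom_def by auto
  moreover have "chart_map d \<circ> \<psi> \<circ> chart_inv c = rep c d \<psi>" by (simp add: rep_def fun_eq_iff)
  ultimately have "smooth_on (rdom c d \<psi>) (rep c d \<psi>)"
    using assms unfolding smooth_map_def by metis
  then show ?thesis
    using open_rdom[OF assms] is_chartD(6)[OF chart_B[OF assms(3)]]
    unfolding smooth_between_def by (auto simp: rdom_def rep_def)
qed

text \<open>\<open>tangent_map\<close> is the Jacobian in the preferred charts. Factoring the local
  representative through them shows that it is given by the Jacobian in any other pair of charts as
  well.\<close>

lemma tangent_map_chart:
  assumes \<psi>: "smooth_map A B \<psi>" and c: "c \<in> A" "p \<in> chart_dom c" and d: "d \<in> B" "\<psi> p \<in> chart_dom d"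
  shows "to_chart B d (\<psi> p) (tangent_map A B \<psi> p (from_chart A c p v)) = dd (rep c d \<psi>) (chart_map c p) v"
proof -
  define c0 d0 where "c0 = chart_at A p" and "d0 = chart_at B (\<psi> p)"
  have c0: "c0 \<in> A" "p \<in> chart_dom c0" using chart_at[OF atlas_A] by (auto simp: c0_def)
  have d0: "d0 \<in> B" "\<psi> p \<in> chart_dom d0" using chart_at[OF atlas_B] by (auto simp: d0_def)
  note chc = chart_A[OF c(1)] and chc0 = chart_A[OF c0(1)] and chd = chart_B[OF d(1)] and chd0 = chart_B[OF d0(1)]
  let ?y = "chart_map c p" and ?\<tau> = "coord_change c c0" and ?\<sigma> = "coord_change d0 d" and ?r = "rep c0 d0 \<psi>"
  let ?S = "chart_map c ` (chart_dom c \<inter> (chart_dom c0 \<inter> \<psi> -` (chart_dom d \<inter> chart_dom d0)))"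
  have inv: "chart_inv c ?y = p" "chart_inv c0 (chart_map c0 p) = p" using is_chartD(5)[OF chc c(2)] is_chartD(5)[OF chc0 c0(2)] by auto
  have \<tau>y: "?\<tau> ?y = chart_map c0 p" by (simp add: coord_change_def inv)
  have ry: "?r (chart_map c0 p) = chart_map d0 (\<psi> p)" by (simp add: rep_def inv)
  have cont: "continuous_on UNIV \<psi>" using \<psi> by (simp add: smooth_map_def)
  have op: "open ?S"
    by (intro open_chart_image chc open_Int open_vimage cont is_chartD(1) chc0 chd chd0)
  have dif: "?\<tau> differentiable (at ?y)" "?\<sigma> differentiable (at (chart_map d0 (\<psi> p)))"
    using coord_change_differentiable[OF chc chc0 atlasD(2)[OF atlas_A c(1) c0(1)] c(2) c0(2)]
      coord_change_differentiable[OF chd0 chd atlasD(2)[OF atlas_B d0(1) d(1)] d0(2) d(2)] by auto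
  have "chart_map c0 p \<in> rdom c0 d0 \<psi>"
    using is_chartD(6)[OF chc0 c0(2)] d0(2) by (simp add: rdom_def inv)
  then have difr: "?r differentiable (at (chart_map c0 p))"
    using smooth_between_rep[OF \<psi> c0(1) d0(1)] by (auto simp: smooth_between_def intro: smooth_on_differentiable)
  have "dd (rep c d \<psi>) ?y = dd (\<lambda>y. ?\<sigma> (?r (?\<tau> y))) ?y"
  proof (rule dd_cong_open[OF op])
    fix y assume "y \<in> ?S"
    then show "rep c d \<psi> y = ?\<sigma> (?r (?\<tau> y))"
      using is_chartD(5)[OF chc] is_chartD(5)[OF chc0] is_chartD(5)[OF chd0]
      by (auto simp: rep_def coord_change_def)
  qed (use c c0 d d0 in blast)
  also have "\<dots> = (\<lambda>v. dd ?\<sigma> (chart_map d0 (\<psi> p)) (dd (\<lambda>y. ?r (?\<tau> y)) ?y v))"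
    using dd_compose[of ?\<sigma> "\<lambda>y. ?r (?\<tau> y)" ?y] dif difr has_derivative_compose[OF dd_has_derivative[OF dif(1)], of ?r "dd ?r (?\<tau> ?y)"]
    unfolding \<tau>y ry using dd_has_derivative[OF difr] by (auto simp: differentiable_def)
  also have "\<dots> = (\<lambda>v. dd ?\<sigma> (chart_map d0 (\<psi> p)) (dd ?r (chart_map c0 p) (dd ?\<tau> ?y v)))"
    using dd_compose[of ?r ?\<tau> ?y] dif difr unfolding \<tau>y by simp
  finally have e: "dd (rep c d \<psi>) ?y v = dd ?\<sigma> (chart_map d0 (\<psi> p)) (dd ?r (chart_map c0 p) (dd ?\<tau> ?y v))" by (rule fun_cong)
  have "tangent_map A B \<psi> p = dd ?r (chart_map c0 p)"
    unfolding tangent_map_def c0_def[symmetric] d0_def[symmetric] rep_def[abs_def] o_def ..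
  then show ?thesis
    unfolding e to_chart_trans from_chart_trans coord_D_def c0_def[symmetric] d0_def[symmetric] by simp
qed

lemma tangent_map_from_chart:
  assumes \<psi>: "smooth_map A B \<psi>" and c: "c \<in> A" "p \<in> chart_dom c" and d: "d \<in> B" "\<psi> p \<in> chart_dom d"
  shows "tangent_map A B \<psi> p (from_chart A c p v) = from_chart B d (\<psi> p) (dd (rep c d \<psi>) (chart_map c p) v)"
  unfolding tangent_map_chart[OF assms, symmetric] from_to_chart(4)[OF atlas_B d] ..

lemma linear_tangent_map:
  assumes \<psi>: "smooth_map A B \<psi>" shows "linear (tangent_map A B \<psi> p)"
proof -
  note c = chart_at[OF atlas_A, of p] and d = chart_at[OF atlas_B, of "\<psi> p"]
  have "chart_map (chart_at A p) p \<in> rdom (chart_at A p) (chart_at B (\<psi> p)) \<psi>"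
    using is_chartD(5,6)[OF chart_A[OF c(1)] c(2)] d(2) by (simp add: rdom_def)
  then have "linear (dd (rep (chart_at A p) (chart_at B (\<psi> p)) \<psi>) (chart_map (chart_at A p) p))"
    using smooth_between_rep[OF \<psi> c(1) d(1)] by (auto simp: smooth_between_def intro: dd_linear smooth_on_differentiable)
  moreover have "tangent_map A B \<psi> p = dd (rep (chart_at A p) (chart_at B (\<psi> p)) \<psi>) (chart_map (chart_at A p) p)"
    using tangent_map_from_chart[OF \<psi> c d] by (simp add: to_chart_at[OF atlas_A] to_chart_at[OF atlas_B] fun_eq_iff)
  ultimately show ?thesis by simp
qed

lemma rdomD:
  assumes "y \<in> rdom c d \<psi>" "c \<in> A" "d \<in> B"
  shows "y \<in> chart_img c" "chart_inv c y \<in> chart_dom c" "chart_map c (chart_inv c y) = y"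
    "\<psi> (chart_inv c y) \<in> chart_dom d" "chart_inv d (rep c d \<psi> y) = \<psi> (chart_inv c y)" "rep c d \<psi> y \<in> chart_img d"
  using assms is_chartD[OF chart_A[OF assms(2)]] is_chartD[OF chart_B[OF assms(3)]]
  by (auto simp: rdom_def rep_def)

lemma pullback_chart:
  assumes "smooth_map A B \<psi>" "c \<in> A" "d \<in> B" "y \<in> rdom c d \<psi>"
  shows "chart_form2 A c (pullback A B \<psi> \<omega>) y u v
    = \<omega>d d (rep c d \<psi> y) (dd (rep c d \<psi>) y u) (dd (rep c d \<psi>) y v)"
  using tangent_map_from_chart[OF assms(1,2) _ assms(3), of "chart_inv c y"] rdomD[OF assms(4,2,3)]
  by (simp add: chart_form2_eq pullback_def)

lemma pullback_contraction_chart: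
  assumes "smooth_map A B \<psi>" "c \<in> A" "d \<in> B" "y \<in> rdom c d \<psi>"
  shows "chart_form1 A c (pullback_contraction A B \<psi> Y \<omega>) y v
    = \<omega>d d (rep c d \<psi> y) (to_chart B d (\<psi> (chart_inv c y)) (Y (chart_inv c y))) (dd (rep c d \<psi>) y v)"
  using tangent_map_from_chart[OF assms(1,2) _ assms(3), of "chart_inv c y"] rdomD[OF assms(4,2,3)]
    from_to_chart(4)[OF atlas_B assms(3), of "\<psi> (chart_inv c y)"]
  by (simp add: chart_form2_eq chart_form1_def pullback_contraction_def)

lemma rdom_cover:
  assumes "c \<in> A" "y \<in> chart_img c"
  obtains d where "d \<in> B" "y \<in> rdom c d \<psi>"
  using chart_at[OF atlas_B, of "\<psi> (chart_inv c y)"] assms by (auto simp: rdom_def)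

lemma smooth_pullback:
  assumes \<psi>: "smooth_map A B \<psi>" shows "smooth_form A 2 (pullback A B \<psi> \<omega>)"
proof (rule smooth_form2I[OF atlas_A])
  note l = linear_tangent_map[OF \<psi>]
  show "pullback A B \<psi> \<omega> p vs = 0" if "length vs \<noteq> 2" for p vs
    using that smooth_form2D(1)[OF \<omega>_smooth_form] by (simp add: pullback_def)
  show "bilinear (\<lambda>u v. pullback A B \<psi> \<omega> p [u, v])" for p
    using bilinear_compose_linear[OF \<omega>_bilinear l] by (simp add: pullback_def)
  show "pullback A B \<psi> \<omega> p [v, v] = 0" for p v
    using smooth_form2D(3)[OF \<omega>_smooth_form] by (simp add: pullback_def)
  fix c u v assume c: "c \<in> A"
  show "smooth_on (chart_img c) (\<lambda>y. chart_form2 A c (pullback A B \<psi> \<omega>) y u v)"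
  proof (rule smooth_on_local)
    fix y assume "y \<in> chart_img c"
    then obtain d where d: "d \<in> B" "y \<in> rdom c d \<psi>" using rdom_cover[OF c] by metis
    note sb = smooth_between_rep[OF \<psi> c d(1)]
    then have S: "open (rdom c d \<psi>)" "smooth_on (rdom c d \<psi>) (rep c d \<psi>)" by (auto simp: smooth_between_def)
    have "smooth_on (rdom c d \<psi>) (\<lambda>y. chart_form2 A c (pullback A B \<psi> \<omega>) y u v)"
      by (subst smooth_on_cong[OF S(1) pullback_chart[OF \<psi> c d(1)]], assumption)
         (rule smooth_bilinear_apply[OF smooth_bilinear_compose[OF \<omega>d_smooth[OF d(1)] sb] smooth_on_dd[OF S(2)] smooth_on_dd[OF S(2)]])
    then show "\<exists>T. open T \<and> y \<in> T \<and> smooth_on T (\<lambda>y. chart_form2 A c (pullback A B \<psi> \<omega>) y u v)" using S(1) d(2) by blast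
  qed
qed

lemma smooth_section_chart:
  assumes "smooth_section A B \<psi> Y" "c \<in> A" "d \<in> B"
  shows "smooth_on (rdom c d \<psi>) (\<lambda>y. to_chart B d (\<psi> (chart_inv c y)) (Y (chart_inv c y)))"
proof -
  have e: "chart_map c ` (chart_dom c \<inter> \<psi> -` chart_dom d) = rdom c d \<psi>"
    unfolding chart_image_Int[OF chart_A[OF assms(2)]] rdom_def by auto
  have "smooth_on (chart_map c ` (chart_dom c \<inter> \<psi> -` chart_dom d))
      (\<lambda>y. to_chart B d (\<psi> (chart_inv c y)) (Y (chart_inv c y)))"
    using assms unfolding smooth_section_def by blast
  then show ?thesis unfolding e .
qed

lemma smooth_pullback_contraction:
  assumes \<psi>: "smooth_map A B \<psi>" and Y: "smooth_section A B \<psi> Y"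
  shows "smooth_form A 1 (pullback_contraction A B \<psi> Y \<omega>)"
proof (rule smooth_form1I[OF atlas_A])
  show "pullback_contraction A B \<psi> Y \<omega> p vs = 0" if "length vs \<noteq> 1" for p vs
    using that smooth_form2D(1)[OF \<omega>_smooth_form] by (simp add: pullback_contraction_def)
  show "linear (\<lambda>v. pullback_contraction A B \<psi> Y \<omega> p [v])" for p
    using linear_compose[OF linear_tangent_map[OF \<psi>], of "\<lambda>v. \<omega> (\<psi> p) [Y p, v]"] \<omega>_bilinear[of "\<psi> p"]
    by (simp add: pullback_contraction_def bilinear_def o_def)
  fix c u assume c: "c \<in> A"
  show "smooth_on (chart_img c) (\<lambda>y. chart_form1 A c (pullback_contraction A B \<psi> Y \<omega>) y u)"
  proof (rule smooth_on_local)
    fix y assume "y \<in> chart_img c"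
    then obtain d where d: "d \<in> B" "y \<in> rdom c d \<psi>" using rdom_cover[OF c] by metis
    note sb = smooth_between_rep[OF \<psi> c d(1)]
    then have S: "open (rdom c d \<psi>)" "smooth_on (rdom c d \<psi>) (rep c d \<psi>)" by (auto simp: smooth_between_def)
    have "smooth_on (rdom c d \<psi>) (\<lambda>y. chart_form1 A c (pullback_contraction A B \<psi> Y \<omega>) y u)"
      by (subst smooth_on_cong[OF S(1) pullback_contraction_chart[OF \<psi> c d(1)]], assumption)
         (rule smooth_bilinear_apply[OF smooth_bilinear_compose[OF \<omega>d_smooth[OF d(1)] sb] smooth_section_chart[OF Y c d(1)] smooth_on_dd[OF S(2)]])
    then show "\<exists>T. open T \<and> y \<in> T \<and> smooth_on T (\<lambda>y. chart_form1 A c (pullback_contraction A B \<psi> Y \<omega>) y u)" using S(1) d(2) by blast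
  qed
qed

end

section \<open>Two-parameter families of maps in charts\<close>

lemma dd_slice:
  fixes f :: "'a::euclidean_space \<times> 'b::euclidean_space \<Rightarrow> 'c::real_normed_vector"
  assumes "f differentiable (at (s, y))"
  shows "dd (\<lambda>y. f (s, y)) y v = dd f (s, y) (0, v)" "dd (\<lambda>s. f (s, y)) s w = dd f (s, y) (w, 0)"
    "(\<lambda>y. f (s, y)) differentiable (at y)" "(\<lambda>s. f (s, y)) differentiable (at s)"
proof -
  have 1: "((\<lambda>y. (s, y)) has_derivative (\<lambda>v. (0, v))) (at y)" "((\<lambda>s. (s, y)) has_derivative (\<lambda>w. (w, 0))) (at s)"
    by (auto intro!: derivative_eq_intros)
  note 2 = has_derivative_compose[OF 1(1) dd_has_derivative[OF assms]] has_derivative_compose[OF 1(2) dd_has_derivative[OF assms]]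
  show "dd (\<lambda>y. f (s, y)) y v = dd f (s, y) (0, v)" "dd (\<lambda>s. f (s, y)) s w = dd f (s, y) (w, 0)"
    using dd_eqI[OF 2(1)] dd_eqI[OF 2(2)] by auto
  show "(\<lambda>y. f (s, y)) differentiable (at y)" "(\<lambda>s. f (s, y)) differentiable (at s)"
    using 2 by (auto simp: differentiable_def)
qed

lemma smooth_on_slice:
  fixes f :: "'a::euclidean_space \<times> 'b::euclidean_space \<Rightarrow> 'c::real_normed_vector"
  assumes "smooth_on D f" "open S" "\<And>y. y \<in> S \<Longrightarrow> (s, y) \<in> D"
  shows "smooth_on S (\<lambda>y. f (s, y))"
  by (rule smooth_on_compose[OF assms(1) _ assms(2,3)])
     (intro smooth_on_Pair assms(2) smooth_on_const smooth_on_id)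

lemma smooth_on_slice':
  fixes f :: "'a::euclidean_space \<times> 'b::euclidean_space \<Rightarrow> 'c::real_normed_vector"
  assumes "smooth_on D f" "open S" "\<And>s. s \<in> S \<Longrightarrow> (s, y) \<in> D"
  shows "smooth_on S (\<lambda>s. f (s, y))"
  by (rule smooth_on_compose[OF assms(1) _ assms(2,3)])
     (intro smooth_on_Pair assms(2) smooth_on_const smooth_on_id)

locale map_family = riemannian_to_kaehler A g B h J
  for A :: "('a::t2_space, 'm::finite) chart set" and g
    and B :: "('b::t2_space, 'n::finite) chart set" and h J +
  fixes U :: "(real \<times> real) set" and \<Phi> :: "real \<times> real \<Rightarrow> 'a \<Rightarrow> 'b"
  assumes open_U: "open U" and zero_U: "(0, 0) \<in> U" and family: "smooth_family A B U \<Phi>"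
begin

text \<open>Parameters and point are kept in one argument, so that derivatives in parameter
  directions and along \<open>M\<close> are directional derivatives of a single smooth function and
  commute.\<close>

definition FF :: "('a, 'm) chart \<Rightarrow> ('b, 'n) chart \<Rightarrow> (real \<times> real) \<times> (real ^ 'm) \<Rightarrow> real ^ 'n" where
  "FF c d x = rep c d (\<Phi> (fst x)) (snd x)"

definition fdom :: "('a, 'm) chart \<Rightarrow> ('b, 'n) chart \<Rightarrow> ((real \<times> real) \<times> (real ^ 'm)) set" where
  "fdom c d = {x. fst x \<in> U \<and> snd x \<in> rdom c d (\<Phi> (fst x))}"

lemma continuous_family: "continuous_on (U \<times> UNIV) (\<lambda>x. \<Phi> (fst x) (snd x))"
  using family by (simp add: smooth_family_def case_prod_unfold)

lemma open_fdom:
  assumes c: "c \<in> A" and d: "d \<in> B" shows "open (fdom c d)"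
proof -
  have "continuous_on (U \<times> chart_img c) (\<lambda>x. \<Phi> (fst x) (chart_inv c (snd x)))"
    by (rule continuous_on_compose2[OF continuous_family, of _ "\<lambda>x. (fst x, chart_inv c (snd x))", simplified])
       (auto intro!: continuous_intros continuous_on_compose2[OF is_chartD(4)[OF chart_A[OF c]]])
  from continuous_open_preimage[OF this open_Times[OF open_U is_chartD(2)[OF chart_A[OF c]]] is_chartD(1)[OF chart_B[OF d]]]
  have "open (U \<times> chart_img c \<inter> (\<lambda>x. \<Phi> (fst x) (chart_inv c (snd x))) -` chart_dom d)" .
  moreover have "U \<times> chart_img c \<inter> (\<lambda>x. \<Phi> (fst x) (chart_inv c (snd x))) -` chart_dom d = fdom c d"
    by (auto simp: fdom_def rdom_def)
  ultimately show ?thesis by simp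
qed

lemma smooth_between_FF:
  assumes c: "c \<in> A" and d: "d \<in> B" shows "smooth_between (fdom c d) (chart_img d) (FF c d)"
proof -
  have e: "{(s, y). s \<in> U \<and> y \<in> chart_img c \<and> \<Phi> s (chart_inv c y) \<in> chart_dom d} = fdom c d"
    by (auto simp: fdom_def rdom_def)
  have e': "(\<lambda>(s, y). chart_map d (\<Phi> s (chart_inv c y))) = FF c d"
    by (auto simp: FF_def rep_def)
  have "smooth_on {(s, y). s \<in> U \<and> y \<in> chart_img c \<and> \<Phi> s (chart_inv c y) \<in> chart_dom d}
      (\<lambda>(s, y). chart_map d (\<Phi> s (chart_inv c y)))"
    using family c d unfolding smooth_family_def by blast
  then have "smooth_on (fdom c d) (FF c d)" unfolding e e' .
  moreover have "FF c d x \<in> chart_img d" if "x \<in> fdom c d" for x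
    using rdomD(6)[of "snd x" c d "\<Phi> (fst x)"] that c d unfolding fdom_def FF_def by blast
  ultimately show ?thesis
    using open_fdom[OF c d] unfolding smooth_between_def by blast
qed

lemma smooth_FF: "c \<in> A \<Longrightarrow> d \<in> B \<Longrightarrow> smooth_on (fdom c d) (FF c d)"
  using smooth_between_FF by (simp add: smooth_between_def)

lemma family_smooth_map:
  assumes s: "s \<in> U" shows "smooth_map A B (\<Phi> s)"
  unfolding smooth_map_def
proof (intro conjI ballI)
  show cont: "continuous_on UNIV (\<Phi> s)"
    by (rule continuous_on_compose2[OF continuous_family, of UNIV "\<lambda>p. (s, p)", simplified])
       (use s continuous_on_Pair1 in auto)
  fix c d assume c: "c \<in> A" and d: "d \<in> B"
  have op: "open (chart_map c ` (chart_dom c \<inter> \<Phi> s -` chart_dom d))"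
    by (intro open_chart_image chart_A c open_vimage cont is_chartD(1)[OF chart_B[OF d]])
  have "smooth_on (chart_map c ` (chart_dom c \<inter> \<Phi> s -` chart_dom d)) (\<lambda>y. FF c d (s, y))"
    by (rule smooth_on_slice[OF smooth_FF[OF c d] op])
       (use s in \<open>auto simp: fdom_def rdom_def chart_image_Int[OF chart_A[OF c]]\<close>)
  then show "smooth_on (chart_map c ` (chart_dom c \<inter> \<Phi> s -` chart_dom d)) (chart_map d \<circ> \<Phi> s \<circ> chart_inv c)"
    by (simp add: FF_def rep_def o_def)
qed

lemma dd_rep_FF:
  assumes "c \<in> A" "d \<in> B" "(s, y) \<in> fdom c d"
  shows "dd (rep c d (\<Phi> s)) y v = dd (FF c d) (s, y) (0, v)"
  using dd_slice(1)[OF smooth_on_differentiable[OF smooth_FF[OF assms(1,2)] assms(3)]]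
  by (simp add: FF_def)

lemma fdomD:
  assumes "(s, y) \<in> fdom c d" shows "s \<in> U" "y \<in> rdom c d (\<Phi> s)"
  using assms by (auto simp: fdom_def)

end

text \<open>\<open>velocity\<close> differentiates in the preferred chart at
  \<open>\<gamma> 0\<close>; by the chain rule the result transforms as a tangent vector.\<close>

lemma velocity_chart:
  assumes B: "atlas B" and d: "d \<in> B" "\<gamma> 0 \<in> chart_dom d" and I: "open I" "0 \<in> I" and \<gamma>: "continuous_on I \<gamma>"
    and dif: "\<And>d. d \<in> B \<Longrightarrow> \<gamma> 0 \<in> chart_dom d \<Longrightarrow> (\<lambda>t. chart_map d (\<gamma> t)) differentiable (at 0)"
  shows "to_chart B d (\<gamma> 0) (velocity B \<gamma>) = dd (\<lambda>t. chart_map d (\<gamma> t)) 0 1"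
proof -
  define d0 where "d0 = chart_at B (\<gamma> 0)"
  have d0: "d0 \<in> B" "\<gamma> 0 \<in> chart_dom d0" using chart_at[OF B] by (auto simp: d0_def)
  note ch = atlasD(1)[OF B d(1)] and ch0 = atlasD(1)[OF B d0(1)]
  have v: "velocity B \<gamma> = dd (\<lambda>t. chart_map d0 (\<gamma> t)) 0 1"
    unfolding velocity_def d0_def[symmetric] frechet_derivative_eq_vector_derivative[OF dif[OF d0]] by simp
  have op: "open (I \<inter> \<gamma> -` (chart_dom d \<inter> chart_dom d0))"
    by (intro continuous_open_preimage \<gamma> I open_Int is_chartD(1) ch ch0)
  have "dd (\<lambda>t. chart_map d (\<gamma> t)) 0 = dd (\<lambda>t. coord_change d0 d (chart_map d0 (\<gamma> t))) 0"
    by (rule dd_cong_open[OF op]) (use I d d0 is_chartD(5)[OF ch0] in \<open>auto simp: coord_change_def\<close>)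
  also have "\<dots> = (\<lambda>t. dd (coord_change d0 d) (chart_map d0 (\<gamma> 0)) (dd (\<lambda>t. chart_map d0 (\<gamma> t)) 0 t))"
    using dd_compose[of "coord_change d0 d" "\<lambda>t. chart_map d0 (\<gamma> t)" 0] dif[OF d0]
      coord_change_differentiable[OF ch0 ch atlasD(2)[OF B d0(1) d(1)] d0(2) d(2)] by simp
  finally show ?thesis unfolding v to_chart_trans coord_D_def d0_def[symmetric] by simp
qed

context map_family
begin

lemma velocity_t:
  assumes c: "c \<in> A" and d: "d \<in> B" and x: "((s, 0), y) \<in> fdom c d"
  shows "to_chart B d (\<Phi> (s, 0) (chart_inv c y)) (velocity B (\<lambda>t. \<Phi> (s, t) (chart_inv c y))) = dd (FF c d) ((s, 0), y) ((0, 1), 0)"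
proof -
  let ?p = "chart_inv c y"
  let ?I = "{t. (s, t) \<in> U}"
  have I: "open ?I"
    using open_vimage[OF open_U continuous_on_Pair1[of UNIV s]] by (simp add: vimage_def)
  have y: "y \<in> chart_img c" and s: "(s, 0) \<in> U" using fdomD[OF x] by (auto simp: rdom_def)
  have \<gamma>: "continuous_on ?I (\<lambda>t. \<Phi> (s, t) ?p)"
    by (rule continuous_on_compose2[OF continuous_family, of _ "\<lambda>t. ((s, t), ?p)", simplified])
       (auto intro!: continuous_intros)
  have line: "((\<lambda>t. ((s, t), y)) has_derivative (\<lambda>t. ((0, t), 0))) (at 0)"
    by (auto intro!: derivative_eq_intros)
  have fd: "((s, 0), y) \<in> fdom c d'" if "\<Phi> (s, 0) ?p \<in> chart_dom d'" for d'
    using that s y by (auto simp: fdom_def rdom_def)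
  have hd: "((\<lambda>t. chart_map d' (\<Phi> (s, t) ?p)) has_derivative (\<lambda>t. dd (FF c d') ((s, 0), y) ((0, t), 0))) (at 0)"
    if "d' \<in> B" "\<Phi> (s, 0) ?p \<in> chart_dom d'" for d'
    using has_derivative_compose[OF line smooth_on_has_derivative[OF smooth_FF[OF c that(1)] fd[OF that(2)]]]
    by (simp add: FF_def rep_def)
  have pd: "\<Phi> (s, 0) ?p \<in> chart_dom d" using fdomD(2)[OF x] by (simp add: rdom_def)
  have "to_chart B d (\<Phi> (s, 0) ?p) (velocity B (\<lambda>t. \<Phi> (s, t) ?p)) = dd (\<lambda>t. chart_map d (\<Phi> (s, t) ?p)) 0 1"
    by (rule velocity_chart[OF atlas_B d, of "\<lambda>t. \<Phi> (s, t) ?p", OF pd I _ \<gamma>])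
       (use s hd in \<open>auto simp: differentiable_def\<close>)
  also have "\<dots> = dd (FF c d) ((s, 0), y) ((0, 1), 0)" using dd_eqI[OF hd[OF d pd]] by simp
  finally show ?thesis .
qed

lemma velocity_s:
  assumes c: "c \<in> A" and d: "d \<in> B" and x: "((0, 0), y) \<in> fdom c d"
  shows "to_chart B d (\<Phi> (0, 0) (chart_inv c y)) (velocity B (\<lambda>s. \<Phi> (s, 0) (chart_inv c y))) = dd (FF c d) ((0, 0), y) ((1, 0), 0)"
proof -
  let ?p = "chart_inv c y"
  let ?I = "{s. (s, 0) \<in> U}"
  have "continuous_on UNIV (\<lambda>s::real. (s, 0::real))" by (intro continuous_intros)
  from open_vimage[OF open_U this] have I: "open ?I" by (simp add: vimage_def)
  have y: "y \<in> chart_img c" and s: "(0, 0) \<in> U" using fdomD[OF x] by (auto simp: rdom_def)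
  have \<gamma>: "continuous_on ?I (\<lambda>t. \<Phi> (t, 0) ?p)"
    by (rule continuous_on_compose2[OF continuous_family, of _ "\<lambda>t. ((t, 0), ?p)", simplified])
       (auto intro!: continuous_intros)
  have line: "((\<lambda>t. ((t, 0), y)) has_derivative (\<lambda>t. ((t, 0), 0))) (at 0)"
    by (auto intro!: derivative_eq_intros)
  have fd: "((0, 0), y) \<in> fdom c d'" if "\<Phi> (0, 0) ?p \<in> chart_dom d'" for d'
    using that s y by (auto simp: fdom_def rdom_def)
  have hd: "((\<lambda>t. chart_map d' (\<Phi> (t, 0) ?p)) has_derivative (\<lambda>t. dd (FF c d') ((0, 0), y) ((t, 0), 0))) (at 0)"
    if "d' \<in> B" "\<Phi> (0, 0) ?p \<in> chart_dom d'" for d'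
    using has_derivative_compose[OF line smooth_on_has_derivative[OF smooth_FF[OF c that(1)] fd[OF that(2)]]]
    by (simp add: FF_def rep_def)
  have pd: "\<Phi> (0, 0) ?p \<in> chart_dom d" using fdomD(2)[OF x] by (simp add: rdom_def)
  have "to_chart B d (\<Phi> (0, 0) ?p) (velocity B (\<lambda>s. \<Phi> (s, 0) ?p)) = dd (\<lambda>s. chart_map d (\<Phi> (s, 0) ?p)) 0 1"
    by (rule velocity_chart[OF atlas_B d, of "\<lambda>s. \<Phi> (s, 0) ?p", OF pd I _ \<gamma>])
       (use s hd in \<open>auto simp: differentiable_def\<close>)
  also have "\<dots> = dd (FF c d) ((0, 0), y) ((1, 0), 0)" using dd_eqI[OF hd[OF d pd]] by simp
  finally show ?thesis .
qed

end

section \<open>The second variation of the energy\<close>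

lemma has_real_derivative_slice:
  fixes f :: "real \<times> 'b::euclidean_space \<Rightarrow> real"
  assumes "f differentiable (at (t, y))"
  shows "((\<lambda>t. f (t, y)) has_real_derivative dd f (t, y) (1, 0)) (at t)"
proof -
  have l: "linear (dd f (t, y))" using dd_linear[OF assms] .
  have "dd f (t, y) (w, 0) = w * dd f (t, y) (1, 0)" for w
    using linear_cmul[OF l, of w "(1, 0)"] by simp
  then have "dd (\<lambda>t. f (t, y)) t = (*) (dd f (t, y) (1, 0))"
    by (intro ext) (metis dd_slice(2)[OF assms] mult.commute)
  then show ?thesis
    using dd_has_derivative[OF dd_slice(4)[OF assms]] unfolding has_field_derivative_def by simp
qed

lemma dd_real: "(f has_real_derivative D) (at t) \<Longrightarrow> dd f t 1 = D"
  unfolding has_field_derivative_def by (drule dd_eqI) simp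

context compact_riemannian
begin

text \<open>With a fixed partition of unity the integral is a finite sum of integrals over charts,
  whose supports do not depend on the parameter, so each may be differentiated under the integral
  sign.\<close>

lemma vol_integral_derivative:
  fixes e :: "real \<Rightarrow> 'a \<Rightarrow> real"
  assumes I: "open I" "t0 \<in> I"
    and e: "\<And>c. c \<in> A \<Longrightarrow> smooth_on (I \<times> chart_img c) (\<lambda>x. e (fst x) (chart_inv c (snd x)))"
  shows "((\<lambda>t. vol_integral A g (e t)) has_real_derivative vol_integral A g (\<lambda>p. dd (\<lambda>t. e t p) t0 1)) (at t0)"
proof -
  \<comment> \<open>A ball, because \<open>leibniz_compact_support\<close> asks for a convex set of
    parameters.\<close>
  obtain r where r: "0 < r" "ball t0 r \<subseteq> I" using I by (meson open_contains_ball)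
  let ?I = "ball t0 r"
  obtain n \<kappa> \<rho> where P: "pou n \<kappa> \<rho>" by (rule pou_exists)
  define F where "F c x = e (fst x) (chart_inv c (snd x))" for c and x :: "real \<times> (real ^ 'm)"
  have sF: "smooth_on (?I \<times> chart_img c) (F c)" and op: "open (?I \<times> chart_img c)" if "c \<in> A" for c
    using e[OF that] r is_chartD(2)[OF chart_A[OF that]]
    by (auto simp: F_def[abs_def] intro!: open_Times elim!: smooth_on_subset)
  have der: "((\<lambda>t. e t (chart_inv c y)) has_real_derivative dd (F c) (t, y) (1, 0)) (at t)"
    if "c \<in> A" "t \<in> ?I" "y \<in> chart_img c" for c t y
    using has_real_derivative_slice[OF smooth_on_differentiable[OF sF[OF that(1)]], of t y] that
    by (simp add: F_def)
  have smt: "smooth_fun A (e t)" if "t \<in> ?I" for t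
    unfolding smooth_fun_def
    by (intro ballI smooth_on_slice[OF sF, where s = t, unfolded F_def fst_conv snd_conv])
       (use that is_chartD(2)[OF chart_A] in auto)
  have cont: "continuous_on UNIV (e t)" if "t \<in> ?I" for t
    using smooth_fun_continuous[OF atlas_A smt[OF that]] .
  have t0: "t0 \<in> ?I" using r by simp
  have d0: "dd (\<lambda>t. e t (chart_inv c y)) t0 1 = dd (F c) (t0, y) (1, 0)" if "c \<in> A" "y \<in> chart_img c" for c y
    using dd_real[OF der[OF that(1) t0 that(2)]] .
  have "smooth_on (chart_img c) (\<lambda>y. dd (\<lambda>t. e t (chart_inv c y)) t0 1)" if c: "c \<in> A" for c
    by (subst smooth_on_cong[OF is_chartD(2)[OF chart_A[OF c]] d0[OF c]], assumption)
       (rule smooth_on_slice[OF smooth_on_dd[OF sF[OF c], of "(1,0)"]], use t0 is_chartD(2)[OF chart_A[OF c]] in auto)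
  then have cont': "continuous_on UNIV (\<lambda>p. dd (\<lambda>t. e t p) t0 1)"
    by (intro smooth_fun_continuous[OF atlas_A]) (auto simp: smooth_fun_def)
  have "((\<lambda>t. chart_integral (\<kappa> i) (\<lambda>p. \<rho> i p * e t p)) has_real_derivative
      chart_integral (\<kappa> i) (\<lambda>p. \<rho> i p * dd (\<lambda>t. e t p) t0 1)) (at t0)" if i: "i < n" for i
  proof -
    note c = pouD(1)[OF P i]
    let ?c = "\<kappa> i"
    have S: "open (chart_img ?c)" "compact (chart_map ?c ` msupp (\<rho> i))" "chart_map ?c ` msupp (\<rho> i) \<subseteq> chart_img ?c"
      using is_chartD(2)[OF chart_A[OF c]] chart_image_compact[OF c pouD(5,6)[OF P i]] by auto
    have cr: "continuous_on (?I \<times> chart_img ?c) (\<lambda>x. \<rho> i (chart_inv ?c (snd x)))"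
      by (rule continuous_on_compose2[OF pouD(4)[OF P i]])
         (auto intro!: continuous_on_compose2[OF is_chartD(4)[OF chart_A[OF c]]] continuous_intros)
    have cv: "continuous_on (?I \<times> chart_img ?c) (\<lambda>x. vol ?c (snd x))"
      by (rule continuous_on_compose2[OF smooth_on_continuous[OF smooth_vol[OF c]]]) (auto intro!: continuous_intros)
    have z: "\<rho> i (chart_inv ?c y) = 0" if "y \<in> chart_img ?c - chart_map ?c ` msupp (\<rho> i)" for y
      using pouD(7)[OF P i chart_off_support[OF c that]] .
    have "((\<lambda>t. LINT y:chart_img ?c|lborel. \<rho> i (chart_inv ?c y) * e t (chart_inv ?c y) * vol ?c y) has_real_derivative
        (LINT y:chart_img ?c|lborel. \<rho> i (chart_inv ?c y) * dd (F ?c) (t0, y) (1, 0) * vol ?c y)) (at t0)"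
    proof (rule leibniz_compact_support[where I = ?I and f' = "\<lambda>t y. \<rho> i (chart_inv ?c y) * dd (F ?c) (t, y) (1, 0) * vol ?c y", OF _ _ t0 S])
      show "continuous_on (?I \<times> chart_img ?c) (\<lambda>(t, y). \<rho> i (chart_inv ?c y) * e t (chart_inv ?c y) * vol ?c y)"
        using smooth_on_continuous[OF sF[OF c]] cr cv unfolding case_prod_unfold F_def by (intro continuous_intros)
      show "continuous_on (?I \<times> chart_img ?c) (\<lambda>(t, y). \<rho> i (chart_inv ?c y) * dd (F ?c) (t, y) (1, 0) * vol ?c y)"
        using smooth_on_continuous[OF smooth_on_dd[OF sF[OF c], of "(1,0)"]] cr cv unfolding case_prod_unfold by (intro continuous_intros) simp_all
      fix t y assume "t \<in> ?I" "y \<in> chart_img ?c"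
      from DERIV_cmult_right[OF DERIV_cmult[OF der[OF c this]]]
      show "((\<lambda>t. \<rho> i (chart_inv ?c y) * e t (chart_inv ?c y) * vol ?c y) has_real_derivative
         \<rho> i (chart_inv ?c y) * dd (F ?c) (t, y) (1, 0) * vol ?c y) (at t)" .
    qed (simp_all add: z)
    moreover have "(LINT y:chart_img ?c|lborel. \<rho> i (chart_inv ?c y) * dd (F ?c) (t0, y) (1, 0) * vol ?c y)
        = chart_integral ?c (\<lambda>p. \<rho> i p * dd (\<lambda>t. e t p) t0 1)"
      unfolding chart_integral_def using is_chartD(2)[OF chart_A[OF c]]
      by (intro set_lebesgue_integral_cong) (auto simp: d0[OF c])
    ultimately show ?thesis unfolding chart_integral_def by simp
  qed
  then have "((\<lambda>t. \<Sum>i<n. chart_integral (\<kappa> i) (\<lambda>p. \<rho> i p * e t p)) has_real_derivative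
      (\<Sum>i<n. chart_integral (\<kappa> i) (\<lambda>p. \<rho> i p * dd (\<lambda>t. e t p) t0 1))) (at t0)"
    by (intro DERIV_sum) simp
  then have D: "((\<lambda>t. \<Sum>i<n. chart_integral (\<kappa> i) (\<lambda>p. \<rho> i p * e t p)) has_real_derivative
      vol_integral A g (\<lambda>p. dd (\<lambda>t. e t p) t0 1)) (at t0)"
    unfolding vol_integral_eq[OF P cont'] .
  show ?thesis
    by (rule has_field_derivative_transform_within_open[OF D open_ball t0])
       (simp only: vol_integral_eq[OF P cont])
qed

end

context map_family
begin

text \<open>
  In coordinates, the pull-back of \<open>\<omega>\<close> under the map \<open>(s, t, p) \<mapsto> \<Phi> (s, t) p\<close>. It is closed, and
  its components in the directions of \<open>M\<close> and of the parameters are the forms to be differentiated.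
\<close>

definition \<K> :: "('a, 'm) chart \<Rightarrow> (real \<times> real) \<times> (real ^ 'm) \<Rightarrow> (real \<times> real) \<times> (real ^ 'm) \<Rightarrow> (real \<times> real) \<times> (real ^ 'm) \<Rightarrow> real" where
  "\<K> c a b x = (let d = chart_at B (\<Phi> (fst x) (chart_inv c (snd x))) in
     \<omega>d d (FF c d x) (dd (FF c d) x a) (dd (FF c d) x b))"

lemma fdom_iff: "x \<in> fdom c d \<longleftrightarrow> x \<in> U \<times> chart_img c \<and> \<Phi> (fst x) (chart_inv c (snd x)) \<in> chart_dom d"
  by (auto simp: fdom_def rdom_def mem_Times_iff)

lemma dd_FF_change:
  assumes c: "c \<in> A" and d: "d \<in> B" "d' \<in> B" and x: "x \<in> fdom c d" "x \<in> fdom c d'"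
  shows "FF c d x \<in> overlap d d'" "FF c d' x = coord_change d d' (FF c d x)"
    "dd (FF c d') x = (\<lambda>a. dd (coord_change d d') (FF c d x) (dd (FF c d) x a))"
proof -
  have op: "open (fdom c d \<inter> fdom c d')" by (intro open_Int open_fdom c d)
  note ch = chart_B[OF d(1)] and ch' = chart_B[OF d(2)]
  have e: "FF c d' x = coord_change d d' (FF c d x)" if "x \<in> fdom c d \<inter> fdom c d'" for x
    using that is_chartD(5)[OF ch] by (simp add: FF_def rep_def coord_change_def fdom_iff)
  show ov: "FF c d x \<in> overlap d d'"
    using x is_chartD(5,6)[OF ch] by (simp add: overlap_eq[OF ch] FF_def rep_def fdom_iff)
  show "FF c d' x = coord_change d d' (FF c d x)" using e x by simp
  have "coord_change d d' differentiable (at (FF c d x))"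
    using smooth_between_coord_change[OF ch ch' atlasD(2)[OF atlas_B d]] ov
    by (auto simp: smooth_between_def intro: smooth_on_differentiable)
  then have "dd (\<lambda>x. coord_change d d' (FF c d x)) x = (\<lambda>a. dd (coord_change d d') (FF c d x) (dd (FF c d) x a))"
    by (intro dd_compose smooth_on_differentiable[OF smooth_FF[OF c d(1)] x(1)])
  moreover have "dd (FF c d') x = dd (\<lambda>x. coord_change d d' (FF c d x)) x"
    by (rule dd_cong_open[OF op _ e]) (use x in auto)
  ultimately show "dd (FF c d') x = (\<lambda>a. dd (coord_change d d') (FF c d x) (dd (FF c d) x a))" by simp
qed

lemma \<K>_eq:
  assumes c: "c \<in> A" and d: "d \<in> B" and x: "x \<in> fdom c d"
  shows "\<K> c a b x = \<omega>d d (FF c d x) (dd (FF c d) x a) (dd (FF c d) x b)"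
proof -
  let ?d = "chart_at B (\<Phi> (fst x) (chart_inv c (snd x)))"
  have d': "?d \<in> B" "x \<in> fdom c ?d"
    using chart_at[OF atlas_B] x unfolding fdom_iff by blast+
  note e = dd_FF_change[OF c d'(1) d d'(2) x]
  show ?thesis
    unfolding \<K>_def Let_def e(2,3) chart_form2_def
    by (rule chart_bilinear_change[OF atlas_B d'(1) d e(1)])
qed

lemma fdom_at:
  assumes "x \<in> U \<times> chart_img c"
  obtains d where "d \<in> B" "x \<in> fdom c d"
  using chart_at[OF atlas_B] assms unfolding fdom_iff by blast

lemma \<K>_alt: "c \<in> A \<Longrightarrow> x \<in> U \<times> chart_img c \<Longrightarrow> \<K> c a b x = - \<K> c b a x"
  by (metis fdom_at \<K>_eq \<omega>d_alt)

lemma open_cyl: "c \<in> A \<Longrightarrow> open (U \<times> chart_img c)"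
  by (intro open_Times open_U is_chartD(2)[OF chart_A])

lemma smooth_\<K>:
  assumes c: "c \<in> A" shows "smooth_on (U \<times> chart_img c) (\<K> c a b)"
proof (rule smooth_on_local)
  fix x assume "x \<in> U \<times> chart_img c"
  then obtain d where d: "d \<in> B" "x \<in> fdom c d" by (rule fdom_at)
  note sb = smooth_between_FF[OF c d(1)]
  have S: "open (fdom c d)" "smooth_on (fdom c d) (FF c d)" using sb by (auto simp: smooth_between_def)
  have "smooth_on (fdom c d) (\<K> c a b)"
    by (subst smooth_on_cong[OF S(1) \<K>_eq[OF c d(1)]], assumption)
       (rule smooth_bilinear_apply[OF smooth_bilinear_compose[OF \<omega>d_smooth[OF d(1)] sb] smooth_on_dd[OF S(2)] smooth_on_dd[OF S(2)]])
  then show "\<exists>T. open T \<and> x \<in> T \<and> smooth_on T (\<K> c a b)" using S(1) d(2) by blast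
qed

text \<open>Cartan's formula for a constant field \<open>e\<close>: the Lie derivative of a closed
  form is the exterior derivative of its contraction with \<open>e\<close>. For \<open>e\<close> a
  parameter direction this trades a parameter derivative for derivatives along
  \<open>M\<close>.\<close>

lemma \<K>_closed:
  assumes c: "c \<in> A" and x: "x \<in> U \<times> chart_img c"
  shows "dd (\<K> c a b) x e = dd (\<K> c e b) x a - dd (\<K> c e a) x b"
proof -
  obtain d where d: "d \<in> B" "x \<in> fdom c d" using x by (rule fdom_at)
  let ?w = "\<lambda>y u v. \<omega>d d (FF c d y) (dd (FF c d) y u) (dd (FF c d) y v)"
  have "closed_2form (fdom c d) ?w"
    by (rule closed_2form_pullback[OF \<omega>d_smooth[OF d(1)] \<omega>d_alt \<omega>_closed[OF d(1)] smooth_between_FF[OF c d(1)]])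
  then have "dd (\<lambda>z. ?w z a b) x e + dd (\<lambda>z. ?w z b e) x a + dd (\<lambda>z. ?w z e a) x b = 0"
    using d(2) unfolding closed_2form_def by blast
  moreover have "dd (\<lambda>z. ?w z u v) x = dd (\<K> c u v) x" for u v
    by (rule dd_cong_open[OF open_fdom[OF c d(1)] d(2)]) (simp add: \<K>_eq[OF c d(1)])
  moreover have "dd (\<K> c b e) x = dd (\<lambda>z. - \<K> c e b z) x"
    by (rule dd_cong_open[OF open_cyl[OF c] x \<K>_alt[OF c]])
  moreover have "dd (\<lambda>z. - \<K> c e b z) x a = - dd (\<K> c e b) x a"
    using dd_eqI[OF has_derivative_minus[OF smooth_on_has_derivative[OF smooth_\<K>[OF c] x]]] by simp
  ultimately show ?thesis by simp
qed

lemma pullback_\<K>: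
  assumes c: "c \<in> A" and s: "s \<in> U" and y: "y \<in> chart_img c"
  shows "chart_form2 A c (pullback A B (\<Phi> s) \<omega>) y u v = \<K> c (0, u) (0, v) (s, y)"
proof -
  obtain d where d: "d \<in> B" "(s, y) \<in> fdom c d" using s y by (auto intro: fdom_at)
  show ?thesis
    unfolding \<K>_eq[OF c d] pullback_chart[OF family_smooth_map[OF s] c d(1) fdomD(2)[OF d(2)]] dd_rep_FF[OF c d]
    by (simp add: FF_def)
qed

text \<open>Only \<open>t = 0\<close> occurs: the mixed derivative takes the derivative in
  \<open>t\<close> at 0 for each small \<open>s\<close>, and then differentiates in
  \<open>s\<close>.\<close>

definition \<eta>t :: "real \<Rightarrow> ('a, 'm) form" where
  "\<eta>t s = pullback_contraction A B (\<Phi> (s, 0)) (\<lambda>p. velocity B (\<lambda>t. \<Phi> (s, t) p)) \<omega>"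

definition \<eta>s :: "('a, 'm) form" where
  "\<eta>s = pullback_contraction A B (\<Phi> (0, 0)) (\<lambda>p. velocity B (\<lambda>s. \<Phi> (s, 0) p)) \<omega>"

lemma \<eta>t_\<K>:
  assumes c: "c \<in> A" and s: "(s, 0) \<in> U" and y: "y \<in> chart_img c"
  shows "chart_form1 A c (\<eta>t s) y v = \<K> c ((0, 1), 0) (0, v) ((s, 0), y)"
proof -
  obtain d where d: "d \<in> B" "((s, 0), y) \<in> fdom c d" using s y by (auto intro: fdom_at)
  show ?thesis
    unfolding \<eta>t_def \<K>_eq[OF c d] pullback_contraction_chart[OF family_smooth_map[OF s] c d(1) fdomD(2)[OF d(2)]]
      dd_rep_FF[OF c d] velocity_t[OF c d]
    by (simp add: FF_def)
qed

lemma \<eta>s_\<K>: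
  assumes c: "c \<in> A" and y: "y \<in> chart_img c"
  shows "chart_form1 A c \<eta>s y v = \<K> c ((1, 0), 0) (0, v) ((0, 0), y)"
proof -
  obtain d where d: "d \<in> B" "((0, 0), y) \<in> fdom c d" using zero_U y by (auto intro: fdom_at)
  show ?thesis
    unfolding \<eta>s_def \<K>_eq[OF c d] pullback_contraction_chart[OF family_smooth_map[OF zero_U] c d(1) fdomD(2)[OF d(2)]]
      dd_rep_FF[OF c d] velocity_s[OF c d]
    by (simp add: FF_def)
qed

lemma smooth_velocity_t:
  assumes s: "(s, 0) \<in> U"
  shows "smooth_section A B (\<Phi> (s, 0)) (\<lambda>p. velocity B (\<lambda>t. \<Phi> (s, t) p))"
  unfolding smooth_section_def
proof (intro ballI)
  fix c d assume c: "c \<in> A" and d: "d \<in> B"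
  have e: "chart_map c ` (chart_dom c \<inter> \<Phi> (s, 0) -` chart_dom d) = rdom c d (\<Phi> (s, 0))"
    unfolding chart_image_Int[OF chart_A[OF c]] rdom_def by auto
  note op = open_rdom[OF family_smooth_map[OF s] c d]
  have mem: "((s, 0), y) \<in> fdom c d" if "y \<in> rdom c d (\<Phi> (s, 0))" for y
    using that s by (simp add: fdom_def)
  show "smooth_on (chart_map c ` (chart_dom c \<inter> \<Phi> (s, 0) -` chart_dom d))
      (\<lambda>y. to_chart B d (\<Phi> (s, 0) (chart_inv c y)) (velocity B (\<lambda>t. \<Phi> (s, t) (chart_inv c y))))"
    unfolding e
    by (subst smooth_on_cong[OF op velocity_t[OF c d mem]], assumption)
       (rule smooth_on_slice[OF smooth_on_dd[OF smooth_FF[OF c d]] op mem])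
qed

lemma smooth_velocity_s: "smooth_section A B (\<Phi> (0, 0)) (\<lambda>p. velocity B (\<lambda>s. \<Phi> (s, 0) p))"
  unfolding smooth_section_def
proof (intro ballI)
  fix c d assume c: "c \<in> A" and d: "d \<in> B"
  have e: "chart_map c ` (chart_dom c \<inter> \<Phi> (0, 0) -` chart_dom d) = rdom c d (\<Phi> (0, 0))"
    unfolding chart_image_Int[OF chart_A[OF c]] rdom_def by auto
  note op = open_rdom[OF family_smooth_map[OF zero_U] c d]
  have mem: "((0, 0), y) \<in> fdom c d" if "y \<in> rdom c d (\<Phi> (0, 0))" for y
    using that zero_U by (simp add: fdom_def)
  show "smooth_on (chart_map c ` (chart_dom c \<inter> \<Phi> (0, 0) -` chart_dom d))
      (\<lambda>y. to_chart B d (\<Phi> (0, 0) (chart_inv c y)) (velocity B (\<lambda>s. \<Phi> (s, 0) (chart_inv c y))))"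
    unfolding e
    by (subst smooth_on_cong[OF op velocity_s[OF c d mem]], assumption)
       (rule smooth_on_slice[OF smooth_on_dd[OF smooth_FF[OF c d]] op mem])
qed

lemma smooth_\<eta>t: "(s, 0) \<in> U \<Longrightarrow> smooth_form A 1 (\<eta>t s)"
  unfolding \<eta>t_def by (intro smooth_pullback_contraction family_smooth_map smooth_velocity_t)

lemma smooth_\<eta>s: "smooth_form A 1 \<eta>s"
  unfolding \<eta>s_def by (intro smooth_pullback_contraction family_smooth_map smooth_velocity_s zero_U)

lemma DERIV_t:
  fixes f :: "(real \<times> real) \<times> (real ^ 'm) \<Rightarrow> real"
  assumes "f differentiable (at ((s, t), y))"
  shows "((\<lambda>t. f ((s, t), y)) has_real_derivative dd f ((s, t), y) ((0, 1), 0)) (at t)"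
proof -
  have "((\<lambda>t. ((s, t), y)) has_derivative (\<lambda>w. ((0, w), 0))) (at t)"
    by (intro has_derivative_Pair has_derivative_ident has_derivative_const)
  from has_derivative_compose[OF this dd_has_derivative[OF assms]]
  have "((\<lambda>t. f ((s, t), y)) has_derivative (\<lambda>w. dd f ((s, t), y) ((0, w), 0))) (at t)" .
  moreover have "(\<lambda>w. dd f ((s, t), y) ((0, w), 0)) = (*) (dd f ((s, t), y) ((0, 1), 0))"
    proof
    fix w
    have "dd f ((s, t), y) (w *\<^sub>R ((0, 1), 0)) = w *\<^sub>R dd f ((s, t), y) ((0, 1), 0)"
      by (rule linear_cmul[OF dd_linear[OF assms]])
    then show "dd f ((s, t), y) ((0, w), 0) = dd f ((s, t), y) ((0, 1), 0) * w"
      unfolding scaleR_Pair scaleR_zero_right real_scaleR_def mult_1_right mult_zero_right by (simp only: mult.commute)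
  qed
  ultimately show ?thesis unfolding has_field_derivative_def by simp
qed

lemma DERIV_s:
  fixes f :: "(real \<times> real) \<times> (real ^ 'm) \<Rightarrow> real"
  assumes "f differentiable (at ((s, t), y))"
  shows "((\<lambda>s. f ((s, t), y)) has_real_derivative dd f ((s, t), y) ((1, 0), 0)) (at s)"
proof -
  have "((\<lambda>s. ((s, t), y)) has_derivative (\<lambda>w. ((w, 0), 0))) (at s)"
    by (intro has_derivative_Pair has_derivative_ident has_derivative_const)
  from has_derivative_compose[OF this dd_has_derivative[OF assms]]
  have "((\<lambda>s. f ((s, t), y)) has_derivative (\<lambda>w. dd f ((s, t), y) ((w, 0), 0))) (at s)" .
  moreover have "(\<lambda>w. dd f ((s, t), y) ((w, 0), 0)) = (*) (dd f ((s, t), y) ((1, 0), 0))"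
    proof
    fix w
    have "dd f ((s, t), y) (w *\<^sub>R ((1, 0), 0)) = w *\<^sub>R dd f ((s, t), y) ((1, 0), 0)"
      by (rule linear_cmul[OF dd_linear[OF assms]])
    then show "dd f ((s, t), y) ((w, 0), 0) = dd f ((s, t), y) ((1, 0), 0) * w"
      unfolding scaleR_Pair scaleR_zero_right real_scaleR_def mult_1_right mult_zero_right by (simp only: mult.commute)
  qed
  ultimately show ?thesis unfolding has_field_derivative_def by simp
qed

lemma \<K>_differentiable:
  "c \<in> A \<Longrightarrow> x \<in> U \<times> chart_img c \<Longrightarrow> \<K> c a b differentiable (at x)"
  "c \<in> A \<Longrightarrow> x \<in> U \<times> chart_img c \<Longrightarrow> (\<lambda>x. dd (\<K> c a b) x e) differentiable (at x)"
  by (blast intro: smooth_on_differentiable smooth_\<K> smooth_on_dd)+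

lemma U_slice_s: "\<exists>S. open S \<and> 0 \<in> S \<and> (\<forall>s\<in>S. (s, 0) \<in> U)"
proof -
  have "continuous_on UNIV (\<lambda>s::real. (s, 0::real))" by (intro continuous_intros)
  from open_vimage[OF open_U this] show ?thesis using zero_U by (intro exI[of _ "(\<lambda>s. (s, 0)) -` U"]) auto
qed

lemma U_slice_t: "(s, 0) \<in> U \<Longrightarrow> \<exists>S. open S \<and> 0 \<in> S \<and> (\<forall>t\<in>S. (s, t) \<in> U)"
  using open_vimage[OF open_U continuous_on_Pair1[of UNIV s]] by (intro exI[of _ "Pair s -` U"]) auto

text \<open>\<open>\<eta>t\<close> is the contraction of the pulled-back form with the
  \<open>t\<close> direction, so \<open>\<K>_closed\<close> identifies its exterior derivative with
  the \<open>t\<close> derivative of the pull-back.\<close>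

lemma ext_deriv_\<eta>t:
  assumes c: "c \<in> A" and s: "(s, 0) \<in> U" and y: "y \<in> chart_img c"
  shows "chart_form2 A c (ext_deriv A (\<eta>t s)) y u v = dd (\<K> c (0, u) (0, v)) ((s, 0), y) ((0, 1), 0)"
proof -
  have x: "((s, 0), y) \<in> U \<times> chart_img c" using s y by simp
  have "dd (\<lambda>y. chart_form1 A c (\<eta>t s) y v) y u = dd (\<K> c ((0, 1), 0) (0, v)) ((s, 0), y) (0, u)" for u v
    by (rule trans[OF fun_cong[OF dd_cong_open[OF is_chartD(2)[OF chart_A[OF c]] y \<eta>t_\<K>[OF c s]]] dd_slice(1)[OF \<K>_differentiable(1)[OF c x]]])
  then show ?thesis
    by (simp only: ext_deriv_chart[OF atlas_A smooth_\<eta>t[OF s] c y] \<K>_closed[OF c x, of "(0, u)" "(0, v)" "((0, 1), 0)"])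
qed

lemma ext_deriv_\<eta>s:
  assumes c: "c \<in> A" and y: "y \<in> chart_img c"
  shows "chart_form2 A c (ext_deriv A \<eta>s) y u v = dd (\<K> c (0, u) (0, v)) ((0, 0), y) ((1, 0), 0)"
proof -
  have x: "((0, 0), y) \<in> U \<times> chart_img c" using zero_U y by simp
  have "dd (\<lambda>y. chart_form1 A c \<eta>s y v) y u = dd (\<K> c ((1, 0), 0) (0, v)) ((0, 0), y) (0, u)" for u v
    by (rule trans[OF fun_cong[OF dd_cong_open[OF is_chartD(2)[OF chart_A[OF c]] y \<eta>s_\<K>[OF c]]] dd_slice(1)[OF \<K>_differentiable(1)[OF c x]]])
  then show ?thesis
    by (simp only: ext_deriv_chart[OF atlas_A smooth_\<eta>s c y] \<K>_closed[OF c x, of "(0, u)" "(0, v)" "((1, 0), 0)"])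
qed

definition \<zeta> :: "('a, 'm) form" where "\<zeta> p vs = dd (\<lambda>s. \<eta>t s p vs) 0 1"

lemma \<zeta>_chart:
  assumes c: "c \<in> A" and y: "y \<in> chart_img c"
  shows "chart_form1 A c \<zeta> y v = dd (\<K> c ((0, 1), 0) (0, v)) ((0, 0), y) ((1, 0), 0)"
proof -
  obtain S where S: "open S" "0 \<in> S" "\<And>s. s \<in> S \<Longrightarrow> (s, 0) \<in> U" using U_slice_s by auto
  have x: "((0, 0), y) \<in> U \<times> chart_img c" using zero_U y by simp
  have "chart_form1 A c \<zeta> y v = dd (\<lambda>s. chart_form1 A c (\<eta>t s) y v) 0 1"
    by (simp add: chart_form1_def \<zeta>_def)
  also have "\<dots> = dd (\<lambda>s. \<K> c ((0, 1), 0) (0, v) ((s, 0), y)) 0 1"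
    by (subst dd_cong_open[OF S(1,2) \<eta>t_\<K>[OF c S(3) y]]) auto
  also have "\<dots> = dd (\<K> c ((0, 1), 0) (0, v)) ((0, 0), y) ((1, 0), 0)"
    by (rule dd_real[OF DERIV_s[OF \<K>_differentiable(1)[OF c x]]])
  finally show ?thesis .
qed

lemma \<K>_smooth_linear: 
  assumes c: "c \<in> A" shows "smooth_linear (U \<times> chart_img c) (\<lambda>x v. \<K> c a (0, v) x)"
  unfolding smooth_linear_def
proof (intro conjI ballI allI open_cyl smooth_\<K> c)
  fix x assume "x \<in> U \<times> chart_img c"
  then obtain d where d: "d \<in> B" "x \<in> fdom c d" by (rule fdom_at)
  have l: "linear (dd (FF c d) x)" by (rule dd_linear[OF smooth_on_differentiable[OF smooth_FF[OF c d(1)] d(2)]])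
  have b: "linear (\<omega>d d (FF c d x) w)" for w
    using \<omega>d_smooth[OF d(1)] smooth_between_FF[OF c d(1)] d(2) unfolding smooth_bilinear_def smooth_between_def bilinear_def by blast
  have p: "linear (\<lambda>v :: real ^ 'm. (0 :: real \<times> real, v))" by (auto intro!: linearI)
  show "linear (\<lambda>v. \<K> c a (0, v) x)"
    using linear_compose[OF linear_compose[OF p l] b] unfolding \<K>_eq[OF c d] by (simp add: o_def)
qed

lemma smooth_\<zeta>: "smooth_form A 1 \<zeta>"
proof (rule smooth_form1I[OF atlas_A])
  obtain S where S: "open S" "0 \<in> S" "\<And>s. s \<in> S \<Longrightarrow> (s, 0) \<in> U" using U_slice_s by auto
  show "\<zeta> p vs = 0" if "length vs \<noteq> 1" for p vs
  proof -
    have "\<eta>t s p vs = 0" for s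
      using that smooth_form2D(1)[OF \<omega>_smooth_form] by (simp add: \<eta>t_def pullback_contraction_def)
    then show ?thesis unfolding \<zeta>_def by (simp add: dd_eqI[OF has_derivative_const])
  qed
  fix p
  define c where "c = chart_at A p"
  have c: "c \<in> A" "p \<in> chart_dom c" using chart_at[OF atlas_A] by (auto simp: c_def)
  note y = is_chartD(5,6)[OF chart_A[OF c(1)] c(2)]
  have "\<zeta> p [v] = chart_form1 A c \<zeta> (chart_map c p) v" for v
    unfolding chart_form1_def y(1) using to_chart_at(2)[OF atlas_A] by (simp add: c_def)
  then have e: "(\<lambda>v. \<zeta> p [v]) = (\<lambda>v. dd (\<lambda>x. \<K> c ((0, 1), 0) (0, v) x) ((0, 0), chart_map c p) ((1, 0), 0))"
    unfolding \<zeta>_chart[OF c(1) y(2)] by auto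
  have "((0, 0), chart_map c p) \<in> U \<times> chart_img c" using y zero_U by simp
  from linear_dd_linear_family[OF \<K>_smooth_linear[OF c(1)] this]
  show "linear (\<lambda>v. \<zeta> p [v])" unfolding e .
next
  fix c v assume c: "c \<in> A"
  show "smooth_on (chart_img c) (\<lambda>y. chart_form1 A c \<zeta> y v)"
    by (subst smooth_on_cong[OF is_chartD(2)[OF chart_A[OF c]] \<zeta>_chart[OF c]], assumption)
       (rule smooth_on_slice[OF smooth_on_dd[OF smooth_\<K>[OF c]]], use zero_U is_chartD(2)[OF chart_A[OF c]] in auto)
qed

text \<open>The exterior derivative along \<open>M\<close> commutes with the derivative in
  \<open>s\<close> by symmetry of second derivatives.\<close>

lemma ext_deriv_\<zeta>:
  assumes c: "c \<in> A" and y: "y \<in> chart_img c"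
  shows "chart_form2 A c (ext_deriv A \<zeta>) y u v
    = dd (\<lambda>x. dd (\<K> c (0, u) (0, v)) x ((0, 1), 0)) ((0, 0), y) ((1, 0), 0)"
proof -
  let ?t = "((0, 1), 0) :: (real \<times> real) \<times> (real ^ 'm)" and ?s = "((1, 0), 0) :: (real \<times> real) \<times> (real ^ 'm)"
  let ?x = "((0, 0), y) :: (real \<times> real) \<times> (real ^ 'm)"
  have x: "?x \<in> U \<times> chart_img c" using zero_U y by simp
  have *: "dd (\<lambda>y. chart_form1 A c \<zeta> y v) y u = dd (\<lambda>x. dd (\<K> c ?t (0, v)) x (0, u)) ?x ?s" for u v
  proof -
    have "dd (\<lambda>y. chart_form1 A c \<zeta> y v) y u = dd (\<lambda>x. dd (\<K> c ?t (0, v)) x ?s) ?x (0, u)"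
      by (rule trans[OF fun_cong[OF dd_cong_open[OF is_chartD(2)[OF chart_A[OF c]] y \<zeta>_chart[OF c]]] dd_slice(1)[OF \<K>_differentiable(2)[OF c x]]])
    then show ?thesis
      using second_derivative_symmetric[OF open_cyl[OF c] smooth_\<K>[OF c] x] by simp
  qed
  have "dd (\<lambda>x. dd (\<K> c (0, u) (0, v)) x ?t) ?x
      = dd (\<lambda>x. dd (\<K> c ?t (0, v)) x (0, u) - dd (\<K> c ?t (0, u)) x (0, v)) ?x"
    by (rule dd_cong_open[OF open_cyl[OF c] x \<K>_closed[OF c]])
  also have "\<dots> = (\<lambda>e. dd (\<lambda>x. dd (\<K> c ?t (0, v)) x (0, u)) ?x e - dd (\<lambda>x. dd (\<K> c ?t (0, u)) x (0, v)) ?x e)"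
    by (rule dd_eqI) (intro has_derivative_diff dd_has_derivative \<K>_differentiable c x)
  finally show ?thesis unfolding ext_deriv_chart[OF atlas_A smooth_\<zeta> c y] * by simp
qed

lemma \<K>_smooth_bilinear:
  assumes c: "c \<in> A" shows "smooth_bilinear (U \<times> chart_img c) (\<lambda>x a b. \<K> c a b x)"
  unfolding smooth_bilinear_def
proof (intro conjI ballI allI open_cyl smooth_\<K> c)
  fix x assume "x \<in> U \<times> chart_img c"
  then obtain d where d: "d \<in> B" "x \<in> fdom c d" by (rule fdom_at)
  have l: "linear (dd (FF c d) x)" by (rule dd_linear[OF smooth_on_differentiable[OF smooth_FF[OF c d(1)] d(2)]])
  have b: "bilinear (\<omega>d d (FF c d x))"
    using \<omega>d_smooth[OF d(1)] smooth_between_FF[OF c d(1)] d(2) unfolding smooth_bilinear_def smooth_between_def by blast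
  show "bilinear (\<lambda>a b. \<K> c a b x)"
    unfolding \<K>_eq[OF c d] bilinear_def
    using linear_compose[OF l] b by (auto simp: bilinear_def o_def)
qed

section \<open>Differentiating the energy density and the energy\<close>

abbreviation \<Omega> where "\<Omega> st \<equiv> pullback A B (\<Phi> st) \<omega>"

lemma smooth_energy_density:
  assumes c: "c \<in> A"
  shows "smooth_on (U \<times> chart_img c) (\<lambda>x. form_inner g 2 (\<Omega> (fst x)) (\<Omega> (fst x)) (chart_inv c (snd x)))"
proof -
  have e: "form_inner g 2 (\<Omega> (fst x)) (\<Omega> (fst x)) (chart_inv c (snd x)) =
      1 / 2 * (\<Sum>k\<in>UNIV. \<Sum>l\<in>UNIV. \<K> c (0, axis k 1) (0, axis l 1) x * \<K> c (0, raised c k (snd x)) (0, raised c l (snd x)) x)"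
    if x: "x \<in> U \<times> chart_img c" for x
  proof -
    have x': "fst x \<in> U" "snd x \<in> chart_img c" using x by auto
    note b = smooth_form2D(2)[OF smooth_pullback[OF family_smooth_map[OF x'(1)]]]
    show ?thesis unfolding form_inner_2_chart[OF c x'(2) b b] pullback_\<K>[OF c x'] by simp
  qed
  have r: "smooth_on (U \<times> chart_img c) (\<lambda>x. (0 :: real \<times> real, raised c k (snd x)))" for k
    by (intro smooth_on_Pair smooth_on_const open_cyl c smooth_on_compose[OF smooth_raised[OF c] smooth_on_snd] smooth_on_id)
       auto
  show ?thesis
    by (subst smooth_on_cong[OF open_cyl[OF c] e], assumption)
       (intro smooth_on_mult smooth_on_const smooth_on_sum open_cyl c smooth_\<K> smooth_bilinear_apply[OF \<K>_smooth_bilinear] r)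
qed

text \<open>The frame is chosen from \<open>g p\<close> alone, hence is constant in the parameter,
  and the product rule applies to each summand.\<close>

lemma form_inner_2_DERIV:
  assumes "\<And>u v. ((\<lambda>t. \<alpha> t p [u, v]) has_real_derivative \<alpha>' p [u, v]) (at t0)"
    and "\<And>u v. ((\<lambda>t. \<beta> t p [u, v]) has_real_derivative \<beta>' p [u, v]) (at t0)"
  shows "((\<lambda>t. form_inner g 2 (\<alpha> t) (\<beta> t) p) has_real_derivative
    form_inner g 2 \<alpha>' (\<beta> t0) p + form_inner g 2 (\<alpha> t0) \<beta>' p) (at t0)"
  unfolding form_inner_2 Let_def distrib_left[symmetric] sum.distrib[symmetric]
  by (rule DERIV_cong[OF DERIV_cmult[OF DERIV_sum[OF DERIV_sum[OF DERIV_mult[OF assms]]]]])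
     (simp add: mult.commute add.commute)

lemma form_inner_commute: "form_inner g k \<alpha> \<beta> p = form_inner g k \<beta> \<alpha> p"
  unfolding form_inner_def Let_def by (simp add: mult.commute)

text \<open>In the preferred chart at \<open>p\<close> the conversion of components is the identity,
  so statements about forms at \<open>p\<close> may be proved from coordinate formulas.\<close>

lemma form2_at:
  obtains c y where "c \<in> A" "y \<in> chart_img c" "\<And>\<alpha> u v. \<alpha> p [u, v] = chart_form2 A c \<alpha> y u v"
proof (rule that)
  note c = chart_at[OF atlas_A, of p]
  show "chart_at A p \<in> A" "chart_map (chart_at A p) p \<in> chart_img (chart_at A p)"
    using c is_chartD(6)[OF chart_A[OF c(1)] c(2)] by auto
  show "\<alpha> p [u, v] = chart_form2 A (chart_at A p) \<alpha> (chart_map (chart_at A p) p) u v" for \<alpha> u v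
    unfolding chart_form2_eq is_chartD(5)[OF chart_A[OF c(1)] c(2)] to_chart_at(2)[OF atlas_A] ..
qed

lemma pullback_DERIV_t:
  assumes s: "(s, 0) \<in> U"
  shows "((\<lambda>t. \<Omega> (s, t) p [u, v]) has_real_derivative ext_deriv A (\<eta>t s) p [u, v]) (at 0)"
proof -
  obtain c y where c: "c \<in> A" "y \<in> chart_img c" "\<And>\<alpha> u v. \<alpha> p [u, v] = chart_form2 A c \<alpha> y u v" using form2_at[of p] by blast
  obtain S where S: "open S" "0 \<in> S" "\<And>t. t \<in> S \<Longrightarrow> (s, t) \<in> U" using U_slice_t[OF s] by auto
  have x: "((s, 0), y) \<in> U \<times> chart_img c" using c s by simp
  show ?thesis
    unfolding c(3) ext_deriv_\<eta>t[OF c(1) s c(2)]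
    by (rule has_field_derivative_transform_within_open[OF DERIV_t[OF \<K>_differentiable(1)[OF c(1) x]] S(1,2)])
       (simp only: pullback_\<K>[OF c(1) S(3) c(2)])
qed

lemma pullback_DERIV_s: "((\<lambda>s. \<Omega> (s, 0) p [u, v]) has_real_derivative ext_deriv A \<eta>s p [u, v]) (at 0)"
proof -
  obtain c y where c: "c \<in> A" "y \<in> chart_img c" "\<And>\<alpha> u v. \<alpha> p [u, v] = chart_form2 A c \<alpha> y u v" using form2_at[of p] by blast
  obtain S where S: "open S" "0 \<in> S" "\<And>s. s \<in> S \<Longrightarrow> (s, 0) \<in> U" using U_slice_s by auto
  have x: "((0, 0), y) \<in> U \<times> chart_img c" using c zero_U by simp
  show ?thesis
    unfolding c(3) ext_deriv_\<eta>s[OF c(1,2)]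
    by (rule has_field_derivative_transform_within_open[OF DERIV_s[OF \<K>_differentiable(1)[OF c(1) x]] S(1,2)])
       (simp only: pullback_\<K>[OF c(1) S(3) c(2)])
qed

lemma ext_deriv_DERIV_s: "((\<lambda>s. ext_deriv A (\<eta>t s) p [u, v]) has_real_derivative ext_deriv A \<zeta> p [u, v]) (at 0)"
proof -
  obtain c y where c: "c \<in> A" "y \<in> chart_img c" "\<And>\<alpha> u v. \<alpha> p [u, v] = chart_form2 A c \<alpha> y u v" using form2_at[of p] by blast
  obtain S where S: "open S" "0 \<in> S" "\<And>s. s \<in> S \<Longrightarrow> (s, 0) \<in> U" using U_slice_s by auto
  have x: "((0, 0), y) \<in> U \<times> chart_img c" using c zero_U by simp
  show ?thesis
    unfolding c(3) ext_deriv_\<zeta>[OF c(1,2)]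
    by (rule has_field_derivative_transform_within_open[OF DERIV_s[OF \<K>_differentiable(2)[OF c(1) x]] S(1,2)])
       (simp only: ext_deriv_\<eta>t[OF c(1) S(3) c(2)])
qed

lemma density_DERIV_t:
  assumes s: "(s, 0) \<in> U"
  shows "((\<lambda>t. form_inner g 2 (\<Omega> (s, t)) (\<Omega> (s, t)) p) has_real_derivative
    2 * form_inner g 2 (\<Omega> (s, 0)) (ext_deriv A (\<eta>t s)) p) (at 0)"
  by (rule DERIV_cong[OF form_inner_2_DERIV[where \<alpha> = "\<lambda>t. \<Omega> (s, t)" and \<beta> = "\<lambda>t. \<Omega> (s, t)", OF pullback_DERIV_t[OF s] pullback_DERIV_t[OF s]]])
     (simp add: form_inner_commute)

lemma density_DERIV_s:
  "((\<lambda>s. form_inner g 2 (\<Omega> (s, 0)) (ext_deriv A (\<eta>t s)) p) has_real_derivative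
    form_inner g 2 (ext_deriv A \<eta>s) (ext_deriv A (\<eta>t 0)) p + form_inner g 2 (\<Omega> (0, 0)) (ext_deriv A \<zeta>) p) (at 0)"
  by (rule form_inner_2_DERIV[where \<alpha> = "\<lambda>s. \<Omega> (s, 0)" and \<beta> = "\<lambda>s. ext_deriv A (\<eta>t s)", OF pullback_DERIV_s ext_deriv_DERIV_s])

lemma smooth_first_variation_density:
  assumes s: "(s, 0) \<in> U"
  shows "smooth_fun A (form_inner g 2 (\<Omega> (s, 0)) (ext_deriv A (\<eta>t s)))"
  by (intro smooth_form_inner_2 smooth_pullback family_smooth_map s smooth_ext_deriv atlas_A smooth_\<eta>t)

theorem energy_DERIV_t:
  assumes s: "(s, 0) \<in> U"
  shows "((\<lambda>t. energy A g B h J (\<Phi> (s, t))) has_real_derivative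
    vol_integral A g (form_inner g 2 (\<Omega> (s, 0)) (ext_deriv A (\<eta>t s)))) (at 0)"
proof -
  obtain S where S: "open S" "0 \<in> S" "\<And>t. t \<in> S \<Longrightarrow> (s, t) \<in> U" using U_slice_t[OF s] by auto
  have "((\<lambda>t. vol_integral A g (form_inner g 2 (\<Omega> (s, t)) (\<Omega> (s, t)))) has_real_derivative
      vol_integral A g (\<lambda>p. dd (\<lambda>t. form_inner g 2 (\<Omega> (s, t)) (\<Omega> (s, t)) p) 0 1)) (at 0)"
  proof (rule vol_integral_derivative[OF S(1,2)])
    fix c assume c: "c \<in> A"
    have op: "open (S \<times> chart_img c)" by (intro open_Times S is_chartD(2)[OF chart_A[OF c]])
    have i: "smooth_on (S \<times> chart_img c) (\<lambda>x. ((s, fst x), snd x))"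
      by (intro smooth_on_Pair smooth_on_const smooth_on_fst smooth_on_snd smooth_on_id op)
    show "smooth_on (S \<times> chart_img c) (\<lambda>x. form_inner g 2 (\<Omega> (s, fst x)) (\<Omega> (s, fst x)) (chart_inv c (snd x)))"
      using smooth_on_compose[OF smooth_energy_density[OF c] i op] S(3) by auto
  qed
  then have "((\<lambda>t. vol_integral A g (form_inner g 2 (\<Omega> (s, t)) (\<Omega> (s, t)))) has_real_derivative
      2 * vol_integral A g (form_inner g 2 (\<Omega> (s, 0)) (ext_deriv A (\<eta>t s)))) (at 0)"
    unfolding dd_real[OF density_DERIV_t[OF s]]
      vol_integral_cmult[OF smooth_fun_continuous[OF atlas_A smooth_first_variation_density[OF s]]] .
  from DERIV_cmult[OF this, of "1 / 2"] show ?thesis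
    unfolding energy_def Let_def by simp
qed

theorem energy_DERIV_s:
  "((\<lambda>s. vol_integral A g (form_inner g 2 (\<Omega> (s, 0)) (ext_deriv A (\<eta>t s)))) has_real_derivative
    vol_integral A g (\<lambda>p. form_inner g 2 (ext_deriv A \<eta>s) (ext_deriv A (\<eta>t 0)) p + form_inner g 2 (\<Omega> (0, 0)) (ext_deriv A \<zeta>) p)) (at 0)"
proof -
  obtain S where S: "open S" "0 \<in> S" "\<And>s. s \<in> S \<Longrightarrow> (s, 0) \<in> U" using U_slice_s by auto
  have "((\<lambda>s. vol_integral A g (form_inner g 2 (\<Omega> (s, 0)) (ext_deriv A (\<eta>t s)))) has_real_derivative
      vol_integral A g (\<lambda>p. dd (\<lambda>s. form_inner g 2 (\<Omega> (s, 0)) (ext_deriv A (\<eta>t s)) p) 0 1)) (at 0)"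
  proof (rule vol_integral_derivative[OF S(1,2)])
    fix c assume c: "c \<in> A"
    let ?E = "\<lambda>x. form_inner g 2 (\<Omega> (fst x)) (\<Omega> (fst x)) (chart_inv c (snd x))"
    \<comment> \<open>The first variation density is half the \<open>t\<close> derivative at
      \<open>t = 0\<close> of the energy density. Joint smoothness in \<open>s\<close> and the point
      is therefore inherited from \<open>smooth_energy_density\<close>.\<close>
    let ?D = "\<lambda>x. 1 / 2 * dd ?E x ((0, 1), 0)"
    have op: "open (S \<times> chart_img c)" by (intro open_Times S is_chartD(2)[OF chart_A[OF c]])
    have i: "smooth_on (S \<times> chart_img c) (\<lambda>x. ((fst x, 0 :: real), snd x))"
      by (intro smooth_on_Pair smooth_on_const smooth_on_fst smooth_on_snd smooth_on_id op)
    have e: "form_inner g 2 (\<Omega> (fst x, 0)) (ext_deriv A (\<eta>t (fst x))) (chart_inv c (snd x)) = ?D ((fst x, 0), snd x)"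
      if x: "x \<in> S \<times> chart_img c" for x
    proof -
      have s: "(fst x, 0) \<in> U" and x': "((fst x, 0), snd x) \<in> U \<times> chart_img c" using x S(3) by auto
      have "((\<lambda>t. form_inner g 2 (\<Omega> (fst x, t)) (\<Omega> (fst x, t)) (chart_inv c (snd x))) has_real_derivative
          dd ?E ((fst x, 0), snd x) ((0, 1), 0)) (at 0)"
        using DERIV_t[OF smooth_on_differentiable[OF smooth_energy_density[OF c] x']] by simp
      from DERIV_unique[OF this density_DERIV_t[OF s]] show ?thesis by simp
    qed
    have "smooth_on (U \<times> chart_img c) ?D"
      by (intro smooth_on_mult smooth_on_const open_cyl c smooth_on_dd smooth_energy_density)
    note sm = smooth_on_compose[OF this i op]
    show "smooth_on (S \<times> chart_img c) (\<lambda>x. form_inner g 2 (\<Omega> (fst x, 0)) (ext_deriv A (\<eta>t (fst x))) (chart_inv c (snd x)))"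
      by (subst smooth_on_cong[OF op e], assumption) (use sm S(3) in auto)
  qed
  then show ?thesis unfolding dd_real[OF density_DERIV_s] .
qed

end

section \<open>The covariant acceleration of a variation\<close>

context map_family
begin

text \<open>The surface traced by a fixed point \<open>p\<close>. In contrast to \<open>FF\<close>
  it involves no chart of \<open>M\<close>, so \<open>acc\<close> depends only on \<open>d\<close>
  and \<open>p\<close>.\<close>

definition ff :: "('b, 'n) chart \<Rightarrow> 'a \<Rightarrow> real \<times> real \<Rightarrow> real ^ 'n" where
  "ff d p st = chart_map d (\<Phi> st p)"

definition ffdom :: "('b, 'n) chart \<Rightarrow> 'a \<Rightarrow> (real \<times> real) set" where
  "ffdom d p = {st \<in> U. \<Phi> st p \<in> chart_dom d}"

text \<open>\<open>\<nabla>\<^sub>s\<partial>\<^sub>t\<Phi>\<close> at \<open>(0, 0)\<close>, in the chart \<open>d\<close>\<close>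

definition acc :: "('b, 'n) chart \<Rightarrow> 'a \<Rightarrow> real ^ 'n" where
  "acc d p = dd (\<lambda>st. dd (ff d p) st (0, 1)) (0, 0) (1, 0)
     + \<Gamma>d d (ff d p (0, 0)) (dd (ff d p) (0, 0) (1, 0)) (dd (ff d p) (0, 0) (0, 1))"

lemma smooth_between_ff:
  assumes d: "d \<in> B" shows "smooth_between (ffdom d p) (chart_img d) (ff d p)"
proof -
  define c where "c = chart_at A p"
  have c: "c \<in> A" "p \<in> chart_dom c" using chart_at[OF atlas_A] by (auto simp: c_def)
  note y = is_chartD(5,6)[OF chart_A[OF c(1)] c(2)]
  have "continuous_on U (\<lambda>st. \<Phi> st p)"
    by (rule continuous_on_compose2[OF continuous_family, of _ "\<lambda>st. (st, p)", simplified])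
       (auto intro!: continuous_intros)
  from continuous_open_preimage[OF this open_U is_chartD(1)[OF chart_B[OF d]]]
  have op: "open (ffdom d p)" by (simp add: ffdom_def vimage_def Int_def)
  have "smooth_on (ffdom d p) (\<lambda>st. FF c d (st, chart_map c p))"
    by (rule smooth_on_slice'[OF smooth_FF[OF c(1) d] op]) (simp add: fdom_iff ffdom_def y)
  then have "smooth_on (ffdom d p) (ff d p)" by (simp add: FF_def rep_def ff_def[abs_def] y)
  then show ?thesis
    using op is_chartD(6)[OF chart_B[OF d]] by (auto simp: smooth_between_def ffdom_def ff_def)
qed

lemma ff_FF:
  assumes c: "c \<in> A" and d: "d \<in> B" and x: "(st, y) \<in> fdom c d"
  shows "ff d (chart_inv c y) st = FF c d (st, y)" "dd (ff d (chart_inv c y)) st w = dd (FF c d) (st, y) (w, 0)"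
    "st \<in> ffdom d (chart_inv c y)"
proof -
  have e: "ff d (chart_inv c y) = (\<lambda>st. FF c d (st, y))" by (simp add: fun_eq_iff FF_def rep_def ff_def)
  then show "ff d (chart_inv c y) st = FF c d (st, y)" by simp
  show "dd (ff d (chart_inv c y)) st w = dd (FF c d) (st, y) (w, 0)"
    unfolding e by (rule dd_slice(2)[OF smooth_on_differentiable[OF smooth_FF[OF c d] x]])
  show "st \<in> ffdom d (chart_inv c y)" using x by (simp add: fdom_iff ffdom_def)
qed

lemma acc_FF:
  assumes c: "c \<in> A" and d: "d \<in> B" and x: "((0, 0), y) \<in> fdom c d"
  shows "acc d (chart_inv c y) = dd (\<lambda>x. dd (FF c d) x ((0, 1), 0)) ((0, 0), y) ((1, 0), 0)
     + \<Gamma>d d (FF c d ((0, 0), y)) (dd (FF c d) ((0, 0), y) ((1, 0), 0)) (dd (FF c d) ((0, 0), y) ((0, 1), 0))"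
proof -
  let ?p = "chart_inv c y"
  have y: "y \<in> chart_img c" using x by (simp add: fdom_iff)
  have mem: "(st, y) \<in> fdom c d" if "st \<in> ffdom d ?p" for st
    using that y by (simp add: fdom_iff ffdom_def)
  have op: "open (ffdom d ?p)" using smooth_between_ff[OF d] by (simp add: smooth_between_def)
  have "dd (\<lambda>st. dd (ff d ?p) st (0, 1)) (0, 0) (1, 0) = dd (\<lambda>st. dd (FF c d) (st, y) ((0, 1), 0)) (0, 0) (1, 0)"
    by (rule fun_cong[OF dd_cong_open[OF op ff_FF(3)[OF c d x] ff_FF(2)[OF c d mem]]])
  also have "\<dots> = dd (\<lambda>x. dd (FF c d) x ((0, 1), 0)) ((0, 0), y) ((1, 0), 0)"
    by (rule dd_slice(2)[OF smooth_on_differentiable[OF smooth_on_dd[OF smooth_FF[OF c d]] x]])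
  finally show ?thesis unfolding acc_def ff_FF(1,2)[OF c d x] by simp
qed

text \<open>The chain rule for the second derivative and the transformation law of the Christoffel
  map contribute the same second derivative of the coordinate change. Its cancellation makes the
  acceleration a tangent vector.\<close>

lemma acc_change:
  assumes d: "d \<in> B" "d' \<in> B" and p: "\<Phi> (0, 0) p \<in> chart_dom d" "\<Phi> (0, 0) p \<in> chart_dom d'"
  shows "acc d' p = coord_D d d' (\<Phi> (0, 0) p) (acc d p)"
proof -
  let ?f = "ff d p" and ?f' = "ff d' p" and ?S = "ffdom d p \<inter> ffdom d' p" and ?\<tau> = "coord_change d d'"
  let ?u = "dd ?f (0, 0) (1, 0)" and ?v = "dd ?f (0, 0) (0, 1)" and ?q = "?f (0, 0)"
  note ch = chart_B[OF d(1)] and ch' = chart_B[OF d(2)]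
  note sb = smooth_between_ff[OF d(1), of p]
  have op: "open ?S" using sb smooth_between_ff[OF d(2), of p] by (simp add: smooth_between_def open_Int)
  have x: "(0, 0) \<in> ?S" using p zero_U by (simp add: ffdom_def)
  have e: "?f' st = ?\<tau> (?f st)" if "st \<in> ?S" for st
    using that is_chartD(5)[OF ch] by (simp add: ff_def coord_change_def ffdom_def)
  note s\<tau> = smooth_between_coord_change[OF ch ch' atlasD(2)[OF atlas_B d]]
  have ov: "?f st \<in> overlap d d'" if "st \<in> ?S" for st
    using that is_chartD(5,6)[OF ch] by (simp add: overlap_eq[OF ch] ff_def ffdom_def)
  have sf: "smooth_on ?S ?f" using sb op by (auto simp: smooth_between_def elim: smooth_on_subset)
  then have sbS: "smooth_between ?S (overlap d d') ?f" using ov op by (auto simp: smooth_between_def)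
  have D: "dd ?f' st = (\<lambda>w. dd ?\<tau> (?f st) (dd ?f st w))" if st: "st \<in> ?S" for st
  proof -
    have "dd ?f' st = dd (\<lambda>st. ?\<tau> (?f st)) st" by (rule dd_cong_open[OF op st e])
    also have "\<dots> = (\<lambda>w. dd ?\<tau> (?f st) (dd ?f st w))"
      using s\<tau> ov[OF st] by (intro dd_compose smooth_on_differentiable[OF sf st]) (auto simp: smooth_between_def intro: smooth_on_differentiable)
    finally show ?thesis .
  qed
  have "dd (\<lambda>st. dd ?f' st (0, 1)) (0, 0) (1, 0) = dd (\<lambda>st. dd ?\<tau> (?f st) (dd ?f st (0, 1))) (0, 0) (1, 0)"
    by (rule fun_cong[OF dd_cong_open[OF op x]]) (simp add: D)
  also have "\<dots> = dd (\<lambda>z. dd ?\<tau> z ?v) ?q ?u + dd ?\<tau> ?q (dd (\<lambda>st. dd ?f st (0, 1)) (0, 0) (1, 0))"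
    using s\<tau> by (intro dd_linear_pull[OF smooth_linear_dd sbS smooth_on_dd[OF sf] x]) (auto simp: smooth_between_def)
  finally have 1: "dd (\<lambda>st. dd ?f' st (0, 1)) (0, 0) (1, 0)
    = dd (\<lambda>z. dd ?\<tau> z ?v) ?q ?u + dd ?\<tau> ?q (dd (\<lambda>st. dd ?f st (0, 1)) (0, 0) (1, 0))" .
  have "linear (dd ?\<tau> ?q)" using s\<tau> ov[OF x] by (auto simp: smooth_between_def intro: dd_linear smooth_on_differentiable)
  from linear_add[OF this]
  show ?thesis
    unfolding acc_def coord_D_def ff_def[of d p "(0, 0)", symmetric] 1 \<Gamma>d_change[OF d ov[OF x]] D[OF x] e[OF x]
    by (simp add: algebra_simps \<Gamma>d_change[OF d ov[OF x]])
qed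

definition W :: "'a \<Rightarrow> real ^ 'n" where "W p = acc (chart_at B (\<Phi> (0, 0) p)) p"

lemma W_chart:
  assumes "d \<in> B" "\<Phi> (0, 0) p \<in> chart_dom d"
  shows "to_chart B d (\<Phi> (0, 0) p) (W p) = acc d p"
  unfolding to_chart_trans W_def
  by (rule acc_change[symmetric]) (use chart_at[OF atlas_B] assms in auto)

lemma smooth_W: "smooth_section A B (\<Phi> (0, 0)) W"
  unfolding smooth_section_def
proof (intro ballI)
  fix c d assume c: "c \<in> A" and d: "d \<in> B"
  have e: "chart_map c ` (chart_dom c \<inter> \<Phi> (0, 0) -` chart_dom d) = rdom c d (\<Phi> (0, 0))"
    unfolding chart_image_Int[OF chart_A[OF c]] rdom_def by auto
  note op = open_rdom[OF family_smooth_map[OF zero_U] c d]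
  have mem: "((0, 0), y) \<in> fdom c d" if "y \<in> rdom c d (\<Phi> (0, 0))" for y
    using that zero_U by (simp add: fdom_def)
  note sl = smooth_on_slice[OF _ op mem]
  have sb: "smooth_between (rdom c d (\<Phi> (0, 0))) (chart_img d) (\<lambda>y. FF c d ((0, 0), y))"
    using smooth_between_FF[OF c d] op mem sl[OF smooth_FF[OF c d]] unfolding smooth_between_def by blast
  have q: "to_chart B d (\<Phi> (0, 0) (chart_inv c y)) (W (chart_inv c y))
      = dd (\<lambda>x. dd (FF c d) x ((0, 1), 0)) ((0, 0), y) ((1, 0), 0)
        + \<Gamma>d d (FF c d ((0, 0), y)) (dd (FF c d) ((0, 0), y) ((1, 0), 0)) (dd (FF c d) ((0, 0), y) ((0, 1), 0))"
    if "y \<in> rdom c d (\<Phi> (0, 0))" for y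
    unfolding acc_FF[OF c d mem[OF that], symmetric]
    using that by (intro W_chart d) (simp add: rdom_def)
  show "smooth_on (chart_map c ` (chart_dom c \<inter> \<Phi> (0, 0) -` chart_dom d))
      (\<lambda>y. to_chart B d (\<Phi> (0, 0) (chart_inv c y)) (W (chart_inv c y)))"
    unfolding e
    by (subst smooth_on_cong[OF op q], assumption)
       (intro smooth_on_add op sl[OF smooth_on_dd[OF smooth_on_dd[OF smooth_FF[OF c d]]]]
          smooth_bilinear_apply[OF smooth_bilinear_compose[OF \<Gamma>d_smooth[OF d] sb]] sl[OF smooth_on_dd[OF smooth_FF[OF c d]]])
qed

abbreviation "vel_t p \<equiv> velocity B (\<lambda>t. \<Phi> (0, t) p)"
abbreviation "vel_s p \<equiv> velocity B (\<lambda>s. \<Phi> (s, 0) p)"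

definition \<eta>W :: "('a, 'm) form" where "\<eta>W = pullback_contraction A B (\<Phi> (0, 0)) W \<omega>"

lemma smooth_\<eta>W: "smooth_form A 1 \<eta>W"
  unfolding \<eta>W_def by (intro smooth_pullback_contraction family_smooth_map zero_U smooth_W)

text \<open>The part of \<open>\<zeta>\<close> that remains when the acceleration term is removed;
  the factor -1 matches the form of \<open>smooth_form1_add\<close>.\<close>

definition \<theta> :: "('a, 'm) form" where "\<theta> p vs = \<zeta> p vs + (- 1) * \<eta>W p vs"

lemma smooth_\<theta>: "smooth_form A 1 \<theta>"
  unfolding \<theta>_def[abs_def] by (intro smooth_form1_add atlas_A smooth_\<zeta> smooth_\<eta>W)

text \<open>The product rule splits the \<open>s\<close> derivative of \<open>\<K>\<close> into
  three terms. By \<open>\<omega>_parallel\<close> the derivative of \<open>\<omega>\<close> becomes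
  two Christoffel terms. One completes the second derivative of the family to the acceleration and
  is removed with \<open>\<eta>W\<close>; the other completes the derivative of the \<open>s\<close>
  velocity along \<open>v\<close> to the induced connection, after second derivatives have been
  exchanged.\<close>

theorem \<theta>_eq: "\<theta> p [v] = \<omega> (\<Phi> (0, 0) p) [vel_t p, pullback_connection A B h (\<Phi> (0, 0)) p v vel_s]"
proof -
  define c d where "c = chart_at A p" and "d = chart_at B (\<Phi> (0, 0) p)"
  have c: "c \<in> A" "p \<in> chart_dom c" using chart_at[OF atlas_A] by (auto simp: c_def)
  have d: "d \<in> B" "\<Phi> (0, 0) p \<in> chart_dom d" using chart_at[OF atlas_B] by (auto simp: d_def)
  define y where "y = chart_map c p"
  have inv: "chart_inv c y = p" and y: "y \<in> chart_img c" using is_chartD(5,6)[OF chart_A[OF c(1)] c(2)] by (auto simp: y_def)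
  let ?F = "FF c d" and ?x = "((0, 0), y) :: (real \<times> real) \<times> (real ^ 'm)"
  let ?t = "((0, 1), 0) :: (real \<times> real) \<times> (real ^ 'm)" and ?s = "((1, 0), 0) :: (real \<times> real) \<times> (real ^ 'm)"
  have x: "?x \<in> fdom c d" using y zero_U d inv by (simp add: fdom_iff)
  have x': "?x \<in> U \<times> chart_img c" using x by (simp add: fdom_iff)
  have yr: "y \<in> rdom c d (\<Phi> (0, 0))" using x by (simp add: fdom_def)
  note sm0 = family_smooth_map[OF zero_U]
  have Fx: "?F ?x = chart_map d (\<Phi> (0, 0) p)" by (simp add: FF_def rep_def inv)
  have Fi: "?F ?x \<in> chart_img d" using d is_chartD(6)[OF chart_B[OF d(1)]] by (simp add: Fx)
  have di: "chart_inv d (?F ?x) = \<Phi> (0, 0) p" using is_chartD(5)[OF chart_B[OF d(1)] d(2)] by (simp add: Fx)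
  have X: "vel_t p = dd ?F ?x ?t" and Y: "vel_s p = dd ?F ?x ?s" and Wp: "W p = acc d p"
    using velocity_t[OF c(1) d(1) x] velocity_s[OF c(1) d(1) x] unfolding inv
    by (auto simp: to_chart_at[OF atlas_B] d_def W_def)
  have T: "tangent_map A B (\<Phi> (0, 0)) p v = dd ?F ?x (0, v)"
    using tangent_map_chart[OF sm0 c d, of v] dd_rep_FF[OF c(1) d(1) x, of v]
    by (simp add: y_def c_def d_def to_chart_at[OF atlas_B] to_chart_at[OF atlas_A])
  let ?w = "\<omega>d d (?F ?x)" and ?G = "\<Gamma>d d (?F ?x)"
  let ?Fv = "dd ?F ?x (0, v)"
  have bw: "bilinear ?w" using \<omega>d_smooth[OF d(1)] Fi unfolding smooth_bilinear_def by blast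
  have cv: "\<alpha> p [v] = chart_form1 A c \<alpha> y v" for \<alpha>
    unfolding chart_form1_def inv by (simp add: c_def to_chart_at[OF atlas_A])
  have sF: "smooth_on (fdom c d) ?F" by (rule smooth_FF[OF c(1) d(1)])
  have "\<zeta> p [v] = dd (\<K> c ?t (0, v)) ?x ?s" unfolding cv by (rule \<zeta>_chart[OF c(1) y])
  also have "\<dots> = dd (\<lambda>x. \<omega>d d (?F x) (dd ?F x ?t) (dd ?F x (0, v))) ?x ?s"
    by (rule fun_cong[OF dd_cong_open[OF open_fdom[OF c(1) d(1)] x \<K>_eq[OF c(1) d(1)]]])
  also have "\<dots> = dd (\<lambda>z. \<omega>d d z (dd ?F ?x ?t) ?Fv) (?F ?x) (dd ?F ?x ?s)
      + ?w (dd (\<lambda>x. dd ?F x ?t) ?x ?s) ?Fv + ?w (dd ?F ?x ?t) (dd (\<lambda>x. dd ?F x (0, v)) ?x ?s)"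
    by (rule dd_bilinear_pull[OF \<omega>d_smooth[OF d(1)] smooth_between_FF[OF c(1) d(1)] smooth_on_dd[OF sF] smooth_on_dd[OF sF] x])
  also have "\<dots> = ?w (?G (dd ?F ?x ?s) (dd ?F ?x ?t)) ?Fv + ?w (dd ?F ?x ?t) (?G (dd ?F ?x ?s) ?Fv)
      + ?w (dd (\<lambda>x. dd ?F x ?t) ?x ?s) ?Fv + ?w (dd ?F ?x ?t) (dd (\<lambda>x. dd ?F x ?s) ?x (0, v))"
    unfolding \<omega>_parallel[OF d(1) Fi] second_derivative_symmetric[OF open_fdom[OF c(1) d(1)] sF x, of "(0, v)" ?s] ..
  finally have z: "\<zeta> p [v] = \<dots>" .
  have rF: "rep c d (\<Phi> (0, 0)) y = ?F ?x" by (simp add: FF_def)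
  have w: "\<eta>W p [v] = ?w (W p) ?Fv"
    unfolding cv \<eta>W_def pullback_contraction_chart[OF sm0 c(1) d(1) yr] dd_rep_FF[OF c(1) d(1) x] rF inv
    using to_chart_at(1)[OF atlas_B] by (simp add: d_def)
  have acc: "W p = dd (\<lambda>x. dd ?F x ?t) ?x ?s + ?G (dd ?F ?x ?s) (dd ?F ?x ?t)"
    using acc_FF[OF c(1) d(1) x] unfolding inv Wp .
  have "dd (\<lambda>y. to_chart B d (\<Phi> (0, 0) (chart_inv c y)) (vel_s (chart_inv c y))) y v
      = dd (\<lambda>y. dd ?F ((0, 0), y) ?s) y v"
  proof (rule fun_cong[OF dd_cong_open[OF open_rdom[OF sm0 c(1) d(1)] yr]])
    fix y assume "y \<in> rdom c d (\<Phi> (0, 0))"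
    then have "((0, 0), y) \<in> fdom c d" using zero_U by (simp add: fdom_def)
    from velocity_s[OF c(1) d(1) this]
    show "to_chart B d (\<Phi> (0, 0) (chart_inv c y)) (vel_s (chart_inv c y)) = dd ?F ((0, 0), y) ?s" .
  qed
  also have "\<dots> = dd (\<lambda>x. dd ?F x ?s) ?x (0, v)"
    by (rule dd_slice(1)[OF smooth_on_differentiable[OF smooth_on_dd[OF sF] x]])
  finally have con: "pullback_connection A B h (\<Phi> (0, 0)) p v vel_s
      = dd (\<lambda>x. dd ?F x ?s) ?x (0, v) + ?G ?Fv (dd ?F ?x ?s)"
    unfolding pullback_connection_def Let_def c_def[symmetric] d_def[symmetric] y_def[symmetric] T
      christoffel_eq Fx[symmetric] Y by simp
  have om: "\<omega> (\<Phi> (0, 0) p) [a, b] = ?w a b" for a b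
    unfolding chart_form2_eq di by (simp add: d_def to_chart_at[OF atlas_B])
  note bl = bilinear_ladd[OF bw] bilinear_radd[OF bw]
  show ?thesis
    unfolding \<theta>_def z w om X con acc bl \<Gamma>d_facts(2)[OF d(1) Fi, of ?Fv] by simp
qed

lemma form_inner_\<zeta>:
  "form_inner g 2 \<alpha> (ext_deriv A \<zeta>) p = form_inner g 2 \<alpha> (ext_deriv A \<theta>) p + form_inner g 2 \<alpha> (ext_deriv A \<eta>W) p"
proof -
  have "ext_deriv A \<zeta> p [u, v] = ext_deriv A \<theta> p [u, v] + ext_deriv A \<eta>W p [u, v]" for u v
  proof -
    obtain c y where c: "c \<in> A" "y \<in> chart_img c" "\<And>\<alpha> u v. \<alpha> p [u, v] = chart_form2 A c \<alpha> y u v" using form2_at[of p] by blast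
    have s: "smooth_on (chart_img c) (\<lambda>y. chart_form1 A c \<alpha> y v)" if "smooth_form A 1 \<alpha>" for \<alpha> v
      by (rule smooth_form1D(3)[OF that c(1)])
    have D: "((\<lambda>y. chart_form1 A c \<alpha> y v) has_derivative dd (\<lambda>y. chart_form1 A c \<alpha> y v) y) (at y)"
      if "smooth_form A 1 \<alpha>" for \<alpha> v
      by (rule smooth_on_has_derivative[OF s[OF that] c(2)])
    have "dd (\<lambda>y. chart_form1 A c \<theta> y v) y = (\<lambda>e. dd (\<lambda>y. chart_form1 A c \<zeta> y v) y e - dd (\<lambda>y. chart_form1 A c \<eta>W y v) y e)" for v
      using dd_eqI[OF has_derivative_diff[OF D[OF smooth_\<zeta>] D[OF smooth_\<eta>W]]]
      by (simp add: chart_form1_def \<theta>_def)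
    then show ?thesis
      unfolding c(3) ext_deriv_chart[OF atlas_A smooth_\<zeta> c(1,2)] ext_deriv_chart[OF atlas_A smooth_\<theta> c(1,2)]
        ext_deriv_chart[OF atlas_A smooth_\<eta>W c(1,2)] by simp
  qed
  then show ?thesis
    unfolding form_inner_2 Let_def distrib_left[symmetric] sum.distrib[symmetric] by simp
qed

end

section \<open>Existence of variations\<close>

text \<open>Smoothness over an arbitrary set of pairs of parameter and point, so that it can be
  checked locally and families can be glued; \<open>smooth_family\<close> only allows products with
  all of \<open>M\<close>.\<close>

definition smooth_family_on ::
  "('a::topological_space, 'm::finite) chart set \<Rightarrow> ('b::topological_space, 'n::finite) chart set
   \<Rightarrow> ('s::euclidean_space \<times> 'a) set \<Rightarrow> ('s \<Rightarrow> 'a \<Rightarrow> 'b) \<Rightarrow> bool"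
where
  "smooth_family_on A B N \<Phi> \<longleftrightarrow> continuous_on N (\<lambda>x. \<Phi> (fst x) (snd x)) \<and>
     (\<forall>c\<in>A. \<forall>d\<in>B.
        smooth_on {x. snd x \<in> chart_img c \<and> (fst x, chart_inv c (snd x)) \<in> N \<and> \<Phi> (fst x) (chart_inv c (snd x)) \<in> chart_dom d}
                  (\<lambda>x. chart_map d (\<Phi> (fst x) (chart_inv c (snd x)))))"

lemma smooth_family_iff: "smooth_family A B U \<Phi> \<longleftrightarrow> smooth_family_on A B (U \<times> UNIV) \<Phi>"
  unfolding smooth_family_def smooth_family_on_def case_prod_unfold by (simp add: conj_ac)

context
  fixes A :: "('a::t2_space, 'm::finite) chart set" and B :: "('b::t2_space, 'n::finite) chart set"
  assumes A: "atlas A" and B: "atlas B"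
begin

lemma open_family_chart:
  fixes \<Phi> :: "'s::euclidean_space \<Rightarrow> 'a \<Rightarrow> 'b"
  assumes N: "open N" and \<Phi>: "continuous_on N (\<lambda>x. \<Phi> (fst x) (snd x))" and c: "c \<in> A" and d: "d \<in> B"
  shows "open {x. snd x \<in> chart_img c \<and> (fst x, chart_inv c (snd x)) \<in> N \<and> \<Phi> (fst x) (chart_inv c (snd x)) \<in> chart_dom d}"
proof -
  note ch = atlasD(1)[OF A c]
  have 1: "open (N \<inter> (\<lambda>x. \<Phi> (fst x) (snd x)) -` chart_dom d)"
    by (rule continuous_open_preimage[OF \<Phi> N is_chartD(1)[OF atlasD(1)[OF B d]]])
  have 2: "continuous_on (UNIV \<times> chart_img c) (\<lambda>x :: 's \<times> (real ^ 'm). (fst x, chart_inv c (snd x)))"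
    by (auto intro!: continuous_intros continuous_on_compose2[OF is_chartD(4)[OF ch]])
  have "open ((UNIV \<times> chart_img c) \<inter> (\<lambda>x :: 's \<times> (real ^ 'm). (fst x, chart_inv c (snd x))) -` (N \<inter> (\<lambda>x. \<Phi> (fst x) (snd x)) -` chart_dom d))"
    by (rule continuous_open_preimage[OF 2 _ 1]) (intro open_Times open_UNIV is_chartD(2)[OF ch])
  moreover have "(UNIV \<times> chart_img c) \<inter> (\<lambda>x :: 's \<times> (real ^ 'm). (fst x, chart_inv c (snd x))) -` (N \<inter> (\<lambda>x. \<Phi> (fst x) (snd x)) -` chart_dom d)
      = {x. snd x \<in> chart_img c \<and> (fst x, chart_inv c (snd x)) \<in> N \<and> \<Phi> (fst x) (chart_inv c (snd x)) \<in> chart_dom d}"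
    by (auto simp: mem_Times_iff)
  ultimately show ?thesis by simp
qed

lemma smooth_family_on_cong:
  fixes \<Phi> :: "'s::euclidean_space \<Rightarrow> 'a \<Rightarrow> 'b"
  assumes "open N" "smooth_family_on A B N \<Psi>" "\<And>s p. (s, p) \<in> N \<Longrightarrow> \<Phi> s p = \<Psi> s p"
  shows "smooth_family_on A B N \<Phi>"
  unfolding smooth_family_on_def
proof (intro conjI ballI)
  have e: "\<Phi> (fst x) (snd x) = \<Psi> (fst x) (snd x)" if "x \<in> N" for x using assms(3) that by (cases x) auto
  have c': "continuous_on N (\<lambda>x. \<Psi> (fst x) (snd x))" using assms(2) unfolding smooth_family_on_def by blast
  then show "continuous_on N (\<lambda>x. \<Phi> (fst x) (snd x))" using e by (simp cong: continuous_on_cong)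
  fix c d assume c: "c \<in> A" and d: "d \<in> B"
  have "{x. snd x \<in> chart_img c \<and> (fst x, chart_inv c (snd x)) \<in> N \<and> \<Phi> (fst x) (chart_inv c (snd x)) \<in> chart_dom d}
    = {x. snd x \<in> chart_img c \<and> (fst x, chart_inv c (snd x)) \<in> N \<and> \<Psi> (fst x) (chart_inv c (snd x)) \<in> chart_dom d}" (is "?S = ?T")
    using assms(3) by auto
  moreover have "smooth_on ?T (\<lambda>x. chart_map d (\<Psi> (fst x) (chart_inv c (snd x))))"
    using assms(2) c d unfolding smooth_family_on_def by blast
  then have "smooth_on ?T (\<lambda>x. chart_map d (\<Phi> (fst x) (chart_inv c (snd x))))"
    by (subst smooth_on_cong[OF open_family_chart[OF assms(1) c' c d], where g = "\<lambda>x. chart_map d (\<Psi> (fst x) (chart_inv c (snd x)))"])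
       (auto simp: assms(3))
  ultimately show "smooth_on ?S (\<lambda>x. chart_map d (\<Phi> (fst x) (chart_inv c (snd x))))" by simp
qed

lemma smooth_family_on_local:
  fixes \<Phi> :: "'s::euclidean_space \<Rightarrow> 'a \<Rightarrow> 'b"
  assumes "\<And>x. x \<in> N \<Longrightarrow> \<exists>N'. open N' \<and> x \<in> N' \<and> smooth_family_on A B N' \<Phi>"
  shows "smooth_family_on A B N \<Phi>"
  unfolding smooth_family_on_def
proof (intro conjI ballI)
  show "continuous_on N (\<lambda>x. \<Phi> (fst x) (snd x))"
    unfolding continuous_on_eq_continuous_within
  proof
    fix x assume "x \<in> N"
    from assms[OF this] obtain N' where "open N'" "x \<in> N'" "continuous_on N' (\<lambda>x. \<Phi> (fst x) (snd x))"
      unfolding smooth_family_on_def by blast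
    then have "continuous (at x) (\<lambda>x. \<Phi> (fst x) (snd x))"
      using continuous_on_eq_continuous_at by blast
    then show "continuous (at x within N) (\<lambda>x. \<Phi> (fst x) (snd x))"
      using continuous_at_imp_continuous_at_within by blast
  qed
  fix c d assume c: "c \<in> A" and d: "d \<in> B"
  show "smooth_on {x. snd x \<in> chart_img c \<and> (fst x, chart_inv c (snd x)) \<in> N \<and> \<Phi> (fst x) (chart_inv c (snd x)) \<in> chart_dom d}
      (\<lambda>x. chart_map d (\<Phi> (fst x) (chart_inv c (snd x))))"
  proof (rule smooth_on_local)
    fix x assume x: "x \<in> {x. snd x \<in> chart_img c \<and> (fst x, chart_inv c (snd x)) \<in> N \<and> \<Phi> (fst x) (chart_inv c (snd x)) \<in> chart_dom d}"
    then obtain N' where N': "open N'" "(fst x, chart_inv c (snd x)) \<in> N'" "smooth_family_on A B N' \<Phi>" using assms by blast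
    let ?T = "{x. snd x \<in> chart_img c \<and> (fst x, chart_inv c (snd x)) \<in> N' \<and> \<Phi> (fst x) (chart_inv c (snd x)) \<in> chart_dom d}"
    have "open ?T" using N' by (intro open_family_chart c d) (auto simp: smooth_family_on_def)
    moreover have "x \<in> ?T" using x N' by simp
    moreover have "smooth_on ?T (\<lambda>x. chart_map d (\<Phi> (fst x) (chart_inv c (snd x))))"
      using N'(3) c d unfolding smooth_family_on_def by blast
    ultimately show "\<exists>T. open T \<and> x \<in> T \<and> smooth_on T (\<lambda>x. chart_map d (\<Phi> (fst x) (chart_inv c (snd x))))" by blast
  qed
qed

lemma smooth_family_on_subset:
  "smooth_family_on A B N \<Phi> \<Longrightarrow> open N \<Longrightarrow> N' \<subseteq> N \<Longrightarrow> smooth_family_on A B N' \<Phi>"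
  by (rule smooth_family_on_local) blast

text \<open>In any other pair of charts the coordinate formula \<open>f\<close> is composed with a
  coordinate change on either side.\<close>

lemma smooth_family_on_chart:
  fixes \<Phi> :: "'s::euclidean_space \<Rightarrow> 'a \<Rightarrow> 'b"
  assumes N: "open N" and c: "c \<in> A" and d: "d \<in> B" and T: "open T"
    and NT: "\<And>s p. (s, p) \<in> N \<Longrightarrow> p \<in> chart_dom c \<and> (s, chart_map c p) \<in> T"
    and f: "smooth_on T f" "f ` T \<subseteq> chart_img d"
    and \<Phi>: "\<And>s p. (s, p) \<in> N \<Longrightarrow> \<Phi> s p = chart_inv d (f (s, chart_map c p))"
  shows "smooth_family_on A B N \<Phi>"
  unfolding smooth_family_on_def
proof (intro conjI ballI)
  note ch = atlasD(1)[OF A c] and chd = atlasD(1)[OF B d]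
  have "continuous_on N (\<lambda>x. chart_inv d (f (fst x, chart_map c (snd x))))"
    by (rule continuous_on_compose2[OF is_chartD(4)[OF chd] continuous_on_compose2[OF smooth_on_continuous[OF f(1)]]])
       (use f(2) NT in \<open>auto intro!: continuous_intros continuous_on_compose2[OF is_chartD(3)[OF ch]]\<close>)
  moreover have e: "\<Phi> (fst x) (snd x) = chart_inv d (f (fst x, chart_map c (snd x)))" if "x \<in> N" for x
    using \<Phi> that by (cases x) auto
  ultimately show cont: "continuous_on N (\<lambda>x. \<Phi> (fst x) (snd x))" by (simp cong: continuous_on_cong)
  fix c' d' assume c': "c' \<in> A" and d': "d' \<in> B"
  note ch' = atlasD(1)[OF A c'] and chd' = atlasD(1)[OF B d']
  let ?S = "{x. snd x \<in> chart_img c' \<and> (fst x, chart_inv c' (snd x)) \<in> N \<and> \<Phi> (fst x) (chart_inv c' (snd x)) \<in> chart_dom d'}"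
  let ?\<tau> = "coord_change c' c" and ?\<sigma> = "coord_change d d'"
  have op: "open ?S" by (rule open_family_chart[OF N cont c' d'])
  have s\<tau>: "smooth_between (overlap c' c) (overlap c c') ?\<tau>" and s\<sigma>: "smooth_between (overlap d d') (overlap d' d) ?\<sigma>"
    using smooth_between_coord_change ch ch' chd chd' atlasD(2)[OF A c' c] atlasD(2)[OF B d d'] by blast+
  have in_T: "(fst x, ?\<tau> (snd x)) \<in> T" "snd x \<in> overlap c' c" if "x \<in> ?S" for x
    using that NT by (auto simp: coord_change_def overlap_eq[OF ch'])
  have val: "\<Phi> (fst x) (chart_inv c' (snd x)) = chart_inv d (f (fst x, ?\<tau> (snd x)))" if "x \<in> ?S" for x
    using that \<Phi> by (auto simp: coord_change_def)
  have sm1: "smooth_on ?S (\<lambda>x. (fst x, ?\<tau> (snd x)))"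
  proof (intro smooth_on_Pair smooth_on_fst smooth_on_id op)
    show "smooth_on ?S (\<lambda>x. ?\<tau> (snd x))"
      by (rule smooth_on_compose[OF _ _ op, where T = "overlap c' c"])
         (use s\<tau> in_T op in \<open>auto simp: smooth_between_def intro: smooth_on_snd smooth_on_id\<close>)
  qed
  have sm2: "smooth_on ?S (\<lambda>x. f (fst x, ?\<tau> (snd x)))"
    by (rule smooth_on_compose[OF f(1) sm1 op in_T(1)])
  have "f (fst x, ?\<tau> (snd x)) \<in> overlap d d'" if x: "x \<in> ?S" for x
    using val[OF x] x f(2) in_T(1)[OF x] by (auto simp: overlap_eq[OF chd])
  then have sm3: "smooth_on ?S (\<lambda>x. ?\<sigma> (f (fst x, ?\<tau> (snd x))))"
    using s\<sigma> by (intro smooth_on_compose[OF _ sm2 op, where T = "overlap d d'"]) (auto simp: smooth_between_def)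
  show "smooth_on ?S (\<lambda>x. chart_map d' (\<Phi> (fst x) (chart_inv c' (snd x))))"
  proof (subst smooth_on_cong[OF op, where g = "\<lambda>x. ?\<sigma> (f (fst x, ?\<tau> (snd x)))"])
    fix x assume "x \<in> ?S"
    from arg_cong[OF val[OF this], of "chart_map d'"]
    show "chart_map d' (\<Phi> (fst x) (chart_inv c' (snd x))) = ?\<sigma> (f (fst x, ?\<tau> (snd x)))"
      by (simp only: coord_change_def o_apply)
  qed (rule sm3)
qed

end

context map_family
begin

section \<open>Reading off velocities in one chart, and a single cut-off step\<close>

lemma ff_has_derivative:
  assumes d: "d \<in> B" and p: "\<Phi> (0, 0) p \<in> chart_dom d"
  shows "(ff d p has_derivative dd (ff d p) (0, 0)) (at (0, 0))"
  using smooth_between_ff[OF d, of p] p zero_U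
  by (intro smooth_on_has_derivative[of "ffdom d p"]) (auto simp: smooth_between_def ffdom_def)

lemma velocity_ff:
  assumes d: "d \<in> B" and p: "\<Phi> (0, 0) p \<in> chart_dom d"
  shows "((\<lambda>t. chart_map d (\<Phi> (0, t) p)) has_vector_derivative to_chart B d (\<Phi> (0, 0) p) (vel_t p)) (at 0)"
    "((\<lambda>s. chart_map d (\<Phi> (s, 0) p)) has_vector_derivative to_chart B d (\<Phi> (0, 0) p) (vel_s p)) (at 0)"
proof -
  define c where "c = chart_at A p"
  have c: "c \<in> A" "p \<in> chart_dom c" using chart_at[OF atlas_A] by (auto simp: c_def)
  define y where "y = chart_map c p"
  have inv: "chart_inv c y = p" and y: "y \<in> chart_img c" using is_chartD(5,6)[OF chart_A[OF c(1)] c(2)] by (auto simp: y_def)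
  have x: "((0, 0), y) \<in> fdom c d" using y zero_U p inv by (simp add: fdom_iff)
  note D = ff_has_derivative[OF d p]
  have l: "linear (dd (ff d p) (0, 0))" using D has_derivative_linear by blast
  have 1: "((\<lambda>t::real. (0::real, t)) has_derivative (\<lambda>w. (0, w))) (at 0)" "((\<lambda>s::real. (s, 0::real)) has_derivative (\<lambda>w. (w, 0))) (at 0)"
    by (intro has_derivative_Pair has_derivative_ident has_derivative_const)+
  have e: "dd (ff d p) (0, 0) (0, w) = w *\<^sub>R dd (ff d p) (0, 0) (0, 1)" "dd (ff d p) (0, 0) (w, 0) = w *\<^sub>R dd (ff d p) (0, 0) (1, 0)" for w
    using linear_cmul[OF l, of w "(0, 1)"] linear_cmul[OF l, of w "(1, 0)"] by auto
  have t: "to_chart B d (\<Phi> (0, 0) p) (vel_t p) = dd (ff d p) (0, 0) (0, 1)"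
    and s: "to_chart B d (\<Phi> (0, 0) p) (vel_s p) = dd (ff d p) (0, 0) (1, 0)"
    using velocity_t[OF c(1) d x] velocity_s[OF c(1) d x] ff_FF(2)[OF c(1) d x] unfolding inv by auto
  have e': "(\<lambda>w. w *\<^sub>R dd (ff d p) (0, 0) (0, 1)) = (\<lambda>w. dd (ff d p) (0, 0) (0, w))"
    "(\<lambda>w. w *\<^sub>R dd (ff d p) (0, 0) (1, 0)) = (\<lambda>w. dd (ff d p) (0, 0) (w, 0))"
    by (intro ext e[symmetric])+
  show "((\<lambda>t. chart_map d (\<Phi> (0, t) p)) has_vector_derivative to_chart B d (\<Phi> (0, 0) p) (vel_t p)) (at 0)"
    using has_derivative_compose[OF 1(1) D] unfolding t has_vector_derivative_def e'(1) ff_def .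
  show "((\<lambda>s. chart_map d (\<Phi> (s, 0) p)) has_vector_derivative to_chart B d (\<Phi> (0, 0) p) (vel_s p)) (at 0)"
    using has_derivative_compose[OF 1(2) D] unfolding s has_vector_derivative_def e'(2) ff_def .
qed

text \<open>Since \<open>to_chart\<close> is injective, the velocity of a newly built family can be
  read off from any one chart.\<close>

lemma velocity_ff_unique:
  assumes d: "d \<in> B" and p: "\<Phi> (0, 0) p \<in> chart_dom d"
  shows "((\<lambda>t. chart_map d (\<Phi> (0, t) p)) has_vector_derivative to_chart B d (\<Phi> (0, 0) p) v) (at 0) \<Longrightarrow> vel_t p = v"
    "((\<lambda>s. chart_map d (\<Phi> (s, 0) p)) has_vector_derivative to_chart B d (\<Phi> (0, 0) p) v) (at 0) \<Longrightarrow> vel_s p = v"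
proof -
  have inj: "to_chart B d (\<Phi> (0, 0) p) a = to_chart B d (\<Phi> (0, 0) p) b \<Longrightarrow> a = b" for a b
    by (metis from_to_chart(4)[OF atlas_B d p])
  show "((\<lambda>t. chart_map d (\<Phi> (0, t) p)) has_vector_derivative to_chart B d (\<Phi> (0, 0) p) v) (at 0) \<Longrightarrow> vel_t p = v"
    by (rule inj, rule vector_derivative_unique_at[OF velocity_ff(1)[OF assms]])
  show "((\<lambda>s. chart_map d (\<Phi> (s, 0) p)) has_vector_derivative to_chart B d (\<Phi> (0, 0) p) v) (at 0) \<Longrightarrow> vel_s p = v"
    by (rule inj, rule vector_derivative_unique_at[OF velocity_ff(2)[OF assms]])
qed

text \<open>
  Inside a pair of charts, velocities \<open>X\<close> and \<open>Y\<close>, cut off by \<open>\<rho>\<close>, are added linearly in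
  coordinates. A partition of unity reduces the general case to finitely many such steps.
\<close>

lemma variation_step:
  assumes X: "smooth_section A B (\<Phi> (0, 0)) X" and Y: "smooth_section A B (\<Phi> (0, 0)) Y"
    and \<rho>: "smooth_fun A \<rho>" and c: "c \<in> A" and d: "d \<in> B"
    and K: "closed K" "K \<subseteq> chart_dom c" "\<And>p. p \<in> K \<Longrightarrow> \<Phi> (0, 0) p \<in> chart_dom d" "\<And>p. p \<notin> K \<Longrightarrow> \<rho> p = 0"
  shows "\<exists>U' \<Psi>. open U' \<and> (0, 0) \<in> U' \<and> smooth_family A B U' \<Psi> \<and> \<Psi> (0, 0) = \<Phi> (0, 0) \<and>
    (\<forall>p. velocity B (\<lambda>t. \<Psi> (0, t) p) = vel_t p + \<rho> p *\<^sub>R X p) \<and>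
    (\<forall>p. velocity B (\<lambda>s. \<Psi> (s, 0) p) = vel_s p + \<rho> p *\<^sub>R Y p)"
proof -
  let ?\<phi> = "\<Phi> (0, 0)"
  note sm0 = family_smooth_map[OF zero_U]
  note ch = chart_A[OF c] and chd = chart_B[OF d]
  define Xd where "Xd y = to_chart B d (?\<phi> (chart_inv c y)) (X (chart_inv c y))" for y
  define Yd where "Yd y = to_chart B d (?\<phi> (chart_inv c y)) (Y (chart_inv c y))" for y
  define G where "G x = FF c d x + \<rho> (chart_inv c (snd x)) *\<^sub>R (snd (fst x) *\<^sub>R Xd (snd x) + fst (fst x) *\<^sub>R Yd (snd x))" for x
  let ?R = "rdom c d ?\<phi>"
  \<comment> \<open>\<open>Xd\<close> and \<open>Yd\<close> live along \<open>\<Phi> (0, 0)\<close>,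
    so besides the current map also \<open>\<Phi> (0, 0)\<close> must send the point into the chart
    \<open>d\<close>.\<close>
  define D where "D = fdom c d \<inter> (UNIV \<times> ?R)"
  have opR: "open ?R" by (rule open_rdom[OF sm0 c d])
  have opD: "open D" unfolding D_def by (intro open_Int open_Times open_fdom c d opR open_UNIV)
  have sXd: "smooth_on ?R Xd" "smooth_on ?R Yd"
    using smooth_section_chart[OF X c d] smooth_section_chart[OF Y c d] by (auto simp: Xd_def[abs_def] Yd_def[abs_def])
  have s\<rho>: "smooth_on ?R (\<lambda>y. \<rho> (chart_inv c y))"
    using \<rho> c opR unfolding smooth_fun_def by (auto elim!: smooth_on_subset simp: rdom_def)
  have lift: "smooth_on D (\<lambda>x. f (snd x))" if "smooth_on ?R f" for f :: "real ^ 'm \<Rightarrow> 'z::real_normed_vector"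
    by (rule smooth_on_compose[OF that smooth_on_snd[OF opD smooth_on_id] opD]) (auto simp: D_def)
  have coord: "smooth_on D (\<lambda>x. snd (fst x))" "smooth_on D (\<lambda>x. fst (fst x))"
    by (intro smooth_on_fst smooth_on_snd smooth_on_id opD)+
  have sG: "smooth_on D G"
    unfolding G_def[abs_def]
    by (intro smooth_on_add smooth_on_scaleR lift[OF s\<rho>] lift[OF sXd(1)] lift[OF sXd(2)] coord opD)
       (rule smooth_on_subset[OF smooth_FF[OF c d]], simp add: D_def)
  define T where "T = D \<inter> G -` chart_img d"
  have opT: "open T"
    unfolding T_def by (rule continuous_open_preimage[OF smooth_on_continuous[OF sG] opD is_chartD(2)[OF chd]])
  have sGT: "smooth_on T G" "G ` T \<subseteq> chart_img d" using smooth_on_subset[OF sG] by (auto simp: T_def)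
  have KT: "(0, y) \<in> T" if "y \<in> chart_map c ` K" for y
  proof -
    obtain p where p: "p \<in> K" "y = chart_map c p" using \<open>y \<in> chart_map c ` K\<close> by auto
    have i: "chart_inv c y = p" "y \<in> chart_img c" using p K(2) is_chartD(5,6)[OF ch] by auto
    have "G (0, y) = chart_map d (?\<phi> p)" by (simp add: G_def FF_def rep_def i zero_prod_def)
    then show ?thesis
      using p i K(3)[OF p(1)] zero_U is_chartD(6)[OF chd]
      by (simp add: T_def D_def fdom_iff rdom_def zero_prod_def)
  qed
  have cK: "compact (chart_map c ` K)" by (rule chart_image_compact(1)[OF c K(1,2)])
  \<comment> \<open>For parameter zero \<open>G\<close> maps the compact coordinate image of
    \<open>K\<close> into the chart image. The tube lemma extends this to a neighbourhood of
    parameters that is uniform over \<open>K\<close>.\<close>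
  obtain V where V: "(0, 0) \<in> V" "open V" "V \<times> (chart_map c ` K) \<subseteq> T"
  proof -
    have "{(0, 0)} \<times> (chart_map c ` K) \<subseteq> T" using KT by (auto simp: zero_prod_def)
    from Elementary_Topology.tube_lemma[OF cK opT this] that show ?thesis by blast
  qed
  define U' where "U' = V \<inter> U"
  have U': "open U'" "(0, 0) \<in> U'" "U' \<subseteq> U" using V open_U zero_U by (auto simp: U'_def)
  have in_T: "(st, chart_map c p) \<in> T" if "st \<in> U'" "p \<in> K" for st p using V(3) that by (auto simp: U'_def)
  define \<Psi> where "\<Psi> st p = (if p \<in> K then chart_inv d (G (st, chart_map c p)) else \<Phi> st p)" for st p
  have fam: "smooth_family A B U' \<Psi>"
    unfolding smooth_family_iff
  proof (rule smooth_family_on_local[OF atlas_A atlas_B])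
    fix x assume x: "x \<in> U' \<times> (UNIV :: 'a set)"
    show "\<exists>N'. open N' \<and> x \<in> N' \<and> smooth_family_on A B N' \<Psi>"
    proof (cases "snd x \<in> K")
      case True
      \<comment> \<open>\<open>N'\<close> reaches across the boundary of \<open>K\<close>. Off
        \<open>K\<close> the cut-off \<open>\<rho>\<close> vanishes and \<open>G\<close> reduces to
        \<open>FF\<close>, so one smooth formula describes \<open>\<Psi>\<close> on all of
        \<open>N'\<close> and the gluing is smooth.\<close>
      define N' where "N' = (U' \<times> chart_dom c) \<inter> (\<lambda>x. (fst x, chart_map c (snd x))) -` T"
      have opN: "open N'"
        unfolding N'_def using opT
        by (intro continuous_open_preimage open_Times U' is_chartD(1)[OF ch])
           (auto intro!: continuous_intros continuous_on_compose2[OF is_chartD(3)[OF ch]])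
      have "smooth_family_on A B N' \<Psi>"
      proof (rule smooth_family_on_chart[OF atlas_A atlas_B opN c d opT _ sGT])
        fix st p assume N: "(st, p) \<in> N'"
        then show "p \<in> chart_dom c \<and> (st, chart_map c p) \<in> T" by (simp add: N'_def)
        then have f: "(st, chart_map c p) \<in> fdom c d" and i: "chart_inv c (chart_map c p) = p"
          using is_chartD(5)[OF ch] by (auto simp: T_def D_def)
        show "\<Psi> st p = chart_inv d (G (st, chart_map c p))"
        proof (cases "p \<in> K")
          case False
          then have "G (st, chart_map c p) = chart_map d (\<Phi> st p)" using K(4) by (simp add: G_def i FF_def rep_def)
          then show ?thesis using False f is_chartD(5)[OF chd] by (simp add: \<Psi>_def fdom_iff i)
        qed (simp add: \<Psi>_def)
      qed
      moreover have "x \<in> N'" using x True K(2) in_T[of "fst x" "snd x"] by (auto simp: N'_def)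
      ultimately show ?thesis using opN by blast
    next
      case False
      have opN: "open (U' \<times> - K)" by (intro open_Times U' open_Compl K)
      have "smooth_family_on A B (U' \<times> - K) \<Phi>"
        using smooth_family_on_subset[OF atlas_A atlas_B family[unfolded smooth_family_iff], of "U' \<times> - K"] U'(3) open_U
        by (auto simp: open_Times)
      then have "smooth_family_on A B (U' \<times> - K) \<Psi>"
        by (rule smooth_family_on_cong[OF atlas_A atlas_B opN]) (simp add: \<Psi>_def)
      moreover have "x \<in> U' \<times> - K" using x False by (cases x) auto
      ultimately show ?thesis using opN by blast
    qed
  qed
  have \<Psi>0: "\<Psi> (0, 0) = ?\<phi>"
  proof
    fix p show "\<Psi> (0, 0) p = ?\<phi> p"
    proof (cases "p \<in> K")
      case True
      then have "G ((0, 0), chart_map c p) = chart_map d (?\<phi> p)" using K(2) is_chartD(5)[OF ch] by (auto simp: G_def FF_def rep_def)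
      then show ?thesis using True K(3) is_chartD(5)[OF chd] by (simp add: \<Psi>_def)
    qed (simp add: \<Psi>_def)
  qed
  interpret N: map_family A g B h J U' \<Psi> by unfold_locales (use U' fam in auto)
  have vel: "velocity B (\<lambda>t. \<Psi> (0, t) p) = vel_t p + \<rho> p *\<^sub>R X p \<and> velocity B (\<lambda>s. \<Psi> (s, 0) p) = vel_s p + \<rho> p *\<^sub>R Y p" for p
  proof (cases "p \<in> K")
    case True
    have pd: "?\<phi> p \<in> chart_dom d" and i: "chart_inv c (chart_map c p) = p" using True K is_chartD(5)[OF ch] by auto
    have pd': "\<Psi> (0, 0) p \<in> chart_dom d" using pd by (simp add: \<Psi>0)
    let ?L = "to_chart B d (?\<phi> p)"
    have val: "chart_map d (\<Psi> st p) = chart_map d (\<Phi> st p) + (snd st * \<rho> p) *\<^sub>R ?L (X p) + (fst st * \<rho> p) *\<^sub>R ?L (Y p)" if "st \<in> U'" for st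
      using in_T[OF that True] True is_chartD(7)[OF chd]
      by (simp add: \<Psi>_def T_def G_def FF_def rep_def i Xd_def Yd_def algebra_simps)
    have L: "?L (v + r *\<^sub>R w) = ?L v + r *\<^sub>R ?L w" for v w r
      using from_to_chart(2)[OF atlas_B d pd] by (simp add: linear_add linear_cmul)
    obtain S where S: "open S" "0 \<in> S" "\<And>t. t \<in> S \<Longrightarrow> (0, t) \<in> U'" using N.U_slice_t[OF N.zero_U] by auto
    obtain S' where S': "open S'" "0 \<in> S'" "\<And>t. t \<in> S' \<Longrightarrow> (t, 0) \<in> U'" using N.U_slice_s by auto
    have lin: "((\<lambda>t. (t * r) *\<^sub>R v) has_vector_derivative r *\<^sub>R v) (at (0::real))" for r and v :: "real ^ 'n"
      by (auto intro!: derivative_eq_intros)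
    have "((\<lambda>t. chart_map d (\<Phi> (0, t) p) + (t * \<rho> p) *\<^sub>R ?L (X p)) has_vector_derivative ?L (vel_t p + \<rho> p *\<^sub>R X p)) (at 0)"
      unfolding L by (intro has_vector_derivative_add velocity_ff(1)[OF d pd] lin)
    then have "((\<lambda>t. chart_map d (\<Psi> (0, t) p)) has_vector_derivative ?L (vel_t p + \<rho> p *\<^sub>R X p)) (at 0)"
      by (rule has_vector_derivative_transform_within_open[OF _ S(1,2)]) (simp add: val S(3))
    moreover have "((\<lambda>t. chart_map d (\<Phi> (t, 0) p) + (t * \<rho> p) *\<^sub>R ?L (Y p)) has_vector_derivative ?L (vel_s p + \<rho> p *\<^sub>R Y p)) (at 0)"
      unfolding L by (intro has_vector_derivative_add velocity_ff(2)[OF d pd] lin)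
    then have "((\<lambda>t. chart_map d (\<Psi> (t, 0) p)) has_vector_derivative ?L (vel_s p + \<rho> p *\<^sub>R Y p)) (at 0)"
      by (rule has_vector_derivative_transform_within_open[OF _ S'(1,2)]) (simp add: val S'(3))
    ultimately show ?thesis
      using N.velocity_ff_unique[OF d pd'] unfolding \<Psi>0 by blast
  next
    case False
    then show ?thesis using K(4) by (simp add: \<Psi>_def)
  qed
  show ?thesis
    by (intro exI[of _ U'] exI[of _ \<Psi>] conjI U' fam \<Psi>0 allI) (simp_all add: vel)
qed

end

lemma velocity_const: "velocity B (\<lambda>t. q) = 0"
  by (simp add: velocity_def)

context riemannian_to_kaehler
begin

lemma smooth_family_const:
  assumes \<phi>: "smooth_map A B \<phi>"
  shows "smooth_family A B (UNIV :: (real \<times> real) set) (\<lambda>_. \<phi>)"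
  unfolding smooth_family_iff smooth_family_on_def
proof (intro conjI ballI)
  have "continuous_on UNIV \<phi>" using \<phi> by (simp add: smooth_map_def)
  then show c0: "continuous_on (UNIV \<times> UNIV :: ((real \<times> real) \<times> 'a) set) (\<lambda>x. \<phi> (snd x))"
    by (rule continuous_on_compose2) (auto intro!: continuous_intros)
  fix c d assume c: "c \<in> A" and d: "d \<in> B"
  let ?S = "{x :: (real \<times> real) \<times> (real ^ 'm). snd x \<in> chart_img c \<and> (fst x, chart_inv c (snd x)) \<in> UNIV \<times> UNIV \<and> \<phi> (chart_inv c (snd x)) \<in> chart_dom d}"
  have op: "open ?S" using open_family_chart[OF atlas_A atlas_B _ c0 c d] by (simp add: open_Times)
  have "smooth_on (rdom c d \<phi>) (rep c d \<phi>)" using smooth_between_rep[OF \<phi> c d] by (simp add: smooth_between_def)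
  then have "smooth_on ?S (\<lambda>x. rep c d \<phi> (snd x))"
    by (rule smooth_on_compose[OF _ smooth_on_snd[OF op smooth_on_id] op]) (simp add: rdom_def)
  then show "smooth_on ?S (\<lambda>x. chart_map d (\<phi> (chart_inv c (snd x))))" by (simp add: rep_def)
qed

text \<open>Induction over the members of a partition of unity, starting from the constant family.
  After \<open>k\<close> steps the velocities are \<open>X\<close> and \<open>Y\<close> times the
  sum of the first \<open>k\<close> weights, which is 1 at the end. Each member is supported where
  \<open>\<phi>\<close> stays in one chart of \<open>N\<close>, as \<open>variation_step\<close>
  requires.\<close>

theorem variation_exists:
  assumes \<phi>: "smooth_map A B \<phi>" and X: "smooth_section A B \<phi> X" and Y: "smooth_section A B \<phi> Y"
  shows "\<exists>\<Phi>. variation2 A B \<phi> X Y \<Phi>"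
proof -
  define G where "G q = \<phi> -` chart_dom (chart_at B (\<phi> q))" for q
  have cont: "continuous_on UNIV \<phi>" using \<phi> by (simp add: smooth_map_def)
  have "open (G q)" "q \<in> G q" for q
    using chart_at[OF atlas_B] open_vimage[OF is_chartD(1)[OF chart_B] cont] by (auto simp: G_def)
  then obtain n q \<rho> where P: "partition_of_unity A n (\<lambda>i. chart_at A (q i)) \<rho>"
    and K: "\<And>i. i < n \<Longrightarrow> closure {p. \<rho> i p \<noteq> 0} \<subseteq> G (q i) \<inter> chart_dom (chart_at A (q i))"
    using partition_of_unity_exists[OF compact_M atlas_A] by metis
  have pou: "pou n (\<lambda>i. chart_at A (q i)) \<rho>" using P by (simp add: pou_def)
  have "\<exists>U \<Phi>. open U \<and> (0, 0) \<in> U \<and> smooth_family A B U \<Phi> \<and> \<Phi> (0, 0) = \<phi> \<and>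
    (\<forall>p. velocity B (\<lambda>t. \<Phi> (0, t) p) = (\<Sum>i<k. \<rho> i p) *\<^sub>R X p) \<and>
    (\<forall>p. velocity B (\<lambda>s. \<Phi> (s, 0) p) = (\<Sum>i<k. \<rho> i p) *\<^sub>R Y p)" if "k \<le> n" for k
    using that
  proof (induction k)
    case 0
    show ?case
      by (intro exI[of _ UNIV] exI[of _ "\<lambda>_. \<phi>"]) (simp add: smooth_family_const[OF \<phi>] velocity_const)
  next
    case (Suc k)
    then obtain U \<Phi> where F: "open U" "(0, 0) \<in> U" "smooth_family A B U \<Phi>" "\<Phi> (0, 0) = \<phi>"
      and vX: "\<And>p. velocity B (\<lambda>t. \<Phi> (0, t) p) = (\<Sum>i<k. \<rho> i p) *\<^sub>R X p"
      and vY: "\<And>p. velocity B (\<lambda>s. \<Phi> (s, 0) p) = (\<Sum>i<k. \<rho> i p) *\<^sub>R Y p" by auto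
    have k: "k < n" using Suc by simp
    interpret N: map_family A g B h J U \<Phi> by unfold_locales (use F in auto)
    have sec: "smooth_section A B (\<Phi> (0, 0)) X" "smooth_section A B (\<Phi> (0, 0)) Y" using X Y F(4) by auto
    have "\<Phi> (0, 0) p \<in> chart_dom (chart_at B (\<phi> (q k)))" if "p \<in> msupp (\<rho> k)" for p
      using that K[OF k] F(4) by (auto simp: G_def msupp_def)
    from N.variation_step[OF sec pouD(3)[OF pou k] pouD(1)[OF pou k] chart_at(1)[OF atlas_B] pouD(5,6)[OF pou k] this pouD(7)[OF pou k]]
    obtain U' \<Psi> where "open U'" "(0, 0) \<in> U'" "smooth_family A B U' \<Psi>" "\<Psi> (0, 0) = \<phi>"
      "\<And>p. velocity B (\<lambda>t. \<Psi> (0, t) p) = (\<Sum>i<k. \<rho> i p) *\<^sub>R X p + \<rho> k p *\<^sub>R X p"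
      "\<And>p. velocity B (\<lambda>s. \<Psi> (s, 0) p) = (\<Sum>i<k. \<rho> i p) *\<^sub>R Y p + \<rho> k p *\<^sub>R Y p"
      unfolding F(4) vX vY by blast
    then show ?case
      by (intro exI[of _ U'] exI[of _ \<Psi>]) (simp add: scaleR_add_left)
  qed
  from this[OF order_refl] show ?thesis
    unfolding pou_sum[OF pou] scaleR_one variation2_def by metis
qed

text \<open>\<open>critical_point\<close> speaks of one-parameter families, while the first
  variation formula is available for two-parameter ones; restriction to \<open>s = 0\<close>
  connects them.\<close>

lemma smooth_family_line:
  fixes U :: "(real \<times> real) set"
  assumes U: "open U" and \<Phi>: "smooth_family A B U \<Phi>"
  shows "smooth_family A B {t. (0, t) \<in> U} (\<lambda>t. \<Phi> (0, t))"
proof -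
  let ?I = "{t. (0, t) \<in> U}"
  have opI: "open ?I" using open_vimage[OF U continuous_on_Pair1[of UNIV 0]] by (simp add: vimage_def)
  have F: "continuous_on (U \<times> UNIV) (\<lambda>x. \<Phi> (fst x) (snd x))" using \<Phi> by (simp add: smooth_family_iff smooth_family_on_def)
  show ?thesis
    unfolding smooth_family_iff smooth_family_on_def
  proof (intro conjI ballI)
    show cont: "continuous_on (?I \<times> UNIV) (\<lambda>x. \<Phi> (0, fst x) (snd x))"
      by (rule continuous_on_compose2[OF F, of _ "\<lambda>x. ((0, fst x), snd x)", simplified])
         (auto intro!: continuous_intros)
    fix c d assume c: "c \<in> A" and d: "d \<in> B"
    let ?S = "{x. snd x \<in> chart_img c \<and> (fst x, chart_inv c (snd x)) \<in> ?I \<times> UNIV \<and> \<Phi> (0, fst x) (chart_inv c (snd x)) \<in> chart_dom d}"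
    let ?T = "{x. snd x \<in> chart_img c \<and> (fst x, chart_inv c (snd x)) \<in> U \<times> UNIV \<and> \<Phi> (fst x) (chart_inv c (snd x)) \<in> chart_dom d}"
    have op: "open ?S" using open_family_chart[OF atlas_A atlas_B _ cont c d] opI by (simp add: open_Times)
    have T: "smooth_on ?T (\<lambda>x. chart_map d (\<Phi> (fst x) (chart_inv c (snd x))))"
      using \<Phi> c d unfolding smooth_family_iff smooth_family_on_def by blast
    have "smooth_on ?S (\<lambda>x. ((0 :: real, fst x), snd x))"
      by (intro smooth_on_Pair smooth_on_const smooth_on_fst smooth_on_snd smooth_on_id op)
    from smooth_on_compose[OF T this op]
    show "smooth_on ?S (\<lambda>x. chart_map d (\<Phi> (0, fst x) (chart_inv c (snd x))))" by simp
  qed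
qed

section \<open>The Hessian\<close>

text \<open>Criticality yields information only about velocities of families. By
  \<open>variation_exists\<close> every smooth section is such a velocity, and the energy derivative
  along that family is both the integral and zero.\<close>

theorem first_variation_zero:
  assumes crit: "critical_point A g B h J \<phi>" and W: "smooth_section A B \<phi> W"
  shows "vol_integral A g (form_inner g 2 (pullback A B \<phi> \<omega>) (ext_deriv A (pullback_contraction A B \<phi> W \<omega>))) = 0"
proof -
  have \<phi>: "smooth_map A B \<phi>" using crit by (simp add: critical_point_def)
  obtain \<Phi> and U :: "(real \<times> real) set" where F: "open U" "(0, 0) \<in> U" "smooth_family A B U \<Phi>" "\<Phi> (0, 0) = \<phi>"
    and v: "\<And>p. W p = velocity B (\<lambda>t. \<Phi> (0, t) p)"
    using variation_exists[OF \<phi> W W] unfolding variation2_def by blast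
  interpret N: map_family A g B h J U \<Phi> by unfold_locales (use F in auto)
  have W': "(\<lambda>p. velocity B (\<lambda>t. \<Phi> (0, t) p)) = W" using v by auto
  have "open {t. (0, t) \<in> U}" using open_vimage[OF F(1) continuous_on_Pair1[of UNIV 0]] by (simp add: vimage_def)
  then have "((\<lambda>t. energy A g B h J (\<Phi> (0, t))) has_real_derivative 0) (at 0)"
    using crit smooth_family_line[OF F(1,3)] F(2,4) unfolding critical_point_def by blast
  from DERIV_unique[OF N.energy_DERIV_t[OF N.zero_U] this]
  show ?thesis unfolding N.\<eta>t_def W' F(4) .
qed

text \<open>The adjointness of \<open>codiff\<close> is used twice. It turns the product of the two
  exterior derivatives into the contraction for \<open>X\<close> evaluated on the sharp of the
  codifferential in the second term of \<open>jacobi_operator\<close>, and the pairing of the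
  derivative of \<open>\<theta>\<close> with the pull-back into \<open>\<theta>\<close> evaluated on
  \<open>Z_field\<close>.\<close>

theorem second_variation:
  assumes crit: "critical_point A g B h J \<phi>" and var: "variation2 A B \<phi> X Y \<Phi>"
  shows "has_mixed_derivative_at_0 (\<lambda>st. energy A g B h J (\<Phi> st))
    (vol_integral A g (\<lambda>p. h (\<phi> p) (X p) (jacobi_operator A g B h J \<phi> Y p)))"
proof -
  obtain U :: "(real \<times> real) set" where F: "open U" "(0, 0) \<in> U" "smooth_family A B U \<Phi>" "\<Phi> (0, 0) = \<phi>"
    and v: "\<And>p. X p = velocity B (\<lambda>t. \<Phi> (0, t) p)" "\<And>p. Y p = velocity B (\<lambda>s. \<Phi> (s, 0) p)"
    using var unfolding variation2_def by blast
  interpret N: map_family A g B h J U \<Phi> by unfold_locales (use F in auto)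
  have XY: "(\<lambda>p. velocity B (\<lambda>t. \<Phi> (0, t) p)) = X" "(\<lambda>p. velocity B (\<lambda>s. \<Phi> (s, 0) p)) = Y" using v by auto
  let ?\<Omega> = "pullback A B \<phi> \<omega>"
  let ?X = "pullback_contraction A B \<phi> X \<omega>" and ?Y = "pullback_contraction A B \<phi> Y \<omega>"
  have \<eta>: "N.\<eta>t 0 = ?X" "N.\<eta>s = ?Y" unfolding N.\<eta>t_def N.\<eta>s_def XY F(4) by auto
  have \<phi>: "smooth_map A B \<phi>" using crit by (simp add: critical_point_def)
  have s\<Omega>: "smooth_form A 2 ?\<Omega>" by (rule smooth_pullback[OF \<phi>])
  have sX: "smooth_form A 1 ?X" and sY: "smooth_form A 1 ?Y"
    using N.smooth_\<eta>t[OF N.zero_U] N.smooth_\<eta>s unfolding \<eta> by auto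
  have sdY: "smooth_form A 2 (ext_deriv A ?Y)" by (rule smooth_ext_deriv[OF atlas_A sY])
  note cont = smooth_fun_continuous[OF atlas_A]
  let ?\<delta>Y = "codiff A g 1 (ext_deriv A ?Y)" and ?\<delta>\<Omega> = "codiff A g 1 ?\<Omega>"
  have comm2: "form_inner g k \<alpha> \<beta> = form_inner g k \<beta> \<alpha>" for k and \<alpha> \<beta> :: "('a, 'm) form"
    by (intro ext N.form_inner_commute)
  have "vol_integral A g (\<lambda>p. form_inner g 2 (ext_deriv A ?Y) (ext_deriv A ?X) p + form_inner g 2 ?\<Omega> (ext_deriv A N.\<zeta>) p)
    = vol_integral A g (\<lambda>p. form_inner g 2 (ext_deriv A ?X) (ext_deriv A ?Y) p +
        (form_inner g 2 (ext_deriv A N.\<theta>) ?\<Omega> p + form_inner g 2 ?\<Omega> (ext_deriv A N.\<eta>W) p))"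
    unfolding N.form_inner_\<zeta> comm2[of 2 "ext_deriv A ?Y"] comm2[of 2 "ext_deriv A N.\<theta>"] ..
  also have "\<dots> = vol_integral A g (form_inner g 2 (ext_deriv A ?X) (ext_deriv A ?Y))
      + (vol_integral A g (form_inner g 2 (ext_deriv A N.\<theta>) ?\<Omega>) + vol_integral A g (form_inner g 2 ?\<Omega> (ext_deriv A N.\<eta>W)))"
    by (simp only: vol_integral_add cont continuous_on_add smooth_form_inner_2 s\<Omega> sdY smooth_ext_deriv[OF atlas_A] sX N.smooth_\<theta> N.smooth_\<eta>W)
  also have "vol_integral A g (form_inner g 2 ?\<Omega> (ext_deriv A N.\<eta>W)) = 0"
    using first_variation_zero[OF crit] N.smooth_W unfolding N.\<eta>W_def F(4) by blast
  also have "vol_integral A g (form_inner g 2 (ext_deriv A ?X) (ext_deriv A ?Y)) = vol_integral A g (form_inner g 1 ?X ?\<delta>Y)"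
    by (rule codiff(2)[OF sdY sX])
  also have "vol_integral A g (form_inner g 2 (ext_deriv A N.\<theta>) ?\<Omega>) = vol_integral A g (form_inner g 1 N.\<theta> ?\<delta>\<Omega>)"
    by (rule codiff(2)[OF s\<Omega> N.smooth_\<theta>])
  also have "vol_integral A g (form_inner g 1 ?X ?\<delta>Y) + (vol_integral A g (form_inner g 1 N.\<theta> ?\<delta>\<Omega>) + 0)
    = vol_integral A g (\<lambda>p. form_inner g 1 ?X ?\<delta>Y p + form_inner g 1 N.\<theta> ?\<delta>\<Omega> p)"
    by (simp only: add_0_right vol_integral_add cont smooth_form_inner_1 sX N.smooth_\<theta> codiff(1)[OF s\<Omega>] codiff(1)[OF sdY])
  also have "(\<lambda>p. form_inner g 1 ?X ?\<delta>Y p + form_inner g 1 N.\<theta> ?\<delta>\<Omega> p)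
    = (\<lambda>p. h (\<phi> p) (X p) (jacobi_operator A g B h J \<phi> Y p))"
  proof
    fix p
    let ?V = "tangent_map A B \<phi> p (sharp g ?\<delta>Y p)" and ?C = "pullback_connection A B h \<phi> p (sharp g ?\<delta>\<Omega> p) Y"
    have 1: "form_inner g 1 ?X ?\<delta>Y p = \<omega> (\<phi> p) [X p, ?V]"
      using form_inner_1[where \<alpha> = ?X and \<beta> = ?\<delta>Y and p = p, OF smooth_form1D(2)[OF sX] smooth_form1D(2)[OF codiff(1)[OF sdY]]]
      unfolding pullback_contraction_def[of A B \<phi> X] by simp
    have 2: "form_inner g 1 N.\<theta> ?\<delta>\<Omega> p = \<omega> (\<phi> p) [X p, ?C]"
      using form_inner_1[where \<alpha> = N.\<theta> and \<beta> = ?\<delta>\<Omega> and p = p, OF smooth_form1D(2)[OF N.smooth_\<theta>] smooth_form1D(2)[OF codiff(1)[OF s\<Omega>]]]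
      unfolding N.\<theta>_eq F(4) XY v(1)[symmetric] .
    \<comment> \<open>Moving \<open>J\<close> to the second argument of \<open>h\<close> costs a
      sign; this is the origin of the factor \<open>- J\<close> in the operator.\<close>
    have "\<omega> (\<phi> p) [X p, ?V] + \<omega> (\<phi> p) [X p, ?C] = - h (\<phi> p) (X p) (J (\<phi> p) ?V) - h (\<phi> p) (X p) (J (\<phi> p) ?C)"
      by (simp add: \<omega>_eq h_J)
    also have "\<dots> = h (\<phi> p) (X p) (- J (\<phi> p) (?C + ?V))"
      unfolding linear_add[OF J(1)] bilinear_radd[OF h_metric(1)] bilinear_rneg[OF h_metric(1)] by simp
    finally show "form_inner g 1 ?X ?\<delta>Y p + form_inner g 1 N.\<theta> ?\<delta>\<Omega> p = h (\<phi> p) (X p) (jacobi_operator A g B h J \<phi> Y p)"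
      unfolding 1 2 jacobi_operator_def Z_field_def .
  qed
  finally have r: "vol_integral A g (\<lambda>p. form_inner g 2 (ext_deriv A ?Y) (ext_deriv A ?X) p + form_inner g 2 ?\<Omega> (ext_deriv A N.\<zeta>) p)
    = vol_integral A g (\<lambda>p. h (\<phi> p) (X p) (jacobi_operator A g B h J \<phi> Y p))" .
  obtain S where S: "open S" "0 \<in> S" "\<And>s. s \<in> S \<Longrightarrow> (s, 0) \<in> U" using N.U_slice_s by auto
  have "\<forall>\<^sub>F s in nhds 0. ((\<lambda>t. energy A g B h J (\<Phi> (s, t))) has_real_derivative
      vol_integral A g (form_inner g 2 (N.\<Omega> (s, 0)) (ext_deriv A (N.\<eta>t s)))) (at 0)"
    using S N.energy_DERIV_t unfolding eventually_nhds by blast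
  then show ?thesis
    using N.energy_DERIV_s unfolding \<eta> F(4) r has_mixed_derivative_at_0_def by (intro exI conjI)
qed

text \<open>The inner derivatives need agree only for \<open>s\<close> near 0, which is enough for
  their derivatives at 0 to coincide.\<close>

lemma mixed_derivative_unique:
  assumes "has_mixed_derivative_at_0 f r" "has_mixed_derivative_at_0 f r'"
  shows "r = r'"
proof -
  obtain f1 f2 where f: "\<forall>\<^sub>F s in nhds 0. ((\<lambda>t. f (s, t)) has_real_derivative f1 s) (at 0)" "(f1 has_real_derivative r) (at 0)"
    "\<forall>\<^sub>F s in nhds 0. ((\<lambda>t. f (s, t)) has_real_derivative f2 s) (at 0)" "(f2 has_real_derivative r') (at 0)"
    using assms unfolding has_mixed_derivative_at_0_def by blast
  have "\<forall>\<^sub>F s in nhds 0. f1 s = f2 s"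
    using f(1,3) by eventually_elim (rule DERIV_unique)
  then have "(f2 has_real_derivative r) (at 0)" using f(2) DERIV_cong_ev[of 0 0 f1 f2 r r] by simp
  then show ?thesis using f(4) DERIV_unique by blast
qed

text \<open>Existence of a variation is essential here: without one, every real number would satisfy
  the description in \<open>hessian\<close> vacuously. Given one, the value is fixed by uniqueness
  of mixed derivatives.\<close>

theorem hessian_eq:
  assumes crit: "critical_point A g B h J \<phi>" and X: "smooth_section A B \<phi> X" and Y: "smooth_section A B \<phi> Y"
  shows "hessian A g B h J \<phi> X Y = vol_integral A g (\<lambda>p. h (\<phi> p) (X p) (jacobi_operator A g B h J \<phi> Y p))"
proof -
  have "smooth_map A B \<phi>" using crit by (simp add: critical_point_def)
  from variation_exists[OF this X Y] obtain \<Phi> where \<Phi>: "variation2 A B \<phi> X Y \<Phi>" ..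
  show ?thesis
    unfolding hessian_def
    by (rule the_equality) (use second_variation[OF crit] mixed_derivative_unique \<Phi> in blast)+
qed

end

theorem proposition4p7:
  fixes A :: "('a::t2_space, 'm::finite) chart set"
    and g :: "'a \<Rightarrow> real ^ 'm \<Rightarrow> real ^ 'm \<Rightarrow> real"
    and B :: "('b::t2_space, 'n::finite) chart set"
    and h :: "'b \<Rightarrow> real ^ 'n \<Rightarrow> real ^ 'n \<Rightarrow> real"
    and J :: "'b \<Rightarrow> real ^ 'n \<Rightarrow> real ^ 'n"
    and \<phi> :: "'a \<Rightarrow> 'b"
    and X Y :: "'a \<Rightarrow> real ^ 'n"
  assumes M: "compact (UNIV :: 'a set)" "oriented_atlas A" "riemannian_metric A g"
    and N: "compact (UNIV :: 'b set)" "atlas B" "kaehler B h J"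
    and crit: "critical_point A g B h J \<phi>"
    and sections: "smooth_section A B \<phi> X" "smooth_section A B \<phi> Y"
  shows "hessian A g B h J \<phi> X Y
         = vol_integral A g (\<lambda>p. h (\<phi> p) (X p) (jacobi_operator A g B h J \<phi> Y p))"
proof -
  interpret riemannian_to_kaehler A g B h J
    by unfold_locales (use M N in \<open>auto simp: oriented_atlas_def\<close>)
  show ?thesis by (rule hessian_eq[OF crit sections])
qed

end
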